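(* Let $q=p^r$ be a prime power ($p$ prime), let $M$ be chosen uniformly at random from $\mathrm{U}(n,q)$, and let $1\le k\le(n-1)/2$. For any elements $a_i\in\mathbb{F}_{q^2}$ indexed by the integers $1\le i\le k$ with $p\nmid i$, $$\left|\mathbb{P}_{M\in\mathrm{U}(n,q)}\big(\forall\,1\le i\le k\text{ with }p\nmid i:\ \mathrm{Tr}(M^i)=a_i\big)-\frac{1}{(q^2)^{k-\lfloor k/p\rfloor}}\right|\le\frac{2(k+1)\,q^{2\lfloor k/p\rfloor}}{q^n}.$$
   Context: $\mathrm{U}(n,q)=\{M\in\mathrm{GL}(n,\mathbb{F}_{q^2}):M\overline{M}^t=I_n\}$, where $\overline{M}$ raises every entry of $M$ to the $q$-th power; it carries the uniform probability measure. *)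

theory Defs
  imports "HOL-Analysis.Analysis" "HOL-Probability.Probability"
begin

text \<open>Power of a square matrix: M^0 = I, M^(i+1) = M ** M^i.\<close>
definition matpow :: "'a::semiring_1^'n^'n \<Rightarrow> nat \<Rightarrow> 'a^'n^'n" where
  "matpow M i = (((**) M) ^^ i) (mat 1)"

text \<open>Entrywise q-th power (Frobenius conjugation on F_{q^2}).\<close>
definition conjq :: "nat \<Rightarrow> 'a::field^'n^'n \<Rightarrow> 'a^'n^'n" where
  "conjq q M = (\<chi> i j. (M $ i $ j) ^ q)"

text \<open>The unitary group U(n,q) inside GL(n, F_{q^2}); the matrix size is CARD('n).\<close>
definition unitary_group :: "nat \<Rightarrow> ('a::field^'n^'n) set" where
  "unitary_group q = {M. invertible M \<and> M ** transpose (conjq q M) = mat 1}"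

end

theory Submission
  imports Defs "HOL-Algebra.Algebraic_Closure_Type" "HOL-Library.Poly_Mapping"
    "Jordan_Normal_Form.Char_Poly" "HOL-Number_Theory.Number_Theory"
begin

text \<open>
  The traces in question are power sums of the eigenvalues, so by Newton's identities the event only
  concerns the first \<open>k\<close> coefficients of the reversed characteristic polynomial; it is a union of
  \<open>q\<^bsup>2\<lfloor>k/p\<rfloor>\<^esup>\<close> classes of truncated power series with constant term \<open>1\<close>.

  Let \<open>F(u) = \<Sum>\<^sub>n u\<^sup>n |U(n,q)|\<^sup>-\<^sup>1 \<Sum>\<^sub>g [eigenvalues of g]\<close>, with coefficients in the monoid
  algebra of multisets over the algebraic closure. Counting pairs (unitary matrix, vector) by the Krylov
  space of the vector, whose radical splits off by Witt's theorem, gives \<open>F(q\<^sup>2 u) = R(u) \<Phi>(u) F(u)\<close>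
  for explicit series \<open>R\<close> and \<open>\<Phi>\<close>, and this forces \<open>F(u) = L(u/q) F(-u/q)\<close>, where \<open>L\<close> is the
  generating function of the multisets stable under \<open>x \<mapsto> x\<^sup>-\<^sup>q\<close>, that is, of the unitary polynomials.
  Hence \<open>q\<^sup>n P(event)\<close> is an alternating sum over \<open>m \<le> n\<close> of counts of unitary polynomials of
  degree \<open>m\<close>. For \<open>m > 2k\<close> these are exactly equidistributed over the classes, which yields the
  main term. In each of the remaining \<open>2k + 1\<close> terms the count is at most \<open>1\<close> per class up to a
  correction supported on series with a run of \<open>\<rho>\<close> vanishing coefficients, and applying the recursion
  for \<open>F\<close> once more bounds the probability of such a run by \<open>(k/(q - 1))\<^sup>\<rho> / \<rho>!\<close>.
\<close>

text \<open>Origin of F(q^2 u) = R Phi F. A pair (g, v) is sorted by its correlations c(j) = <v, g^j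
  v>, whose minimal polynomial d is automatically unitary, and by the minimal polynomial of z = d(g)
  v, which generates the radical of the Krylov space. A radical with eigenvalue multiset rho is dual
  to a quotient with eigenvalues phi(rho), whence R; the nondegenerate part gives Phi; the rest is a
  smaller unitary group. A unitary polynomial of degree m annihilates exactly q^m Hermitian
  sequences, so Phi(u) L(u) = L(q u), and all logarithmic derivatives become explicit. The obstacle
  to a bound linear in k: in degrees k < m <= 2k a class may contain q + 1 unitary polynomials, and
  using q + 1 throughout would cost a factor of order q. More than one occurs only if the prescribed
  coefficients contain a run of zeros, hence the probability estimate for runs. The constant: even
  and odd degrees enter with opposite signs, so the two sums are bounded separately, by 2k + 3 and
  2k + 1 times the number of classes; the main term leaves one further multiple, and 2k + 2 results
  on either side.\<close>

hide_const (open) Finite_Cartesian_Product.vec Cartesian_Space.vector Determinants.det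
  Finite_Cartesian_Product.row Finite_Cartesian_Product.column
  Polynomials.degree Polynomials.lead_coeff Divisibility.prime Divisibility.irreducible
  up_ring.coeff up_ring.monom module.smult Coset.order
no_notation vec_nth (infixl "$" 90)
no_notation fps_nth (infixl "$" 75)

section \<open>Multisets stable under a map\<close>

text \<open>Entries repeat once \<open>c\<close> exceeds the period: at a point of period
  \<open>b\<close>, the value for \<open>c = i * b\<close> is \<open>i\<close> copies of the true
  orbit. This lets \<open>c\<close> run over all multiples of the period, as a logarithmic
  derivative requires.\<close>

definition orb :: "('b \<Rightarrow> 'b) \<Rightarrow> nat \<Rightarrow> 'b \<Rightarrow> 'b multiset" where
  "orb \<phi> c \<theta> = (\<Sum>i<c. {#(\<phi> ^^ i) \<theta>#})"

definition inv_msets :: "'b set \<Rightarrow> ('b \<Rightarrow> 'b) \<Rightarrow> nat \<Rightarrow> 'b multiset set" where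
  "inv_msets S \<phi> m = {\<nu>. size \<nu> = m \<and> set_mset \<nu> \<subseteq> S \<and> image_mset \<phi> \<nu> = \<nu>}"

definition period_pts :: "'b set \<Rightarrow> ('b \<Rightarrow> 'b) \<Rightarrow> nat \<Rightarrow> 'b set" where
  "period_pts S \<phi> c = {\<theta> \<in> S. (\<phi> ^^ c) \<theta> = \<theta>}"

lemma size_orb [simp]: "size (orb \<phi> c \<theta>) = c"
  unfolding orb_def by (induction c) auto

lemma orb_0 [simp]: "orb \<phi> 0 \<theta> = {#}"
  by (simp add: orb_def)

lemma orb_Suc: "orb \<phi> (Suc c) \<theta> = add_mset ((\<phi> ^^ c) \<theta>) (orb \<phi> c \<theta>)"
  by (simp add: orb_def)

lemma set_mset_orb: "set_mset (orb \<phi> c \<theta>) = (\<lambda>i. (\<phi> ^^ i) \<theta>) ` {..<c}"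
  by (induction c) (auto simp: orb_Suc lessThan_Suc)

lemma mem_orb: "c \<ge> 1 \<Longrightarrow> \<theta> \<in># orb \<phi> c \<theta>"
  unfolding set_mset_orb by (rule image_eqI[of _ _ 0]) auto

lemma orb_add: "orb \<phi> (c + d) \<theta> = orb \<phi> c \<theta> + orb \<phi> d ((\<phi> ^^ c) \<theta>)"
proof (induction d)
  case (Suc d)
  have "(\<phi> ^^ (c + d)) \<theta> = (\<phi> ^^ d) ((\<phi> ^^ c) \<theta>)"
    by (metis add.commute comp_apply funpow_add)
  then show ?case using Suc by (simp add: orb_Suc)
qed simp

lemma funpow_mult_fix: "(\<phi> ^^ b) \<theta> = \<theta> \<Longrightarrow> (\<phi> ^^ (i * b)) \<theta> = \<theta>"
  by (induction i) (simp_all add: funpow_add)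

lemma orb_mult: "(\<phi> ^^ b) \<theta> = \<theta> \<Longrightarrow> orb \<phi> (i * b) \<theta> = repeat_mset i (orb \<phi> b \<theta>)"
proof (induction i)
  case (Suc i)
  have "orb \<phi> (Suc i * b) \<theta> = orb \<phi> (i * b + b) \<theta>" by (simp add: add.commute)
  also have "\<dots> = orb \<phi> (i * b) \<theta> + orb \<phi> b \<theta>"
    using funpow_mult_fix[OF Suc.prems] by (simp add: orb_add)
  finally show ?case using Suc by (simp add: add.commute)
qed simp

lemma image_orb: assumes "(\<phi> ^^ c) \<theta> = \<theta>"
  shows "image_mset \<phi> (orb \<phi> c \<theta>) = orb \<phi> c \<theta>"
proof -
  have "image_mset \<phi> (orb \<phi> c \<theta>) + {#\<theta>#} = orb \<phi> (Suc c) \<theta>"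
    by (induction c) (simp_all add: orb_Suc)
  then show ?thesis using assms by (simp add: orb_Suc)
qed

lemma orb_sq: "orb (\<phi> \<circ> \<phi>) c \<theta> + image_mset \<phi> (orb (\<phi> \<circ> \<phi>) c \<theta>) = orb \<phi> (2 * c) \<theta>"
proof (induction c)
  case (Suc c)
  define \<psi> where "\<psi> = \<phi> \<circ> \<phi>"
  have "(\<psi> ^^ c) \<theta> = (\<phi> ^^ (2 * c)) \<theta>"
    unfolding \<psi>_def by (induction c) auto
  moreover have "orb \<psi> c \<theta> + image_mset \<phi> (orb \<psi> c \<theta>) = orb \<phi> (2 * c) \<theta>"
    using Suc unfolding \<psi>_def .
  ultimately have "orb \<psi> (Suc c) \<theta> + image_mset \<phi> (orb \<psi> (Suc c) \<theta>) = orb \<phi> (2 * Suc c) \<theta>"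
    by (simp add: orb_Suc)
  then show ?case unfolding \<psi>_def .
qed simp

lemma count_inv:
  assumes "inj \<phi>" "image_mset \<phi> \<nu> = \<nu>" shows "count \<nu> ((\<phi> ^^ i) \<theta>) = count \<nu> \<theta>"
proof (induction i)
  case (Suc i)
  have "count (image_mset \<phi> \<nu>) (\<phi> x) = count \<nu> x" for x
    using assms(1) by (induction \<nu>) (auto simp: inj_eq)
  then show ?case using Suc assms(2) by simp
qed simp

text \<open>All iterates of an element have the same multiplicity in the stable multiset, so they
  stay in its finite support. Two of the first \<open>size \<nu> + 1\<close> iterates coincide, and
  injectivity cancels the smaller exponent.\<close>

lemma period_exists:
  assumes "inj \<phi>" "image_mset \<phi> \<nu> = \<nu>" "\<theta> \<in># \<nu>"
  obtains b where "b \<ge> 1" "b \<le> size \<nu>" "(\<phi> ^^ b) \<theta> = \<theta>" "inj_on (\<lambda>i. (\<phi> ^^ i) \<theta>) {..<b}"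
    "\<And>c. (\<phi> ^^ c) \<theta> = \<theta> \<longleftrightarrow> b dvd c"
proof -
  let ?f = "\<lambda>i. (\<phi> ^^ i) \<theta>"
  have mem: "?f i \<in> set_mset \<nu>" for i
    using count_inv[OF assms(1,2), of i \<theta>] assms(3) by (metis count_greater_zero_iff)
  have "\<not> inj_on ?f {..size \<nu>}"
  proof
    assume "inj_on ?f {..size \<nu>}"
    then have "card {..size \<nu>} \<le> card (set_mset \<nu>)"
      by (rule card_inj_on_le) (use mem in auto)
    moreover have "card (set_mset \<nu>) \<le> size \<nu>"
      by (simp add: size_multiset_overloaded_eq sum_mono card_eq_sum Suc_leI del: sum_constant)
    ultimately show False by simp
  qed
  then obtain i j where ij: "i < j" "j \<le> size \<nu>" "?f i = ?f j"
    unfolding inj_on_def by (metis atMost_iff linorder_neqE_nat)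
  have inji: "inj (\<phi> ^^ i)" for i using assms(1) by (induction i) (auto intro: inj_compose)
  have cancel: "(\<phi> ^^ (j - i)) \<theta> = \<theta>" if "i \<le> j" "?f i = ?f j" for i j
  proof -
    have "(\<phi> ^^ i) ((\<phi> ^^ (j - i)) \<theta>) = (\<phi> ^^ i) \<theta>"
      using that by (metis comp_apply funpow_add le_add_diff_inverse)
    then show ?thesis using inji by (simp add: inj_eq)
  qed
  define b where "b = (LEAST b. b \<ge> 1 \<and> ?f b = \<theta>)"
  have ex: "j - i \<ge> 1 \<and> ?f (j - i) = \<theta>" using cancel[of i j] ij by auto
  have b: "b \<ge> 1 \<and> ?f b = \<theta>" unfolding b_def by (rule LeastI, rule ex)
  have min: "c \<ge> b" if "c \<ge> 1" "?f c = \<theta>" for c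
    unfolding b_def by (rule Least_le) (use that in auto)
  have "b \<le> size \<nu>" using min[of "j - i"] ex ij by auto
  moreover have "inj_on ?f {..<b}"
  proof (rule linorder_inj_onI')
    fix i j assume h: "i \<in> {..<b}" "j \<in> {..<b}" "i < j"
    show "?f i \<noteq> ?f j"
    proof
      assume "?f i = ?f j"
      then have "?f (j - i) = \<theta>" using cancel h by auto
      then have "b \<le> j - i" using h by (intro min) auto
      then show False using h by auto
    qed
  qed
  moreover have "?f c = \<theta> \<longleftrightarrow> b dvd c" for c
  proof
    assume c: "?f c = \<theta>"
    have "?f (c div b * b) = \<theta>" using b funpow_mult_fix[of b \<phi> \<theta> "c div b"] by simp
    then have "?f (c - c div b * b) = \<theta>" using cancel[of "c div b * b" c] c by simp
    then have "?f (c mod b) = \<theta>" by (simp add: minus_div_mult_eq_mod)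
    then have "c mod b = 0" using min[of "c mod b"] b mod_less_divisor[of b c] by linarith
    then show "b dvd c" by auto
  next
    assume "b dvd c" then show "?f c = \<theta>" using b funpow_mult_fix[of b \<phi> \<theta> "c div b"] by simp
  qed
  ultimately show ?thesis using that b by blast
qed

lemma card_filter_sum: "finite A \<Longrightarrow> (\<Sum>c\<in>A. if P c then 1 else 0 :: nat) = card {c\<in>A. P c}"
  by (simp only: card_eq_sum sum.inter_filter)

text \<open>Double counting. If an element has exact period \<open>b\<close>, the admissible
  \<open>c\<close> are the multiples \<open>i * b\<close> with \<open>i\<close> between 1 and its
  multiplicity; so each element accounts for its multiplicity, and these add up to the size.\<close>

lemma inv_mset_weight:
  assumes "inj \<phi>" "image_mset \<phi> \<nu> = \<nu>"
  shows "(\<Sum>c=1..size \<nu>. card {\<theta>. (\<phi> ^^ c) \<theta> = \<theta> \<and> orb \<phi> c \<theta> \<subseteq># \<nu>}) = size \<nu>"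
proof -
  have mem: "\<theta> \<in># \<nu>" if "c \<ge> 1" "orb \<phi> c \<theta> \<subseteq># \<nu>" for c \<theta>
    using mset_subset_eqD[OF that(2) mem_orb[OF that(1)]] .
  have *: "card {c\<in>{1..size \<nu>}. (\<phi> ^^ c) \<theta> = \<theta> \<and> orb \<phi> c \<theta> \<subseteq># \<nu>} = count \<nu> \<theta>" if mem\<theta>: "\<theta> \<in># \<nu>" for \<theta>
  proof -
    obtain b where b: "b \<ge> 1" "(\<phi> ^^ b) \<theta> = \<theta>" "inj_on (\<lambda>i. (\<phi> ^^ i) \<theta>) {..<b}"
      "\<And>c. (\<phi> ^^ c) \<theta> = \<theta> \<longleftrightarrow> b dvd c" using period_exists[OF assms mem\<theta>] by metis
    have c1: "count (orb \<phi> b \<theta>) \<eta> = (if \<eta> \<in> (\<lambda>i. (\<phi> ^^ i) \<theta>) ` {..<b} then 1 else 0)" for \<eta>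
    proof -
      have "orb \<phi> b \<theta> = image_mset (\<lambda>i. (\<phi> ^^ i) \<theta>) (mset_set {..<b})"
        by (induction b) (auto simp: orb_Suc lessThan_Suc)
      also have "\<dots> = mset_set ((\<lambda>i. (\<phi> ^^ i) \<theta>) ` {..<b})"
        using b(3) by (rule image_mset_mset_set)
      finally show ?thesis by (simp add: count_mset_set')
    qed
    have sub: "orb \<phi> (i * b) \<theta> \<subseteq># \<nu> \<longleftrightarrow> i \<le> count \<nu> \<theta>" for i
    proof -
      have "orb \<phi> (i * b) \<theta> \<subseteq># \<nu> \<longleftrightarrow> (\<forall>\<eta>. i * count (orb \<phi> b \<theta>) \<eta> \<le> count \<nu> \<eta>)"
        by (simp add: orb_mult[OF b(2)] subseteq_mset_def)
      also have "\<dots> \<longleftrightarrow> i \<le> count \<nu> \<theta>"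
      proof
        assume "\<forall>\<eta>. i * count (orb \<phi> b \<theta>) \<eta> \<le> count \<nu> \<eta>"
        moreover have "count (orb \<phi> b \<theta>) \<theta> = 1" using b(1) by (simp add: c1 image_iff Bex_def exI[of _ 0])
        ultimately show "i \<le> count \<nu> \<theta>" by (metis mult.right_neutral)
      next
        assume "i \<le> count \<nu> \<theta>"
        then show "\<forall>\<eta>. i * count (orb \<phi> b \<theta>) \<eta> \<le> count \<nu> \<eta>"
          by (auto simp: c1 count_inv[OF assms])
      qed
      finally show ?thesis .
    qed
    have "{c\<in>{1..size \<nu>}. (\<phi> ^^ c) \<theta> = \<theta> \<and> orb \<phi> c \<theta> \<subseteq># \<nu>} = (\<lambda>i. i * b) ` {1..count \<nu> \<theta>}"
    proof (intro equalityI subsetI)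
      fix c assume "c \<in> {c\<in>{1..size \<nu>}. (\<phi> ^^ c) \<theta> = \<theta> \<and> orb \<phi> c \<theta> \<subseteq># \<nu>}"
      then have c: "c \<ge> 1" "b dvd c" "orb \<phi> c \<theta> \<subseteq># \<nu>" using b(4) by auto
      then obtain i where i: "c = i * b" by (metis dvd_div_mult_self)
      then have "i \<ge> 1" "i \<le> count \<nu> \<theta>" using c sub by auto
      then show "c \<in> (\<lambda>i. i * b) ` {1..count \<nu> \<theta>}" using i by auto
    next
      fix c assume "c \<in> (\<lambda>i. i * b) ` {1..count \<nu> \<theta>}"
      then obtain i where "i \<in> {1..count \<nu> \<theta>}" and i1: "c = i * b" by blast
      then have i: "c = i * b" "1 \<le> i" "i \<le> count \<nu> \<theta>" by simp_all
      have "orb \<phi> c \<theta> \<subseteq># \<nu>" using i sub by auto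
      moreover from this have "c \<le> size \<nu>" using size_mset_mono by fastforce
      ultimately show "c \<in> {c\<in>{1..size \<nu>}. (\<phi> ^^ c) \<theta> = \<theta> \<and> orb \<phi> c \<theta> \<subseteq># \<nu>}"
        using i b by (auto simp: Suc_le_eq)
    qed
    moreover have "inj_on (\<lambda>i. i * b) {1..count \<nu> \<theta>}" using b(1) by (auto intro!: inj_onI)
    ultimately show ?thesis by (simp add: card_image)
  qed
  have "(\<Sum>c=1..size \<nu>. card {\<theta>. (\<phi> ^^ c) \<theta> = \<theta> \<and> orb \<phi> c \<theta> \<subseteq># \<nu>})
      = (\<Sum>c=1..size \<nu>. \<Sum>\<theta>\<in>set_mset \<nu>. if (\<phi> ^^ c) \<theta> = \<theta> \<and> orb \<phi> c \<theta> \<subseteq># \<nu> then 1 else 0)"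
  proof (rule sum.cong[OF refl])
    fix c assume "c \<in> {1..size \<nu>}"
    then have "{\<theta>. (\<phi> ^^ c) \<theta> = \<theta> \<and> orb \<phi> c \<theta> \<subseteq># \<nu>} =
        {\<theta> \<in> set_mset \<nu>. (\<phi> ^^ c) \<theta> = \<theta> \<and> orb \<phi> c \<theta> \<subseteq># \<nu>}" using mem by auto
    then show "card {\<theta>. (\<phi> ^^ c) \<theta> = \<theta> \<and> orb \<phi> c \<theta> \<subseteq># \<nu>} =
      (\<Sum>\<theta>\<in>set_mset \<nu>. if (\<phi> ^^ c) \<theta> = \<theta> \<and> orb \<phi> c \<theta> \<subseteq># \<nu> then 1 else 0)"
      by (simp only: card_filter_sum finite_set_mset)
  qed
  also have "\<dots> = (\<Sum>\<theta>\<in>set_mset \<nu>. \<Sum>c=1..size \<nu>. if (\<phi> ^^ c) \<theta> = \<theta> \<and> orb \<phi> c \<theta> \<subseteq># \<nu> then 1 else 0)"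
    by (rule sum.swap)
  also have "\<dots> = (\<Sum>\<theta>\<in>set_mset \<nu>. count \<nu> \<theta>)"
    using * by (intro sum.cong[OF refl]) (simp only: card_filter_sum finite_atLeastAtMost)
  also have "\<dots> = size \<nu>" by (simp add: size_multiset_overloaded_eq)
  finally show ?thesis .
qed

lemma finite_msets_size: "finite T \<Longrightarrow> finite {\<nu>. size \<nu> = m \<and> set_mset \<nu> \<subseteq> T}"
proof -
  assume "finite T"
  then have "finite {xs. set xs \<subseteq> T \<and> length xs = m}" by (rule finite_lists_length_eq)
  then have "finite (mset ` {xs. set xs \<subseteq> T \<and> length xs = m})" by simp
  moreover have "{\<nu>. size \<nu> = m \<and> set_mset \<nu> \<subseteq> T} \<subseteq> mset ` {xs. set xs \<subseteq> T \<and> length xs = m}"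
  proof
    fix \<nu> assume \<nu>: "\<nu> \<in> {\<nu>. size \<nu> = m \<and> set_mset \<nu> \<subseteq> T}"
    obtain xs where "mset xs = \<nu>" using ex_mset by blast
    then show "\<nu> \<in> mset ` {xs. set xs \<subseteq> T \<and> length xs = m}" using \<nu> by force
  qed
  ultimately show ?thesis by (rule rev_finite_subset)
qed

lemma finite_inv_msets:
  assumes "inj \<phi>" "\<And>c. c \<ge> 1 \<Longrightarrow> finite (period_pts S \<phi> c)"
  shows "finite (inv_msets S \<phi> m)"
proof -
  have "finite (\<Union>c\<in>{1..m}. period_pts S \<phi> c)" using assms(2) by auto
  then have "finite {\<nu>. size \<nu> = m \<and> set_mset \<nu> \<subseteq> (\<Union>c\<in>{1..m}. period_pts S \<phi> c)}"
    by (rule finite_msets_size)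
  moreover have "inv_msets S \<phi> m \<subseteq> {\<nu>. size \<nu> = m \<and> set_mset \<nu> \<subseteq> (\<Union>c\<in>{1..m}. period_pts S \<phi> c)}"
  proof safe
    fix \<nu> assume \<nu>: "\<nu> \<in> inv_msets S \<phi> m"
    then show "size \<nu> = m" by (simp add: inv_msets_def)
    fix \<theta> assume "\<theta> \<in># \<nu>"
    moreover have "image_mset \<phi> \<nu> = \<nu>" using \<nu> by (simp add: inv_msets_def)
    ultimately obtain b where "b \<ge> 1" "b \<le> size \<nu>" "(\<phi> ^^ b) \<theta> = \<theta>"
      using period_exists[OF assms(1)] by metis
    then show "\<theta> \<in> (\<Union>c\<in>{1..m}. period_pts S \<phi> c)"
      using \<nu> \<open>\<theta> \<in># \<nu>\<close> by (auto simp: inv_msets_def period_pts_def)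
  qed
  ultimately show ?thesis by (rule rev_finite_subset)
qed

lemma inv_msets_0 [simp]: "inv_msets S \<phi> 0 = {{#}}"
  by (auto simp: inv_msets_def)

text \<open>Coefficient form of u L' = M L for the weighted generating function L of stable
  multisets: \<open>inv_mset_weight\<close> distributes the factor \<open>n\<close> over the orbits
  contained in a multiset, and removing such an orbit leaves a stable multiset of size
  \<open>n - c\<close>. The weight is kept abstract because it is used both with \<open>mel\<close>
  and with a multiset joined to its image.\<close>

lemma inv_msets_rec:
  fixes w :: "'b multiset \<Rightarrow> 'r::comm_ring_1"
  assumes inj: "inj \<phi>" and fin: "\<And>c. c \<ge> 1 \<Longrightarrow> finite (period_pts S \<phi> c)"
    and closed: "\<And>\<theta>. \<theta> \<in> S \<Longrightarrow> \<phi> \<theta> \<in> S"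
    and w: "\<And>\<mu> \<nu>. w (\<mu> + \<nu>) = w \<mu> * w \<nu>"
  shows "of_nat n * (\<Sum>\<nu>\<in>inv_msets S \<phi> n. w \<nu>) =
    (\<Sum>c=1..n. (\<Sum>\<theta>\<in>period_pts S \<phi> c. w (orb \<phi> c \<theta>)) * (\<Sum>\<nu>\<in>inv_msets S \<phi> (n - c). w \<nu>))"
proof -
  have S_orb: "(\<phi> ^^ i) \<theta> \<in> S" if "\<theta> \<in> S" for i \<theta> using that closed by (induction i) auto
  note fini = finite_inv_msets[OF inj fin]
  define T where "T c \<nu> = {\<theta>. (\<phi> ^^ c) \<theta> = \<theta> \<and> orb \<phi> c \<theta> \<subseteq># \<nu>}" for c \<nu>
  have T: "T c \<nu> = {\<theta>\<in>period_pts S \<phi> c. orb \<phi> c \<theta> \<subseteq># \<nu>}" if "c \<ge> 1" "\<nu> \<in> inv_msets S \<phi> n" for c \<nu>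
  proof -
    have "\<theta> \<in> S" if "orb \<phi> c \<theta> \<subseteq># \<nu>" for \<theta>
      using mset_subset_eqD[OF that mem_orb] \<open>c \<ge> 1\<close> \<open>\<nu> \<in> _\<close> by (auto simp: inv_msets_def)
    then show ?thesis by (auto simp: T_def period_pts_def)
  qed
  have "of_nat n * (\<Sum>\<nu>\<in>inv_msets S \<phi> n. w \<nu>) = (\<Sum>\<nu>\<in>inv_msets S \<phi> n. of_nat (\<Sum>c=1..n. card (T c \<nu>)) * w \<nu>)"
    unfolding sum_distrib_left
  proof (rule sum.cong[OF refl])
    fix \<nu> assume "\<nu> \<in> inv_msets S \<phi> n"
    then have "(\<Sum>c=1..n. card (T c \<nu>)) = n"
      using inv_mset_weight[OF inj, of \<nu>] by (simp add: inv_msets_def T_def)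
    then show "of_nat n * w \<nu> = of_nat (\<Sum>c=1..n. card (T c \<nu>)) * w \<nu>" by simp
  qed
  also have "\<dots> = (\<Sum>\<nu>\<in>inv_msets S \<phi> n. \<Sum>c=1..n. \<Sum>\<theta>\<in>T c \<nu>. w \<nu>)"
    by (simp add: sum_distrib_right)
  also have "\<dots> = (\<Sum>c=1..n. \<Sum>\<nu>\<in>inv_msets S \<phi> n. \<Sum>\<theta>\<in>T c \<nu>. w \<nu>)"
    by (rule sum.swap)
  also have "\<dots> = (\<Sum>c=1..n. (\<Sum>\<theta>\<in>period_pts S \<phi> c. w (orb \<phi> c \<theta>)) * (\<Sum>\<nu>\<in>inv_msets S \<phi> (n - c). w \<nu>))"
  proof (rule sum.cong[OF refl])
    fix c assume c: "c \<in> {1..n}"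
    have "(\<Sum>\<nu>\<in>inv_msets S \<phi> n. \<Sum>\<theta>\<in>T c \<nu>. w \<nu>) = (\<Sum>(\<nu>,\<theta>)\<in>Sigma (inv_msets S \<phi> n) (T c). w \<nu>)"
      using c T fin[of c] by (subst sum.Sigma) (auto simp: fini)
    also have "\<dots> = (\<Sum>(\<theta>,\<mu>)\<in>period_pts S \<phi> c \<times> inv_msets S \<phi> (n - c). w (orb \<phi> c \<theta>) * w \<mu>)"
    proof (rule sum.reindex_bij_witness[where i = "\<lambda>(\<theta>,\<mu>). (orb \<phi> c \<theta> + \<mu>, \<theta>)"
          and j = "\<lambda>(\<nu>,\<theta>). (\<theta>, \<nu> - orb \<phi> c \<theta>)"])
      fix a assume a: "a \<in> Sigma (inv_msets S \<phi> n) (T c)"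
      obtain \<nu> \<theta> where [simp]: "a = (\<nu>, \<theta>)" by (cases a)
      have h: "\<nu> \<in> inv_msets S \<phi> n" "(\<phi> ^^ c) \<theta> = \<theta>" "orb \<phi> c \<theta> \<subseteq># \<nu>" "\<theta> \<in> period_pts S \<phi> c"
        using a T[of c] c by (auto simp: T_def)
      then obtain \<mu> where \<mu>: "\<nu> = orb \<phi> c \<theta> + \<mu>" by (metis subset_mset.le_iff_add)
      have "image_mset \<phi> \<mu> = \<mu>" using h(1) image_orb[OF h(2)] by (simp add: \<mu> inv_msets_def)
      then have "\<mu> \<in> inv_msets S \<phi> (n - c)" using h(1) by (auto simp: inv_msets_def \<mu>)
      then show "(case case a of (\<nu>, \<theta>) \<Rightarrow> (\<theta>, \<nu> - orb \<phi> c \<theta>) of (\<theta>, \<mu>) \<Rightarrow> (orb \<phi> c \<theta> + \<mu>, \<theta>)) = a"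
        "(case a of (\<nu>, \<theta>) \<Rightarrow> (\<theta>, \<nu> - orb \<phi> c \<theta>)) \<in> period_pts S \<phi> c \<times> inv_msets S \<phi> (n - c)"
        "(case case a of (\<nu>, \<theta>) \<Rightarrow> (\<theta>, \<nu> - orb \<phi> c \<theta>) of (\<theta>, \<mu>) \<Rightarrow> w (orb \<phi> c \<theta>) * w \<mu>) = (case a of (\<nu>, \<theta>) \<Rightarrow> w \<nu>)"
        using h(4) by (simp_all add: \<mu> w)
    next
      fix b assume b: "b \<in> period_pts S \<phi> c \<times> inv_msets S \<phi> (n - c)"
      obtain \<theta> \<mu> where [simp]: "b = (\<theta>, \<mu>)" by (cases b)
      have h: "(\<phi> ^^ c) \<theta> = \<theta>" "\<theta> \<in> S" "\<mu> \<in> inv_msets S \<phi> (n - c)" using b by (auto simp: period_pts_def)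
      have "orb \<phi> c \<theta> + \<mu> \<in> inv_msets S \<phi> n"
        using h c S_orb by (auto simp: inv_msets_def image_orb set_mset_orb)
      then show "(case b of (\<theta>, \<mu>) \<Rightarrow> (orb \<phi> c \<theta> + \<mu>, \<theta>)) \<in> Sigma (inv_msets S \<phi> n) (T c)"
        "(case case b of (\<theta>, \<mu>) \<Rightarrow> (orb \<phi> c \<theta> + \<mu>, \<theta>) of (\<nu>, \<theta>) \<Rightarrow> (\<theta>, \<nu> - orb \<phi> c \<theta>)) = b"
        using h by (auto simp: T_def)
    qed
    also have "\<dots> = (\<Sum>\<theta>\<in>period_pts S \<phi> c. w (orb \<phi> c \<theta>)) * (\<Sum>\<nu>\<in>inv_msets S \<phi> (n - c). w \<nu>)"
      by (simp add: sum_product sum.cartesian_product)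
    finally show "(\<Sum>\<nu>\<in>inv_msets S \<phi> n. \<Sum>\<theta>\<in>T c \<nu>. w \<nu>) =
      (\<Sum>\<theta>\<in>period_pts S \<phi> c. w (orb \<phi> c \<theta>)) * (\<Sum>\<nu>\<in>inv_msets S \<phi> (n - c). w \<nu>)" .
  qed
  finally show ?thesis .
qed

section \<open>The monoid algebra of multisets and its power series\<close>

text \<open>With multisets as monomials, multiplying characteristic polynomials becomes adding
  multisets, and a single power series records the distribution of all eigenvalues together.\<close>

type_synonym 'b malg = "'b multiset \<Rightarrow>\<^sub>0 real"

definition mel :: "'b multiset \<Rightarrow> 'b malg" where "mel \<nu> = Poly_Mapping.single \<nu> 1"
definition cst :: "real \<Rightarrow> 'b malg" where "cst r = Poly_Mapping.single 0 r"

lemma mel_add: "mel (\<mu> + \<nu>) = mel \<mu> * mel \<nu>"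
  by (simp add: mel_def mult_single)

lemma cst_mult: "cst a * cst b = cst (a * b)"
  by (simp add: cst_def mult_single)

lemma cst_add: "cst a + cst b = cst (a + b)"
  by (simp add: cst_def single_add)

lemma cst_1 [simp]: "cst 1 = 1"
  by (simp add: cst_def)

lemma cst_0 [simp]: "cst 0 = 0"
  by (simp add: cst_def)

lemma cst_of_nat: "cst (of_nat n) = of_nat n"
  by (induction n) (simp_all flip: cst_add)

lemma cst_cancel: assumes "r \<noteq> 0" "cst r * x = cst r * y" shows "x = y"
proof -
  have "cst (1 / r) * (cst r * x) = cst (1 / r) * (cst r * y)" using assms(2) by simp
  then show ?thesis using assms(1) by (simp add: cst_mult flip: mult.assoc)
qed

text \<open>Substitution of \<open>r u\<close> for the variable \<open>u\<close>.\<close>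

definition scale :: "real \<Rightarrow> 'b malg fps \<Rightarrow> 'b malg fps" where
  "scale r F = Abs_fps (\<lambda>n. cst (r ^ n) * fps_nth F n)"

lemma scale_nth [simp]: "fps_nth (scale r F) n = cst (r ^ n) * fps_nth F n"
  by (simp add: scale_def)

lemma scale_mult: "scale r (F * G) = scale r F * scale r G"
proof (rule fps_ext)
  fix n
  have "cst (r ^ n) * (fps_nth F i * fps_nth G (n - i)) =
    (cst (r ^ i) * fps_nth F i) * (cst (r ^ (n - i)) * fps_nth G (n - i))" if "i \<le> n" for i
  proof -
    have "(cst (r ^ i) * fps_nth F i) * (cst (r ^ (n - i)) * fps_nth G (n - i)) =
       (cst (r ^ i) * cst (r ^ (n - i))) * (fps_nth F i * fps_nth G (n - i))"
      by (simp only: mult_ac)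
    also have "cst (r ^ i) * cst (r ^ (n - i)) = cst (r ^ n)"
      using that by (simp add: cst_mult flip: power_add)
    finally show ?thesis by simp
  qed
  then show "fps_nth (scale r (F * G)) n = fps_nth (scale r F * scale r G) n"
    by (simp add: fps_mult_nth sum_distrib_left)
qed

section \<open>Logarithmic derivatives of power series over the monoid algebra\<close>

text \<open>\<open>G\<close> is u F' / F, written without division; the normalisation of the
  constant term makes \<open>F\<close> unique for given \<open>G\<close>.\<close>

definition logd :: "'b malg fps \<Rightarrow> 'b malg fps \<Rightarrow> bool" where
  "logd F G \<longleftrightarrow> fps_nth F 0 = 1 \<and> fps_X * fps_deriv F = G * F"

lemma logd_iff: "logd F G \<longleftrightarrow> fps_nth F 0 = 1 \<and>
  (\<forall>n. of_nat n * fps_nth F n = (\<Sum>c=0..n. fps_nth G c * fps_nth F (n - c)))"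
proof -
  have "fps_nth (fps_X * fps_deriv F) n = of_nat n * fps_nth F n" for n
    by (cases n) auto
  then show ?thesis by (simp add: logd_def fps_eq_iff fps_mult_nth)
qed

lemma logd_0: "logd F G \<Longrightarrow> fps_nth G 0 = 0"
  by (auto simp: logd_iff dest: spec[of _ 0])

lemma logd_iff': "logd F G \<longleftrightarrow> fps_nth F 0 = 1 \<and> fps_nth G 0 = 0 \<and>
  (\<forall>n. of_nat n * fps_nth F n = (\<Sum>c=1..n. fps_nth G c * fps_nth F (n - c)))"
proof -
  have "(\<Sum>c=0..n. fps_nth G c * fps_nth F (n - c)) = (\<Sum>c=1..n. fps_nth G c * fps_nth F (n - c))"
    if "fps_nth G 0 = 0" for n
    using that by (subst sum.atLeast_Suc_atMost) auto
  then show ?thesis using logd_0[of F G] logd_iff[of F G] by auto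
qed

lemma logd_mult: "logd F G \<Longrightarrow> logd F' G' \<Longrightarrow> logd (F * F') (G + G')"
proof -
  assume h: "logd F G" "logd F' G'"
  have "fps_X * fps_deriv (F * F') = (fps_X * fps_deriv F) * F' + (fps_X * fps_deriv F') * F"
    by (simp add: algebra_simps)
  also have "\<dots> = (G * F) * F' + (G' * F') * F" using h by (simp add: logd_def)
  also have "\<dots> = (G + G') * (F * F')" by (simp add: algebra_simps)
  finally show ?thesis using h by (simp add: logd_def)
qed

lemma logd_scale: "logd F G \<Longrightarrow> logd (scale r F) (scale r G)"
proof -
  assume h: "logd F G"
  have "fps_X * fps_deriv (scale r F) = scale r (fps_X * fps_deriv F)"
  proof (rule fps_ext)
    fix n show "fps_nth (fps_X * fps_deriv (scale r F)) n = fps_nth (scale r (fps_X * fps_deriv F)) n"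
      by (cases n) (simp_all add: mult_ac)
  qed
  then show ?thesis using h scale_mult[of r G F] by (simp add: logd_def)
qed

lemma logd_unique: assumes "logd F G" "logd F' G" shows "F = F'"
proof (rule fps_ext)
  fix n show "fps_nth F n = fps_nth F' n"
  proof (induction n rule: less_induct)
    case (less n)
    show ?case
    proof (cases "n = 0")
      case False
      have "of_nat n * fps_nth F n = of_nat n * fps_nth F' n"
        using assms less by (simp add: logd_iff')
      then show ?thesis using cst_cancel[of "of_nat n"] False by (simp add: cst_of_nat)
    qed (use assms in \<open>simp add: logd_def\<close>)
  qed
qed

fun lsol :: "(nat \<Rightarrow> 'b malg) \<Rightarrow> nat \<Rightarrow> 'b malg" where
  "lsol g 0 = 1"
| "lsol g (Suc n) = cst (1 / of_nat (Suc n)) * (\<Sum>c\<le>n. g (Suc c) * lsol g (n - c))"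

lemma logd_exists: assumes "fps_nth G 0 = 0" shows "\<exists>F. logd F G"
proof
  show "logd (Abs_fps (lsol (fps_nth G))) G"
    unfolding logd_iff'
  proof (intro conjI allI)
    fix n
    show "of_nat n * fps_nth (Abs_fps (lsol (fps_nth G))) n =
      (\<Sum>c=1..n. fps_nth G c * fps_nth (Abs_fps (lsol (fps_nth G))) (n - c))"
    proof (cases n)
      case (Suc m)
      have "of_nat n * lsol (fps_nth G) n = (cst (of_nat n) * cst (1 / of_nat n)) *
          (\<Sum>c\<le>m. fps_nth G (Suc c) * lsol (fps_nth G) (m - c))"
        by (simp only: Suc lsol.simps cst_of_nat mult.assoc)
      also have "\<dots> = (\<Sum>c\<le>m. fps_nth G (Suc c) * lsol (fps_nth G) (m - c))"
        by (simp add: cst_mult Suc)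
      also have "\<dots> = (\<Sum>c=1..n. fps_nth G c * lsol (fps_nth G) (n - c))"
        by (simp only: Suc One_nat_def sum.shift_bounds_cl_Suc_ivl atMost_atLeast0 diff_Suc_Suc)
      finally show ?thesis by simp
    qed simp
  qed (use assms in auto)
qed

text \<open>At u^n the equation expresses (r^n - 1) F_n through earlier coefficients, and the factor
  is invertible since r > 1. Hence exhibiting one solution is enough.\<close>

lemma functional_unique:
  fixes F H L Q :: "'b malg fps"
  assumes F: "scale r F * L = Q * F" "fps_nth F 0 = 1" and H: "scale r H * L = Q * H" "fps_nth H 0 = 1"
    and LQ: "fps_nth L 0 = 1" "fps_nth Q 0 = 1" and r: "r > 1"
  shows "F = H"
proof (rule fps_ext)
  fix n show "fps_nth F n = fps_nth H n"
  proof (induction n rule: less_induct)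
    case (less n)
    show ?case
    proof (cases "n = 0")
      case False
      have *: "cst (r ^ n - 1) * fps_nth G n = (\<Sum>i=1..n. fps_nth Q i * fps_nth G (n - i))
          - (\<Sum>i<n. fps_nth (scale r G) i * fps_nth L (n - i))"
        if "scale r G * L = Q * G" "fps_nth G 0 = 1" for G
      proof -
        have "(\<Sum>i=0..n. fps_nth (scale r G) i * fps_nth L (n - i)) = (\<Sum>i=0..n. fps_nth Q i * fps_nth G (n - i))"
          using that(1) by (simp only: flip: fps_mult_nth)
        moreover have "(\<Sum>i=0..n. fps_nth (scale r G) i * fps_nth L (n - i)) =
           cst (r ^ n) * fps_nth G n + (\<Sum>i<n. fps_nth (scale r G) i * fps_nth L (n - i))"
          using LQ by (simp add: atLeast0AtMost lessThan_Suc_atMost[symmetric])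
        moreover have "(\<Sum>i=0..n. fps_nth Q i * fps_nth G (n - i)) =
           fps_nth G n + (\<Sum>i=1..n. fps_nth Q i * fps_nth G (n - i))"
          using LQ by (subst sum.atLeast_Suc_atMost) auto
        ultimately have main: "cst (r ^ n) * fps_nth G n + (\<Sum>i<n. fps_nth (scale r G) i * fps_nth L (n - i)) =
           fps_nth G n + (\<Sum>i=1..n. fps_nth Q i * fps_nth G (n - i))" by (simp only:)
        have e: "cst (r ^ n - 1) = cst (r ^ n) - (1 :: 'b malg)"
          using cst_add[of "r ^ n - 1" 1] by (metis add_diff_cancel_right' cst_1 diff_add_cancel)
        show ?thesis unfolding e left_diff_distrib mult_1
          using main by (simp only: eq_diff_eq diff_add_eq diff_eq_eq) (simp only: add.commute)
      qed
      have "cst (r ^ n - 1) * fps_nth F n = cst (r ^ n - 1) * fps_nth H n"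
        unfolding *[OF F] *[OF H] using less by simp
      moreover have "r ^ n > 1" using r False by (intro one_less_power) auto
      ultimately show ?thesis using cst_cancel by (metis diff_gt_0_iff_gt less_irrefl)
    qed (use F(2) H(2) in simp)
  qed
qed

section \<open>Generating functions of stable multisets and the functional equation\<close>

locale periodic_bij =
  fixes S :: "'b set" and \<phi> :: "'b \<Rightarrow> 'b"
  assumes inj: "inj \<phi>" and closed: "\<And>\<theta>. \<theta> \<in> S \<Longrightarrow> \<phi> \<theta> \<in> S"
    and fin: "\<And>c. c \<ge> 1 \<Longrightarrow> finite (period_pts S \<phi> c)"
begin

definition Mf :: "nat \<Rightarrow> 'b malg" where "Mf c = (\<Sum>\<theta>\<in>period_pts S \<phi> c. mel (orb \<phi> c \<theta>))"

definition Lf :: "'b malg fps" where "Lf = Abs_fps (\<lambda>m. \<Sum>\<nu>\<in>inv_msets S \<phi> m. mel \<nu>)"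

text \<open>In the application the multisets stable under the square of the map are the root
  multisets of polynomials over F_{q^2}, namely the eigenvalues on a radical, and their images are
  the eigenvalues on the dual quotient. The pair occupies an even number of dimensions.\<close>

definition Rf :: "'b malg fps" where
  "Rf = Abs_fps (\<lambda>m. if even m then \<Sum>\<rho>\<in>inv_msets S (\<phi> \<circ> \<phi>) (m div 2). mel (\<rho> + image_mset \<phi> \<rho>) else 0)"

lemma finite_inv: "finite (inv_msets S \<phi> m)"
  using inj fin by (rule finite_inv_msets)

lemma funpow_sq: "(\<phi> \<circ> \<phi>) ^^ c = \<phi> ^^ (2 * c)"
  by (induction c) (auto simp: fun_eq_iff)

lemma period_pts_sq: "period_pts S (\<phi> \<circ> \<phi>) c = period_pts S \<phi> (2 * c)"
  unfolding period_pts_def funpow_sq ..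

lemma finite_inv_sq: "finite (inv_msets S (\<phi> \<circ> \<phi>) m)"
  using inj fin by (intro finite_inv_msets) (auto simp: inj_compose period_pts_sq)

lemma logd_Lf: "logd Lf (Abs_fps (\<lambda>c. if c = 0 then 0 else Mf c))"
  unfolding logd_iff'
proof (intro conjI allI)
  fix n
  show "of_nat n * fps_nth Lf n =
    (\<Sum>c=1..n. fps_nth (Abs_fps (\<lambda>c. if c = 0 then 0 else Mf c)) c * fps_nth Lf (n - c))"
    using inv_msets_rec[OF inj fin closed, of mel n] by (simp add: mel_add Lf_def Mf_def)
qed (simp_all add: Lf_def mel_def)

text \<open>The \<open>c\<close>-periodic points of the squared map are the
  \<open>2 * c\<close>-periodic points of the map, and \<open>orb_sq\<close> glues an orbit of the
  square to its image. The factor 2 arises because the recursion is in \<open>a\<close> while the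
  exponent is \<open>n = 2 * a\<close>.\<close>

lemma logd_Rf: "logd Rf (Abs_fps (\<lambda>c. if c = 0 \<or> odd c then 0 else 2 * Mf c))"
  unfolding logd_iff'
proof (intro conjI allI)
  fix n
  define w where "w \<rho> = mel (\<rho> + image_mset \<phi> \<rho>)" for \<rho>
  show "of_nat n * fps_nth Rf n =
    (\<Sum>c=1..n. fps_nth (Abs_fps (\<lambda>c. if c = 0 \<or> odd c then 0 else 2 * Mf c)) c * fps_nth Rf (n - c))"
  proof (cases "even n")
    case False
    have "fps_nth (Abs_fps (\<lambda>c. if c = 0 \<or> odd c then 0 else 2 * Mf c)) c * fps_nth Rf (n - c) = 0" if "c \<le> n" for c
      using False that by (cases "even c") (auto simp: Rf_def)
    then have "(\<Sum>c=1..n. fps_nth (Abs_fps (\<lambda>c. if c = 0 \<or> odd c then 0 else 2 * Mf c)) c * fps_nth Rf (n - c)) = 0"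
      by (intro sum.neutral ballI) (simp only: atLeastAtMost_iff)
    moreover have "fps_nth Rf n = 0" using False by (simp add: Rf_def)
    ultimately show ?thesis by simp
  next
    case True
    then obtain a where n: "n = 2 * a" by (auto elim: evenE)
    have w: "w (\<mu> + \<nu>) = w \<mu> * w \<nu>" for \<mu> \<nu>
      unfolding w_def mel_add[symmetric] by (simp add: ac_simps)
    have R: "fps_nth Rf (2 * i) = (\<Sum>\<rho>\<in>inv_msets S (\<phi> \<circ> \<phi>) i. w \<rho>)" for i
      by (simp add: Rf_def w_def)
    have M: "(\<Sum>\<theta>\<in>period_pts S (\<phi> \<circ> \<phi>) c. w (orb (\<phi> \<circ> \<phi>) c \<theta>)) = Mf (2 * c)" for c
      unfolding Mf_def period_pts_sq w_def orb_sq ..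
    have "of_nat a * fps_nth Rf (2 * a) = (\<Sum>c=1..a. Mf (2 * c) * fps_nth Rf (2 * (a - c)))"
      unfolding R M[symmetric]
      by (rule inv_msets_rec) (use inj fin closed w in \<open>auto simp: inj_compose period_pts_sq\<close>)
    then have "of_nat n * fps_nth Rf n = (\<Sum>c=1..a. 2 * Mf (2 * c) * fps_nth Rf (n - 2 * c))"
      by (simp add: n mult.assoc sum_distrib_left[symmetric] right_diff_distrib')
    also have "\<dots> = (\<Sum>c\<in>{c\<in>{1..n}. even c}. 2 * Mf c * fps_nth Rf (n - c))"
      by (rule sum.reindex_bij_witness[where i = "\<lambda>c. c div 2" and j = "\<lambda>c. 2 * c"]) (auto simp: n)
    also have "\<dots> = (\<Sum>c=1..n. if even c then 2 * Mf c * fps_nth Rf (n - c) else 0)"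
      by (rule sum.inter_filter) auto
    also have "\<dots> = (\<Sum>c=1..n. fps_nth (Abs_fps (\<lambda>c. if c = 0 \<or> odd c then 0 else 2 * Mf c)) c * fps_nth Rf (n - c))"
      by (rule sum.cong) auto
    finally show ?thesis .
  qed
qed (simp_all add: Rf_def mel_def flip: zero_multiset_def)

text \<open>On logarithmic derivatives the equation is linear: with e = (-1)^c, the unknown
  coefficient satisfies q^(2c) g_c + M_c = (1 + e) M_c + q^c M_c + g_c. As q^(2c) - 1 = (q^c -
  e)(q^c + e), this gives g_c = M_c / (q^c - e).\<close>

theorem functional_solution:
  fixes q :: real
  assumes q: "q > 1"
    and eq: "scale (q\<^sup>2) F * Lf = (Rf * scale q Lf) * F" and F0: "fps_nth F 0 = 1"
  shows "logd F (Abs_fps (\<lambda>c. if c = 0 then 0 else cst (1 / (q ^ c - (-1) ^ c)) * Mf c))"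
    and "F = scale (1 / q) Lf * scale (- 1 / q) F"
proof -
  define G where "G = Abs_fps (\<lambda>c. if c = 0 then 0 else cst (1 / (q ^ c - (-1) ^ c)) * Mf c)"
  obtain H where H: "logd H G" using logd_exists[of G] by (auto simp: G_def)
  have nz: "q ^ c - (-1) ^ c \<noteq> 0" if "c \<noteq> 0" for c :: nat
  proof -
    have "q ^ c > 1" using q that by (intro one_less_power) auto
    moreover have "(-1 :: real) ^ c \<le> 1" by (cases "even c") auto
    ultimately show ?thesis by linarith
  qed
  have eps: "(-1 :: real) ^ c * (-1) ^ c = 1" for c :: nat by (simp flip: power_add)
  have cM: "cst a * Mf c + cst b * Mf c = cst (a + b) * Mf c" for a b c
    by (simp add: cst_add flip: distrib_right)
  have c2: "2 * Mf c = cst 2 * Mf c" for c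
    by (metis cst_of_nat of_nat_numeral)
  have 1: "scale (q\<^sup>2) G + Abs_fps (\<lambda>c. if c = 0 then 0 else Mf c) =
     (Abs_fps (\<lambda>c. if c = 0 \<or> odd c then 0 else 2 * Mf c) + scale q (Abs_fps (\<lambda>c. if c = 0 then 0 else Mf c))) + G"
  proof (rule fps_ext)
    fix c
    show "fps_nth (scale (q\<^sup>2) G + Abs_fps (\<lambda>c. if c = 0 then 0 else Mf c)) c = fps_nth (
     (Abs_fps (\<lambda>c. if c = 0 \<or> odd c then 0 else 2 * Mf c) + scale q (Abs_fps (\<lambda>c. if c = 0 then 0 else Mf c))) + G) c"
    proof (cases "c = 0")
      case False
      define e :: real where "e = (-1) ^ c"
      have e: "e * e = 1" "q ^ c - e \<noteq> 0" using eps nz[OF False] by (auto simp: e_def)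
      define t :: real where "t = (if even c then 2 else 0)"
      have t: "t = 1 + e" by (auto simp: t_def e_def)
      have "((q\<^sup>2) ^ c) * (1 / (q ^ c - e)) + 1 = t + q ^ c + 1 / (q ^ c - e)"
      proof -
        have "(q\<^sup>2) ^ c = q ^ c * q ^ c" by (simp add: power2_eq_square power_mult_distrib)
        then have "(q\<^sup>2) ^ c - 1 = (q ^ c + e) * (q ^ c - e)" using e by (simp add: algebra_simps)
        then have "((q\<^sup>2) ^ c - 1) / (q ^ c - e) = q ^ c + e" using e by simp
        then show ?thesis unfolding t by (simp add: diff_divide_distrib)
      qed
      then have "cst ((q\<^sup>2) ^ c) * (cst (1 / (q ^ c - e)) * Mf c) + cst 1 * Mf c =
         cst t * Mf c + cst (q ^ c) * Mf c + cst (1 / (q ^ c - e)) * Mf c"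
        by (simp only: cM cst_mult flip: mult.assoc)
      then show ?thesis using False by (auto simp: G_def t_def e_def c2 add.assoc simp flip: e_def)
    qed (simp add: G_def)
  qed
  have "scale (q\<^sup>2) H * Lf = (Rf * scale q Lf) * H"
    by (rule logd_unique[OF logd_mult[OF logd_scale[OF H] logd_Lf]], subst 1)
       (intro logd_mult logd_scale logd_Lf logd_Rf H)
  moreover have "fps_nth H 0 = 1" using H by (simp add: logd_def)
  moreover have "fps_nth Lf 0 = 1" using logd_Lf by (simp add: logd_def)
  moreover have "fps_nth (Rf * scale q Lf) 0 = 1" using logd_Lf logd_Rf by (simp add: logd_def fps_mult_nth)
  moreover have "q\<^sup>2 > 1" using q by simp
  ultimately have FH: "F = H" using functional_unique[OF eq F0] by blast
  then show "logd F (Abs_fps (\<lambda>c. if c = 0 then 0 else cst (1 / (q ^ c - (-1) ^ c)) * Mf c))"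
    using H by (simp add: G_def)
  \<comment> \<open>One step of a geometric expansion, 1/(q^c - e) = q^(-c) + e q^(-c)/(q^c - e);
    exponentiated, it is the recursion F(u) = L(u/q) F(-u/q).\<close>
  have 2: "G = scale (1 / q) (Abs_fps (\<lambda>c. if c = 0 then 0 else Mf c)) + scale (- 1 / q) G"
  proof (rule fps_ext)
    fix c
    show "fps_nth G c = fps_nth (scale (1 / q) (Abs_fps (\<lambda>c. if c = 0 then 0 else Mf c)) + scale (- 1 / q) G) c"
    proof (cases "c = 0")
      case False
      define e :: real where "e = (-1) ^ c"
      have e: "e * e = 1" "q ^ c - e \<noteq> 0" using eps nz[OF False] by (auto simp: e_def)
      have qc: "q ^ c \<noteq> 0" using q by simp
      have "1 / (q ^ c - e) = 1 / q ^ c + e / q ^ c * (1 / (q ^ c - e))"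
        using e qc by (simp add: field_simps)
      moreover have "(- 1 / q) ^ c = e / q ^ c" by (metis e_def power_divide)
      ultimately have "cst (1 / (q ^ c - e)) * Mf c = cst ((1 / q) ^ c) * Mf c +
          cst ((- 1 / q) ^ c) * (cst (1 / (q ^ c - e)) * Mf c)"
        by (simp only: cM cst_mult power_one_over flip: mult.assoc)
      then show ?thesis using False by (simp add: G_def e_def)
    qed (simp add: G_def)
  qed
  have "H = scale (1 / q) Lf * scale (- 1 / q) H"
    by (rule logd_unique[OF H], subst 2) (intro logd_mult logd_scale logd_Lf H)
  then show "F = scale (1 / q) Lf * scale (- 1 / q) F" using FH by simp
qed

end

section \<open>Polynomials over the finite field and multisets of roots\<close>

definition pol :: "'b::field multiset \<Rightarrow> 'b poly" where
  "pol \<nu> = (\<Prod>\<theta>\<in>#\<nu>. [:-\<theta>, 1:])"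

lemma pol_empty [simp]: "pol {#} = 1"
  by (simp add: pol_def)

lemma pol_add_mset [simp]: "pol (add_mset \<theta> \<nu>) = [:-\<theta>, 1:] * pol \<nu>"
  by (simp add: pol_def)

lemma monic_pol: "monic (pol \<nu>)"
  by (induction \<nu>) (auto simp: lead_coeff_mult simp del: mult_pCons_left)

lemma pol_nz [simp]: "pol \<nu> \<noteq> 0"
  using monic_pol[of \<nu>] by auto

lemma degree_pol [simp]: "degree (pol \<nu>) = size \<nu>"
  by (induction \<nu>) (auto simp: degree_mult_eq simp del: mult_pCons_left)

lemma proots_pol [simp]: "proots (pol \<nu>) = \<nu>"
proof (induction \<nu>)
  case (add \<theta> \<nu>)
  have "proots ([:-\<theta>, 1:] * pol \<nu>) = proots [:-\<theta>, 1:] + proots (pol \<nu>)"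
    by (rule proots_mult) auto
  then show ?case using add by (simp del: mult_pCons_left)
qed simp

lemma pol_proots: assumes "monic P" shows "pol (proots P) = (P :: 'b::alg_closed_field poly)"
proof -
  have "P \<noteq> 0" using assms by auto
  then obtain A where "P = smult (lead_coeff P) (\<Prod>x\<in>#A. [:- x, 1:])"
    using alg_closed_imp_factorization by metis
  then have "P = pol A" using assms by (simp add: pol_def)
  then show ?thesis by simp
qed

lemma size_proots_ac: assumes "monic P" shows "size (proots P) = degree (P :: 'b::alg_closed_field poly)"
  using degree_pol[of "proots P"] pol_proots[OF assms] by simp

lemma map_poly_pol:
  assumes "comm_ring_hom h" shows "map_poly h (pol \<nu>) = pol (image_mset h \<nu>)"
proof -
  interpret map_poly_comm_ring_hom h using assms by (simp add: map_poly_comm_ring_hom.intro)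
  show ?thesis
    by (induction \<nu>) (simp_all add: hom_mult base.hom_uminus del: mult_pCons_left)
qed

lemma reflect_pol:
  assumes "0 \<notin># \<nu>"
  shows "reflect_poly (pol \<nu>) = smult (\<Prod>\<theta>\<in>#\<nu>. -\<theta>) (pol (image_mset inverse \<nu>))"
  using assms
proof (induction \<nu>)
  case (add \<theta> \<nu>)
  have "reflect_poly [:-\<theta>, 1:] = smult (-\<theta>) [:-inverse \<theta>, 1:]"
    using add.prems by (simp add: reflect_poly_pCons)
  then have "reflect_poly (pol (add_mset \<theta> \<nu>)) =
      smult (-\<theta>) [:-inverse \<theta>, 1:] * smult (\<Prod>\<theta>\<in>#\<nu>. -\<theta>) (pol (image_mset inverse \<nu>))"
    using add by (simp only: pol_add_mset reflect_poly_mult set_mset_add_mset_insert insert_iff de_Morgan_disj simp_thms)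
  then show ?case
    by (simp only: image_mset_add_mset prod_mset.add_mset pol_add_mset mult_smult_left mult_smult_right smult_smult mult.commute)
qed simp

lemma coeff_0_pol: "poly.coeff (pol \<nu>) 0 = (\<Prod>\<theta>\<in>#\<nu>. -\<theta>)"
  by (induction \<nu>) (simp_all add: coeff_mult_0 del: mult_pCons_left)

lemma coeff_0_pol_nz: "poly.coeff (pol \<nu>) 0 \<noteq> 0 \<longleftrightarrow> 0 \<notin># \<nu>"
  by (auto simp: coeff_0_pol prod_mset_zero_iff)

section \<open>The field F_{q^2} and its algebraic closure\<close>

locale ff_setup =
  fixes q p r :: nat and ty :: "'a::{field,finite} itself"
  assumes p: "prime p" and r: "r \<ge> 1" and q_def: "q = p ^ r" and card_K: "CARD('a) = q ^ 2"
begin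

lemma q_gt1: "q > 1"
  unfolding q_def using one_less_power[of p r] prime_gt_1_nat[OF p] r by simp

lemma fermat: "x ^ (q ^ 2) = (x :: 'a)"
proof (cases "x = 0")
  case False
  let ?U = "UNIV - {0} :: 'a set"
  have "(\<Prod>y\<in>?U. y) = (\<Prod>y\<in>?U. x * y)"
    by (rule prod.reindex_bij_witness[where i = "\<lambda>y. x * y" and j = "\<lambda>y. y / x"]) (use False in auto)
  also have "\<dots> = x ^ card ?U * (\<Prod>y\<in>?U. y)" by (simp add: prod.distrib)
  finally have "x ^ card ?U = 1" using prod_zero_iff[of ?U "\<lambda>y. y"] by auto
  then have "x ^ (q ^ 2 - 1) = 1" by (simp add: card_Diff_singleton card_K)
  then have "x ^ (q ^ 2 - 1) * x = x" by simp
  then have "x ^ Suc (q ^ 2 - 1) = x" by (simp only: power_Suc mult.commute)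
  moreover have "Suc (q ^ 2 - 1) = q ^ 2" using q_gt1 by simp
  ultimately show ?thesis by (simp only:)
qed (use q_gt1 in auto)

lemma char_K: "CHAR('a) = p"
proof -
  have "CHAR('a) dvd q ^ 2" using CHAR_dvd_CARD[where ?'a = 'a] card_K by simp
  then have "CHAR('a) dvd p ^ (r * 2)" by (simp add: q_def power_mult)
  moreover have "prime CHAR('a)"
    by (rule prime_CHAR_semidom) (simp add: finite_imp_CHAR_pos)
  ultimately show ?thesis using p by (metis prime_dvd_power primes_dvd_imp_eq)
qed

lemma char_ac: "CHAR('a alg_closure) = p"
  by (simp add: char_K)

lemma hom_K: "comm_ring_hom (\<lambda>x :: 'a. x ^ q)"
proof -
  have "(x + y :: 'a) ^ q = x ^ q + y ^ q" for x y
    by (rule freshmans_dream'[of _ r]) (simp_all add: char_K p q_def)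
  then show ?thesis using q_gt1 by unfold_locales (auto simp: power_mult_distrib)
qed

lemma hom_ac: "comm_ring_hom (\<lambda>x :: 'a alg_closure. x ^ (q ^ i))"
proof -
  have "(x + y :: 'a alg_closure) ^ (q ^ i) = x ^ (q ^ i) + y ^ (q ^ i)" for x y
    by (rule freshmans_dream'[of _ "r * i"]) (simp_all add: char_ac char_K p q_def power_mult)
  then show ?thesis using q_gt1 by unfold_locales (auto simp: power_mult_distrib)
qed

lemma to_ac_hom: "comm_ring_hom (to_ac :: 'a \<Rightarrow> 'a alg_closure)"
  by unfold_locales simp_all

lemma inj_pow_ac: "inj (\<lambda>x :: 'a alg_closure. x ^ (q ^ i))"
proof (rule injI)
  interpret h: comm_ring_hom "\<lambda>x :: 'a alg_closure. x ^ (q ^ i)" by (rule hom_ac)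
  fix x y :: "'a alg_closure" assume "x ^ (q ^ i) = y ^ (q ^ i)"
  then have "(x - y) ^ (q ^ i) = 0" by (simp add: h.hom_minus)
  then show "x = y" by simp
qed

text \<open>The image of the field has q^2 elements and consists of roots of X^(q^2) - X, which has
  no more than q^2. This is the criterion for descending coefficients from the closure to
  F_{q^2}.\<close>

lemma range_to_ac: "range to_ac = {x :: 'a alg_closure. x ^ (q ^ 2) = x}"
proof (rule card_seteq)
  let ?P = "Polynomial.monom 1 (q ^ 2) - Polynomial.monom 1 1 :: 'a alg_closure poly"
  have q1: "q ^ 2 > 1" using q_gt1 by (rule one_less_power) simp
  have c: "poly.coeff ?P (q ^ 2) = 1" using q1 by simp
  then have nz: "?P \<noteq> 0" by (metis coeff_0 zero_neq_one)
  have eq: "{x :: 'a alg_closure. x ^ (q ^ 2) = x} = {x. poly ?P x = 0}"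
    by (auto simp: poly_monom)
  then show "finite {x :: 'a alg_closure. x ^ (q ^ 2) = x}" using poly_roots_finite[OF nz] by simp
  have "degree ?P \<le> q ^ 2" using q1 by (intro degree_diff_le) (auto intro: order.trans[OF degree_monom_le])
  moreover have "card (range (to_ac :: 'a \<Rightarrow> 'a alg_closure)) = q ^ 2"
    by (simp add: card_image inj_to_ac card_K)
  ultimately show "card {x :: 'a alg_closure. x ^ (q ^ 2) = x} \<le> card (range (to_ac :: 'a \<Rightarrow> 'a alg_closure))"
    unfolding eq using card_poly_roots_bound[OF nz] by simp
  show "range to_ac \<subseteq> {x :: 'a alg_closure. x ^ (q ^ 2) = x}"
    by (auto simp: fermat simp flip: to_ac_power)
qed

text \<open>The action on eigenvalues of the inverse conjugate transpose. Its square is the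
  Frobenius x -> x^(q^2), and the convention \<open>inverse 0 = 0\<close> makes it injective on the
  whole closure.\<close>

definition phi :: "'a alg_closure \<Rightarrow> 'a alg_closure" where "phi \<theta> = inverse (\<theta> ^ q)"

lemma inj_phi: "inj phi"
  using inj_pow_ac[of 1] by (auto simp: phi_def inj_on_def)

lemma phi_eq_0_iff [simp]: "phi x = 0 \<longleftrightarrow> x = 0"
  using q_gt1 by (auto simp: phi_def)

lemma phi_phi: "(phi \<circ> phi) \<theta> = \<theta> ^ (q ^ 2)"
  by (simp add: phi_def power_inverse power2_eq_square power_mult)

lemma phi_pow: "(phi ^^ c) \<theta> = (if even c then \<theta> ^ (q ^ c) else inverse (\<theta> ^ (q ^ c)))"
proof (induction c)
  case (Suc c)
  then show ?case by (simp add: phi_def power_inverse mult.commute flip: power_mult)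
qed simp

lemma finite_period_phi: assumes "c \<ge> 1" shows "finite (period_pts (-{0}) phi c)"
proof -
  let ?P = "if even c then Polynomial.monom 1 (q ^ c) - Polynomial.monom 1 1
    else Polynomial.monom 1 (Suc (q ^ c)) - 1 :: 'a alg_closure poly"
  have q1: "q ^ c > 1" using q_gt1 assms by (intro one_less_power) auto
  have "poly.coeff ?P (if even c then q ^ c else Suc (q ^ c)) = 1" using q1 by auto
  then have "?P \<noteq> 0" by force
  then have "finite {x. poly ?P x = 0}" by (rule poly_roots_finite)
  moreover have "period_pts (-{0}) phi c \<subseteq> {x. poly ?P x = 0}"
    by (auto simp: period_pts_def phi_pow poly_monom field_simps)
  ultimately show ?thesis by (rule rev_finite_subset)
qed

sublocale P: periodic_bij "-{0} :: 'a alg_closure set" phi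
  using inj_phi finite_period_phi by unfold_locales auto

section \<open>Root multisets and unitary polynomials\<close>

definition ev :: "'a poly \<Rightarrow> 'a alg_closure multiset" where
  "ev f = proots (map_poly to_ac f)"

lemma degree_map_ac [simp]: "degree (map_poly to_ac f) = degree f" for f :: "'a poly"
  by (simp add: degree_map_poly)

lemma monic_map_ac: "monic f \<Longrightarrow> monic (map_poly to_ac f)" for f :: "'a poly"
  by (simp add: coeff_map_poly)

lemma map_ac_inj: "map_poly to_ac f = map_poly to_ac g \<Longrightarrow> f = (g :: 'a poly)"
  by (auto simp: poly_eq_iff coeff_map_poly)

lemma map_ac_eq_iff: "map_poly to_ac f = map_poly to_ac g \<longleftrightarrow> f = (g :: 'a poly)"
  using map_ac_inj by (intro iffI) simp_all

lemma map_ac_mult: "map_poly to_ac (f * g) = map_poly to_ac f * map_poly to_ac (g :: 'a poly)"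
proof -
  interpret map_poly_comm_ring_hom "to_ac :: 'a \<Rightarrow> 'a alg_closure"
    using to_ac_hom by (simp add: map_poly_comm_ring_hom.intro)
  show ?thesis by (rule hom_mult)
qed

lemma pol_ev: "monic f \<Longrightarrow> pol (ev f) = map_poly to_ac f"
  unfolding ev_def by (rule pol_proots) (rule monic_map_ac)

lemma size_ev: "monic f \<Longrightarrow> size (ev f) = degree f"
  unfolding ev_def by (simp add: size_proots_ac[OF monic_map_ac])

lemma ev_mult: "monic f \<Longrightarrow> monic g \<Longrightarrow> ev (f * g) = ev f + ev g"
proof -
  assume "monic f" "monic g"
  then have "map_poly to_ac f \<noteq> 0" "map_poly to_ac g \<noteq> 0" using monic_map_ac by force+
  then show ?thesis unfolding ev_def map_ac_mult by (rule proots_mult)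
qed

lemma ev_inj: "monic f \<Longrightarrow> monic g \<Longrightarrow> ev f = ev g \<Longrightarrow> f = g"
  using pol_ev map_ac_inj by metis

lemma zero_ev: "monic f \<Longrightarrow> 0 \<notin># ev f \<longleftrightarrow> poly.coeff f 0 \<noteq> 0"
  using coeff_0_pol_nz[of "ev f"] by (simp add: pol_ev coeff_map_poly)

lemma ev_frob: assumes "monic f" shows "image_mset (\<lambda>\<theta>. \<theta> ^ (q ^ 2)) (ev f) = ev f"
proof -
  have "pol (image_mset (\<lambda>\<theta>. \<theta> ^ (q ^ 2)) (ev f)) = map_poly (\<lambda>x. x ^ (q ^ 2)) (pol (ev f))"
    by (rule map_poly_pol[OF hom_ac, symmetric])
  also have "\<dots> = map_poly to_ac f"
    using q_gt1 by (auto simp: pol_ev[OF assms] poly_eq_iff coeff_map_poly fermat simp flip: to_ac_power)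
  also have "\<dots> = pol (ev f)" by (simp add: pol_ev[OF assms])
  finally show ?thesis by (metis proots_pol)
qed

definition polys :: "nat \<Rightarrow> 'a poly set" where
  "polys a = {f. monic f \<and> degree f = a \<and> poly.coeff f 0 \<noteq> 0}"

text \<open>Galois descent: a root multiset is stable under x -> x^(q^2) exactly when the
  coefficients of its monic polynomial are fixed by that map, that is, lie in F_{q^2}.\<close>

lemma bij_ev: "bij_betw ev (polys a) (inv_msets (-{0}) (phi \<circ> phi) a)"
proof (rule bij_betw_imageI)
  show "inj_on ev (polys a)" by (auto simp: inj_on_def polys_def ev_inj)
  show "ev ` polys a = inv_msets (-{0}) (phi \<circ> phi) a"
  proof (intro equalityI subsetI)
    fix \<nu> assume "\<nu> \<in> ev ` polys a"
    then obtain f where f: "monic f" "degree f = a" "poly.coeff f 0 \<noteq> 0" "\<nu> = ev f" by (auto simp: polys_def)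
    have "image_mset (phi \<circ> phi) (ev f) = ev f"
      using ev_frob[OF f(1)] by (simp add: phi_phi cong: image_mset_cong del: comp_apply)
    then show "\<nu> \<in> inv_msets (-{0}) (phi \<circ> phi) a"
      using f zero_ev[OF f(1)] by (auto simp: inv_msets_def size_ev)
  next
    fix \<nu> :: "'a alg_closure multiset" assume \<nu>: "\<nu> \<in> inv_msets (-{0}) (phi \<circ> phi) a"
    have "image_mset (phi \<circ> phi) \<nu> = \<nu>" using \<nu> by (simp add: inv_msets_def)
    then have "image_mset (\<lambda>\<theta>. \<theta> ^ (q ^ 2)) \<nu> = \<nu>" by (simp add: phi_phi cong: image_mset_cong del: comp_apply)
    then have "map_poly (\<lambda>x. x ^ (q ^ 2)) (pol \<nu>) = pol \<nu>" by (simp add: map_poly_pol[OF hom_ac])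
    then have "poly.coeff (pol \<nu>) i ^ (q ^ 2) = poly.coeff (pol \<nu>) i" for i
      using q_gt1 by (metis coeff_map_poly power_0_left zero_less_power not_less_zero less_one not_less_iff_gr_or_eq power2_eq_square mult_is_0 power_eq_0_iff)
    then have rng: "poly.coeff (pol \<nu>) i \<in> range to_ac" for i by (simp add: range_to_ac)
    define f where "f = map_poly of_ac (pol \<nu>)"
    have mf: "map_poly to_ac f = pol \<nu>"
      using rng by (simp add: poly_eq_iff f_def coeff_map_poly to_ac_of_ac)
    have deg: "degree f = a" using arg_cong[OF mf, of degree] \<nu> by (simp add: inv_msets_def)
    have "monic f"
    proof -
      have "to_ac (poly.coeff f (degree f)) = 1"
        using arg_cong[OF mf, of "\<lambda>P. poly.coeff P (degree P)"] monic_pol[of \<nu>] by (simp add: coeff_map_poly)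
      then show ?thesis by (metis to_ac_1 to_ac_eq_iff)
    qed
    moreover from this have "ev f = \<nu>" unfolding ev_def mf by simp
    moreover have "0 \<notin># \<nu>" using \<nu> by (auto simp: inv_msets_def)
    ultimately have "f \<in> polys a" using zero_ev[of f] deg by (auto simp: polys_def)
    then show "\<nu> \<in> ev ` polys a" using \<open>ev f = \<nu>\<close> by auto
  qed
qed

text \<open>Conjugating the coefficients raises the roots to the q-th power and reversing the
  polynomial inverts them. The scalar is the leading coefficient after reversal, i.e. the conjugated
  constant coefficient.\<close>

lemma reflect_conj:
  assumes f: "monic f" "poly.coeff f 0 \<noteq> 0"
  shows "map_poly to_ac (reflect_poly (map_poly (\<lambda>x. x ^ q) f)) =
    smult (to_ac (poly.coeff f 0 ^ q)) (pol (image_mset phi (ev f)))"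
proof -
  have q0: "(0 :: 'a) ^ q = 0" "(0 :: 'a alg_closure) ^ q = 0" using q_gt1 by auto
  let ?\<nu> = "image_mset (\<lambda>x. x ^ (q ^ 1)) (ev f)"
  have "map_poly to_ac (reflect_poly (map_poly (\<lambda>x. x ^ q) f)) =
    reflect_poly (map_poly (\<lambda>x. x ^ (q ^ 1)) (map_poly to_ac f))"
  proof -
    have dg: "degree (map_poly (\<lambda>x. x ^ (q ^ 1)) (map_poly to_ac f)) = degree f"
      using q_gt1 f by (subst degree_map_poly) (auto simp: coeff_map_poly)
    have "degree (map_poly (\<lambda>x. x ^ q) f) = degree f" using q_gt1 f by (subst degree_map_poly) auto
    then show ?thesis using q0 dg by (auto simp: poly_eq_iff coeff_map_poly coeff_reflect_poly)
  qed
  also have "\<dots> = reflect_poly (pol ?\<nu>)"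
    by (simp only: map_poly_pol[OF hom_ac] flip: pol_ev[OF f(1)])
  also have "0 \<notin># ?\<nu>" using zero_ev[OF f(1)] f(2) by (auto split: if_splits)
  then have "reflect_poly (pol ?\<nu>) = smult (\<Prod>\<theta>\<in>#?\<nu>. -\<theta>) (pol (image_mset inverse ?\<nu>))"
    by (rule reflect_pol)
  also have "image_mset inverse ?\<nu> = image_mset phi (ev f)"
    by (simp add: multiset.map_comp comp_def phi_def[abs_def])
  also have "(\<Prod>\<theta>\<in>#?\<nu>. -\<theta>) = poly.coeff (pol ?\<nu>) 0" by (simp add: coeff_0_pol)
  also have "\<dots> = to_ac (poly.coeff f 0 ^ q)"
    unfolding map_poly_pol[OF hom_ac, symmetric] pol_ev[OF f(1)]
    using q0 by (simp add: coeff_map_poly)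
  finally show ?thesis .
qed

text \<open>Unitarity is defined by the roots, which suits factorisation and the generating
  functions; \<open>upoly_iff\<close> and \<open>upoly_coeff\<close> translate it into
  self-reciprocity of the coefficients.\<close>

definition upoly :: "'a poly \<Rightarrow> bool" where
  "upoly f \<longleftrightarrow> monic f \<and> poly.coeff f 0 \<noteq> 0 \<and> image_mset phi (ev f) = ev f"

lemma upoly_iff:
  "upoly f \<longleftrightarrow> monic f \<and> poly.coeff f 0 \<noteq> 0 \<and>
     reflect_poly (map_poly (\<lambda>x. x ^ q) f) = smult (poly.coeff f 0 ^ q) f"
proof -
  have "image_mset phi (ev f) = ev f \<longleftrightarrow>
     reflect_poly (map_poly (\<lambda>x. x ^ q) f) = smult (poly.coeff f 0 ^ q) f"
    if f: "monic f" "poly.coeff f 0 \<noteq> 0"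
  proof -
    define c where "c = to_ac (poly.coeff f 0 ^ q)"
    have c: "c \<noteq> 0" using f(2) by (simp add: c_def)
    have A: "map_poly to_ac (smult (poly.coeff f 0 ^ q) f) = smult c (pol (ev f))"
      by (simp add: pol_ev[OF f(1)] poly_eq_iff coeff_map_poly c_def)
    have "image_mset phi (ev f) = ev f \<longleftrightarrow> pol (image_mset phi (ev f)) = pol (ev f)"
      by (metis proots_pol)
    also have "\<dots> \<longleftrightarrow> smult c (pol (image_mset phi (ev f))) = smult c (pol (ev f))"
      using c by (simp add: poly_eq_iff)
    also have "\<dots> \<longleftrightarrow> map_poly to_ac (reflect_poly (map_poly (\<lambda>x. x ^ q) f)) =
        map_poly to_ac (smult (poly.coeff f 0 ^ q) f)"
      unfolding A reflect_conj[OF f] c_def ..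
    also have "\<dots> \<longleftrightarrow> reflect_poly (map_poly (\<lambda>x. x ^ q) f) = smult (poly.coeff f 0 ^ q) f"
      by (rule map_ac_eq_iff)
    finally show ?thesis .
  qed
  then show ?thesis by (auto simp: upoly_def)
qed

definition upolys :: "nat \<Rightarrow> 'a poly set" where
  "upolys m = {f. upoly f \<and> degree f = m}"

lemma inv_phi_sq: "\<nu> \<in> inv_msets S phi m \<Longrightarrow> \<nu> \<in> inv_msets S (phi \<circ> phi) m"
  unfolding inv_msets_def by (auto simp flip: multiset.map_comp)

lemma bij_ev_upolys: "bij_betw ev (upolys m) (inv_msets (-{0}) phi m)"
proof -
  have eq: "inv_msets (-{0}) phi m = {\<nu> \<in> inv_msets (-{0}) (phi \<circ> phi) m. image_mset phi \<nu> = \<nu>}"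
    using inv_phi_sq by (auto simp: inv_msets_def)
  have "upolys m = {f \<in> polys m. image_mset phi (ev f) = ev f}"
    by (auto simp: upolys_def polys_def upoly_def)
  moreover have "bij_betw f {x \<in> XX. Q (f x)} {y \<in> Y. Q y}" if "bij_betw f XX Y"
    for f :: "'a poly \<Rightarrow> 'a alg_closure multiset" and XX Y Q
    using that by (auto simp: bij_betw_def intro: inj_on_subset)
  ultimately show ?thesis unfolding eq using bij_ev[of m] by simp
qed

end

section \<open>Hermitian geometry\<close>

context ff_setup
begin

section \<open>Conjugation, trace and norm of F_{q^2} over F_q\<close>

lemma cj_add: "(x + y :: 'a) ^ q = x ^ q + y ^ q"
proof -
  interpret comm_ring_hom "\<lambda>x :: 'a. x ^ q" by (rule hom_K)
  show ?thesis by (rule hom_add)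
qed

lemma cj_minus: "(x - y :: 'a) ^ q = x ^ q - y ^ q"
proof -
  interpret comm_ring_hom "\<lambda>x :: 'a. x ^ q" by (rule hom_K)
  show ?thesis by (rule hom_minus)
qed

lemma cj_uminus: "(- y :: 'a) ^ q = - (y ^ q)"
proof -
  interpret comm_ring_hom "\<lambda>x :: 'a. x ^ q" by (rule hom_K)
  show ?thesis by (rule hom_uminus)
qed

lemma cj_sum: "(\<Sum>i\<in>I. f i :: 'a) ^ q = (\<Sum>i\<in>I. f i ^ q)"
proof -
  interpret comm_ring_hom "\<lambda>x :: 'a. x ^ q" by (rule hom_K)
  show ?thesis by (rule hom_sum)
qed

lemma cj_cj: "(x ^ q) ^ q = (x :: 'a)"
  using fermat[of x] by (simp add: power2_eq_square power_mult)

lemma cj_0: "(0 :: 'a) ^ q = 0"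
  using q_gt1 by simp

lemma card_roots_le:
  assumes "\<And>x. x \<in> S \<Longrightarrow> poly P x = 0" "P \<noteq> (0 :: 'a poly)" "degree P \<le> d"
  shows "card S \<le> d"
proof -
  have "card S \<le> card {x. poly P x = 0}" by (rule card_mono) (use assms(1) in auto)
  also have "\<dots> \<le> degree P" by (rule card_poly_roots_bound) fact
  finally show ?thesis using assms(3) by simp
qed

lemma q_sq_gt: "q * q > q" using q_gt1 by simp

lemma not_fixed: "\<exists>s :: 'a. s ^ q \<noteq> s"
proof (rule ccontr)
  assume h: "\<not> (\<exists>s :: 'a. s ^ q \<noteq> s)"
  let ?P = "Polynomial.monom 1 q - Polynomial.monom 1 1 :: 'a poly"
  have "poly.coeff ?P q = 1" using q_gt1 by simp
  then have nz: "?P \<noteq> 0" by (metis coeff_0 zero_neq_one)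
  have "card (UNIV :: 'a set) \<le> q"
    by (rule card_roots_le[OF _ nz]) (use h q_gt1 in \<open>auto simp: poly_monom intro!: degree_diff_le order.trans[OF degree_monom_le]\<close>)
  then show False using card_K q_sq_gt by (simp add: power2_eq_square)
qed

lemma tr_nonzero: "\<exists>t :: 'a. t + t ^ q \<noteq> 0"
proof (rule ccontr)
  assume h: "\<not> (\<exists>t :: 'a. t + t ^ q \<noteq> 0)"
  let ?P = "Polynomial.monom 1 q + Polynomial.monom 1 1 :: 'a poly"
  have "poly.coeff ?P q = 1" using q_gt1 by simp
  then have nz: "?P \<noteq> 0" by (metis coeff_0 zero_neq_one)
  have "card (UNIV :: 'a set) \<le> q"
    by (rule card_roots_le[OF _ nz]) (use h q_gt1 in \<open>auto simp: poly_monom add.commute intro!: degree_add_le order.trans[OF degree_monom_le]\<close>)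
  then show False using card_K q_sq_gt by (simp add: power2_eq_square)
qed

lemma tr_surj: assumes "c ^ q = (c :: 'a)" shows "\<exists>x. x + x ^ q = c"
proof -
  obtain t :: 'a where t: "t + t ^ q \<noteq> 0" using tr_nonzero by blast
  have fx: "(t + t ^ q) ^ q = t + t ^ q" by (simp add: cj_add cj_cj add.commute)
  have "(c / (t + t ^ q)) ^ q = c / (t + t ^ q)" by (simp only: power_divide fx assms)
  then have "c / (t + t ^ q) * t + (c / (t + t ^ q) * t) ^ q = c / (t + t ^ q) * (t + t ^ q)"
    by (simp only: power_mult_distrib distrib_left)
  then show ?thesis using t by auto
qed

lemma tr_kernel: "\<exists>t :: 'a. t \<noteq> 0 \<and> t + t ^ q = 0"
proof -
  obtain s :: 'a where "s ^ q \<noteq> s" using not_fixed by blast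
  then have "s - s ^ q \<noteq> 0 \<and> (s - s ^ q) + (s - s ^ q) ^ q = 0" by (simp add: cj_minus cj_cj)
  then show ?thesis by blast
qed

text \<open>By counting: the norm maps q^2 - 1 units into the nonzero fixed points of conjugation,
  of which there are at most q - 1, and its fibres have at most q + 1 elements. Hence every fixed
  unit is attained.\<close>

lemma norm_surj: assumes "c ^ q = (c :: 'a)" "c \<noteq> 0" shows "\<exists>x. x * x ^ q = c"
proof -
  let ?U = "UNIV - {0 :: 'a}" and ?F = "{c :: 'a. c ^ q = c \<and> c \<noteq> 0}"
  let ?N = "\<lambda>x :: 'a. x * x ^ q"
  have sub: "?N ` ?U \<subseteq> ?F" by (auto simp: power_mult_distrib cj_cj mult.commute)
  have fib: "card {x \<in> ?U. ?N x = d} \<le> q + 1" for d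
  proof -
    let ?P = "Polynomial.monom 1 (q + 1) - [:d:]"
    have "poly.coeff ?P (q + 1) = 1" by simp
    then have nz: "?P \<noteq> 0" by (metis coeff_0 zero_neq_one)
    show ?thesis by (rule card_roots_le[OF _ nz])
      (auto simp: poly_monom intro!: degree_diff_le order.trans[OF degree_monom_le])
  qed
  have "card ?F \<le> q - 1"
  proof -
    let ?P = "Polynomial.monom 1 (q - 1) - 1 :: 'a poly"
    have "poly.coeff ?P (q - 1) = 1" using q_gt1 by simp
    then have nz: "?P \<noteq> 0" by (metis coeff_0 zero_neq_one)
    have "x ^ (q - 1) = 1" if "x ^ q = x" "x \<noteq> 0" for x :: 'a
      using that q_gt1 power_minus_mult[of q x] by simp
    then show ?thesis by (intro card_roots_le[OF _ nz])
      (auto simp: poly_monom intro!: degree_diff_le order.trans[OF degree_monom_le])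
  qed
  moreover have "card ?U \<le> card (?N ` ?U) * (q + 1)"
  proof -
    have eq: "(\<Union>d\<in>?N ` ?U. {x \<in> ?U. ?N x = d}) = ?U" by auto
    have "card (\<Union>d\<in>?N ` ?U. {x \<in> ?U. ?N x = d}) \<le> (\<Sum>d\<in>?N ` ?U. card {x \<in> ?U. ?N x = d})"
      by (rule card_UN_le) simp
    then have "card ?U \<le> (\<Sum>d\<in>?N ` ?U. card {x \<in> ?U. ?N x = d})" unfolding eq .
    also have "\<dots> \<le> (\<Sum>d\<in>?N ` ?U. q + 1)" by (rule sum_mono) (rule fib)
    finally show ?thesis by simp
  qed
  moreover have "card ?U = (q - 1) * (q + 1)"
    using q_gt1 by (simp add: card_Diff_singleton card_K power2_eq_square algebra_simps)
  ultimately have "(q - 1) * (q + 1) \<le> card (?N ` ?U) * (q + 1)" "card ?F \<le> q - 1" by (simp_all only:)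
  moreover from this have "q - 1 \<le> card (?N ` ?U)" by (intro mult_right_le_imp_le[of "q - 1" "q + 1"]) simp_all
  ultimately have "card ?F \<le> card (?N ` ?U)" by (simp only: le_trans[of "card ?F" "q - 1"])
  then have "?N ` ?U = ?F" by (intro card_seteq sub) auto
  then show ?thesis using assms by (metis (mono_tags, lifting) image_iff mem_Collect_eq)
qed

section \<open>The standard Hermitian form and its isometries\<close>

text \<open>Vectors are functions on \<open>nat\<close> read only below \<open>n\<close>, so that
  the dimension may vary within one type. The form is conjugate-linear in the first
  argument.\<close>

definition ip :: "nat \<Rightarrow> (nat \<Rightarrow> 'a) \<Rightarrow> (nat \<Rightarrow> 'a) \<Rightarrow> 'a" where
  "ip n x y = (\<Sum>k<n. x k ^ q * y k)"

definition app :: "nat \<Rightarrow> (nat \<Rightarrow> nat \<Rightarrow> 'a) \<Rightarrow> (nat \<Rightarrow> 'a) \<Rightarrow> nat \<Rightarrow> 'a" where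
  "app n G x = (\<lambda>i. \<Sum>k<n. G i k * x k)"

definition ufun :: "nat \<Rightarrow> (nat \<Rightarrow> nat \<Rightarrow> 'a) \<Rightarrow> bool" where
  "ufun n G \<longleftrightarrow> (\<forall>i<n. \<forall>j<n. (\<Sum>k<n. G k i ^ q * G k j) = (if i = j then 1 else 0))"

text \<open>Linear independence of \<open>v 0, ..., v (m - 1)\<close>, expressed by dual functionals
  because these directly provide vectors orthogonal to all but one of the given ones.\<close>

definition has_dual :: "nat \<Rightarrow> nat \<Rightarrow> (nat \<Rightarrow> nat \<Rightarrow> 'a) \<Rightarrow> bool" where
  "has_dual n m v \<longleftrightarrow> (\<exists>\<psi>. \<forall>i<m. \<forall>j<m. (\<Sum>k<n. \<psi> i k * v j k) = (if i = j then 1 else 0))"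

lemma ip_cong: "(\<And>k. k < n \<Longrightarrow> x k = x' k) \<Longrightarrow> (\<And>k. k < n \<Longrightarrow> y k = y' k) \<Longrightarrow> ip n x y = ip n x' y'"
  by (simp add: ip_def)

lemma ip_cj: "ip n x y ^ q = ip n y x"
  by (simp add: ip_def cj_sum power_mult_distrib cj_cj mult.commute)

lemma ip_lin1: "ip n (\<lambda>k. x k + y k) z = ip n x z + ip n y z"
  "ip n (\<lambda>k. x k - y k) z = ip n x z - ip n y z" "ip n (\<lambda>k. c * x k) z = c ^ q * ip n x z"
  by (simp_all add: ip_def cj_add cj_minus distrib_right left_diff_distrib sum.distrib sum_subtractf
    power_mult_distrib sum_distrib_left mult.assoc)

lemma ip_lin2: "ip n z (\<lambda>k. x k + y k) = ip n z x + ip n z y"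
  "ip n z (\<lambda>k. x k - y k) = ip n z x - ip n z y" "ip n z (\<lambda>k. c * x k) = c * ip n z x"
  by (simp_all add: ip_def distrib_left right_diff_distrib sum.distrib sum_subtractf sum_distrib_left mult_ac)

lemma delta_sum: "j < n \<Longrightarrow> (\<Sum>k<n. (if k = j then 1 else 0) * (f k :: 'a)) = f j" for n :: nat
  by (simp add: sum.delta if_distrib[of "\<lambda>x. x * _"] cong: if_cong)

lemma ip_app: assumes "ufun n G" shows "ip n (app n G x) (app n G y) = ip n x y"
proof -
  have "ip n (app n G x) (app n G y) = (\<Sum>i<n. \<Sum>k<n. \<Sum>l<n. (G i k ^ q * x k ^ q) * (G i l * y l))"
    by (simp add: ip_def app_def cj_sum power_mult_distrib sum_product)
  also have "\<dots> = (\<Sum>k<n. \<Sum>l<n. \<Sum>i<n. (G i k ^ q * x k ^ q) * (G i l * y l))"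
    by (subst sum.swap, rule sum.cong[OF refl], rule sum.swap)
  also have "\<dots> = (\<Sum>k<n. \<Sum>l<n. x k ^ q * y l * (\<Sum>i<n. G i k ^ q * G i l))"
    by (simp add: sum_distrib_left mult_ac)
  also have "\<dots> = (\<Sum>k<n. \<Sum>l<n. x k ^ q * y l * (if k = l then 1 else 0))"
    by (intro sum.cong refl) (use assms in \<open>simp add: ufun_def\<close>)
  also have "\<dots> = ip n x y"
    unfolding ip_def
  proof (rule sum.cong[OF refl])
    fix k assume "k \<in> {..<n}"
    then have "(\<Sum>l<n. (if l = k then 1 else 0) * (x k ^ q * y l)) = x k ^ q * y k" by (intro delta_sum) simp
    moreover have "(\<Sum>l<n. x k ^ q * y l * (if k = l then 1 else 0)) = (\<Sum>l<n. (if l = k then 1 else 0) * (x k ^ q * y l))"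
      by (rule sum.cong) auto
    ultimately show "(\<Sum>l<n. x k ^ q * y l * (if k = l then 1 else 0)) = x k ^ q * y k" by simp
  qed
  finally show ?thesis .
qed

lemma ufun_comp: assumes "ufun n G" "ufun n H" shows "ufun n (\<lambda>i j. app n G (\<lambda>k. H k j) i)"
  unfolding ufun_def
proof (intro allI impI)
  fix i j assume h: "i < n" "j < n"
  have "(\<Sum>k<n. app n G (\<lambda>k. H k i) k ^ q * app n G (\<lambda>k. H k j) k) = ip n (app n G (\<lambda>k. H k i)) (app n G (\<lambda>k. H k j))"
    by (simp add: ip_def)
  also have "\<dots> = ip n (\<lambda>k. H k i) (\<lambda>k. H k j)" by (rule ip_app) fact
  also have "\<dots> = (if i = j then 1 else 0)" using assms(2) h by (simp add: ufun_def ip_def)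
  finally show "(\<Sum>k<n. app n G (\<lambda>k. H k i) k ^ q * app n G (\<lambda>k. H k j) k) = (if i = j then 1 else 0)" .
qed

lemma app_comp: "app n (\<lambda>i j. app n G (\<lambda>k. H k j) i) x i = app n G (app n H x) i"
proof -
  have "app n (\<lambda>i j. app n G (\<lambda>k. H k j) i) x i = (\<Sum>l<n. \<Sum>k<n. G i k * H k l * x l)"
    by (simp add: app_def sum_distrib_right)
  also have "\<dots> = (\<Sum>k<n. \<Sum>l<n. G i k * H k l * x l)" by (rule sum.swap)
  also have "\<dots> = app n G (app n H x) i" by (simp add: app_def sum_distrib_left mult.assoc)
  finally show ?thesis .
qed

lemma app_cong: "(\<And>k. k < n \<Longrightarrow> x k = x' k) \<Longrightarrow> app n G x = app n G x'"
  by (simp add: app_def)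

lemma ufun_id: "ufun n (\<lambda>i j. if i = j then 1 else 0)"
proof -
  have "(\<Sum>k<n. (if k = i then 1 else 0) ^ q * (if k = j then 1 else 0 :: 'a)) = (if i = j then 1 else 0)"
    if "i < n" for i j
  proof -
    have "(if k = i then 1 else 0 :: 'a) ^ q = (if k = i then 1 else 0)" for k by (simp add: cj_0)
    then show ?thesis using delta_sum[OF that, of "\<lambda>k. if k = j then 1 else 0"] by simp
  qed
  then show ?thesis by (simp add: ufun_def)
qed

section \<open>Quasi-reflections and Witt's theorem\<close>

text \<open>The map x -> x + \<alpha> <u,x> u with u = w - v and \<alpha> = 1/<u,v> sends v to w and
  fixes what is orthogonal to u. It is an isometry iff \<alpha> + \<alpha>^q + \<alpha>^(q+1) <u,u>
  = 0, and equal lengths of v and w give <u,u> = -(s + s^q) for s = <u,v>, which is just this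
  condition.\<close>

lemma refl_move:
  assumes vw: "ip n v v = ip n w w" and nz: "ip n (\<lambda>k. w k - v k) v \<noteq> 0"
  shows "\<exists>G. ufun n G \<and> (\<forall>i<n. app n G v i = w i) \<and>
    (\<forall>x. ip n (\<lambda>k. w k - v k) x = 0 \<longrightarrow> (\<forall>i<n. app n G x i = x i))"
proof -
  define u where "u = (\<lambda>k. w k - v k)"
  define s where "s = ip n u v"
  define \<alpha> where "\<alpha> = 1 / s"
  have s: "s \<noteq> 0" using nz by (simp add: s_def u_def)
  define G where "G = (\<lambda>i k. (if i = k then 1 else 0) + \<alpha> * u i * u k ^ q)"
  have appG: "app n G x i = x i + \<alpha> * ip n u x * u i" if "i < n" for x i
  proof -
    have "app n G x i = (\<Sum>k<n. (if i = k then 1 else 0) * x k) + (\<Sum>k<n. \<alpha> * u i * (u k ^ q * x k))"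
      by (simp add: app_def G_def distrib_right sum.distrib mult.assoc)
    also have "(\<Sum>k<n. (if i = k then 1 else 0) * x k) = x i"
      using delta_sum[OF that, of x] by (simp add: eq_commute)
    finally show ?thesis by (simp add: ip_def sum_distrib_left mult_ac)
  qed
  have N: "ip n u u = - (s + s ^ q)"
  proof -
    have "s = ip n w v - ip n v v" by (simp add: s_def u_def ip_lin1)
    moreover from this have "s ^ q = ip n v w - ip n v v" by (simp add: cj_minus ip_cj)
    ultimately show ?thesis using vw by (simp add: u_def ip_lin1 ip_lin2)
  qed
  have cond: "\<alpha> + \<alpha> ^ q + \<alpha> ^ q * \<alpha> * ip n u u = 0"
    unfolding N \<alpha>_def using s by (simp add: power_divide field_simps)
  have ipG: "ip n (app n G x) (app n G y) = ip n x y" for x y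
  proof -
    have "ip n (app n G x) (app n G y) =
      ip n (\<lambda>i. x i + \<alpha> * ip n u x * u i) (\<lambda>i. y i + \<alpha> * ip n u y * u i)"
      by (rule ip_cong) (simp_all add: appG)
    also have "\<dots> = ip n x y + (ip n x u * ip n u y) * (\<alpha> + \<alpha> ^ q + \<alpha> ^ q * \<alpha> * ip n u u)"
      by (simp only: ip_lin1 ip_lin2 power_mult_distrib ip_cj) (simp add: algebra_simps)
    finally show ?thesis by (simp add: cond)
  qed
  have "ufun n G"
    unfolding ufun_def
  proof (intro allI impI)
    fix i j assume h: "i < n" "j < n"
    have col: "app n G (\<lambda>k. if k = j then 1 else 0) i' = G i' j" if "j < n" for j i'
      using delta_sum[OF that, of "\<lambda>k. G i' k"] by (simp add: app_def mult.commute)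
    have "(\<Sum>k<n. G k i ^ q * G k j) = ip n (app n G (\<lambda>k. if k = i then 1 else 0)) (app n G (\<lambda>k. if k = j then 1 else 0))"
      using h by (simp add: ip_def col)
    also have "\<dots> = ip n (\<lambda>k. if k = i then 1 else 0) (\<lambda>k. if k = j then 1 else 0)" by (rule ipG)
    also have "\<dots> = (if i = j then 1 else 0)" using ufun_id h by (simp add: ip_def ufun_def)
    finally show "(\<Sum>k<n. G k i ^ q * G k j) = (if i = j then 1 else 0)" .
  qed
  moreover have "app n G v i = w i" if "i < n" for i
    using s by (simp add: appG[OF that] \<alpha>_def flip: s_def) (simp add: u_def)
  moreover have "app n G x i = x i" if "ip n (\<lambda>k. w k - v k) x = 0" "i < n" for x i
    using that by (simp add: appG u_def)
  ultimately show ?thesis by blast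
qed

text \<open>If w - v is not orthogonal to v, one quasi-reflection does it. Otherwise a detour v -> z
  -> w is taken, where z = v + y has the length of v and y is orthogonal to all \<open>x i\<close>
  but to neither v nor w.\<close>

lemma witt_step:
  assumes xs: "\<And>i. i < m \<Longrightarrow> ip n (x i) v = ip n (x i) w" and vw: "ip n v v = ip n w w"
    and yv: "\<And>i. i < m \<Longrightarrow> ip n yv (x i) = 0" "ip n yv v = 1"
    and yw: "\<And>i. i < m \<Longrightarrow> ip n yw (x i) = 0" "ip n yw w = 1"
  shows "\<exists>G. ufun n G \<and> (\<forall>i<n. app n G v i = w i) \<and> (\<forall>j<m. \<forall>i<n. app n G (x j) i = x j i)"
proof -
  let ?u = "\<lambda>k. w k - v k"
  have ux: "ip n ?u (x i) = 0" if "i < m" for i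
  proof -
    have "ip n (x i) ?u = 0" using xs[OF that] by (simp add: ip_lin2)
    then have "ip n (x i) ?u ^ q = 0" by (simp add: cj_0)
    then show ?thesis by (simp add: ip_cj)
  qed
  show ?thesis
  proof (cases "ip n ?u v = 0")
    case False
    then show ?thesis using refl_move[OF vw False] ux by blast
  next
    case True
    \<comment> \<open>\<open>yv\<close> pairs with v and \<open>yw\<close> pairs with w; at least
      one of \<open>yv\<close>, \<open>yw\<close> and their sum pairs with both.\<close>
    obtain y0 where y0: "\<And>i. i < m \<Longrightarrow> ip n y0 (x i) = 0" "ip n y0 v \<noteq> 0" "ip n y0 w \<noteq> 0"
    proof (cases "ip n yv w = 0 \<and> ip n yw v = 0")
      case True
      then show ?thesis using that[of "\<lambda>k. yv k + yw k"] yv yw by (simp add: ip_lin1)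
    next
      case False
      then show ?thesis using that[of yv] that[of yw] yv yw by fastforce
    qed
    define \<beta> \<nu> where "\<beta> = ip n v y0" and "\<nu> = ip n y0 y0"
    have \<beta>: "\<beta> \<noteq> 0"
    proof
      assume "\<beta> = 0"
      then have "ip n v y0 ^ q = 0" by (simp add: \<beta>_def cj_0)
      then show False using y0(2) by (simp add: ip_cj)
    qed
    have \<nu>: "\<nu> ^ q = \<nu>" by (simp add: \<nu>_def ip_cj)
    \<comment> \<open>The scaling of \<open>y0\<close> that makes z = v + c y0 as long as v, i.e.
      <v,y> + <y,v> + <y,y> = 0 for y = c y0.\<close>
    have "\<exists>c. c \<noteq> 0 \<and> c * \<beta> + (c * \<beta>) ^ q + c ^ q * c * \<nu> = 0"
    proof (cases "\<nu> = 0")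
      case True
      obtain t :: 'a where t: "t \<noteq> 0" "t + t ^ q = 0" using tr_kernel by blast
      then show ?thesis using True \<beta> by (intro exI[of _ "t / \<beta>"]) simp
    next
      case False
      have "(- \<nu>) ^ q = - \<nu>" using \<nu> by (simp add: cj_uminus)
      then obtain t :: 'a where t: "t + t ^ q = - \<nu>" using tr_surj by blast
      have t0: "t \<noteq> 0"
      proof
        assume "t = 0"
        then have "- \<nu> = 0" using t cj_0 by (metis add_0)
        then show False using False by simp
      qed
      \<comment> \<open>With this c the left-hand side is \<beta> \<beta>^q / (t t^q) times t + t^q
        + \<nu>, so the trace condition on t makes it vanish.\<close>
      define c where "c = (\<beta> / t) ^ q"
      have cq: "c ^ q = \<beta> / t" by (simp add: c_def cj_cj)
      have tq: "t ^ q \<noteq> 0" "\<beta> ^ q \<noteq> 0" using t0 \<beta> by auto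
      have "c * \<beta> + (c * \<beta>) ^ q + c ^ q * c * \<nu> = (\<beta> ^ q / t ^ q) * \<beta> + (\<beta> / t) * \<beta> ^ q + (\<beta> / t) * (\<beta> ^ q / t ^ q) * \<nu>"
        unfolding power_mult_distrib cq by (simp add: c_def power_divide)
      also have "\<dots> = \<beta> * \<beta> ^ q / (t * t ^ q) * (t + t ^ q + \<nu>)"
        using t0 tq by (simp add: field_simps)
      also have "\<dots> = 0" using t by simp
      finally show ?thesis using t0 \<beta> by (intro exI[of _ c]) (simp add: c_def)
    qed
    then obtain c where c: "c \<noteq> 0" "c * \<beta> + (c * \<beta>) ^ q + c ^ q * c * \<nu> = 0" by blast
    define y where "y = (\<lambda>k. c * y0 k)"
    define z where "z = (\<lambda>k. v k + y k)"
    have "ip n y0 v = \<beta> ^ q" by (simp add: \<beta>_def ip_cj)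
    then have Q: "ip n v y + ip n y v + ip n y y = 0"
      using c(2) by (simp add: y_def ip_lin1 ip_lin2 power_mult_distrib mult_ac flip: \<beta>_def \<nu>_def)
    have vz: "ip n v v = ip n z z" using Q by (simp add: z_def ip_lin1 ip_lin2 algebra_simps)
    have yx: "ip n y (x i) = 0" if "i < m" for i using y0(1)[OF that] by (simp add: y_def ip_lin1)
    have "ip n (\<lambda>k. z k - v k) v \<noteq> 0" using y0(2) c(1) by (simp add: z_def y_def ip_lin1)
    from refl_move[OF vz this] obtain G1 where G1: "ufun n G1" "\<forall>i<n. app n G1 v i = z i"
      "\<forall>j<m. \<forall>i<n. app n G1 (x j) i = x j i" using yx by (auto simp: z_def)
    have "ip n (\<lambda>k. w k - z k) z = ip n ?u v + ip n ?u y - ip n y v - ip n y y"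
      by (simp add: z_def ip_lin1 ip_lin2 algebra_simps)
    also have "\<dots> = ip n w y" using True Q by (simp add: ip_lin1 algebra_simps add_eq_0_iff2)
    finally have e: "ip n (\<lambda>k. w k - z k) z = ip n w y" .
    have "ip n w y \<noteq> 0"
    proof
      assume "ip n w y = 0"
      then have "ip n w y ^ q = 0" by (simp add: cj_0)
      then show False using y0(3) c(1) by (simp add: ip_cj y_def ip_lin1)
    qed
    then have "ip n (\<lambda>k. w k - z k) z \<noteq> 0" using e by simp
    from refl_move[OF _ this] vz vw obtain G2 where G2: "ufun n G2" "\<forall>i<n. app n G2 z i = w i"
      "\<And>x. ip n (\<lambda>k. w k - z k) x = 0 \<Longrightarrow> \<forall>i<n. app n G2 x i = x i" by metis
    have wz: "ip n (\<lambda>k. w k - z k) (x j) = 0" if "j < m" for j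
      using ux[OF that] yx[OF that] by (simp add: z_def ip_lin1)
    let ?G = "\<lambda>i j. app n G2 (\<lambda>k. G1 k j) i"
    have "ufun n ?G" using G1 G2 by (intro ufun_comp)
    moreover have "app n ?G v i = w i" if "i < n" for i
      using that G2(2) app_cong[of n "app n G1 v" z G2] G1(2) by (simp add: app_comp)
    moreover have "app n ?G (x j) i = x j i" if "i < n" "j < m" for i j
      using that G2(3)[OF wz] app_cong[of n "app n G1 (x j)" "x j" G2] G1(3) by (simp add: app_comp)
    ultimately show ?thesis by blast
  qed
qed

lemma has_dual_ip: assumes "has_dual n (Suc m) v"
  shows "\<exists>y. (\<forall>i<m. ip n y (v i) = 0) \<and> ip n y (v m) = 1"
proof -
  obtain \<psi> where \<psi>: "\<And>i j. i < Suc m \<Longrightarrow> j < Suc m \<Longrightarrow> (\<Sum>k<n. \<psi> i k * v j k) = (if i = j then 1 else 0)"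
    using assms by (auto simp: has_dual_def)
  have "ip n (\<lambda>k. \<psi> m k ^ q) (v j) = (if m = j then 1 else 0)" if "j < Suc m" for j
    using \<psi>[of m j] that by (simp add: ip_def cj_cj)
  then show ?thesis by (intro exI[of _ "\<lambda>k. \<psi> m k ^ q"]) auto
qed

lemma has_dual_mono: "has_dual n m v \<Longrightarrow> m' \<le> m \<Longrightarrow> has_dual n m' v"
proof -
  assume h: "has_dual n m v" "m' \<le> m"
  then obtain \<psi> where \<psi>: "\<forall>i<m. \<forall>j<m. (\<Sum>k<n. \<psi> i k * v j k) = (if i = j then 1 else 0)"
    unfolding has_dual_def by blast
  have "\<forall>i<m'. \<forall>j<m'. (\<Sum>k<n. \<psi> i k * v j k) = (if i = j then 1 else 0)"
    using \<psi> h(2) by simp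
  then show ?thesis unfolding has_dual_def by (intro exI[of _ \<psi>])
qed

lemma has_dual_app: assumes "ufun n G" "has_dual n m v" shows "has_dual n m (\<lambda>j. app n G (v j))"
proof -
  obtain \<psi> where \<psi>: "\<And>i j. i < m \<Longrightarrow> j < m \<Longrightarrow> (\<Sum>k<n. \<psi> i k * v j k) = (if i = j then 1 else 0)"
    using assms(2) by (auto simp: has_dual_def)
  have "(\<Sum>k<n. app n G (\<lambda>l. \<psi> i l ^ q) k ^ q * app n G (v j) k) = (if i = j then 1 else 0)"
    if "i < m" "j < m" for i j
    using \<psi>[OF that] ip_app[OF assms(1), of "\<lambda>l. \<psi> i l ^ q" "v j"] by (simp add: ip_def cj_cj)
  then show ?thesis unfolding has_dual_def by (intro exI[of _ "\<lambda>i. \<lambda>k. app n G (\<lambda>l. \<psi> i l ^ q) k ^ q"]) simp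
qed

text \<open>Induction on the number of vectors: an isometry matching the first m of them moves the
  next one to some v', and \<open>witt_step\<close> corrects v' while fixing the vectors already
  matched.\<close>

theorem witt:
  assumes "has_dual n m v" "has_dual n m w"
    and "\<And>i j. i < m \<Longrightarrow> j < m \<Longrightarrow> ip n (v i) (v j) = ip n (w i) (w j)"
  shows "\<exists>G. ufun n G \<and> (\<forall>j<m. \<forall>i<n. app n G (v j) i = w j i)"
  using assms
proof (induction m)
  case 0
  then show ?case using ufun_id by auto
next
  case (Suc m)
  obtain G where G: "ufun n G" "\<forall>j<m. \<forall>i<n. app n G (v j) i = w j i"
    using Suc.IH[OF has_dual_mono[OF Suc.prems(1)] has_dual_mono[OF Suc.prems(2)]] Suc.prems(3) by auto
  define v' where "v' = app n G (v m)"
  have "has_dual n (Suc m) (\<lambda>j. app n G (v j))" using G(1) Suc.prems(1) by (rule has_dual_app)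
  then obtain yv where yv: "\<forall>i<m. ip n yv (app n G (v i)) = 0" "ip n yv v' = 1"
    using has_dual_ip by (force simp: v'_def)
  obtain yw where yw: "\<forall>i<m. ip n yw (w i) = 0" "ip n yw (w m) = 1"
    using has_dual_ip[OF Suc.prems(2)] by blast
  have cg: "ip n z (app n G (v i)) = ip n z (w i)" "ip n (app n G (v i)) z = ip n (w i) z" if "i < m" for i z
    using G(2) that by (auto intro!: ip_cong)
  have "\<exists>H. ufun n H \<and> (\<forall>i<n. app n H v' i = w m i) \<and> (\<forall>j<m. \<forall>i<n. app n H (w j) i = w j i)"
  proof (rule witt_step)
    show "ip n (w i) v' = ip n (w i) (w m)" if "i < m" for i
    proof -
      have "ip n (w i) v' = ip n (app n G (v i)) (app n G (v m))" using cg(2)[OF that] by (simp add: v'_def)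
      also have "\<dots> = ip n (w i) (w m)" using ip_app[OF G(1)] Suc.prems(3) that by simp
      finally show ?thesis .
    qed
    show "ip n v' v' = ip n (w m) (w m)" using ip_app[OF G(1)] Suc.prems(3) by (simp add: v'_def)
    show "ip n yv (w i) = 0" if "i < m" for i using yv(1) cg(1)[OF that, of yv] that by simp
  qed (use yv yw in auto)
  then obtain H where H: "ufun n H" "\<forall>i<n. app n H v' i = w m i" "\<forall>j<m. \<forall>i<n. app n H (w j) i = w j i" by blast
  let ?F = "\<lambda>i j. app n H (\<lambda>k. G k j) i"
  have "ufun n ?F" using H(1) G(1) by (rule ufun_comp)
  moreover have "app n ?F (v j) i = w j i" if "j < Suc m" "i < n" for i j
  proof (cases "j = m")
    case True then show ?thesis using H(2) that by (simp add: app_comp v'_def)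
  next
    case False
    then have j: "j < m" using that by simp
    have "app n H (app n G (v j)) = app n H (w j)" by (rule app_cong) (use G(2) j in auto)
    then show ?thesis using H(3) that j by (simp add: app_comp)
  qed
  ultimately show ?case by blast
qed

section \<open>Dimension, and Hermitian Gram-Schmidt\<close>

text \<open>The old functionals predict a combination for the new vector, which is wrong in some
  coordinate \<open>k0\<close>. That coordinate functional, freed of its values on the old vectors
  and divided by the error, is the new dual functional; the old ones are then corrected by
  it.\<close>

lemma has_dual_extend:
  assumes dual: "has_dual n m v"
    and new: "\<And>c. \<exists>k<n. v m k \<noteq> (\<Sum>j<m. c j * v j k)"
  shows "has_dual n (Suc m) v"
proof -
  obtain \<psi> where \<psi>: "\<And>i j. i < m \<Longrightarrow> j < m \<Longrightarrow> (\<Sum>k<n. \<psi> i k * v j k) = (if i = j then 1 else 0)"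
    using dual by (auto simp: has_dual_def)
  define b where "b j = (\<Sum>k<n. \<psi> j k * v m k)" for j
  obtain k0 where k0: "k0 < n" "v m k0 \<noteq> (\<Sum>j<m. b j * v j k0)" using new[of b] by blast
  define d where "d = v m k0 - (\<Sum>j<m. b j * v j k0)"
  have d: "d \<noteq> 0" using k0 by (simp add: d_def)
  define \<gamma> where "\<gamma> k = ((if k = k0 then 1 else 0) - (\<Sum>j<m. v j k0 * \<psi> j k)) / d" for k
  have \<gamma>: "(\<Sum>k<n. \<gamma> k * z k) = (z k0 - (\<Sum>j<m. v j k0 * (\<Sum>k<n. \<psi> j k * z k))) / d" for z
  proof -
    have "(\<Sum>k<n. \<gamma> k * z k) = (\<Sum>k<n. (if k = k0 then 1 else 0) * z k - (\<Sum>j<m. v j k0 * \<psi> j k * z k)) / d"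
      unfolding sum_divide_distrib by (rule sum.cong) (simp_all add: \<gamma>_def left_diff_distrib sum_distrib_right)
    also have "(\<Sum>k<n. (if k = k0 then 1 else 0) * z k - (\<Sum>j<m. v j k0 * \<psi> j k * z k)) =
      z k0 - (\<Sum>k<n. \<Sum>j<m. v j k0 * \<psi> j k * z k)"
      by (simp only: sum_subtractf delta_sum[OF k0(1)])
    also have "(\<Sum>k<n. \<Sum>j<m. v j k0 * \<psi> j k * z k) = (\<Sum>j<m. v j k0 * (\<Sum>k<n. \<psi> j k * z k))"
      by (subst sum.swap) (simp add: sum_distrib_left mult.assoc)
    finally show ?thesis .
  qed
  have \<gamma>1: "(\<Sum>k<n. \<gamma> k * v i k) = 0" if "i < m" for i
  proof -
    have "(\<Sum>j<m. v j k0 * (\<Sum>k<n. \<psi> j k * v i k)) = (\<Sum>j<m. (if j = i then 1 else 0) * v j k0)"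
      by (rule sum.cong) (use \<psi> that in auto)
    then show ?thesis unfolding \<gamma> using delta_sum[OF that, of "\<lambda>j. v j k0"] by simp
  qed
  have \<gamma>2: "(\<Sum>k<n. \<gamma> k * v m k) = 1"
    unfolding \<gamma> using d by (simp add: d_def b_def mult.commute)
  define \<psi>' where "\<psi>' i k = (if i = m then \<gamma> k else \<psi> i k - b i * \<gamma> k)" for i k
  have "(\<Sum>k<n. \<psi>' i k * v j k) = (if i = j then 1 else 0)" if "i < Suc m" "j < Suc m" for i j
  proof (cases "i = m")
    case True
    then show ?thesis using \<gamma>1 \<gamma>2 that by (auto simp: \<psi>'_def less_Suc_eq)
  next
    case False
    then have "(\<Sum>k<n. \<psi>' i k * v j k) = (\<Sum>k<n. \<psi> i k * v j k) - b i * (\<Sum>k<n. \<gamma> k * v j k)"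
      by (simp add: \<psi>'_def left_diff_distrib sum_subtractf sum_distrib_left mult.assoc)
    then show ?thesis using \<gamma>1 \<gamma>2 \<psi> that False by (auto simp: less_Suc_eq b_def)
  qed
  then show ?thesis unfolding has_dual_def by blast
qed

definition Vs :: "nat \<Rightarrow> (nat \<Rightarrow> 'a) set" where "Vs n = {x. \<forall>k\<ge>n. x k = 0}"

lemma card_Vs: "finite (Vs n)" "card (Vs n) = (q ^ 2) ^ n"
proof -
  have bij: "bij_betw (\<lambda>f k. if k < n then f k else 0) (PiE {..<n} (\<lambda>_. UNIV)) (Vs n)"
  proof (rule bij_betwI[where g = "\<lambda>x. restrict x {..<n}"])
    show "(\<lambda>f k. if k < n then f k else 0) \<in> PiE {..<n} (\<lambda>_. UNIV) \<rightarrow> Vs n" by (auto simp: Vs_def)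
    show "(\<lambda>x. restrict x {..<n}) \<in> Vs n \<rightarrow> PiE {..<n} (\<lambda>_. UNIV)" by auto
    show "restrict (\<lambda>k. if k < n then f k else 0) {..<n} = f" if "f \<in> PiE {..<n} (\<lambda>_. UNIV)" for f
      using that by (auto simp: fun_eq_iff PiE_def extensional_def)
    show "(\<lambda>k. if k < n then restrict x {..<n} k else 0) = x" if "x \<in> Vs n" for x
      using that by (auto simp: fun_eq_iff Vs_def)
  qed
  show "finite (Vs n)" using bij_betw_finite[OF bij] by (simp add: finite_PiE)
  show "card (Vs n) = (q ^ 2) ^ n"
    using bij_betw_same_card[OF bij] by (simp add: card_PiE card_K)
qed

text \<open>Dimension by cardinality: forming linear combinations embeds \<open>Vs m\<close> into
  \<open>Vs n\<close>, and both are finite powers of q^2.\<close>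

lemma has_dual_le: assumes "has_dual n m v" shows "m \<le> n"
proof -
  obtain \<psi> where \<psi>: "\<And>i j. i < m \<Longrightarrow> j < m \<Longrightarrow> (\<Sum>k<n. \<psi> i k * v j k) = (if i = j then 1 else 0)"
    using assms by (auto simp: has_dual_def)
  define f where "f c = (\<lambda>k. if k < n then \<Sum>j<m. c j * v j k else 0)" for c
  have "inj_on f (Vs m)"
  proof (rule inj_onI)
    fix c c' assume h: "c \<in> Vs m" "c' \<in> Vs m" "f c = f c'"
    have coord: "c i = (\<Sum>k<n. \<psi> i k * f c k)" if "i < m" for c i
    proof -
      have "(\<Sum>k<n. \<psi> i k * f c k) = (\<Sum>k<n. \<Sum>j<m. c j * (\<psi> i k * v j k))"
        by (rule sum.cong) (simp_all add: f_def sum_distrib_left mult_ac)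
      also have "\<dots> = (\<Sum>j<m. c j * (\<Sum>k<n. \<psi> i k * v j k))"
        by (subst sum.swap) (simp add: sum_distrib_left)
      also have "\<dots> = (\<Sum>j<m. (if j = i then 1 else 0) * c j)"
        by (rule sum.cong) (use \<psi> that in auto)
      finally show ?thesis using delta_sum[OF that, of c] by simp
    qed
    show "c = c'"
    proof
      fix i show "c i = c' i"
      proof (cases "i < m")
        case True
        then show ?thesis using coord[of i c] coord[of i c'] h(3) by simp
      qed (use h in \<open>simp add: Vs_def\<close>)
    qed
  qed
  moreover have "f ` Vs m \<subseteq> Vs n" by (auto simp: f_def Vs_def)
  ultimately have "card (Vs m) \<le> card (Vs n)" by (rule card_inj_on_le) (rule card_Vs)
  moreover have "1 < q ^ 2" using q_gt1 by (rule one_less_power) simp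
  ultimately show ?thesis by (simp add: card_Vs)
qed

text \<open>Gram--Schmidt for a nondegenerate Hermitian form: isotropic complements are excluded by
  polarisation, since the trace form on the field does not vanish.\<close>

definition hf :: "nat \<Rightarrow> (nat \<Rightarrow> nat \<Rightarrow> 'a) \<Rightarrow> (nat \<Rightarrow> 'a) \<Rightarrow> (nat \<Rightarrow> 'a) \<Rightarrow> 'a" where
  "hf n H x y = (\<Sum>i<n. \<Sum>j<n. x i ^ q * H i j * y j)"

lemma hf_lin1: "hf n H (\<lambda>k. x k + y k) z = hf n H x z + hf n H y z"
  "hf n H (\<lambda>k. x k - y k) z = hf n H x z - hf n H y z" "hf n H (\<lambda>k. c * x k) z = c ^ q * hf n H x z"
  by (simp_all add: hf_def cj_add cj_minus distrib_right left_diff_distrib sum.distrib sum_subtractf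
    power_mult_distrib sum_distrib_left mult.assoc)

lemma hf_lin2: "hf n H z (\<lambda>k. x k + y k) = hf n H z x + hf n H z y"
  "hf n H z (\<lambda>k. x k - y k) = hf n H z x - hf n H z y" "hf n H z (\<lambda>k. c * x k) = c * hf n H z x"
  by (simp_all add: hf_def distrib_left right_diff_distrib sum.distrib sum_subtractf sum_distrib_left mult_ac)

lemma hf_sum2: "hf n H z (\<lambda>k. \<Sum>i<m. c i * x i k) = (\<Sum>i<m. c i * hf n H z (x i))" for m :: nat
proof (induction m)
  case 0 then show ?case by (simp add: hf_def)
next
  case (Suc m) then show ?case by (simp add: hf_lin2)
qed

lemma hf_cj: assumes "\<And>i j. i < n \<Longrightarrow> j < n \<Longrightarrow> H i j ^ q = H j i" shows "hf n H x y ^ q = hf n H y x"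
proof -
  have "hf n H x y ^ q = (\<Sum>i<n. \<Sum>j<n. x i * H j i * y j ^ q)"
    using assms by (simp add: hf_def cj_sum power_mult_distrib cj_cj)
  also have "\<dots> = hf n H y x" unfolding hf_def by (subst sum.swap) (simp add: mult_ac)
  finally show ?thesis .
qed

theorem hermitian_basis:
  assumes herm: "\<And>i j. i < n \<Longrightarrow> j < n \<Longrightarrow> H i j ^ q = H j i"
    and nondeg: "\<And>y. (\<And>i. i < n \<Longrightarrow> (\<Sum>j<n. H i j * y j) = 0) \<Longrightarrow> (\<And>j. j < n \<Longrightarrow> y j = 0)"
    and m: "m \<le> n"
  shows "\<exists>x. \<forall>i<m. \<forall>j<m. hf n H (x i) (x j) = (if i = j then 1 else 0)"
proof -
  have hcj: "hf n H x y ^ q = hf n H y x" for x y using herm by (rule hf_cj)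
  show ?thesis using m
  proof (induction m)
  case (Suc m)
  then obtain x where x: "\<And>i j. i < m \<Longrightarrow> j < m \<Longrightarrow> hf n H (x i) (x j) = (if i = j then 1 else 0)" by force
  define proj where "proj z = (\<lambda>k. z k - (\<Sum>i<m. hf n H (x i) z * x i k))" for z
  have W: "hf n H (x i) (proj z) = 0" if "i < m" for i z
  proof -
    have "(\<Sum>j<m. hf n H (x j) z * hf n H (x i) (x j)) = (\<Sum>j<m. (if j = i then 1 else 0) * hf n H (x j) z)"
      by (rule sum.cong) (use x that in auto)
    then show ?thesis using delta_sum[OF that, of "\<lambda>j. hf n H (x j) z"]
      by (simp add: proj_def hf_lin2 hf_sum2)
  qed
  have "\<exists>y. (\<forall>i<m. hf n H (x i) y = 0) \<and> hf n H y y \<noteq> 0"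
  proof (rule ccontr)
    assume "\<not> ?thesis"
    then have iso: "hf n H y y = 0" if "\<And>i. i < m \<Longrightarrow> hf n H (x i) y = 0" for y using that by blast
    have orth: "hf n H y z = 0" if y: "\<And>i. i < m \<Longrightarrow> hf n H (x i) y = 0" and z: "\<And>i. i < m \<Longrightarrow> hf n H (x i) z = 0" for y z
    proof (rule ccontr)
      let ?\<eta> = "hf n H y z"
      assume nz: "?\<eta> \<noteq> 0"
      obtain t :: 'a where t: "t + t ^ q \<noteq> 0" using tr_nonzero by blast
      define c where "c = t / ?\<eta>"
      have ct: "c * ?\<eta> = t" using nz by (simp add: c_def)
      have "hf n H (\<lambda>k. y k + c * z k) (\<lambda>k. y k + c * z k) = 0"
        by (rule iso) (simp add: hf_lin2 y z)
      moreover have "hf n H (\<lambda>k. y k + c * z k) (\<lambda>k. y k + c * z k) =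
        hf n H y y + c * ?\<eta> + c ^ q * ?\<eta> ^ q + c ^ q * c * hf n H z z"
        by (simp add: hf_lin1 hf_lin2 hcj algebra_simps)
      ultimately have "c * ?\<eta> + (c * ?\<eta>) ^ q = 0" using iso[OF y] iso[OF z] by (simp add: power_mult_distrib)
      then show False using t by (simp only: ct)
    qed
    have zero: "y k = 0" if y: "\<And>i. i < m \<Longrightarrow> hf n H (x i) y = 0" and "k < n" for y k
    proof (rule nondeg[OF _ that(2)])
      have y': "hf n H y (x i) = 0" if "i < m" for i
        using y[OF that] hcj[of "x i" y] by (simp add: cj_0)
      have all: "hf n H y z = 0" for z
      proof -
        have "hf n H y (proj z) = 0" by (rule orth) (use y W in auto)
        moreover have "(\<Sum>i<m. hf n H (x i) z * hf n H y (x i)) = 0" using y' by simp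
        ultimately show ?thesis by (simp add: proj_def hf_lin2 hf_sum2)
      qed
      fix i assume i: "i < n"
      have "hf n H (\<lambda>k. if k = i then 1 else 0) y = (\<Sum>i'<n. (if i' = i then 1 else 0) * (\<Sum>j<n. H i' j * y j))"
        unfolding hf_def sum_distrib_left by (intro sum.cong refl) (simp add: cj_0)
      also have "\<dots> = (\<Sum>j<n. H i j * y j)" by (rule delta_sum) fact
      finally show "(\<Sum>j<n. H i j * y j) = 0"
        using all[of "\<lambda>k. if k = i then 1 else 0"] hcj[of y "\<lambda>k. if k = i then 1 else 0"] by (simp add: cj_0)
    qed
    \<comment> \<open>Every vector is now the combination of the \<open>x i\<close> with
      coefficients <x_i, .>. Read on unit vectors, this says that their n images in m-dimensional
      space are independent, which is impossible for m < n.\<close>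
    have "has_dual m n (\<lambda>j i. hf n H (x i) (\<lambda>k. if k = j then 1 else 0))"
      unfolding has_dual_def
    proof (intro exI[of _ "\<lambda>k i. x i k"] allI impI)
      fix k j assume h: "k < n" "j < n"
      have "proj (\<lambda>k. if k = j then 1 else 0) k = 0" by (rule zero) (use W h in auto)
      then show "(\<Sum>i<m. x i k * hf n H (x i) (\<lambda>k. if k = j then 1 else 0)) = (if k = j then 1 else 0)"
        by (simp add: proj_def mult.commute)
    qed
    then have "n \<le> m" by (rule has_dual_le)
    then show False using Suc.prems by simp
  qed
  then obtain y where y: "\<And>i. i < m \<Longrightarrow> hf n H (x i) y = 0" "hf n H y y \<noteq> 0" by blast
  let ?N = "hf n H y y"
  have "?N ^ q = ?N" by (rule hcj)
  then have "(1 / ?N) ^ q = 1 / ?N" by (simp add: power_divide)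
  then obtain s where s: "s * s ^ q = 1 / ?N" using norm_surj[of "1 / ?N"] y(2) by auto
  define x' where "x' i = (if i = m then (\<lambda>k. s * y k) else x i)" for i
  have y': "hf n H y (x i) = 0" if "i < m" for i
    using y(1)[OF that] hcj[of "x i" y] by (simp add: cj_0)
  have "hf n H (\<lambda>k. s * y k) (\<lambda>k. s * y k) = (s * s ^ q) * ?N" by (simp add: hf_lin1 hf_lin2)
  then have "hf n H (\<lambda>k. s * y k) (\<lambda>k. s * y k) = 1" using s y(2) by simp
  then have "hf n H (x' i) (x' j) = (if i = j then 1 else 0)" if "i < Suc m" "j < Suc m" for i j
    using that x y(1) y' by (auto simp: x'_def less_Suc_eq hf_lin1 hf_lin2)
  then show ?case by blast
  qed simp
qed

end

section \<open>Recurrent sequences\<close>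

text \<open>\<open>f(T)\<close> applied to \<open>x\<close>. The operator is an arbitrary function
  so that one theory serves both the shift on sequences and a matrix acting on vectors.\<close>

definition pact :: "(('i \<Rightarrow> 'k::comm_ring_1) \<Rightarrow> 'i \<Rightarrow> 'k) \<Rightarrow> 'k poly \<Rightarrow> ('i \<Rightarrow> 'k) \<Rightarrow> 'i \<Rightarrow> 'k" where
  "pact T f x = (\<lambda>i. \<Sum>k\<le>degree f. poly.coeff f k * (T ^^ k) x i)"

locale lin_op =
  fixes T :: "('i \<Rightarrow> 'k::field) \<Rightarrow> 'i \<Rightarrow> 'k"
  assumes T_add: "T (\<lambda>i. x i + y i) = (\<lambda>i. T x i + T y i)"
    and T_scale: "T (\<lambda>i. c * x i) = (\<lambda>i. c * T x i)"
begin

lemma T_zero: "T (\<lambda>i. 0) = (\<lambda>i. 0)"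
  using T_scale[of 0] by simp

lemma pact_bound: "degree f \<le> N \<Longrightarrow> pact T f x i = (\<Sum>k\<le>N. poly.coeff f k * (T ^^ k) x i)"
  unfolding pact_def by (rule sum.mono_neutral_left) (auto simp: coeff_eq_0)

lemma pact_add: "pact T (f + g) x = (\<lambda>i. pact T f x i + pact T g x i)"
proof
  fix i
  let ?N = "max (degree f) (degree g)"
  have "degree (f + g) \<le> ?N" by (rule degree_add_le_max)
  then show "pact T (f + g) x i = pact T f x i + pact T g x i"
    by (simp add: pact_bound[of _ ?N] distrib_right sum.distrib)
qed

lemma pact_smult: "pact T (smult c f) x = (\<lambda>i. c * pact T f x i)"
proof
  fix i show "pact T (smult c f) x i = c * pact T f x i"
    using degree_smult_le[of c f]
    by (simp add: pact_bound[of _ "degree f"] sum_distrib_left mult.assoc)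
qed

lemma pact_pCons: "pact T (pCons a f) x = (\<lambda>i. a * x i + pact T f (T x) i)"
proof
  fix i
  have "degree (pCons a f) \<le> Suc (degree f)" by (rule degree_pCons_le)
  then have "pact T (pCons a f) x i = (\<Sum>k\<le>Suc (degree f). poly.coeff (pCons a f) k * (T ^^ k) x i)"
    by (rule pact_bound)
  also have "\<dots> = a * x i + (\<Sum>k\<le>degree f. poly.coeff f k * (T ^^ Suc k) x i)"
    by (simp only: sum.atMost_Suc_shift) simp
  finally show "pact T (pCons a f) x i = a * x i + pact T f (T x) i"
    by (simp add: pact_def funpow_swap1)
qed

lemma pact_0 [simp]: "pact T 0 x = (\<lambda>i. 0)"
  by (simp add: pact_def)

lemma pact_1 [simp]: "pact T 1 x = x"
  by (simp add: pact_def)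

lemma pact_T: "pact T f (T x) = T (pact T f x)"
proof (induction f arbitrary: x)
  case (pCons a f)
  then show ?case by (simp add: pact_pCons T_add T_scale)
qed (simp add: T_zero)

lemma pact_lin: "pact T f (\<lambda>i. x i + y i) = (\<lambda>i. pact T f x i + pact T f y i)"
  "pact T f (\<lambda>i. c * x i) = (\<lambda>i. c * pact T f x i)"
proof (induction f arbitrary: x y)
  case (pCons a f)
  { case 1 then show ?case by (simp add: pact_pCons T_add pCons.IH algebra_simps) }
  { case 2 then show ?case by (simp add: pact_pCons T_scale pCons.IH algebra_simps) }
qed simp_all

lemma pact_mult: "pact T (f * g) x = pact T f (pact T g x)"
proof (induction f arbitrary: x)
  case (pCons a f)
  have "pact T (pCons a f * g) x = (\<lambda>i. a * pact T g x i + pact T (pCons 0 (f * g)) x i)"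
    by (simp add: pact_add pact_smult)
  also have "\<dots> = (\<lambda>i. a * pact T g x i + pact T f (T (pact T g x)) i)"
    by (simp add: pact_pCons pCons.IH pact_T)
  finally show ?case by (simp add: pact_pCons)
qed simp

lemma pact_zero_arg [simp]: "pact T f (\<lambda>i. 0) = (\<lambda>i. 0)"
  using pact_lin(2)[of f 0] by simp

lemma pact_monom: "pact T (Polynomial.monom 1 k) x = (T ^^ k) x"
  by (induction k arbitrary: x) (simp_all add: Polynomial.monom_Suc pact_pCons funpow_swap1 Polynomial.monom_0)

definition is_mp :: "('i \<Rightarrow> 'k) \<Rightarrow> 'k poly \<Rightarrow> bool" where
  "is_mp x d \<longleftrightarrow> monic d \<and> (\<forall>f. pact T f x = (\<lambda>i. 0) \<longleftrightarrow> d dvd f)"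

lemma is_mp_unique: "is_mp x d \<Longrightarrow> is_mp x d' \<Longrightarrow> d = d'"
  by (metis is_mp_def poly_dvd_antisym dvd_refl)

lemma is_mp_exists: assumes "f \<noteq> 0" "pact T f x = (\<lambda>i. 0)" shows "\<exists>d. is_mp x d"
proof -
  let ?Q = "\<lambda>f. f \<noteq> 0 \<and> pact T f x = (\<lambda>i. 0)"
  obtain d0 where d0: "?Q d0" "\<And>g. ?Q g \<Longrightarrow> degree d0 \<le> degree g"
    using ex_has_least_nat[of ?Q f degree] assms by blast
  define d where "d = smult (inverse (lead_coeff d0)) d0"
  have lc: "lead_coeff d0 \<noteq> 0" using d0(1) by simp
  have d: "monic d" "pact T d x = (\<lambda>i. 0)" "degree d = degree d0"
    using d0(1) lc by (simp_all add: d_def pact_smult)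
  have "d dvd g" if g: "pact T g x = (\<lambda>i. 0)" for g
  proof -
    have "g = g div d * d + g mod d" by simp
    then have "pact T g x = (\<lambda>i. pact T (g div d * d) x i + pact T (g mod d) x i)"
      by (metis pact_add)
    then have "pact T (g mod d) x = (\<lambda>i. 0)" using g d(2) by (simp add: pact_mult)
    moreover have "d \<noteq> 0" using d(1) by auto
    ultimately have "g mod d = 0" using d0(2)[of "g mod d"] d(3) degree_mod_less'[of d g]
      by (metis leD)
    then show ?thesis by (simp add: mod_eq_0_iff_dvd)
  qed
  moreover have "pact T g x = (\<lambda>i. 0)" if dv: "d dvd g" for g
  proof -
    from dv obtain h where "g = d * h" ..
    then have "g = h * d" by (simp add: mult.commute)
    then show ?thesis using d(2) by (simp add: pact_mult)
  qed
  ultimately show ?thesis using d(1) unfolding is_mp_def by blast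
qed

end

section \<open>Two-sided linear recurrences\<close>

definition shft :: "(int \<Rightarrow> 'k) \<Rightarrow> int \<Rightarrow> 'k" where "shft c = (\<lambda>j. c (j + 1))"

lemma shft_pow: "(shft ^^ k) c j = c (j + int k)"
  by (induction k arbitrary: j) (simp_all add: shft_def add_ac)

interpretation SH: lin_op "shft :: (int \<Rightarrow> 'k::field) \<Rightarrow> _"
  by unfold_locales (simp_all add: shft_def)

lemma pact_shft: "pact shft f c j = (\<Sum>k\<le>degree f. poly.coeff f k * c (j + int k))"
  by (simp add: pact_def shft_pow)

text \<open>A window of \<open>degree d\<close> consecutive zeros moves right because
  \<open>d\<close> is monic, and left because its constant coefficient is invertible.\<close>

lemma rec_zero:
  fixes e :: "int \<Rightarrow> 'k::field"
  assumes d: "monic d" "poly.coeff d 0 \<noteq> 0" "pact shft d e = (\<lambda>i. 0)"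
    and w: "\<And>i. i < degree d \<Longrightarrow> e (s + int i) = 0"
  shows "e = (\<lambda>i. 0)"
proof -
  let ?b = "degree d"
  have rec: "(\<Sum>k\<le>?b. poly.coeff d k * e (j + int k)) = 0" for j
    using fun_cong[OF d(3), of j] by (simp add: pact_shft)
  show ?thesis
  proof (cases "?b = 0")
    case True
    then show ?thesis using rec d(1) by (auto simp: fun_eq_iff)
  next
    case False
    have win: "\<forall>i<?b. e (s + t + int i) = 0" for t
    proof (induction t rule: int_induct[of _ 0])
      case base then show ?case using w by simp
    next
      case (step1 t)
      have "(\<Sum>k\<le>?b. poly.coeff d k * e (s + t + int k)) = poly.coeff d ?b * e (s + t + int ?b)"
        using step1(2) by (subst lessThan_Suc_atMost[symmetric], simp)
      then have "e (s + t + int ?b) = 0" using rec[of "s + t"] d(1) by simp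
      then have "e (s + t + int (Suc i)) = 0" if "i < ?b" for i
        using that step1(2)[rule_format, of "Suc i"] by (cases "Suc i = ?b") auto
      then show ?case by (simp add: add_ac)
    next
      case (step2 t)
      have "(\<Sum>k\<le>?b. poly.coeff d k * e (s + (t - 1) + int k)) =
         poly.coeff d 0 * e (s + (t - 1)) + (\<Sum>k=1..?b. poly.coeff d k * e (s + (t - 1) + int k))"
        by (simp add: atMost_atLeast0 sum.atLeast_Suc_atMost)
      also have "(\<Sum>k=1..?b. poly.coeff d k * e (s + (t - 1) + int k)) = 0"
      proof (rule sum.neutral, intro ballI)
        fix k assume k: "k \<in> {1..?b}"
        then have "k - 1 < ?b" by auto
        then have "e (s + t + int (k - 1)) = 0" using step2(2) by blast
        moreover have "s + t + int (k - 1) = s + (t - 1) + int k" using k by auto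
        ultimately have "e (s + (t - 1) + int k) = 0" by metis
        then show "poly.coeff d k * e (s + (t - 1) + int k) = 0" by (simp only: mult_zero_right)
      qed
      finally have e0: "e (s + (t - 1)) = 0" using rec[of "s + (t - 1)"] d(2) by simp
      show ?case
      proof (intro allI impI)
        fix i assume i: "i < ?b"
        show "e (s + (t - 1) + int i) = 0"
        proof (cases i)
          case (Suc i')
          then have "e (s + t + int i') = 0" using step2(2) i by auto
          then show ?thesis using Suc by (simp add: algebra_simps)
        qed (use e0 in simp)
      qed
    qed
    show ?thesis
    proof
      fix j show "e j = 0" using win[of "j - s"] False by force
    qed
  qed
qed

text \<open>The shift is invertible on two-sided sequences, so a factor X of the minimal polynomial
  could be cancelled.\<close>

lemma mp_coeff_0: assumes "SH.is_mp c d" shows "poly.coeff d 0 \<noteq> (0 :: 'k::field)"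
proof
  assume "poly.coeff d 0 = 0"
  then obtain d' where d': "d = pCons 0 d'" by (cases d) auto
  have d: "monic d" "pact shft d c = (\<lambda>i. 0)" using assms by (auto simp: SH.is_mp_def)
  have "shft (pact shft d' c) = (\<lambda>i. 0)" using d(2) by (simp add: d' SH.pact_pCons SH.pact_T)
  then have "pact shft d' c (j + 1) = 0" for j by (simp add: shft_def fun_eq_iff)
  then have "pact shft d' c j = 0" for j by (metis diff_add_cancel)
  then have "d dvd d'" using assms by (auto simp: SH.is_mp_def)
  moreover have "d' \<noteq> 0" using d(1) d' by auto
  ultimately have "degree d \<le> degree d'" by (rule dvd_imp_degree_le)
  then show False using d' \<open>d' \<noteq> 0\<close> by simp
qed

text \<open>Two-sided solutions of a linear recurrence, built from a functional on the residue ring,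
  in which the indeterminate is invertible.\<close>

lemma rec_solution:
  fixes f :: "'k::field poly"
  assumes f: "monic f" "poly.coeff f 0 \<noteq> 0"
  shows "\<exists>c. pact shft f c = (\<lambda>i. 0) \<and> (\<forall>i<degree f. c (int i) = l i)"
proof (cases "degree f = 0")
  case True
  then show ?thesis by (intro exI[of _ "\<lambda>i. 0"]) simp
next
  case False
  obtain a g where g: "f = pCons a g" by (cases f)
  have a: "a \<noteq> 0" using f(2) g by simp
  \<comment> \<open>The inverse of X modulo f, read off from f = a + X g.\<close>
  define y where "y = smult (- 1 / a) g"
  have xy: "f dvd [:0, 1:] * y - 1"
  proof -
    have "f = [:a:] + [:0, 1:] * g" by (simp add: g)
    then have "[:0, 1:] * y - 1 = smult (- 1 / a) f" using a by (simp add: y_def smult_add_right one_pCons)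
    then show ?thesis by (metis dvd_smult dvd_refl)
  qed
  define e where "e j = (if j \<ge> 0 then Polynomial.monom 1 (nat j) else y ^ nat (- j))" for j :: int
  have step: "f dvd [:0, 1:] * e j - e (j + 1)" for j
  proof -
    consider "j \<ge> 0" | "j = -1" | "j < -1" by linarith
    then show ?thesis
    proof cases
      case 1
      then have "[:0, 1:] * e j = e (j + 1)"
        by (simp add: e_def nat_add_distrib Polynomial.monom_Suc flip: Suc_eq_plus1)
      then show ?thesis by simp
    next
      case 2 then show ?thesis using xy by (simp add: e_def one_pCons Polynomial.monom_0)
    next
      case 3
      define m where "m = nat (- (j + 1))"
      have m: "nat (- j) = Suc m" "nat (- (j + 1)) = m" using 3 by (simp_all add: m_def)
      have "[:0, 1:] * e j - e (j + 1) = ([:0, 1:] * y - 1) * y ^ m"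
        using 3 m by (simp add: e_def algebra_simps)
      then show ?thesis using xy by (metis dvd_mult2)
    qed
  qed
  define lam where "lam h = (\<Sum>i<degree f. l i * poly.coeff (h mod f) i)" for h
  have lam_add: "lam (h + h') = lam h + lam h'" for h h'
    by (simp add: lam_def poly_mod_add_left distrib_left sum.distrib)
  have lam_smult: "lam (smult k h) = k * lam h" for h k
    by (simp add: lam_def mod_smult_left sum_distrib_left mult_ac)
  have lam_cong: "lam h = lam h'" if "f dvd h - h'" for h h'
  proof -
    have "h mod f = h' mod f" using that by (metis mod_eq_dvd_iff)
    then show ?thesis by (simp add: lam_def)
  qed
  define c where "c j = lam (e j)" for j
  have "pact shft h c j = lam (h * e j)" for h j
  proof (induction h arbitrary: j)
    case 0 then show ?case by (simp add: lam_def)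
  next
    case (pCons k h)
    have "pact shft (pCons k h) c j = k * c j + pact shft h c (j + 1)"
      by (simp add: SH.pact_pCons SH.pact_T) (simp add: shft_def)
    also have "\<dots> = lam (smult k (e j)) + lam (h * e (j + 1))" by (simp add: pCons.IH lam_smult c_def)
    also have "lam (h * e (j + 1)) = lam (h * ([:0, 1:] * e j))"
    proof (rule lam_cong)
      have "h * e (j + 1) - h * ([:0, 1:] * e j) = - (h * ([:0, 1:] * e j - e (j + 1)))"
        by (simp add: right_diff_distrib)
      then show "f dvd h * e (j + 1) - h * ([:0, 1:] * e j)" using step[of j] by (metis dvd_minus_iff dvd_mult)
    qed
    also have "lam (smult k (e j)) + lam (h * ([:0, 1:] * e j)) = lam (pCons k h * e j)"
      by (simp add: lam_add[symmetric])
    finally show ?case .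
  qed
  then have "pact shft f c = (\<lambda>i. 0)" by (auto simp: lam_def)
  moreover have "c (int i) = l i" if "i < degree f" for i
  proof -
    have "degree (Polynomial.monom (1 :: 'k) i) < degree f" using that by (simp add: degree_monom_eq)
    then have "c (int i) = (\<Sum>k<degree f. l k * (if i = k then 1 else 0))"
      by (simp add: c_def lam_def e_def mod_poly_less cong: if_cong)
    also have "\<dots> = l i" using that by (simp add: if_distrib cong: if_cong)
    finally show ?thesis .
  qed
  ultimately show ?thesis by blast
qed

context ff_setup
begin

section \<open>Hermitian sequences and their minimal polynomials\<close>

text \<open>The symmetry of the correlations <v, g^j v> of a unitary g.\<close>

definition hseq :: "(int \<Rightarrow> 'a) set" where "hseq = {c. \<forall>j. c (- j) = c j ^ q}"

definition cj_poly :: "'a poly \<Rightarrow> 'a poly" where "cj_poly f = reflect_poly (map_poly (\<lambda>x. x ^ q) f)"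

text \<open>The conjugate-linear involution fixing exactly the Hermitian sequences; it exchanges
  annihilation by \<open>f\<close> and by \<open>cj_poly f\<close>.\<close>

definition cj_seq :: "(int \<Rightarrow> 'a) \<Rightarrow> int \<Rightarrow> 'a" where "cj_seq c = (\<lambda>j. c (- j) ^ q)"

lemma degree_cj: "degree (map_poly (\<lambda>x. x ^ q) f) = degree (f :: 'a poly)"
  using q_gt1 by (simp add: degree_map_poly)

lemma coeff_cj_poly: "i \<le> degree f \<Longrightarrow> poly.coeff (cj_poly f) i = poly.coeff f (degree f - i) ^ q"
  using q_gt1 by (simp add: cj_poly_def coeff_reflect_poly degree_cj coeff_map_poly)

lemma degree_cj_poly: "poly.coeff f 0 \<noteq> 0 \<Longrightarrow> degree (cj_poly f) = degree f"
  using q_gt1 by (simp add: cj_poly_def coeff_map_poly degree_cj)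

lemma hseq_iff: "c \<in> hseq \<longleftrightarrow> cj_seq c = c"
proof
  assume "c \<in> hseq"
  then have "c (- j) ^ q = c j" for j by (simp add: hseq_def cj_cj)
  then show "cj_seq c = c" by (simp add: cj_seq_def)
next
  assume "cj_seq c = c"
  have e: "c (- j) ^ q = c j" for j
  proof -
    have "cj_seq c j = c j" by (simp add: \<open>cj_seq c = c\<close>)
    then show ?thesis by (simp add: cj_seq_def)
  qed
  have "c (- j) = c j ^ q" for j using e[of "- j"] by simp
  then show "c \<in> hseq" by (simp add: hseq_def)
qed

lemma pact_cj: assumes "poly.coeff f 0 \<noteq> 0"
  shows "pact shft (cj_poly f) (cj_seq c) j = pact shft f c (- j - int (degree f)) ^ q"
proof -
  have "pact shft (cj_poly f) (cj_seq c) j = (\<Sum>k\<le>degree f. (poly.coeff f (degree f - k) * c (- (j + int k))) ^ q)"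
    by (simp add: pact_shft degree_cj_poly[OF assms] coeff_cj_poly cj_seq_def power_mult_distrib)
  also have "\<dots> = (\<Sum>k\<le>degree f. (poly.coeff f k * c (- j - int (degree f) + int k)) ^ q)"
    by (rule sum.reindex_bij_witness[where i = "\<lambda>k. degree f - k" and j = "\<lambda>k. degree f - k"])
       (auto simp: of_nat_diff algebra_simps)
  finally show ?thesis by (simp add: pact_shft cj_sum)
qed

lemma pact_cj_zero: assumes "poly.coeff f 0 \<noteq> 0"
  shows "pact shft f c = (\<lambda>i. 0) \<longleftrightarrow> pact shft (cj_poly f) (cj_seq c) = (\<lambda>i. 0)"
proof -
  have "pact shft (cj_poly f) (cj_seq c) j = 0 \<longleftrightarrow> pact shft f c (- j - int (degree f)) = 0" for j
    using q_gt1 by (simp add: pact_cj[OF assms])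
  then have "(\<forall>j. pact shft (cj_poly f) (cj_seq c) j = 0) \<longleftrightarrow> (\<forall>j. pact shft f c (- j - int (degree f)) = 0)"
    by simp
  also have "\<dots> \<longleftrightarrow> (\<forall>j. pact shft f c j = 0)"
  proof safe
    fix j assume "\<forall>j. pact shft f c (- j - int (degree f)) = 0"
    from spec[OF this, of "- j - int (degree f)"] show "pact shft f c j = 0" by simp
  qed simp
  finally show ?thesis by (simp add: fun_eq_iff)
qed

text \<open>The involution shows that \<open>cj_poly d\<close> annihilates the sequence too, so
  \<open>d\<close> divides it. The degrees agree, hence the quotient is a constant, which the
  leading coefficients identify.\<close>

lemma mp_unitary: assumes c: "c \<in> hseq" and d: "SH.is_mp c d" shows "upoly d"
proof -
  have d0: "poly.coeff d 0 \<noteq> 0" using d by (rule mp_coeff_0)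
  have m: "monic d" "pact shft d c = (\<lambda>i. 0)" using d by (auto simp: SH.is_mp_def)
  then have "pact shft (cj_poly d) c = (\<lambda>i. 0)"
    using pact_cj_zero[OF d0, of c] c by (simp add: hseq_iff)
  then have "d dvd cj_poly d" using d by (simp add: SH.is_mp_def)
  then obtain h where h: "cj_poly d = d * h" by (elim dvdE)
  have nz: "cj_poly d \<noteq> 0"
  proof
    assume "cj_poly d = 0"
    then have "poly.coeff (cj_poly d) 0 = 0" by simp
    then show False using m(1) by (simp add: coeff_cj_poly)
  qed
  then have "degree d = degree d + degree h" using h degree_cj_poly[OF d0] degree_mult_eq[of d h] by auto
  then have "degree h = 0" by simp
  then obtain k where k: "h = [:k:]" by (rule degree_eq_zeroE)
  then have e: "cj_poly d = smult k d" using h by simp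
  then have "poly.coeff (cj_poly d) (degree d) = k" using m(1) by simp
  then have "k = poly.coeff d 0 ^ q" by (simp add: coeff_cj_poly)
  then show ?thesis using e m(1) d0 by (simp add: upoly_iff cj_poly_def)
qed

lemma cj_poly_upoly: "upoly f \<Longrightarrow> cj_poly f = smult (poly.coeff f 0 ^ q) f"
  by (simp add: upoly_iff cj_poly_def)

lemma bij_rec: assumes f: "monic f" "poly.coeff f 0 \<noteq> 0"
  shows "bij_betw (\<lambda>c i. if i < degree f then c (int i) else 0) {c. pact shft f c = (\<lambda>i. 0)} (Vs (degree f) :: (nat \<Rightarrow> 'a) set)"
proof (rule bij_betw_imageI)
  show "inj_on (\<lambda>c i. if i < degree f then c (int i) else 0) {c. pact shft f c = (\<lambda>i. 0 :: 'a)}"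
  proof (rule inj_onI, simp)
    fix c c' :: "int \<Rightarrow> 'a" assume h: "pact shft f c = (\<lambda>i. 0)" "pact shft f c' = (\<lambda>i. 0)"
      "(\<lambda>i. if i < degree f then c (int i) else 0) = (\<lambda>i. if i < degree f then c' (int i) else 0)"
    have "(\<lambda>j. c j + (-1) * c' j) = (\<lambda>i. 0)"
    proof (rule rec_zero[OF f, where s = 0])
      show "pact shft f (\<lambda>j. c j + (-1) * c' j) = (\<lambda>i. 0)"
        by (simp only: SH.pact_lin h) simp
      show "c (0 + int i) + (-1) * c' (0 + int i) = 0" if "i < degree f" for i
        using fun_cong[OF h(3), of i] that by simp
    qed
    then have "c j + (-1) * c' j = 0" for j by (simp add: fun_eq_iff)
    then show "c = c'" by (simp add: fun_eq_iff)
  qed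
  show "(\<lambda>c i. if i < degree f then c (int i) else 0) ` {c. pact shft f c = (\<lambda>i. 0)} = (Vs (degree f) :: (nat \<Rightarrow> 'a) set)"
  proof (intro equalityI subsetI)
    fix l :: "nat \<Rightarrow> 'a" assume l: "l \<in> Vs (degree f)"
    obtain c where c: "pact shft f c = (\<lambda>i. 0)" "\<forall>i<degree f. c (int i) = l i"
      using rec_solution[OF f] by blast
    have "l = (\<lambda>i. if i < degree f then c (int i) else 0)" using c(2) l by (auto simp: Vs_def)
    then show "l \<in> (\<lambda>c i. if i < degree f then c (int i) else 0) ` {c. pact shft f c = (\<lambda>i. 0)}" using c(1) by blast
  qed (auto simp: Vs_def)
qed

text \<open>The full solution space has q^(2 deg f) elements and is stable under
  \<open>cj_seq\<close>, as f is unitary. Its Hermitian elements are an F_q-form: for w outside F_q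
  every solution is uniquely \<alpha> + w \<beta> with Hermitian parts, so their number is the
  square root.\<close>

lemma card_hseq: assumes f: "upoly f"
  shows "finite {c \<in> hseq. pact shft f c = (\<lambda>i. 0)}" "card {c \<in> hseq. pact shft f c = (\<lambda>i. 0)} = q ^ degree f"
proof -
  let ?N = "{c. pact shft f c = (\<lambda>i. 0 :: 'a)}" and ?H = "{c \<in> hseq. pact shft f c = (\<lambda>i. 0)}"
  have f': "monic f" "poly.coeff f 0 \<noteq> 0" using f by (auto simp: upoly_def)
  note bij = bij_rec[OF f']
  have finN: "finite ?N" using bij_betw_finite[OF bij] card_Vs(1) by blast
  show finH: "finite ?H" using finN by (rule rev_finite_subset) auto
  have cardN: "card ?N = (q ^ 2) ^ degree f" using bij_betw_same_card[OF bij] card_Vs(2) by simp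
  have cjN: "cj_seq c \<in> ?N" if "c \<in> ?N" for c
  proof -
    have "pact shft (cj_poly f) (cj_seq c) = (\<lambda>i. 0)" using that pact_cj_zero[OF f'(2)] by simp
    then have "(\<lambda>i. poly.coeff f 0 ^ q * pact shft f (cj_seq c) i) = (\<lambda>i. 0)"
      by (simp add: cj_poly_upoly[OF f] SH.pact_smult)
    then show ?thesis using f'(2) by (simp add: fun_eq_iff)
  qed
  obtain w :: 'a where w: "w ^ q \<noteq> w" using not_fixed by blast
  define k where "k = w - w ^ q"
  have k: "k \<noteq> 0" "k ^ q = - k" using w by (simp_all add: k_def cj_minus cj_cj)
  have "bij_betw (\<lambda>(\<alpha>,\<beta>) j. \<alpha> j + w * \<beta> j) (?H \<times> ?H) ?N"
  \<comment> \<open>Solving c = \<alpha> + w \<beta> and its conjugate gives \<beta> = (c - cj c)/(w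
    - w^q) and \<alpha> = c - w \<beta>. Differences are written with the scalar \<open>-1\<close>
    to match \<open>SH.pact_lin\<close>.\<close>
  proof (rule bij_betw_byWitness[where f' = "\<lambda>c. ((\<lambda>j. c j + (- w / k) * (c j + (-1) * cj_seq c j)), (\<lambda>j. (1 / k) * (c j + (-1) * cj_seq c j)))"])
    show "\<forall>a\<in>?H \<times> ?H. (\<lambda>c. ((\<lambda>j. c j + (- w / k) * (c j + (-1) * cj_seq c j)), (\<lambda>j. (1 / k) * (c j + (-1) * cj_seq c j)))) ((\<lambda>(\<alpha>,\<beta>) j. \<alpha> j + w * \<beta> j) a) = a"
    proof (clarsimp)
      fix \<alpha> \<beta> assume "\<alpha> \<in> hseq" "\<beta> \<in> hseq"
      then have ab: "\<alpha> (- j) ^ q = \<alpha> j" "\<beta> (- j) ^ q = \<beta> j" for j by (simp_all add: hseq_def cj_cj)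
      have e: "\<alpha> j + w * \<beta> j - cj_seq (\<lambda>j. \<alpha> j + w * \<beta> j) j = k * \<beta> j" for j
        by (simp add: cj_seq_def cj_add power_mult_distrib ab k_def algebra_simps)
      show "(\<lambda>j. \<alpha> j + w * \<beta> j - w * (\<alpha> j + w * \<beta> j - cj_seq (\<lambda>j. \<alpha> j + w * \<beta> j) j) / k) = \<alpha> \<and>
        (\<lambda>j. (\<alpha> j + w * \<beta> j - cj_seq (\<lambda>j. \<alpha> j + w * \<beta> j) j) / k) = \<beta>"
        unfolding e using k by simp
    qed
    show "\<forall>c\<in>?N. (\<lambda>(\<alpha>,\<beta>) j. \<alpha> j + w * \<beta> j) ((\<lambda>c. ((\<lambda>j. c j + (- w / k) * (c j + (-1) * cj_seq c j)), (\<lambda>j. (1 / k) * (c j + (-1) * cj_seq c j)))) c) = c"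
      by (simp add: fun_eq_iff)
    show "(\<lambda>(\<alpha>,\<beta>) j. \<alpha> j + w * \<beta> j) ` (?H \<times> ?H) \<subseteq> ?N"
      by (auto simp: SH.pact_lin)
    have 1: "(\<lambda>j. (1 / k) * (c j + (-1) * cj_seq c j)) \<in> hseq" for c
      unfolding hseq_def by (auto simp: cj_seq_def power_divide k cj_minus cj_cj field_simps)
    have 2: "(\<lambda>j. c j + (- w / k) * (c j + (-1) * cj_seq c j)) \<in> hseq" for c
    proof -
      have e: "c j + (- w / k) * (c j + (-1) * cj_seq c j) = (- (w ^ q) * c j + w * cj_seq c j) / k" for j
        using k(1) by (simp add: field_simps) (simp add: k_def algebra_simps)
      show ?thesis unfolding hseq_def e
        by (auto simp: cj_seq_def power_divide power_mult_distrib k cj_add cj_uminus cj_cj cj_minus)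
           (simp add: field_simps k)
    qed
    show "(\<lambda>c. ((\<lambda>j. c j + (- w / k) * (c j + (-1) * cj_seq c j)), (\<lambda>j. (1 / k) * (c j + (-1) * cj_seq c j)))) ` ?N \<subseteq> ?H \<times> ?H"
    proof (rule image_subsetI)
      fix c assume c: "c \<in> ?N"
      have 3: "pact shft f (\<lambda>j. c j + (-1) * cj_seq c j) = (\<lambda>i. 0)"
        using c cjN[OF c] by (simp only: SH.pact_lin mem_Collect_eq) simp
      have "pact shft f (\<lambda>j. u * (c j + (-1) * cj_seq c j)) = (\<lambda>i. 0)" for u
        by (simp only: SH.pact_lin(2) 3 mult_zero_right)
      then show "((\<lambda>j. c j + (- w / k) * (c j + (-1) * cj_seq c j)), (\<lambda>j. (1 / k) * (c j + (-1) * cj_seq c j))) \<in> ?H \<times> ?H"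
        using 1[of c] 2[of c] c by (simp only: SH.pact_lin(1) mem_Collect_eq mem_Times_iff fst_conv snd_conv) simp
    qed
  qed
  then have "card ?N = card ?H * card ?H" by (simp add: bij_betw_same_card[symmetric] card_cartesian_product)
  then have "card ?H * card ?H = q ^ degree f * q ^ degree f"
    using cardN by (simp add: power2_eq_square power_mult_distrib)
  then have "(card ?H) ^ 2 = (q ^ degree f) ^ 2" by (simp add: power2_eq_square)
  then show "card ?H = q ^ degree f" by (simp add: power2_eq_iff_nonneg)
qed

definition mp_seq :: "(int \<Rightarrow> 'a) \<Rightarrow> 'a poly" where "mp_seq c = (THE d. SH.is_mp c d)"

definition hseqs :: "nat \<Rightarrow> (int \<Rightarrow> 'a) set" where
  "hseqs b = {c \<in> hseq. \<exists>d. SH.is_mp c d \<and> degree d = b}"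

lemma mp_seq_eq: "SH.is_mp c d \<Longrightarrow> mp_seq c = d"
  unfolding mp_seq_def by (rule the_equality) (auto intro: SH.is_mp_unique)

lemma hseqs_mp: assumes "c \<in> hseqs b"
  shows "SH.is_mp c (mp_seq c)" "degree (mp_seq c) = b" "upoly (mp_seq c)" "c \<in> hseq"
  using assms mp_unitary mp_seq_eq by (auto simp: hseqs_def)

lemma finite_hseqs: "finite (hseqs b)"
proof -
  have "finite (ev ` upolys b)" using bij_betw_imp_surj_on[OF bij_ev_upolys[of b]] P.finite_inv by simp
  then have "finite (upolys b)" using bij_ev_upolys[of b] bij_betw_finite P.finite_inv by blast
  moreover have "hseqs b \<subseteq> (\<Union>f\<in>upolys b. {c \<in> hseq. pact shft f c = (\<lambda>i. 0)})"
  proof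
    fix c assume c: "c \<in> hseqs b"
    have "pact shft (mp_seq c) c = (\<lambda>i. 0)" using hseqs_mp(1)[OF c] by (simp add: SH.is_mp_def)
    then show "c \<in> (\<Union>f\<in>upolys b. {c \<in> hseq. pact shft f c = (\<lambda>i. 0)})"
      using hseqs_mp[OF c] by (auto simp: upolys_def)
  qed
  moreover have "finite (\<Union>f\<in>upolys b. {c \<in> hseq. pact shft f c = (\<lambda>i. 0)})"
    using \<open>finite (upolys b)\<close> by (rule finite_UN_I) (simp add: upolys_def card_hseq(1))
  ultimately show ?thesis using finite_subset by blast
qed

definition Phf :: "'a alg_closure malg fps" where
  "Phf = Abs_fps (\<lambda>b. \<Sum>c\<in>hseqs b. mel (ev (mp_seq c)))"

text \<open>A pair of a sequence with minimal polynomial d and a unitary cofactor h is the same as a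
  unitary f = d h with a Hermitian sequence annihilated by f. Each f of degree m has q^m such
  sequences.\<close>

theorem Phf_Lf: "Phf * P.Lf = scale (real q) P.Lf"
proof (rule fps_ext)
  fix m
  have finU: "finite (upolys m)" for m using bij_ev_upolys[of m] bij_betw_finite P.finite_inv by blast
  have L: "fps_nth P.Lf m = (\<Sum>f\<in>upolys m. mel (ev f))" for m
    unfolding P.Lf_def by (simp add: sum.reindex_bij_betw[OF bij_ev_upolys[of m]])
  have "fps_nth (Phf * P.Lf) m = (\<Sum>b\<le>m. \<Sum>c\<in>hseqs b. \<Sum>h\<in>upolys (m - b). mel (ev (mp_seq c) + ev h))"
    by (simp add: fps_mult_nth L Phf_def sum_product mel_add atMost_atLeast0)
  also have "\<dots> = (\<Sum>(b,c,h)\<in>(SIGMA b:{..m}. hseqs b \<times> upolys (m - b)). mel (ev (mp_seq c) + ev h))"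
    by (simp add: sum.Sigma finite_hseqs finU sum.cartesian_product)
  also have "\<dots> = (\<Sum>(f,c)\<in>(SIGMA f:upolys m. {c \<in> hseq. pact shft f c = (\<lambda>i. 0)}). mel (ev f))"
  proof (rule sum.reindex_bij_witness[where j = "\<lambda>(b,c,h). (mp_seq c * h, c)"
        and i = "\<lambda>(f,c). (degree (mp_seq c), c, f div mp_seq c)"])
    fix x assume x: "x \<in> (SIGMA b:{..m}. hseqs b \<times> upolys (m - b))"
    obtain b c h where [simp]: "x = (b, c, h)" by (cases x)
    have bch: "b \<le> m" "c \<in> hseqs b" "upoly h" "degree h = m - b" using x by (auto simp: upolys_def)
    note d = hseqs_mp[OF bch(2)]
    have md: "monic (mp_seq c)" "monic h" "mp_seq c \<noteq> 0" "h \<noteq> 0" using d(3) bch(3) by (auto simp: upoly_def)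
    have ev: "ev (mp_seq c * h) = ev (mp_seq c) + ev h" using md by (intro ev_mult)
    have up: "upoly (mp_seq c * h)"
      using d(3) bch(3) by (simp add: upoly_def ev_mult lead_coeff_mult coeff_mult_0)
    have "pact shft (mp_seq c * h) c = (\<lambda>i. 0)" using d(1) by (simp add: SH.is_mp_def)
    then show "(case x of (b, c, h) \<Rightarrow> (mp_seq c * h, c)) \<in> (SIGMA f:upolys m. {c \<in> hseq. pact shft f c = (\<lambda>i. 0)})"
      using up d md bch by (auto simp: upolys_def degree_mult_eq)
    show "(case case x of (b, c, h) \<Rightarrow> (mp_seq c * h, c) of (f, c) \<Rightarrow> (degree (mp_seq c), c, f div mp_seq c)) = x"
      using d(2) md by simp
    show "(case case x of (b, c, h) \<Rightarrow> (mp_seq c * h, c) of (f, c) \<Rightarrow> mel (ev f)) = (case x of (b, c, h) \<Rightarrow> mel (ev (mp_seq c) + ev h))"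
      using ev by simp
  next
    fix x assume x: "x \<in> (SIGMA f:upolys m. {c \<in> hseq. pact shft f c = (\<lambda>i. 0)})"
    obtain f c where [simp]: "x = (f, c)" by (cases x)
    have fc: "upoly f" "degree f = m" "c \<in> hseq" "pact shft f c = (\<lambda>i. 0)" using x by (auto simp: upolys_def)
    have fnz: "f \<noteq> 0" using fc(1) by (auto simp: upoly_def)
    obtain d where d: "SH.is_mp c d" using SH.is_mp_exists[OF fnz fc(4)] by blast
    have mp: "mp_seq c = d" using d by (rule mp_seq_eq)
    have ud: "upoly d" using fc(3) d by (rule mp_unitary)
    have "d dvd f" using d fc(4) by (simp add: SH.is_mp_def)
    then obtain h where h: "f = d * h" by (elim dvdE)
    have dnz: "d \<noteq> 0" "h \<noteq> 0" using fnz h by auto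
    have "monic h" using fc(1) ud h by (simp add: upoly_def lead_coeff_mult)
    moreover have "poly.coeff h 0 \<noteq> 0" using fc(1) h by (auto simp: upoly_def coeff_mult_0)
    moreover have "image_mset phi (ev h) = ev h"
      using fc(1) ud ev_mult[of d h] \<open>monic h\<close> by (simp add: upoly_def h)
    ultimately have "h \<in> upolys (m - degree d)" using fc(2) dnz by (auto simp: upolys_def upoly_def h degree_mult_eq)
    moreover have "degree d \<le> m" using fc(2) dnz by (auto simp: h degree_mult_eq)
    moreover have "c \<in> hseqs (degree d)" using fc(3) d by (auto simp: hseqs_def)
    moreover have "f div d = h" using h dnz by simp
    ultimately show "(case x of (f, c) \<Rightarrow> (degree (mp_seq c), c, f div mp_seq c)) \<in> (SIGMA b:{..m}. hseqs b \<times> upolys (m - b))"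
      "(case case x of (f, c) \<Rightarrow> (degree (mp_seq c), c, f div mp_seq c) of (b, c, h) \<Rightarrow> (mp_seq c * h, c)) = x"
      by (simp_all add: mp h)
  qed
  also have "\<dots> = (\<Sum>f\<in>upolys m. of_nat (card {c \<in> hseq. pact shft f c = (\<lambda>i. 0)}) * mel (ev f))"
    using finU card_hseq(1) by (subst sum.Sigma[symmetric]) (auto simp: upolys_def)
  also have "\<dots> = (\<Sum>f\<in>upolys m. cst (real q ^ m) * mel (ev f))"
  proof (rule sum.cong[OF refl])
    fix f assume "f \<in> upolys m"
    then have "card {c \<in> hseq. pact shft f c = (\<lambda>i. 0)} = q ^ m" using card_hseq(2) by (simp add: upolys_def)
    then show "of_nat (card {c \<in> hseq. pact shft f c = (\<lambda>i. 0)}) * mel (ev f) = cst (real q ^ m) * mel (ev f)"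
      by (metis cst_of_nat of_nat_power)
  qed
  also have "\<dots> = fps_nth (scale (real q) P.Lf) m" by (simp add: L sum_distrib_left)
  finally show "fps_nth (Phf * P.Lf) m = fps_nth (scale (real q) P.Lf) m" .
qed

end

section \<open>Characteristic polynomials of unitary matrices\<close>

lemma sum_lessThan_add: "(\<Sum>i<m + n. f i) = (\<Sum>i<m. f i) + (\<Sum>i<n. f (m + i))"
  for m n :: nat and f :: "nat \<Rightarrow> 'c::comm_monoid_add"
  by (induction n) (simp_all add: add_ac)

lemma mat_mult_index: "A \<in> carrier_mat n m \<Longrightarrow> B \<in> carrier_mat m l \<Longrightarrow> i < n \<Longrightarrow> j < l \<Longrightarrow>
    (A * B) $$ (i, j) = (\<Sum>k<m. A $$ (i, k) * B $$ (k, j))" for A :: "'c::semiring_0 mat"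
  by (simp add: scalar_prod_def atLeast0LessThan)

lemma det_one_mult_inverse:
  fixes A B :: "'c::field mat"
  assumes "A \<in> carrier_mat n n" "B \<in> carrier_mat n n" "A * B = 1\<^sub>m n"
  shows "det A \<noteq> 0"
  using det_mult[OF assms(1,2)] assms(3) by auto

lemma obtain_mat_inverse:
  fixes A :: "'c::field mat"
  assumes A: "A \<in> carrier_mat n n" and d: "det A \<noteq> 0"
  obtains B where "B \<in> carrier_mat n n" "A * B = 1\<^sub>m n" "B * A = 1\<^sub>m n"
proof -
  let ?B = "inverse (det A) \<cdot>\<^sub>m adj_mat A"
  have 1: "inverse (det A) \<cdot>\<^sub>m (det A \<cdot>\<^sub>m 1\<^sub>m n) = 1\<^sub>m n"
    using d by (intro eq_matI) auto
  have "A * ?B = 1\<^sub>m n" "?B * A = 1\<^sub>m n" "?B \<in> carrier_mat n n"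
    using adj_mat[OF A] 1 mult_smult_distrib[OF A adj_mat(1)[OF A]] mult_smult_assoc_mat[OF adj_mat(1)[OF A] A]
    by simp_all
  then show ?thesis using that by blast
qed

lemma kernel_imp_det_nonzero:
  fixes A :: "'c::field mat"
  assumes A: "A \<in> carrier_mat n n"
    and k: "\<And>y j. (\<And>i. i < n \<Longrightarrow> (\<Sum>k<n. A $$ (i, k) * y k) = 0) \<Longrightarrow> j < n \<Longrightarrow> y j = 0"
  shows "det A \<noteq> 0"
proof
  assume "det A = 0"
  then obtain v where v: "v \<in> carrier_vec n" "v \<noteq> 0\<^sub>v n" "A *\<^sub>v v = 0\<^sub>v n"
    using det_0_iff_vec_prod_zero_field[OF A] by blast
  have "(\<Sum>k<n. A $$ (i, k) * vec_index v k) = 0" if i: "i < n" for i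
  proof -
    have "vec_index (A *\<^sub>v v) i = (\<Sum>k<n. A $$ (i, k) * vec_index v k)"
      using A v(1) i by (simp add: scalar_prod_def atLeast0LessThan)
    then show ?thesis using v(3) i by simp
  qed
  then have "vec_index v j = 0" if "j < n" for j using k[of "vec_index v"] that by blast
  then have "v = 0\<^sub>v n" using v(1) by auto
  then show False using v(2) by simp
qed

lemma char_poly_block:
  fixes XX :: "'c::field mat"
  assumes XX: "XX \<in> carrier_mat (s + t) (s + t)"
    and z: "\<And>i j. s \<le> i \<Longrightarrow> i < s + t \<Longrightarrow> j < s \<Longrightarrow> XX $$ (i, j) = 0"
  shows "char_poly XX = char_poly (mat s s (\<lambda>(i, j). XX $$ (i, j))) * char_poly (mat t t (\<lambda>(i, j). XX $$ (s + i, s + j)))"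
proof -
  let ?A = "mat s s (\<lambda>(i, j). XX $$ (i, j))" and ?B = "mat t t (\<lambda>(i, j). XX $$ (s + i, s + j))"
  let ?E = "mat s t (\<lambda>(i, j). [: - XX $$ (i, s + j) :])"
  have "char_poly_matrix XX = four_block_mat (char_poly_matrix ?A) ?E (0\<^sub>m t s) (char_poly_matrix ?B)"
    using XX z by (intro eq_matI) (auto simp: char_poly_matrix_def four_block_mat_def Let_def)
  then have "det (char_poly_matrix XX) = det (char_poly_matrix ?A) * det (char_poly_matrix ?B)"
    by (simp only:, intro det_four_block_mat_lower_left_zero) auto
  then show ?thesis by (simp add: char_poly_def)
qed

definition comp_mat :: "'c::comm_ring_1 poly \<Rightarrow> 'c mat" where
  "comp_mat f = mat (degree f) (degree f) (\<lambda>(i, j). (if i = Suc j then 1 else 0) -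
     (if Suc j = degree f then poly.coeff f i else 0))"

lemma comp_mat_carrier [simp]: "comp_mat f \<in> carrier_mat (degree f) (degree f)"
  by (simp add: comp_mat_def)

text \<open>Row operations: replacing the first row of \<open>x I - C\<close> by its combination with weights
  \<open>1, x, x\<^sup>2, \<dots>\<close> leaves only the last entry of that row, namely \<open>f\<close>.\<close>

lemma char_poly_comp_mat:
  fixes f :: "'c::field poly"
  assumes f: "monic f"
  shows "char_poly (comp_mat f) = f"
proof (cases "degree f")
  case 0
  then have "f = 1" using f by (metis monic_degree_0)
  moreover have "comp_mat f \<in> carrier_mat 0 0" using comp_mat_carrier[of f] 0 by simp
  ultimately show ?thesis by (simp add: char_poly_def)
next
  case (Suc m)
  let ?n = "Suc m"
  let ?x = "[:0, 1:] :: 'c poly"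
  let ?M = "char_poly_matrix (comp_mat f)"
  have M: "?M \<in> carrier_mat ?n ?n" using comp_mat_carrier[of f] Suc by simp
  have Mij: "?M $$ (i, j) = (if i = j then ?x else 0) - (if i = Suc j then 1 else 0) + (if j = m then [:poly.coeff f i:] else 0)"
    if "i < ?n" "j < ?n" for i j
    using that Suc by (auto simp: char_poly_matrix_def comp_mat_def one_pCons)
  define W where "W = mat ?n ?n (\<lambda>(i, j). if i = 0 then ?x ^ j else if i = j then 1 else 0)"
  have W: "W \<in> carrier_mat ?n ?n" by (simp add: W_def)
  have "det W = prod_list (diag_mat W)"
    by (rule det_upper_triangular[OF _ W]) (auto simp: W_def upper_triangular_def)
  also have "\<dots> = 1" by (rule prod_list_neutral) (auto simp: diag_mat_def W_def)
  finally have detW: "det W = 1" .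
  have row0: "(W * ?M) $$ (0, j) = (if j = m then f else 0)" if j: "j < ?n" for j
  proof -
    have "(W * ?M) $$ (0, j) = (\<Sum>k<?n. W $$ (0, k) * ?M $$ (k, j))"
      using j by (intro mat_mult_index[OF W M]) auto
    also have "\<dots> = (\<Sum>k<?n. ?x ^ k * ((if k = j then ?x else 0) - (if k = Suc j then 1 else 0) + (if j = m then [:poly.coeff f k:] else 0)))"
      using j by (intro sum.cong) (auto simp: Mij W_def)
    also have "\<dots> = (\<Sum>k<?n. if k = j then ?x ^ Suc j else 0) - (\<Sum>k<?n. if k = Suc j then ?x ^ Suc j else 0)
         + (if j = m then \<Sum>k<?n. ?x ^ k * [:poly.coeff f k:] else 0)"
      unfolding sum_subtractf[symmetric]
      by (subst sum.distrib[symmetric] | auto simp: algebra_simps intro!: sum.cong)+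
    also have "\<dots> = (if j = m then ?x ^ ?n + (\<Sum>k<?n. ?x ^ k * [:poly.coeff f k:]) else 0)"
      using j by auto
    also have "?x ^ ?n + (\<Sum>k<?n. ?x ^ k * [:poly.coeff f k:]) = (\<Sum>k\<le>?n. Polynomial.monom (poly.coeff f k) k)"
      using f Suc by (simp add: monom_altdef flip: lessThan_Suc_atMost)
    also have "\<dots> = f" using poly_as_sum_of_monoms[of f] Suc by simp
    finally show ?thesis .
  qed
  have rowi: "(W * ?M) $$ (i, j) = ?M $$ (i, j)" if "i < ?n" "j < ?n" "i > 0" for i j
  proof -
    have "(W * ?M) $$ (i, j) = (\<Sum>k<?n. W $$ (i, k) * ?M $$ (k, j))"
      using that by (intro mat_mult_index[OF W M]) auto
    also have "\<dots> = (\<Sum>k<?n. if k = i then ?M $$ (k, j) else 0)"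
      using that by (intro sum.cong) (auto simp: W_def)
    finally show ?thesis using that by simp
  qed
  have WM: "W * ?M \<in> carrier_mat ?n ?n" using W M by simp
  let ?D = "mat_delete (W * ?M) 0 m"
  have D: "?D \<in> carrier_mat m m" using mat_delete_carrier[OF WM, of 0 m] by simp
  have Dij: "?D $$ (i, j) = ?M $$ (Suc i, j)" if "i < m" "j < m" for i j
    using that W M rowi[of "Suc i" j] by (simp add: mat_delete_def)
  have "det ?D = prod_list (diag_mat ?D)"
    by (rule det_upper_triangular[OF _ D]) (use D in \<open>auto simp: upper_triangular_def Dij Mij\<close>)
  also have "diag_mat ?D = map (\<lambda>i. -1) [0..<m]"
    using D by (auto simp: diag_mat_def Dij Mij)
  also have "prod_list \<dots> = (-1) ^ m" by (simp add: map_replicate_const)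
  finally have detD: "det ?D = (-1) ^ m" .
  have "det ?M = det (W * ?M)" using det_mult[OF W M] detW by simp
  also have "\<dots> = (\<Sum>j<?n. (W * ?M) $$ (0, j) * cofactor (W * ?M) 0 j)"
    by (rule laplace_expansion_row[OF WM]) simp
  also have "\<dots> = (\<Sum>j<?n. if j = m then f * cofactor (W * ?M) 0 m else 0)"
    by (rule sum.cong) (auto simp: row0)
  also have "\<dots> = f * cofactor (W * ?M) 0 m" by simp
  also have "\<dots> = f" by (simp add: cofactor_def detD flip: power_add mult_2)
  finally show ?thesis by (simp add: char_poly_def)
qed

text \<open>For s nonzero, X (s - Y) = -s (1/s - X). Taking determinants yields the identity at
  infinitely many points; this is why the finite field has to be replaced by its closure before
  applying it.\<close>

lemma char_poly_inverse:
  fixes XX :: "'c::field mat"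
  assumes XX: "XX \<in> carrier_mat n n" and Y: "Y \<in> carrier_mat n n" and XY: "XX * Y = 1\<^sub>m n"
    and inf: "infinite (UNIV :: 'c set)"
  shows "smult (det XX) (char_poly Y) = smult ((-1) ^ n) (reflect_poly (char_poly XX))"
proof -
  have deg: "degree (char_poly XX) = n" using degree_monic_char_poly[OF XX] by simp
  have pc: "poly (char_poly Z) s = det (s \<cdot>\<^sub>m 1\<^sub>m n - Z)" if Z: "Z \<in> carrier_mat n n" for Z and s :: 'c
    unfolding char_poly_def
    by (rule poly_det_cong[of _ n]) (use Z in \<open>auto simp: char_poly_matrix_def\<close>)
  have "poly (smult (det XX) (char_poly Y) - smult ((-1) ^ n) (reflect_poly (char_poly XX))) s = 0" if s: "s \<noteq> 0" for s
  proof -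
    have "det XX * poly (char_poly Y) s = det (XX * (s \<cdot>\<^sub>m 1\<^sub>m n - Y))"
      using XX Y det_mult[OF XX, of "s \<cdot>\<^sub>m 1\<^sub>m n - Y"] minus_carrier_mat[OF Y, of "s \<cdot>\<^sub>m 1\<^sub>m n"] by (simp add: pc)
    also have "XX * (s \<cdot>\<^sub>m 1\<^sub>m n - Y) = (- s) \<cdot>\<^sub>m (inverse s \<cdot>\<^sub>m 1\<^sub>m n - XX)"
    proof -
      have "XX * (s \<cdot>\<^sub>m 1\<^sub>m n - Y) = XX * (s \<cdot>\<^sub>m 1\<^sub>m n) - XX * Y"
        using XX Y by (intro mult_minus_distrib_mat) auto
      also have "\<dots> = s \<cdot>\<^sub>m XX - 1\<^sub>m n" using XX XY mult_smult_distrib[OF XX, of "1\<^sub>m n" n s] by simp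
      also have "\<dots> = (- s) \<cdot>\<^sub>m (inverse s \<cdot>\<^sub>m 1\<^sub>m n - XX)" using XX s by (intro eq_matI) (auto simp: algebra_simps)
      finally show ?thesis .
    qed
    also have "det \<dots> = (- s) ^ n * poly (char_poly XX) (inverse s)" using XX by (simp add: pc)
    also have "\<dots> = (-1) ^ n * poly (reflect_poly (char_poly XX)) s"
      using s by (simp add: poly_reflect_poly_nz deg power_minus[of s])
    finally show ?thesis by simp
  qed
  moreover have "infinite (- {0 :: 'c})" using inf by (simp add: Compl_eq_Diff_UNIV)
  ultimately have "infinite {s. poly (smult (det XX) (char_poly Y) - smult ((-1) ^ n) (reflect_poly (char_poly XX))) s = 0}"
    by (elim infinite_super[rotated]) auto
  then have "smult (det XX) (char_poly Y) - smult ((-1) ^ n) (reflect_poly (char_poly XX)) = 0"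
    using poly_roots_finite by blast
  then show ?thesis by simp
qed

context ff_setup
begin

section \<open>The unitary group and its eigenvalues\<close>

definition adj :: "'a mat \<Rightarrow> 'a mat" where
  "adj M = mat (dim_col M) (dim_row M) (\<lambda>(i, j). M $$ (j, i) ^ q)"

lemma adj_carrier [simp]: "M \<in> carrier_mat m n \<Longrightarrow> adj M \<in> carrier_mat n m"
  by (auto simp: adj_def)

lemma adj_index: "M \<in> carrier_mat m n \<Longrightarrow> i < n \<Longrightarrow> j < m \<Longrightarrow> adj M $$ (i, j) = M $$ (j, i) ^ q"
  by (auto simp: adj_def)

lemma adj_adj: "adj (adj M) = M"
  by (rule eq_matI) (simp_all add: adj_def cj_cj)

lemma adj_one: "adj (1\<^sub>m n) = 1\<^sub>m n"
  using q_gt1 by (intro eq_matI) (simp_all add: adj_def)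

lemma adj_mult: assumes "A \<in> carrier_mat n m" "B \<in> carrier_mat m l" shows "adj (A * B) = adj B * adj A"
proof (rule eq_matI)
  fix i j assume "i < dim_row (adj B * adj A)" "j < dim_col (adj B * adj A)"
  then have ij: "i < l" "j < n" using assms by (simp_all add: adj_def)
  have AB: "A * B \<in> carrier_mat n l" using assms by simp
  have "adj (A * B) $$ (i, j) = (\<Sum>k<m. A $$ (j, k) * B $$ (k, i)) ^ q"
    using ij by (simp only: adj_index[OF AB] mat_mult_index[OF assms])
  also have "\<dots> = (\<Sum>k<m. adj B $$ (i, k) * adj A $$ (k, j))"
    using ij assms by (simp add: cj_sum power_mult_distrib adj_index mult.commute)
  also have "\<dots> = (adj B * adj A) $$ (i, j)" using assms ij by (subst mat_mult_index[of _ l m _ n]) auto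
  finally show "adj (A * B) $$ (i, j) = (adj B * adj A) $$ (i, j)" .
qed (use assms in \<open>auto simp: adj_def\<close>)

lemma det_adj: assumes A: "A \<in> carrier_mat n n" shows "det (adj A) = det A ^ q"
proof -
  interpret h: comm_ring_hom "\<lambda>x :: 'a. x ^ q"
    by unfold_locales (use q_gt1 in \<open>simp_all add: cj_add power_mult_distrib\<close>)
  have "adj A = map_mat (\<lambda>x. x ^ q) (A\<^sup>T)" using A by (intro eq_matI) (auto simp: adj_def)
  then show ?thesis using h.hom_det[of "A\<^sup>T"] det_transpose[OF A] by simp
qed

definition UG :: "nat \<Rightarrow> 'a mat set" where "UG n = {g \<in> carrier_mat n n. adj g * g = 1\<^sub>m n}"

lemma Un_D: "g \<in> UG n \<Longrightarrow> g \<in> carrier_mat n n" "g \<in> UG n \<Longrightarrow> adj g * g = 1\<^sub>m n" "g \<in> UG n \<Longrightarrow> g * adj g = 1\<^sub>m n"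
  using mat_mult_left_right_inverse[of "adj g" n g] by (auto simp: UG_def)

lemma Un_one: "1\<^sub>m n \<in> UG n" by (simp add: UG_def adj_one)

lemma Un_mult: assumes "g \<in> UG n" "h \<in> UG n" shows "g * h \<in> UG n"
proof -
  note c = Un_D(1)[OF assms(1)] Un_D(1)[OF assms(2)]
  have "adj (g * h) * (g * h) = adj h * (adj g * (g * h))"
    using c by (simp add: adj_mult[OF c] assoc_mult_mat[of _ n n _ n _ n])
  also have "adj g * (g * h) = (adj g * g) * h" using c by (simp add: assoc_mult_mat[of _ n n _ n _ n])
  also have "\<dots> = h" using c Un_D(2)[OF assms(1)] by simp
  finally show ?thesis using c assms by (simp add: UG_def)
qed

lemma Un_adj: "g \<in> UG n \<Longrightarrow> adj g \<in> UG n"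
  using Un_D(1,3)[of g n] by (simp add: UG_def adj_adj)

lemma finite_Un: "finite (UG n)"
proof -
  have "UG n \<subseteq> (\<lambda>f. mat n n (\<lambda>(i, j). f (i, j))) ` (PiE ({..<n} \<times> {..<n}) (\<lambda>_. UNIV))"
  proof
    fix g assume "g \<in> UG n"
    then have "g \<in> carrier_mat n n" by (rule Un_D)
    then have "g = mat n n (\<lambda>(i, j). restrict (\<lambda>ij. g $$ ij) ({..<n} \<times> {..<n}) (i, j))" by (intro eq_matI) auto
    then show "g \<in> (\<lambda>f. mat n n (\<lambda>(i, j). f (i, j))) ` (PiE ({..<n} \<times> {..<n}) (\<lambda>_. UNIV))"
      by (rule image_eqI[where x = "restrict (\<lambda>ij. g $$ ij) ({..<n} \<times> {..<n})"]) auto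
  qed
  then show ?thesis by (rule finite_subset) (auto intro!: finite_PiE)
qed

lemma card_Un_pos: "card (UG n) > 0"
  using finite_Un Un_one by (auto simp: card_gt_0_iff)

lemma monic_char_poly: "A \<in> carrier_mat n n \<Longrightarrow> monic (char_poly A)" for A :: "'a mat"
  using degree_monic_char_poly[of A n] by simp

lemma coeff_0_char_poly:
  fixes A :: "'a mat"
  assumes A: "A \<in> carrier_mat n n"
  shows "poly.coeff (char_poly A) 0 = (-1) ^ n * det A"
proof -
  have "poly (char_poly A) 0 = det ((-1) \<cdot>\<^sub>m A)"
    unfolding char_poly_def by (rule poly_det_cong[of _ n]) (use A in \<open>auto simp: char_poly_matrix_def\<close>)
  then show ?thesis using A by (simp add: poly_0_coeff_0)
qed

lemma infinite_alg_closure: "infinite (UNIV :: 'a alg_closure set)"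
proof
  assume fin: "finite (UNIV :: 'a alg_closure set)"
  let ?\<nu> = "mset_set (UNIV :: 'a alg_closure set)"
  let ?p = "pol ?\<nu> + 1"
  have pos: "degree (pol ?\<nu>) > 0" using fin by (simp add: degree_pol finite_UNIV_card_ge_0)
  then have deg: "degree ?p = degree (pol ?\<nu>)" by (intro degree_add_eq_left) simp
  then have "monic ?p" using pos monic_pol[of ?\<nu>] by (simp only: coeff_add deg) simp
  then have "size (proots ?p) > 0" using pos deg by (simp add: size_proots_ac)
  then obtain x where "x \<in># proots ?p" by fastforce
  moreover have "?p \<noteq> 0" using \<open>monic ?p\<close> leading_coeff_0_iff by fastforce
  ultimately have "poly ?p x = 0" by simp
  moreover have "poly (pol ?\<nu>) x = 0"
  proof -
    have "x \<in># proots (pol ?\<nu>)" using fin by simp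
    then show ?thesis using pol_nz by (simp del: proots_pol)
  qed
  ultimately show False by simp
qed

text \<open>\<open>Y\<close> is the inverse of the conjugate transpose of \<open>XX\<close>. Stated
  for a pair so that it covers both a unitary matrix, where the two coincide, and the block acting
  on the space dual to a radical.\<close>

lemma ev_inverse_adj:
  assumes XX: "XX \<in> carrier_mat n n" and Y: "Y \<in> carrier_mat n n" and XY: "adj XX * Y = 1\<^sub>m n"
  shows "ev (char_poly Y) = image_mset phi (ev (char_poly XX))"
proof -
  interpret t: comm_ring_hom "to_ac :: 'a \<Rightarrow> 'a alg_closure" by (rule to_ac_hom)
  interpret h: comm_ring_hom "\<lambda>x :: 'a. x ^ q"
    by unfold_locales (use q_gt1 in \<open>simp_all add: cj_add power_mult_distrib\<close>)
  interpret tp: map_poly_comm_ring_hom "to_ac :: 'a \<Rightarrow> 'a alg_closure" ..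
  have aX: "adj XX \<in> carrier_mat n n" using XX by simp
  have d0: "det (adj XX) \<noteq> 0" using det_one_mult_inverse[OF aX Y XY] .
  then have dX: "det XX \<noteq> 0" using det_adj[OF XX] q_gt1 by auto
  have cX: "poly.coeff (char_poly XX) 0 \<noteq> 0" using coeff_0_char_poly[OF XX] dX by simp
  have "char_poly (adj XX) = char_poly (map_mat (\<lambda>x. x ^ q) (XX\<^sup>T))"
    using XX by (intro arg_cong[of _ _ char_poly] eq_matI) (auto simp: adj_def)
  also have "\<dots> = map_poly (\<lambda>x. x ^ q) (char_poly XX)"
    using XX by (subst h.char_poly_hom[of _ n]) auto
  finally have cadj: "char_poly (adj XX) = map_poly (\<lambda>x. x ^ q) (char_poly XX)" .
  have mr: "reflect_poly (map_poly to_ac f) = map_poly to_ac (reflect_poly f)" for f :: "'a poly"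
    by (rule poly_eqI) (simp add: coeff_reflect_poly coeff_map_poly)
  let ?XX = "map_mat to_ac (adj XX)" and ?Y = "map_mat to_ac Y"
  have "smult (det ?XX) (char_poly ?Y) = smult ((-1) ^ n) (reflect_poly (char_poly ?XX))"
  proof (rule char_poly_inverse)
    show "?XX * ?Y = 1\<^sub>m n" using t.mat_hom_mult[OF aX Y] t.mat_hom_one[of n] XY by simp
    show "infinite (UNIV :: 'a alg_closure set)" by (rule infinite_alg_closure)
  qed (use aX Y in auto)
  then have e: "smult (to_ac (det (adj XX))) (map_poly to_ac (char_poly Y)) =
     smult ((-1) ^ n) (map_poly to_ac (reflect_poly (map_poly (\<lambda>x. x ^ q) (char_poly XX))))"
    by (simp add: t.hom_det t.char_poly_hom[OF aX] t.char_poly_hom[OF Y] cadj mr)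
  also have "\<dots> = smult ((-1) ^ n * to_ac (poly.coeff (char_poly XX) 0 ^ q)) (pol (image_mset phi (ev (char_poly XX))))"
    using reflect_conj[OF monic_char_poly[OF XX] cX] by simp
  finally have e: "smult (to_ac (det (adj XX))) (pol (ev (char_poly Y))) =
    smult ((-1) ^ n * to_ac (poly.coeff (char_poly XX) 0 ^ q)) (pol (image_mset phi (ev (char_poly XX))))" (is "smult ?u _ = smult ?w _")
    by (simp add: pol_ev[OF monic_char_poly[OF Y]])
  have m: "monic (pol \<nu>)" for \<nu> :: "'a alg_closure multiset" by (rule monic_pol)
  have "?u \<noteq> 0" using d0 by simp
  have "lead_coeff (smult ?u (pol (ev (char_poly Y)))) = ?u" "lead_coeff (smult ?w (pol (image_mset phi (ev (char_poly XX))))) = ?w"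
    by (simp_all only: lead_coeff_smult m mult_1_right)
  then have "?u = ?w" using e by metis
  then have "smult (inverse ?u) (smult ?u (pol (ev (char_poly Y)))) = smult (inverse ?u) (smult ?u (pol (image_mset phi (ev (char_poly XX)))))"
    using e by metis
  then have "pol (ev (char_poly Y)) = pol (image_mset phi (ev (char_poly XX)))"
    by (simp only: smult_smult left_inverse[OF \<open>?u \<noteq> 0\<close>] smult_1_left)
  then show ?thesis by (metis proots_pol)
qed

lemma ev_Un: assumes "g \<in> UG n" shows "ev (char_poly g) \<in> inv_msets (-{0}) phi n"
proof -
  have "adj g * g = 1\<^sub>m n" "g \<in> carrier_mat n n" using assms by (rule Un_D)+
  then have 1: "image_mset phi (ev (char_poly g)) = ev (char_poly g)" using ev_inverse_adj[of g n g] by simp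
  have "adj g * g = 1\<^sub>m n" "g \<in> carrier_mat n n" using assms by (rule Un_D)+
  then have "det g \<noteq> 0" using det_one_mult_inverse[of g n "adj g"] Un_D(3)[OF assms] by simp
  then have "poly.coeff (char_poly g) 0 \<noteq> 0" using coeff_0_char_poly[OF Un_D(1)[OF assms]] by simp
  then have "char_poly g \<in> upolys n"
    using 1 degree_monic_char_poly[OF Un_D(1)[OF assms]] by (simp add: upolys_def upoly_def)
  then show ?thesis using bij_betw_apply[OF bij_ev_upolys] by blast
qed

end

section \<open>Averages over block matrices\<close>

lemma delta_sum': "j < n \<Longrightarrow> (\<Sum>k<n. (if k = j then 1 else 0) * f k) = f j"
  "j < n \<Longrightarrow> (\<Sum>k<n. (if j = k then 1 else 0) * f k) = f j"
  for n :: nat and f :: "nat \<Rightarrow> 'c::comm_ring_1"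
  by (simp_all add: if_distrib[of "\<lambda>x. x * _"] cong: if_cong)

lemma det_nonzero_kernel:
  fixes A :: "'c::field mat"
  assumes A: "A \<in> carrier_mat n n" and d: "det A \<noteq> 0"
    and z: "\<And>i. i < n \<Longrightarrow> (\<Sum>k<n. A $$ (i, k) * y k) = 0" and j: "j < n"
  shows "y j = 0"
proof -
  obtain B where B: "B \<in> carrier_mat n n" "B * A = 1\<^sub>m n" using obtain_mat_inverse[OF A d] by metis
  have "y j = (\<Sum>k<n. (if j = k then 1 else 0) * y k)" by (rule delta_sum'(2)[OF j, symmetric])
  also have "\<dots> = (\<Sum>k<n. (B * A) $$ (j, k) * y k)" using j B(2) by (intro sum.cong) auto
  also have "\<dots> = (\<Sum>k<n. \<Sum>i<n. B $$ (j, i) * A $$ (i, k) * y k)"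
    using j by (intro sum.cong refl) (simp add: mat_mult_index[OF B(1) A] sum_distrib_right del: index_mult_mat)
  also have "\<dots> = (\<Sum>i<n. B $$ (j, i) * (\<Sum>k<n. A $$ (i, k) * y k))"
    by (subst sum.swap) (simp add: sum_distrib_left mult.assoc)
  also have "\<dots> = 0" using z by simp
  finally show ?thesis .
qed

lemma sum_four: "(\<Sum>u<a + b + m + c. f u) = (\<Sum>u<a. f u) + (\<Sum>u<b. f (a + u)) + (\<Sum>u<m. f (a + b + u)) + (\<Sum>u<c. f (a + b + m + u))"
  for a b m c :: nat and f :: "nat \<Rightarrow> 'c::comm_monoid_add"
  by (simp add: sum_lessThan_add)

text \<open>Gram matrix of a basis adapted to a subspace of dimension \<open>a + b\<close> with
  radical of dimension \<open>a\<close>: the radical is paired with the last \<open>a\<close>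
  vectors, \<open>T\<close> is the form on a complement of the radical in the subspace, and the
  \<open>m\<close> remaining vectors are orthonormal.\<close>

definition Jm :: "nat \<Rightarrow> nat \<Rightarrow> nat \<Rightarrow> 'c mat \<Rightarrow> 'c::comm_ring_1 mat" where
  "Jm a b m T = mat (a + b + m + a) (a + b + m + a) (\<lambda>(i, j).
     if i < a then (if j = a + b + m + i then 1 else 0)
     else if i < a + b then (if a \<le> j \<and> j < a + b then T $$ (i - a, j - a) else 0)
     else if i < a + b + m then (if i = j then 1 else 0)
     else (if i = a + b + m + j then 1 else 0))"

lemma Jm_carrier [simp]: "Jm a b m T \<in> carrier_mat (a + b + m + a) (a + b + m + a)"
  by (simp add: Jm_def)

lemma Jm_row:
  "u < a \<Longrightarrow> (\<Sum>v<a + b + m + a. Jm a b m T $$ (u, v) * y v) = y (a + b + m + u)"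
  "u < b \<Longrightarrow> (\<Sum>v<a + b + m + a. Jm a b m T $$ (a + u, v) * y v) = (\<Sum>l<b. T $$ (u, l) * y (a + l))"
  "u < m \<Longrightarrow> (\<Sum>v<a + b + m + a. Jm a b m T $$ (a + b + u, v) * y v) = y (a + b + u)"
  "u < a \<Longrightarrow> (\<Sum>v<a + b + m + a. Jm a b m T $$ (a + b + m + u, v) * y v) = y u"
proof -
  assume u: "u < a"
  have "(\<Sum>v<a + b + m + a. Jm a b m T $$ (u, v) * y v) = (\<Sum>v<a + b + m + a. (if v = a + b + m + u then 1 else 0) * y v)"
    using u by (intro sum.cong) (auto simp: Jm_def)
  also have "\<dots> = y (a + b + m + u)" by (rule delta_sum') (use u in simp)
  finally show "(\<Sum>v<a + b + m + a. Jm a b m T $$ (u, v) * y v) = y (a + b + m + u)" .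
next
  assume u: "u < b"
  have "(\<Sum>v<a + b + m + a. Jm a b m T $$ (a + u, v) * y v) =
     (\<Sum>v<a. 0) + (\<Sum>l<b. T $$ (u, l) * y (a + l)) + (\<Sum>v<m. 0) + (\<Sum>v<a. 0)"
    unfolding sum_four
    by (intro arg_cong2[of _ _ _ _ "(+)"] sum.cong) (use u in \<open>auto simp: Jm_def\<close>)
  then show "(\<Sum>v<a + b + m + a. Jm a b m T $$ (a + u, v) * y v) = (\<Sum>l<b. T $$ (u, l) * y (a + l))" by simp
next
  assume u: "u < m"
  have "(\<Sum>v<a + b + m + a. Jm a b m T $$ (a + b + u, v) * y v) = (\<Sum>v<a + b + m + a. (if v = a + b + u then 1 else 0) * y v)"
    using u by (intro sum.cong) (auto simp: Jm_def)
  also have "\<dots> = y (a + b + u)" by (rule delta_sum') (use u in simp)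
  finally show "(\<Sum>v<a + b + m + a. Jm a b m T $$ (a + b + u, v) * y v) = y (a + b + u)" .
next
  assume u: "u < a"
  have "(\<Sum>v<a + b + m + a. Jm a b m T $$ (a + b + m + u, v) * y v) = (\<Sum>v<a + b + m + a. (if v = u then 1 else 0) * y v)"
    using u by (intro sum.cong) (auto simp: Jm_def)
  also have "\<dots> = y u" by (rule delta_sum') (use u in simp)
  finally show "(\<Sum>v<a + b + m + a. Jm a b m T $$ (a + b + m + u, v) * y v) = y u" .
qed

context ff_setup
begin

lemma Jm_form:
  fixes a b m :: nat
  defines "n \<equiv> a + b + m + a"
  assumes XX: "XX \<in> carrier_mat n l" and ij: "i < l" "j < l"
  shows "(adj XX * (Jm a b m T * XX)) $$ (i, j) =
     (\<Sum>u<a. XX $$ (u, i) ^ q * XX $$ (a + b + m + u, j))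
   + (\<Sum>u<b. XX $$ (a + u, i) ^ q * (\<Sum>k<b. T $$ (u, k) * XX $$ (a + k, j)))
   + (\<Sum>u<m. XX $$ (a + b + u, i) ^ q * XX $$ (a + b + u, j))
   + (\<Sum>u<a. XX $$ (a + b + m + u, i) ^ q * XX $$ (u, j))"
proof -
  have J: "Jm a b m T \<in> carrier_mat n n" by (simp add: n_def)
  have JX: "Jm a b m T * XX \<in> carrier_mat n l" using J XX by simp
  define g where "g u = (\<Sum>v<n. Jm a b m T $$ (u, v) * XX $$ (v, j))" for u
  have "(adj XX * (Jm a b m T * XX)) $$ (i, j) = (\<Sum>u<n. XX $$ (u, i) ^ q * g u)"
    using ij XX by (subst mat_mult_index[OF adj_carrier[OF XX] JX]) (auto simp: g_def adj_index[OF XX] mat_mult_index[OF J XX] simp del: index_mult_mat intro!: sum.cong)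
  also have "\<dots> = (\<Sum>u<a. XX $$ (u, i) ^ q * g u) + (\<Sum>u<b. XX $$ (a + u, i) ^ q * g (a + u))
    + (\<Sum>u<m. XX $$ (a + b + u, i) ^ q * g (a + b + u)) + (\<Sum>u<a. XX $$ (a + b + m + u, i) ^ q * g (a + b + m + u))"
    unfolding n_def by (rule sum_four)
  finally have e: "(adj XX * (Jm a b m T * XX)) $$ (i, j) = (\<Sum>u<a. XX $$ (u, i) ^ q * g u) + (\<Sum>u<b. XX $$ (a + u, i) ^ q * g (a + u))
    + (\<Sum>u<m. XX $$ (a + b + u, i) ^ q * g (a + b + u)) + (\<Sum>u<a. XX $$ (a + b + m + u, i) ^ q * g (a + b + m + u))" .
  have gv: "u < a \<Longrightarrow> g u = XX $$ (a + b + m + u, j)" "u < b \<Longrightarrow> g (a + u) = (\<Sum>k<b. T $$ (u, k) * XX $$ (a + k, j))"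
    "u < m \<Longrightarrow> g (a + b + u) = XX $$ (a + b + u, j)" "u < a \<Longrightarrow> g (a + b + m + u) = XX $$ (u, j)" for u
    unfolding g_def n_def by (erule Jm_row)+
  show ?thesis unfolding e by (intro arg_cong2[of _ _ _ _ "(+)"] sum.cong refl) (simp_all add: gv)
qed

lemma form_mult:
  assumes A: "A \<in> carrier_mat n n" and B: "B \<in> carrier_mat n n" and J: "J \<in> carrier_mat n n"
  shows "adj (A * B) * (J * (A * B)) = adj B * ((adj A * (J * A)) * B)"
proof -
  have 1: "J * (A * B) = (J * A) * B" using J A B by (rule assoc_mult_mat[symmetric])
  have 2: "adj A * ((J * A) * B) = (adj A * (J * A)) * B"
    using A B J by (intro assoc_mult_mat[symmetric, of _ n n _ n _ n]) auto
  have "adj (A * B) * (J * (A * B)) = (adj B * adj A) * ((J * A) * B)" unfolding 1 adj_mult[OF A B] ..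
  also have "\<dots> = adj B * (adj A * ((J * A) * B))" using A B J by (intro assoc_mult_mat[of _ n n _ n _ n]) auto
  finally show ?thesis unfolding 2 .
qed

text \<open>Invariance of the form forces elements of \<open>G\<close> to be block upper triangular
  with diagonal blocks C1, C2, P, R, where P is unitary of size \<open>m\<close> and
  \<open>adj C1 * R = 1\<close>. So only P is left to vary among the eigenvalues. Right
  multiplication by an isometry acting on the middle block permutes \<open>G\<close> and multiplies
  P, so P is uniformly distributed in \<open>UG m\<close>.\<close>

lemma block_average:
  fixes a b m :: nat and C1 C2 T C :: "'a mat"
  defines "n \<equiv> a + b + m + a"
  defines "G \<equiv> {XX \<in> carrier_mat n n. adj XX * (Jm a b m T * XX) = Jm a b m T \<and>
     (\<forall>i<n. \<forall>j<a + b. XX $$ (i, j) = (if i < a + b then C $$ (i, j) else 0))}"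
  assumes C1: "C1 \<in> carrier_mat a a" "det C1 \<noteq> 0" and C2: "C2 \<in> carrier_mat b b" "det C2 \<noteq> 0"
    and T: "T \<in> carrier_mat b b" "det T \<noteq> 0"
    and C: "\<And>i j. i < a \<Longrightarrow> j < a \<Longrightarrow> C $$ (i, j) = C1 $$ (i, j)"
      "\<And>i j. i < b \<Longrightarrow> j < a \<Longrightarrow> C $$ (a + i, j) = 0"
      "\<And>i j. i < b \<Longrightarrow> j < b \<Longrightarrow> C $$ (a + i, a + j) = C2 $$ (i, j)"
  shows "finite G"
    "of_nat (card (UG m)) * (\<Sum>XX\<in>G. mel (ev (char_poly XX))) =
     of_nat (card G) * (mel (ev (char_poly C1) + image_mset phi (ev (char_poly C1)) + ev (char_poly C2)) * (\<Sum>P\<in>UG m. mel (ev (char_poly P))))"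
proof -
  let ?J = "Jm a b m T"
  have J: "?J \<in> carrier_mat n n" by (simp add: n_def)
  have aC1: "adj C1 \<in> carrier_mat a a" "det (adj C1) \<noteq> 0" using C1 q_gt1 by (simp_all add: det_adj)
  have aC2: "adj C2 \<in> carrier_mat b b" "det (adj C2) \<noteq> 0" using C2 q_gt1 by (simp_all add: det_adj)
  have Jv: "?J $$ (i, j) = (if j = a + b + m + i then 1 else 0)" if "i < a" "j < n" for i j
    using that by (simp add: Jm_def n_def)
  have Jf: "?J $$ (a + i, a + b + l) = 0" if "i < b" "l < m" for i l
    using that by (simp add: Jm_def)
  have Jw: "?J $$ (a + b + i, a + b + l) = (if i = l then 1 else 0)" if "i < m" "l < m" for i l
    using that by (simp add: Jm_def)
  define PP where "PP XX = mat m m (\<lambda>(i, j). XX $$ (a + b + i, a + b + j))" for XX :: "'a mat"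
  have PPc: "PP XX \<in> carrier_mat m m" for XX by (simp add: PP_def)
  have PPi: "PP XX $$ (i, j) = XX $$ (a + b + i, a + b + j)" if "i < m" "j < m" for XX i j using that by (simp add: PP_def)
  have main: "PP XX \<in> UG m \<and> char_poly XX = char_poly C1 * (char_poly C2 * (char_poly (PP XX) * char_poly (mat a a (\<lambda>(i, j). XX $$ (a + b + m + i, a + b + m + j)))))
     \<and> adj C1 * mat a a (\<lambda>(i, j). XX $$ (a + b + m + i, a + b + m + j)) = 1\<^sub>m a" if XX: "XX \<in> G" for XX
  proof -
    have c: "XX \<in> carrier_mat n n" "adj XX * (?J * XX) = ?J" using XX by (auto simp: G_def)
    have col: "XX $$ (i, j) = (if i < a + b then C $$ (i, j) else 0)" if "i < n" "j < a + b" for i j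
      using XX that by (auto simp: G_def)
    note form = Jm_form[OF c(1)[unfolded n_def], of _ _ T, folded n_def, unfolded c(2)]
    \<comment> \<open>Column i < a of \<open>XX\<close> contains nothing but the entries of
      \<open>C1\<close>, so of the form only the pairing of the radical with the last block
      survives.\<close>
    have e1: "?J $$ (i, j) = (\<Sum>u<a. adj C1 $$ (i, u) * XX $$ (a + b + m + u, j))" if "i < a" "j < n" for i j
      using that by (subst form) (auto simp: n_def col C adj_index[OF C1(1)] cj_0 intro!: sum.neutral)
    have ez: "XX $$ (a + b + m + k, j) = 0" if "j < a + b + m" "k < a" for j k
    proof (rule det_nonzero_kernel[OF aC1, where y = "\<lambda>k. XX $$ (a + b + m + k, j)"])
      show "(\<Sum>u<a. adj C1 $$ (i, u) * XX $$ (a + b + m + u, j)) = 0" if "i < a" for i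
        using that \<open>j < a + b + m\<close> by (subst e1[symmetric]) (auto simp: Jv n_def)
    qed (use that in auto)
    have e2: "?J $$ (a + i, j) = (\<Sum>u<b. adj C2 $$ (i, u) * (\<Sum>k<b. T $$ (u, k) * XX $$ (a + k, j)))"
      if "i < b" "j < a + b + m" for i j
      using that by (subst form) (auto simp: n_def col C adj_index[OF C2(1)] ez cj_0 intro!: sum.neutral)
    have fz: "XX $$ (a + k, a + b + l) = 0" if kl: "k < b" "l < m" for k l
    proof (rule det_nonzero_kernel[OF T, where y = "\<lambda>k. XX $$ (a + k, a + b + l)"])
      fix i assume i: "i < b"
      show "(\<Sum>k<b. T $$ (i, k) * XX $$ (a + k, a + b + l)) = 0"
      proof (rule det_nonzero_kernel[OF aC2, where y = "\<lambda>i. (\<Sum>k<b. T $$ (i, k) * XX $$ (a + k, a + b + l))"])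
        show "(\<Sum>u<b. adj C2 $$ (i, u) * (\<Sum>k<b. T $$ (u, k) * XX $$ (a + k, a + b + l))) = 0" if "i < b" for i
          using that kl by (subst e2[symmetric]) (auto simp: Jf)
      qed (use i in auto)
    qed (use kl in auto)
    have "adj (PP XX) * PP XX = 1\<^sub>m m"
    proof (rule eq_matI)
      fix i j assume "i < dim_row (1\<^sub>m m :: 'a mat)" "j < dim_col (1\<^sub>m m :: 'a mat)"
      then have ij: "i < m" "j < m" by auto
      have "(adj (PP XX) * PP XX) $$ (i, j) = (\<Sum>u<m. XX $$ (a + b + u, a + b + i) ^ q * XX $$ (a + b + u, a + b + j))"
        using ij by (subst mat_mult_index[OF adj_carrier[OF PPc] PPc]) (auto simp: adj_index[OF PPc] PPi intro!: sum.cong)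
      also have "\<dots> = ?J $$ (a + b + i, a + b + j)"
        using ij by (subst form) (auto simp: n_def ez fz cj_0 intro!: sum.neutral)
      finally show "(adj (PP XX) * PP XX) $$ (i, j) = 1\<^sub>m m $$ (i, j)" using ij by (simp add: Jw)
    qed (auto simp: PP_def adj_def)
    then have P: "PP XX \<in> UG m" using PPc by (simp add: UG_def)
    let ?R = "mat a a (\<lambda>(i, j). XX $$ (a + b + m + i, a + b + m + j))"
    have R: "adj C1 * ?R = 1\<^sub>m a"
    proof (rule eq_matI)
      fix i j assume "i < dim_row (1\<^sub>m a :: 'a mat)" "j < dim_col (1\<^sub>m a :: 'a mat)"
      then have ij: "i < a" "j < a" by auto
      have "(adj C1 * ?R) $$ (i, j) = (\<Sum>u<a. adj C1 $$ (i, u) * XX $$ (a + b + m + u, a + b + m + j))"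
        using ij by (subst mat_mult_index[OF aC1(1), of _ a]) auto
      also have "\<dots> = ?J $$ (i, a + b + m + j)" using ij by (subst e1) (auto simp: n_def)
      finally show "(adj C1 * ?R) $$ (i, j) = 1\<^sub>m a $$ (i, j)" using ij by (auto simp: Jv n_def)
    qed (use C1 in \<open>auto simp: adj_def\<close>)
    let ?Y = "mat (b + (m + a)) (b + (m + a)) (\<lambda>(i, j). XX $$ (a + i, a + j))"
    let ?Z = "mat (m + a) (m + a) (\<lambda>(i, j). XX $$ (a + b + i, a + b + j))"
    have "char_poly XX = char_poly (mat a a (\<lambda>(i, j). XX $$ (i, j))) * char_poly ?Y"
    proof (rule char_poly_block)
      fix i j assume ij: "a \<le> i" "i < a + (b + (m + a))" "j < a"
      then show "XX $$ (i, j) = 0" using col[of i j] C(2)[of "i - a" j] by (auto simp: n_def)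
    qed (use c(1) in \<open>simp add: n_def add_ac\<close>)
    also have "mat a a (\<lambda>(i, j). XX $$ (i, j)) = C1" using C1(1) by (intro eq_matI) (auto simp: col C n_def)
    also have "char_poly ?Y = char_poly (mat b b (\<lambda>(i, j). ?Y $$ (i, j))) * char_poly (mat (m + a) (m + a) (\<lambda>(i, j). ?Y $$ (b + i, b + j)))"
      by (rule char_poly_block) (auto simp: col n_def)
    also have "mat b b (\<lambda>(i, j). ?Y $$ (i, j)) = C2" using C2(1) by (intro eq_matI) (auto simp: col C n_def)
    also have "mat (m + a) (m + a) (\<lambda>(i, j). ?Y $$ (b + i, b + j)) = ?Z" by (intro eq_matI) (auto simp: add_ac)
    also have "char_poly ?Z = char_poly (mat m m (\<lambda>(i, j). ?Z $$ (i, j))) * char_poly (mat a a (\<lambda>(i, j). ?Z $$ (m + i, m + j)))"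
    proof (rule char_poly_block)
      fix i j assume ij: "m \<le> i" "i < m + a" "j < m"
      then have "XX $$ (a + b + m + (i - m), a + b + j) = 0" by (intro ez) auto
      moreover have "a + b + m + (i - m) = a + b + i" using ij by simp
      ultimately have "XX $$ (a + b + i, a + b + j) = 0" by metis
      then show "?Z $$ (i, j) = 0" using ij by simp
    qed auto
    also have "mat m m (\<lambda>(i, j). ?Z $$ (i, j)) = PP XX" by (intro eq_matI) (auto simp: PP_def)
    also have "mat a a (\<lambda>(i, j). ?Z $$ (m + i, m + j)) = ?R" by (intro eq_matI) (auto simp: add_ac)
    finally show ?thesis using P R by blast
  qed
  have evX: "mel (ev (char_poly XX)) = mel (ev (char_poly C1) + image_mset phi (ev (char_poly C1)) + ev (char_poly C2)) * mel (ev (char_poly (PP XX)))"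
    if XX: "XX \<in> G" for XX
  proof -
    let ?R = "mat a a (\<lambda>(i, j). XX $$ (a + b + m + i, a + b + m + j))"
    have Rc: "?R \<in> carrier_mat a a" by simp
    have 1: "char_poly XX = char_poly C1 * (char_poly C2 * (char_poly (PP XX) * char_poly ?R))" and 2: "adj C1 * ?R = 1\<^sub>m a"
      using main[OF XX] by blast+
    have mm: "monic (f * g)" if "monic f" "monic g" for f g :: "'a poly" using that by (simp add: lead_coeff_mult)
    note mo = monic_char_poly[OF C1(1)] monic_char_poly[OF C2(1)] monic_char_poly[OF PPc] monic_char_poly[OF Rc]
    have "ev (char_poly XX) = ev (char_poly C1) + (ev (char_poly C2) + (ev (char_poly (PP XX)) + ev (char_poly ?R)))"
      unfolding 1 by (simp only: ev_mult mo mm)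
    also have "ev (char_poly ?R) = image_mset phi (ev (char_poly C1))" using C1(1) Rc 2 by (rule ev_inverse_adj)
    finally show ?thesis by (simp add: mel_add[symmetric] ac_simps)
  qed
  show finG: "finite G"
  proof -
    have "G \<subseteq> (\<lambda>f. mat n n (\<lambda>(i, j). f (i, j))) ` (PiE ({..<n} \<times> {..<n}) (\<lambda>_. UNIV))"
    proof
      fix g assume "g \<in> G"
      then have "g \<in> carrier_mat n n" by (simp add: G_def)
      then have "g = mat n n (\<lambda>(i, j). restrict (\<lambda>ij. g $$ ij) ({..<n} \<times> {..<n}) (i, j))" by (intro eq_matI) auto
      then show "g \<in> (\<lambda>f. mat n n (\<lambda>(i, j). f (i, j))) ` (PiE ({..<n} \<times> {..<n}) (\<lambda>_. UNIV))"
        by (rule image_eqI[where x = "restrict (\<lambda>ij. g $$ ij) ({..<n} \<times> {..<n})"]) auto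
    qed
    then show ?thesis by (rule finite_subset) (auto intro!: finite_PiE)
  qed
  \<comment> \<open>The isometry that acts by Q on the orthonormal block and trivially
    elsewhere.\<close>
  define D where "D Q = mat n n (\<lambda>(i, j). if a + b \<le> i \<and> i < a + b + m \<and> a + b \<le> j \<and> j < a + b + m then Q $$ (i - (a + b), j - (a + b)) else if i = j then 1 else 0)" for Q :: "'a mat"
  have Dc: "D Q \<in> carrier_mat n n" for Q by (simp add: D_def)
  have Dmul: "(A * D Q) $$ (i, j) = (if a + b \<le> j \<and> j < a + b + m then \<Sum>u<m. A $$ (i, a + b + u) * Q $$ (u, j - (a + b)) else A $$ (i, j))"
    if A: "A \<in> carrier_mat n n" and ij: "i < n" "j < n" for A Q i j
  proof (cases "a + b \<le> j \<and> j < a + b + m")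
    case True
    have "(A * D Q) $$ (i, j) = (\<Sum>u<n. A $$ (i, u) * D Q $$ (u, j))" using ij by (intro mat_mult_index[OF A Dc])
    also have "\<dots> = (\<Sum>u<m. A $$ (i, a + b + u) * Q $$ (u, j - (a + b)))"
      unfolding n_def sum_four using True by (auto simp: D_def n_def intro!: sum.neutral)
    finally show ?thesis using True by simp
  next
    case False
    have "(A * D Q) $$ (i, j) = (\<Sum>u<n. A $$ (i, u) * D Q $$ (u, j))" using ij by (intro mat_mult_index[OF A Dc])
    also have "\<dots> = (\<Sum>u<n. (if u = j then 1 else 0) * A $$ (i, u))"
      using False ij by (intro sum.cong) (auto simp: D_def)
    also have "\<dots> = A $$ (i, j)" using ij by (intro delta_sum')
    finally show ?thesis by (subst if_not_P[OF False])
  qed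
  have DJ: "adj (D Q) * (?J * D Q) = ?J" if Q: "Q \<in> UG m" for Q
  proof (rule eq_matI)
    have Qc: "Q \<in> carrier_mat m m" using Q by (rule Un_D)
    fix i j assume "i < dim_row ?J" "j < dim_col ?J"
    then have ij: "i < n" "j < n" using J by auto
    have QQ: "(\<Sum>u<m. Q $$ (u, i) ^ q * Q $$ (u, j)) = (if i = j then 1 else 0)" if "i < m" "j < m" for i j
    proof -
      have "(adj Q * Q) $$ (i, j) = (\<Sum>u<m. Q $$ (u, i) ^ q * Q $$ (u, j))"
        using that by (subst mat_mult_index[OF adj_carrier[OF Qc] Qc]) (auto simp: adj_index[OF Qc])
      then show ?thesis using that Un_D(2)[OF Q] by simp
    qed
    have D1: "D Q $$ (u, i) = (if u = i then 1 else 0)" if "u < a" "i < n" for u i using that by (auto simp: D_def n_def)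
    have D2: "D Q $$ (a + u, i) = (if a + u = i then 1 else 0)" if "u < b" "i < n" for u i using that by (auto simp: D_def n_def)
    have D4: "D Q $$ (a + b + m + u, i) = (if a + b + m + u = i then 1 else 0)" if "u < a" "i < n" for u i using that by (auto simp: D_def n_def)
    have D3: "D Q $$ (a + b + u, i) = (if a + b \<le> i \<and> i < a + b + m then Q $$ (u, i - (a + b)) else 0)" if "u < m" "i < n" for u i
      using that by (auto simp: D_def n_def)
    have q0: "0 ^ q = (0 :: 'a)" using q_gt1 by simp
    have D1q: "D Q $$ (u, i) ^ q = (if u = i then 1 else 0)" if "u < a" "i < n" for u i using D1[OF that] q0 by simp
    have D2q: "D Q $$ (a + u, i) ^ q = (if a + u = i then 1 else 0)" if "u < b" "i < n" for u i using D2[OF that] q0 by simp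
    have D4q: "D Q $$ (a + b + m + u, i) ^ q = (if a + b + m + u = i then 1 else 0)" if "u < a" "i < n" for u i using D4[OF that] q0 by simp
    have D3q: "D Q $$ (a + b + u, i) ^ q = (if a + b \<le> i \<and> i < a + b + m then Q $$ (u, i - (a + b)) ^ q else 0)" if "u < m" "i < n" for u i
      using D3[OF that] q0 by simp
    have s1: "(\<Sum>u<N. (if c + u = i then 1 else 0) * f u) = (if c \<le> i \<and> i < c + N then f (i - c) else 0)" for N c i and f :: "nat \<Rightarrow> 'a"
    proof (cases "c \<le> i \<and> i < c + N")
      case True
      then have "(\<Sum>u<N. (if c + u = i then 1 else 0) * f u) = (\<Sum>u<N. (if u = i - c then 1 else 0) * f u)" by (intro sum.cong) auto
      also have "\<dots> = f (i - c)" using True by (intro delta_sum') auto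
      finally show ?thesis using True by simp
    qed (auto intro!: sum.neutral)
    have s2: "(\<Sum>k<N. f k * (if c + k = i then 1 else 0)) = (if c \<le> i \<and> i < c + N then f (i - c) else 0)" for N c i and f :: "nat \<Rightarrow> 'a"
      using s1[of c i f N] by (simp add: mult.commute)
    have s3: "(\<Sum>u<m. (if a + b \<le> i \<and> i < a + b + m then Q $$ (u, i - (a + b)) ^ q else 0) * (if a + b \<le> j \<and> j < a + b + m then Q $$ (u, j - (a + b)) else 0))
       = (if a + b \<le> i \<and> i < a + b + m \<and> i = j then 1 else 0)"
    proof (cases "(a + b \<le> i \<and> i < a + b + m) \<and> (a + b \<le> j \<and> j < a + b + m)")
      case True
      then have "i - (a + b) < m" "j - (a + b) < m" "(i - (a + b) = j - (a + b)) = (i = j)" by auto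
      then show ?thesis using True QQ[of "i - (a + b)" "j - (a + b)"] by (simp only: if_True simp_thms)
    qed (auto intro!: sum.neutral)
    have "(adj (D Q) * (?J * D Q)) $$ (i, j) =
       (\<Sum>u<a. (if 0 + u = i then 1 else 0) * (if a + b + m + u = j then 1 else 0))
     + (\<Sum>u<b. (if a + u = i then 1 else 0) * (\<Sum>k<b. T $$ (u, k) * (if a + k = j then 1 else 0)))
     + (\<Sum>u<m. (if a + b \<le> i \<and> i < a + b + m then Q $$ (u, i - (a + b)) ^ q else 0) * (if a + b \<le> j \<and> j < a + b + m then Q $$ (u, j - (a + b)) else 0))
     + (\<Sum>u<a. (if a + b + m + u = i then 1 else 0) * (if u = j then 1 else 0))"
      unfolding Jm_form[OF Dc[unfolded n_def] ij[unfolded n_def], folded n_def]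
      using ij by (intro arg_cong2[of _ _ _ _ "(+)"] sum.cong refl) (use q_gt1 in \<open>auto simp: q0 D1 D2 D3 D4\<close>)
    also have "\<dots> = ?J $$ (i, j)"
      unfolding s1 s2 s3 using ij
      by (auto simp: Jm_def n_def)
    finally show "(adj (D Q) * (?J * D Q)) $$ (i, j) = ?J $$ (i, j)" .
  qed (use J Dc in \<open>auto simp: adj_def\<close>)
  have DG: "XX * D Q \<in> G" if "XX \<in> G" and Q: "Q \<in> UG m" for XX Q
  proof -
    have c: "XX \<in> carrier_mat n n" "adj XX * (?J * XX) = ?J" using that by (auto simp: G_def)
    have "adj (XX * D Q) * (?J * (XX * D Q)) = adj (D Q) * ((adj XX * (?J * XX)) * D Q)"
      by (rule form_mult[OF c(1) Dc J])
    also have "\<dots> = ?J" using DJ[OF Q] c(2) by simp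
    finally have 1: "adj (XX * D Q) * (?J * (XX * D Q)) = ?J" .
    have 2: "(XX * D Q) $$ (i, j) = XX $$ (i, j)" if "i < n" "j < a + b" for i j
      using that by (subst Dmul[OF c(1)]) (auto simp: n_def)
    show ?thesis using 1 2 mult_carrier_mat[OF c(1) Dc] \<open>XX \<in> G\<close> unfolding G_def mem_Collect_eq by metis
  qed
  have PD: "PP (XX * D Q) = PP XX * Q" if "XX \<in> G" and Q: "Q \<in> UG m" for XX Q
  proof (rule eq_matI)
    have c: "XX \<in> carrier_mat n n" "Q \<in> carrier_mat m m" using that Un_D(1) by (auto simp: G_def)
    fix i j assume "i < dim_row (PP XX * Q)" "j < dim_col (PP XX * Q)"
    then have ij: "i < m" "j < m" using c by (auto simp: PP_def)
    have "PP (XX * D Q) $$ (i, j) = (XX * D Q) $$ (a + b + i, a + b + j)" using ij by (simp add: PP_def)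
    also have "\<dots> = (\<Sum>u<m. XX $$ (a + b + i, a + b + u) * Q $$ (u, j))"
      using ij c by (subst Dmul) (auto simp: n_def)
    also have "\<dots> = (PP XX * Q) $$ (i, j)" using ij c by (subst mat_mult_index[OF PPc c(2)]) (auto simp: PPi intro!: sum.cong)
    finally show "PP (XX * D Q) $$ (i, j) = (PP XX * Q) $$ (i, j)" .
  qed (use that Un_D(1) in \<open>auto simp: PP_def\<close>)
  have Dinv: "XX * D Q * D (adj Q) = XX" if "XX \<in> G" and Q: "Q \<in> UG m" for XX Q
  proof (rule eq_matI)
    have c: "XX \<in> carrier_mat n n" "Q \<in> carrier_mat m m" "XX * D Q \<in> carrier_mat n n"
      using that Un_D(1) mult_carrier_mat[OF _ Dc] unfolding G_def mem_Collect_eq by metis+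
    fix i j assume "i < dim_row XX" "j < dim_col XX"
    then have ij: "i < n" "j < n" using c by auto
    show "(XX * D Q * D (adj Q)) $$ (i, j) = XX $$ (i, j)"
    proof (cases "a + b \<le> j \<and> j < a + b + m")
      case True
      have "(XX * D Q * D (adj Q)) $$ (i, j) = (\<Sum>u<m. (\<Sum>v<m. XX $$ (i, a + b + v) * Q $$ (v, u)) * adj Q $$ (u, j - (a + b)))"
        using True ij by (subst Dmul[OF c(3)]) (auto simp: Dmul[OF c(1)] n_def simp del: index_mult_mat intro!: sum.cong)
      also have "\<dots> = (\<Sum>v<m. XX $$ (i, a + b + v) * (\<Sum>u<m. Q $$ (v, u) * adj Q $$ (u, j - (a + b))))"
        by (simp add: sum_distrib_left sum_distrib_right mult.assoc) (rule sum.swap)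
      also have "\<dots> = (\<Sum>v<m. XX $$ (i, a + b + v) * (Q * adj Q) $$ (v, j - (a + b)))"
      proof (rule sum.cong[OF refl])
        fix v assume "v \<in> {..<m}"
        then have "(Q * adj Q) $$ (v, j - (a + b)) = (\<Sum>u<m. Q $$ (v, u) * adj Q $$ (u, j - (a + b)))"
          using True by (intro mat_mult_index[OF c(2) adj_carrier[OF c(2)]]) auto
        then show "XX $$ (i, a + b + v) * (\<Sum>u<m. Q $$ (v, u) * adj Q $$ (u, j - (a + b))) = XX $$ (i, a + b + v) * (Q * adj Q) $$ (v, j - (a + b))"
          by simp
      qed
      also have "\<dots> = (\<Sum>v<m. (if v = j - (a + b) then 1 else 0) * XX $$ (i, a + b + v))"
        unfolding Un_D(3)[OF Q] using True by (intro sum.cong) auto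
      also have "\<dots> = XX $$ (i, a + b + (j - (a + b)))" by (rule delta_sum') (use True in auto)
      also have "a + b + (j - (a + b)) = j" using True by simp
      finally show ?thesis .
    next
      case False
      then show ?thesis using ij by (subst Dmul[OF c(3)]) (auto simp: Dmul[OF c(1)] simp del: index_mult_mat)
    qed
  qed (use that Dc in \<open>auto simp: G_def\<close>)
  let ?f = "\<lambda>P. mel (ev (char_poly P))"
  have bijD: "bij_betw (\<lambda>XX. XX * D Q) G G" if Q: "Q \<in> UG m" for Q
  proof (rule bij_betwI[where g = "\<lambda>XX. XX * D (adj Q)"])
    show "XX * D (adj Q) * D Q = XX" if "XX \<in> G" for XX using Dinv[OF that Un_adj[OF Q]] by (simp add: adj_adj)
  qed (use DG Dinv Q Un_adj in auto)
  have bijU: "bij_betw (\<lambda>Q. P * Q) (UG m) (UG m)" if P: "P \<in> UG m" for P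
  proof (rule bij_betwI[where g = "\<lambda>Q. adj P * Q"])
    have c: "P \<in> carrier_mat m m" "adj P \<in> carrier_mat m m" using Un_D(1)[OF P] by auto
    show "adj P * (P * Q) = Q" "P * (adj P * Q) = Q" if "Q \<in> UG m" for Q
      using c Un_D[OF P] Un_D(1)[OF that] by (simp_all add: assoc_mult_mat[symmetric, of _ m m _ m _ m])
  qed (use Un_mult P Un_adj in auto)
  have "of_nat (card (UG m)) * (\<Sum>XX\<in>G. ?f (PP XX)) = (\<Sum>Q\<in>UG m. \<Sum>XX\<in>G. ?f (PP XX))" by simp
  also have "\<dots> = (\<Sum>Q\<in>UG m. \<Sum>XX\<in>G. ?f (PP (XX * D Q)))"
    by (intro sum.cong refl sum.reindex_bij_betw[OF bijD, symmetric])
  also have "\<dots> = (\<Sum>XX\<in>G. \<Sum>Q\<in>UG m. ?f (PP XX * Q))" by (subst sum.swap) (simp add: PD cong: sum.cong)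
  also have "\<dots> = (\<Sum>XX\<in>G. \<Sum>Q\<in>UG m. ?f Q)"
  proof (rule sum.cong[OF refl])
    fix XX assume "XX \<in> G"
    then have "PP XX \<in> UG m" using main by blast
    from sum.reindex_bij_betw[OF bijU[OF this], of ?f] show "(\<Sum>Q\<in>UG m. ?f (PP XX * Q)) = (\<Sum>Q\<in>UG m. ?f Q)" .
  qed
  also have "\<dots> = of_nat (card G) * (\<Sum>Q\<in>UG m. ?f Q)" by simp
  finally have *: "of_nat (card (UG m)) * (\<Sum>XX\<in>G. ?f (PP XX)) = of_nat (card G) * (\<Sum>Q\<in>UG m. ?f Q)" .
  let ?w = "mel (ev (char_poly C1) + image_mset phi (ev (char_poly C1)) + ev (char_poly C2))"
  have "of_nat (card (UG m)) * (\<Sum>XX\<in>G. ?f XX) = ?w * (of_nat (card (UG m)) * (\<Sum>XX\<in>G. ?f (PP XX)))"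
    by (simp add: evX sum_distrib_left[symmetric] mult.left_commute cong: sum.cong)
  also have "\<dots> = of_nat (card G) * (?w * (\<Sum>Q\<in>UG m. ?f Q))" unfolding * by (simp add: mult.left_commute)
  finally show "of_nat (card (UG m)) * (\<Sum>XX\<in>G. ?f XX) = of_nat (card G) * (?w * (\<Sum>P\<in>UG m. ?f P))" .
qed

end

section \<open>Krylov frames\<close>

context ff_setup
begin

definition mv :: "nat \<Rightarrow> 'a mat \<Rightarrow> (nat \<Rightarrow> 'a) \<Rightarrow> nat \<Rightarrow> 'a" where
  "mv n g x = (\<lambda>i. if i < n then \<Sum>k<n. g $$ (i, k) * x k else 0)"

sublocale M: lin_op "mv n g" for n g
  by unfold_locales (auto simp: mv_def fun_eq_iff distrib_left sum.distrib sum_distrib_left mult.left_commute)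

lemma mv_Vs [simp]: "mv n g x \<in> Vs n"
  by (simp add: mv_def Vs_def)

lemma pow_Vs: "x \<in> Vs n \<Longrightarrow> (mv n g ^^ k) x \<in> Vs n"
  by (cases k) simp_all

lemma pact_Vs: "x \<in> Vs n \<Longrightarrow> pact (mv n g) f x \<in> Vs n"
  using pow_Vs by (auto simp: pact_def Vs_def intro!: sum.neutral)

lemma Vs_eqI: "x \<in> Vs n \<Longrightarrow> y \<in> Vs n \<Longrightarrow> (\<And>i. i < n \<Longrightarrow> x i = y i) \<Longrightarrow> x = y"
proof (rule ext)
  fix i assume h: "x \<in> Vs n" "y \<in> Vs n" "\<And>i. i < n \<Longrightarrow> x i = y i"
  show "x i = y i" using h by (cases "i < n") (simp_all add: Vs_def)
qed

lemma mv_mult: assumes g: "g \<in> carrier_mat n n" and h: "h \<in> carrier_mat n n" shows "mv n (g * h) x = mv n g (mv n h x)"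
proof (rule Vs_eqI[of _ n])
  fix i assume i: "i < n"
  have "mv n (g * h) x i = (\<Sum>k<n. (\<Sum>l<n. g $$ (i, l) * h $$ (l, k)) * x k)"
    using i g h by (auto simp: mv_def mat_mult_index[OF g h] simp del: index_mult_mat intro!: sum.cong)
  also have "\<dots> = (\<Sum>l<n. g $$ (i, l) * (\<Sum>k<n. h $$ (l, k) * x k))"
    by (simp add: sum_distrib_left sum_distrib_right mult.assoc) (rule sum.swap)
  also have "\<dots> = mv n g (mv n h x) i" using i by (simp add: mv_def)
  finally show "mv n (g * h) x i = mv n g (mv n h x) i" .
qed simp_all

lemma mv_one: "x \<in> Vs n \<Longrightarrow> mv n (1\<^sub>m n) x = x"
proof (rule Vs_eqI[of _ n])
  fix i assume i: "i < n"
  have "mv n (1\<^sub>m n) x i = (\<Sum>k<n. (if i = k then 1 else 0) * x k)"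
    using i by (auto simp: mv_def intro!: sum.cong)
  then show "mv n (1\<^sub>m n) x i = x i" using i by (simp only: delta_sum'(2))
qed simp_all

lemma ip_mv: assumes g: "g \<in> UG n" shows "ip n (mv n g x) (mv n g y) = ip n x y"
proof -
  note c = Un_D(1)[OF g]
  have "ufun n (\<lambda>i j. g $$ (i, j))"
    unfolding ufun_def
  proof (intro allI impI)
    fix i j assume ij: "i < n" "j < n"
    have "(adj g * g) $$ (i, j) = (\<Sum>k<n. g $$ (k, i) ^ q * g $$ (k, j))"
      using ij by (subst mat_mult_index[OF adj_carrier[OF c] c]) (auto simp: adj_index[OF c])
    then show "(\<Sum>k<n. g $$ (k, i) ^ q * g $$ (k, j)) = (if i = j then 1 else 0)" using ij Un_D(2)[OF g] by simp
  qed
  from ip_app[OF this, of x y] show ?thesis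
    by (simp add: ip_def mv_def app_def)
qed

lemma ip_pow: assumes g: "g \<in> UG n" shows "ip n ((mv n g ^^ (i + k)) x) ((mv n g ^^ (j + k)) y) = ip n ((mv n g ^^ i) x) ((mv n g ^^ j) y)"
  by (induction k) (simp_all add: ip_mv[OF g])

lemma mv_inj: assumes g: "g \<in> UG n" and x: "x \<in> Vs n" and z: "mv n g x = (\<lambda>i. 0)" shows "x = (\<lambda>i. 0)"
proof -
  have "x = mv n (adj g * g) x" using Un_D(2)[OF g] mv_one[OF x] by simp
  also have "\<dots> = mv n (adj g) (mv n g x)" using Un_D(1)[OF g] by (intro mv_mult) auto
  finally show ?thesis unfolding z by (simp add: M.T_zero)
qed

abbreviation mpT :: "nat \<Rightarrow> 'a mat \<Rightarrow> (nat \<Rightarrow> 'a) \<Rightarrow> 'a poly \<Rightarrow> bool" where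
  "mpT n g \<equiv> lin_op.is_mp (mv n g)"

lemma annihilator_exists: assumes x: "x \<in> Vs n" shows "\<exists>f. f \<noteq> 0 \<and> pact (mv n g) f x = (\<lambda>i. 0)"
proof -
  have "range (\<lambda>k. (mv n g ^^ k) x) \<subseteq> Vs n" using pow_Vs[OF x] by auto
  then have "\<not> inj (\<lambda>k. (mv n g ^^ k) x)"
    using card_Vs(1)[of n] finite_subset finite_imageD infinite_UNIV_nat by blast
  then obtain i j where ij: "i \<noteq> j" "(mv n g ^^ i) x = (mv n g ^^ j) x" by (auto simp: inj_def)
  let ?f = "Polynomial.monom 1 i + smult (-1) (Polynomial.monom 1 j) :: 'a poly"
  have "?f \<noteq> 0"
  proof
    assume "?f = 0"
    then have "poly.coeff ?f i = 0" by (simp only: coeff_0)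
    then show False using ij(1) by simp
  qed
  moreover have "pact (mv n g) ?f x = (\<lambda>i. 0)"
    by (simp only: M.pact_add M.pact_smult M.pact_monom ij(2)) simp
  ultimately show ?thesis by blast
qed

lemma mpT_exists: "x \<in> Vs n \<Longrightarrow> \<exists>d. mpT n g x d"
  using annihilator_exists M.is_mp_exists by blast

lemma mpT_coeff_0: assumes g: "g \<in> UG n" and x: "x \<in> Vs n" and d: "mpT n g x d" shows "poly.coeff d 0 \<noteq> 0"
proof
  assume "poly.coeff d 0 = 0"
  then obtain d' where d': "d = pCons 0 d'" by (cases d) auto
  have m: "monic d" "pact (mv n g) d x = (\<lambda>i. 0)" using d by (auto simp: M.is_mp_def)
  have "mv n g (pact (mv n g) d' x) = (\<lambda>i. 0)" using m(2) by (simp add: d' M.pact_pCons M.pact_T)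
  then have "pact (mv n g) d' x = (\<lambda>i. 0)" by (rule mv_inj[OF g pact_Vs[OF x]])
  then have "d dvd d'" using d by (simp add: M.is_mp_def)
  moreover have "d' \<noteq> 0" using m(1) d' by auto
  ultimately have "degree d \<le> degree d'" by (rule dvd_imp_degree_le)
  then show False using d' \<open>d' \<noteq> 0\<close> by simp
qed

section \<open>Correlation sequences\<close>

text \<open>The sequence <v, g^j v> for all integers j. For negative j the power is moved to the
  other argument, so only nonnegative powers of \<open>g\<close> are formed.\<close>

definition cs :: "nat \<Rightarrow> 'a mat \<Rightarrow> (nat \<Rightarrow> 'a) \<Rightarrow> int \<Rightarrow> 'a" where
  "cs n g v = (\<lambda>j. if j \<ge> 0 then ip n v ((mv n g ^^ nat j) v) else ip n ((mv n g ^^ nat (- j)) v) v)"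

lemma cs_hseq: "cs n g v \<in> hseq"
  by (auto simp: hseq_def cs_def ip_cj)

lemma cs_ip: assumes g: "g \<in> UG n"
  shows "ip n ((mv n g ^^ i) v) ((mv n g ^^ j) v) = cs n g v (int j - int i)"
proof (cases "i \<le> j")
  case True
  then have "ip n ((mv n g ^^ i) v) ((mv n g ^^ j) v) = ip n v ((mv n g ^^ (j - i)) v)"
    using ip_pow[OF g, of 0 i v "j - i" v] by simp
  then show ?thesis using True by (simp add: cs_def nat_diff_distrib)
next
  case False
  then have "ip n ((mv n g ^^ i) v) ((mv n g ^^ j) v) = ip n ((mv n g ^^ (i - j)) v) v"
    using ip_pow[OF g, of "i - j" j v 0 v] by simp
  then show ?thesis using False by (simp add: cs_def nat_diff_distrib)
qed

lemma ip_sum2: "ip n z (\<lambda>i. \<Sum>k\<le>N. c k * x k i) = (\<Sum>k\<le>N. c k * ip n z (x k))" for N :: nat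
proof -
  have "ip n z (\<lambda>i. \<Sum>k\<le>N. c k * x k i) = (\<Sum>i<n. \<Sum>k\<le>N. c k * (z i ^ q * x k i))"
    by (simp add: ip_def sum_distrib_left mult.left_commute)
  also have "\<dots> = (\<Sum>k\<le>N. c k * ip n z (x k))" by (subst sum.swap) (simp add: ip_def sum_distrib_left)
  finally show ?thesis .
qed

lemma pact_pow: "pact (mv n g) f ((mv n g ^^ j) v) = (mv n g ^^ j) (pact (mv n g) f v)"
  by (induction j) (simp_all add: M.pact_T)

text \<open>The dictionary between operator and sequence: as i and j vary, f(g) v is orthogonal to
  all iterates of v exactly when f annihilates the correlation sequence.\<close>

lemma cs_pact: assumes g: "g \<in> UG n"
  shows "ip n ((mv n g ^^ i) v) ((mv n g ^^ j) (pact (mv n g) f v)) = pact shft f (cs n g v) (int j - int i)"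
proof -
  have "(mv n g ^^ j) (pact (mv n g) f v) = (\<lambda>l. \<Sum>k\<le>degree f. poly.coeff f k * (mv n g ^^ (k + j)) v l)"
    by (simp only: pact_pow[symmetric]) (simp add: pact_def funpow_add)
  then have "ip n ((mv n g ^^ i) v) ((mv n g ^^ j) (pact (mv n g) f v)) =
     (\<Sum>k\<le>degree f. poly.coeff f k * ip n ((mv n g ^^ i) v) ((mv n g ^^ (k + j)) v))"
    by (simp only: ip_sum2)
  also have "\<dots> = (\<Sum>k\<le>degree f. poly.coeff f k * cs n g v ((int j - int i) + int k))"
    by (simp only: cs_ip[OF g]) (simp add: algebra_simps)
  finally show ?thesis by (simp add: pact_shft)
qed

lemma ip_zero [simp]: "ip n (\<lambda>i. 0) x = 0" "ip n x (\<lambda>i. 0) = 0"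
  by (simp_all add: ip_def cj_0)

lemma cs_pact_zero: assumes g: "g \<in> UG n" and z: "pact (mv n g) f v = (\<lambda>i. 0)"
  shows "pact shft f (cs n g v) = (\<lambda>i. 0)"
proof
  fix j :: int
  have zz: "(mv n g ^^ k) (\<lambda>i. 0) = (\<lambda>i. 0)" for k by (induction k) (simp_all add: M.T_zero)
  have "pact shft f (cs n g v) (int (nat j) - int (nat (- j))) = 0"
    unfolding cs_pact[OF g, symmetric] z zz by simp
  moreover have "int (nat j) - int (nat (- j)) = j" by simp
  ultimately show "pact shft f (cs n g v) j = 0" by metis
qed

section \<open>Matrices with independent columns, and Witt's theorem for them\<close>

definition colf :: "nat \<Rightarrow> 'a mat \<Rightarrow> nat \<Rightarrow> nat \<Rightarrow> 'a" where
  "colf n A j = (\<lambda>i. if i < n then A $$ (i, j) else 0)"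

lemma colf_Vs [simp]: "colf n A j \<in> Vs n"
  by (simp add: colf_def Vs_def)

lemma adj_mult_index: assumes A: "A \<in> carrier_mat n s" and B: "B \<in> carrier_mat n s" and ij: "i < s" "j < s"
  shows "(adj A * B) $$ (i, j) = ip n (colf n A i) (colf n B j)"
  using ij by (subst mat_mult_index[OF adj_carrier[OF A] B]) (auto simp: adj_index[OF A] ip_def colf_def)

lemma mult_cols_iff: assumes g: "g \<in> carrier_mat n n" and A: "A \<in> carrier_mat n s" and C: "C \<in> carrier_mat s s"
  shows "g * A = A * C \<longleftrightarrow> (\<forall>j<s. mv n g (colf n A j) = (\<lambda>i. \<Sum>k<s. colf n A k i * C $$ (k, j)))"
proof -
  have 1: "(g * A) $$ (i, j) = mv n g (colf n A j) i" "(A * C) $$ (i, j) = (\<Sum>k<s. colf n A k i * C $$ (k, j))"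
    if "i < n" "j < s" for i j
    using that by (simp_all add: mat_mult_index[OF g A] mat_mult_index[OF A C] mv_def colf_def del: index_mult_mat)
  show ?thesis
  proof
    assume e: "g * A = A * C"
    show "\<forall>j<s. mv n g (colf n A j) = (\<lambda>i. \<Sum>k<s. colf n A k i * C $$ (k, j))"
    proof (intro allI impI)
      fix j assume j: "j < s"
      show "mv n g (colf n A j) = (\<lambda>i. \<Sum>k<s. colf n A k i * C $$ (k, j))"
      proof (rule Vs_eqI[of _ n])
        fix i assume "i < n"
        then show "mv n g (colf n A j) i = (\<Sum>k<s. colf n A k i * C $$ (k, j))" using j 1[of i j] e by metis
      qed (rule mv_Vs, simp add: Vs_def colf_def)
    qed
  next
    assume h: "\<forall>j<s. mv n g (colf n A j) = (\<lambda>i. \<Sum>k<s. colf n A k i * C $$ (k, j))"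
    show "g * A = A * C"
    proof (rule eq_matI)
      fix i j assume "i < dim_row (A * C)" "j < dim_col (A * C)"
      then have ij: "i < n" "j < s" using A C by auto
      then show "(g * A) $$ (i, j) = (A * C) $$ (i, j)" using 1[OF ij] h by simp
    qed (use g A C in auto)
  qed
qed

lemma left_inverse_exists:
  assumes A: "A \<in> carrier_mat n s"
    and k: "\<And>y j. (\<And>i. i < n \<Longrightarrow> (\<Sum>k<s. A $$ (i, k) * y k) = 0) \<Longrightarrow> j < s \<Longrightarrow> y j = 0"
  shows "has_dual n s (\<lambda>j k. A $$ (k, j))" "\<exists>L\<in>carrier_mat s n. L * A = 1\<^sub>m s"
proof -
  have "m \<le> s \<Longrightarrow> has_dual n m (\<lambda>j k. A $$ (k, j))" for m
  proof (induction m)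
    case 0 then show ?case by (simp add: has_dual_def)
  next
    case (Suc m)
    show ?case
    proof (rule has_dual_extend)
      fix c
      show "\<exists>k<n. A $$ (k, m) \<noteq> (\<Sum>j<m. c j * A $$ (k, j))"
      proof (rule ccontr)
        assume h: "\<not> (\<exists>k<n. A $$ (k, m) \<noteq> (\<Sum>j<m. c j * A $$ (k, j)))"
        define y where "y j = (if j < m then c j else if j = m then - 1 else 0)" for j
        have "y m = 0"
        proof (rule k)
          fix i assume i: "i < n"
          have "(\<Sum>k<s. A $$ (i, k) * y k) = (\<Sum>k<Suc m. A $$ (i, k) * y k)"
            using Suc.prems by (intro sum.mono_neutral_right) (auto simp: y_def)
          also have "\<dots> = (\<Sum>k<m. A $$ (i, k) * y k) + A $$ (i, m) * y m" by simp
          also have "(\<Sum>k<m. A $$ (i, k) * y k) = (\<Sum>j<m. c j * A $$ (i, j))" by (intro sum.cong) (auto simp: y_def)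
          also have "\<dots> = A $$ (i, m)" using h i by simp
          finally show "(\<Sum>k<s. A $$ (i, k) * y k) = 0" by (simp add: y_def)
        qed (use Suc.prems in simp)
        then show False by (simp add: y_def)
      qed
    qed (use Suc in simp)
  qed
  then show hd: "has_dual n s (\<lambda>j k. A $$ (k, j))" by simp
  then obtain \<psi> where \<psi>: "\<And>i j. i < s \<Longrightarrow> j < s \<Longrightarrow> (\<Sum>k<n. \<psi> i k * A $$ (k, j)) = (if i = j then 1 else 0)"
    by (auto simp: has_dual_def)
  let ?L = "mat s n (\<lambda>(i, k). \<psi> i k)"
  have "?L * A = 1\<^sub>m s"
  proof (rule eq_matI)
    fix i j assume "i < dim_row (1\<^sub>m s :: 'a mat)" "j < dim_col (1\<^sub>m s :: 'a mat)"
    then have ij: "i < s" "j < s" by auto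
    then have "(?L * A) $$ (i, j) = (\<Sum>k<n. \<psi> i k * A $$ (k, j))" by (subst mat_mult_index[of _ s n _ s]) (auto simp: A)
    then show "(?L * A) $$ (i, j) = 1\<^sub>m s $$ (i, j)" using \<psi> ij by simp
  qed (use A in auto)
  then show "\<exists>L\<in>carrier_mat s n. L * A = 1\<^sub>m s" by (intro bexI[of _ ?L]) auto
qed

lemma left_inverse_kernel:
  fixes A :: "'a mat"
  assumes A: "A \<in> carrier_mat n s" and L: "L \<in> carrier_mat s n" "L * A = 1\<^sub>m s"
    and z: "\<And>i. i < n \<Longrightarrow> (\<Sum>k<s. A $$ (i, k) * y k) = 0" and j: "j < s"
  shows "y j = 0"
proof -
  have "y j = (\<Sum>k<s. (if j = k then 1 else 0) * y k)" by (rule delta_sum'(2)[OF j, symmetric])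
  also have "\<dots> = (\<Sum>k<s. (L * A) $$ (j, k) * y k)" using j L(2) by (intro sum.cong) auto
  also have "\<dots> = (\<Sum>k<s. \<Sum>i<n. L $$ (j, i) * A $$ (i, k) * y k)"
    using j by (intro sum.cong refl) (simp add: mat_mult_index[OF L(1) A] sum_distrib_right del: index_mult_mat)
  also have "\<dots> = (\<Sum>i<n. L $$ (j, i) * (\<Sum>k<s. A $$ (i, k) * y k))"
    by (subst sum.swap) (simp add: sum_distrib_left mult.assoc)
  also have "\<dots> = 0" using z by simp
  finally show ?thesis .
qed

lemma witt_mat:
  assumes A: "A \<in> carrier_mat n s" and B: "B \<in> carrier_mat n s"
    and LA: "L \<in> carrier_mat s n" "L * A = 1\<^sub>m s" and LB: "L' \<in> carrier_mat s n" "L' * B = 1\<^sub>m s"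
    and gram: "adj A * A = adj B * B"
  shows "\<exists>g\<in>UG n. g * A = B"
proof -
  have "has_dual n s (\<lambda>j. colf n A j)" if A: "A \<in> carrier_mat n s" and L: "L \<in> carrier_mat s n" "L * A = 1\<^sub>m s" for A L
  proof -
    have "has_dual n s (\<lambda>j k. A $$ (k, j))" using A by (rule left_inverse_exists(1)) (rule left_inverse_kernel[OF A L])
    then show ?thesis by (simp add: has_dual_def colf_def)
  qed
  note hd = this[OF A LA] this[OF B LB]
  obtain G where G: "ufun n G" "\<forall>j<s. \<forall>i<n. app n G (colf n A j) i = colf n B j i"
    using witt[OF hd] by (metis adj_mult_index[OF A A] adj_mult_index[OF B B] gram)
  let ?g = "mat n n (\<lambda>(i, j). G i j)"
  have gc: "?g \<in> carrier_mat n n" by simp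
  have "adj ?g * ?g = 1\<^sub>m n"
  proof (rule eq_matI)
    fix i j assume "i < dim_row (1\<^sub>m n :: 'a mat)" "j < dim_col (1\<^sub>m n :: 'a mat)"
    then have ij: "i < n" "j < n" by auto
    then have "(adj ?g * ?g) $$ (i, j) = (\<Sum>k<n. G k i ^ q * G k j)"
      by (subst mat_mult_index[OF adj_carrier[OF gc] gc]) (auto simp: adj_index[OF gc] intro!: sum.cong)
    then show "(adj ?g * ?g) $$ (i, j) = 1\<^sub>m n $$ (i, j)" using G(1) ij by (simp add: ufun_def)
  qed (auto simp: adj_def)
  then have "?g \<in> UG n" by (simp add: UG_def)
  moreover have "?g * A = B"
  proof (rule eq_matI)
    fix i j assume "i < dim_row B" "j < dim_col B"
    then have ij: "i < n" "j < s" using B by auto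
    have "(?g * A) $$ (i, j) = app n G (colf n A j) i"
      using ij by (subst mat_mult_index[OF gc A]) (auto simp: app_def colf_def intro!: sum.cong)
    then show "(?g * A) $$ (i, j) = B $$ (i, j)" using G(2) ij by (simp add: colf_def)
  qed (use A B in auto)
  ultimately show ?thesis by blast
qed

section \<open>Krylov bases, their Gram matrices and the action on them\<close>

lemma comp_sum:
  fixes f :: "'a poly"
  assumes j: "j < degree f"
  shows "(\<Sum>k<degree f. y k * comp_mat f $$ (k, j)) =
    (if Suc j < degree f then y (Suc j) else - (\<Sum>k<degree f. poly.coeff f k * y k))"
proof -
  have "(\<Sum>k<degree f. y k * comp_mat f $$ (k, j)) = (\<Sum>k<degree f. (if k = Suc j then 1 else 0) * y k) - (\<Sum>k<degree f. if Suc j = degree f then poly.coeff f k * y k else 0)"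
    using j unfolding sum_subtractf[symmetric] by (intro sum.cong) (auto simp: comp_mat_def algebra_simps)
  moreover have "(\<Sum>k<degree f. (if k = Suc j then 1 else 0) * y k) = y (Suc j)" if "Suc j < degree f"
    using that by (rule delta_sum')
  moreover have "(\<Sum>k<degree f. (if k = Suc j then 1 else 0) * y k) = 0" if "Suc j = degree f"
    using that by (intro sum.neutral) auto
  ultimately show ?thesis using j by (cases "Suc j < degree f") (simp_all only: if_True if_False, auto)
qed

lemma pact_monic: "monic f \<Longrightarrow> pact T f x i = (\<Sum>k<degree f. poly.coeff f k * (T ^^ k) x i) + (T ^^ degree f) x i"
  by (simp add: pact_def flip: lessThan_Suc_atMost)

text \<open>The matrix of g in the basis z, g z, ..., v, g v, ...: two companion blocks and a single
  coupling entry, which expresses that d(g) v = z, so that g^b v involves z besides the lower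
  iterates of v.\<close>

definition Cmat :: "'a poly \<Rightarrow> 'a poly \<Rightarrow> 'a mat" where
  "Cmat rp d = (let a = degree rp; b = degree d in mat (a + b) (a + b) (\<lambda>(i, j).
     if j < a then (if i < a then comp_mat rp $$ (i, j) else 0)
     else if i < a then (if i = 0 \<and> Suc j = a + b then 1 else 0) else comp_mat d $$ (i - a, j - a)))"

lemma Cmat_carrier [simp]: "Cmat rp d \<in> carrier_mat (degree rp + degree d) (degree rp + degree d)"
  by (simp add: Cmat_def Let_def)

lemma Cmat_sum1: assumes "j < degree rp"
  shows "(\<Sum>k<degree rp + degree d. y k * Cmat rp d $$ (k, j)) = (\<Sum>k<degree rp. y k * comp_mat rp $$ (k, j))"
proof -
  have "(\<Sum>k<degree rp. y k * Cmat rp d $$ (k, j)) = (\<Sum>k<degree rp. y k * comp_mat rp $$ (k, j))"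
    using assms by (intro sum.cong) (auto simp: Cmat_def Let_def)
  moreover have "(\<Sum>k<degree d. y (degree rp + k) * Cmat rp d $$ (degree rp + k, j)) = 0"
    using assms by (intro sum.neutral) (auto simp: Cmat_def Let_def)
  ultimately show ?thesis by (simp add: sum_lessThan_add)
qed

lemma Cmat_sum2: assumes "l < degree d"
  shows "(\<Sum>k<degree rp + degree d. y k * Cmat rp d $$ (k, degree rp + l)) =
    (if Suc l = degree d \<and> degree rp > 0 then y 0 else 0) + (\<Sum>k<degree d. y (degree rp + k) * comp_mat d $$ (k, l))"
proof -
  have "(\<Sum>k<degree rp. y k * Cmat rp d $$ (k, degree rp + l)) = (\<Sum>k<degree rp. (if k = 0 then 1 else 0) * (if Suc l = degree d then y 0 else 0))"
    using assms by (intro sum.cong) (auto simp: Cmat_def Let_def)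
  also have "\<dots> = (if Suc l = degree d \<and> degree rp > 0 then y 0 else 0)"
    by (cases "degree rp > 0") (simp_all add: delta_sum' del: mult_1_left)
  finally have 1: "(\<Sum>k<degree rp. y k * Cmat rp d $$ (k, degree rp + l)) = (if Suc l = degree d \<and> degree rp > 0 then y 0 else 0)" .
  have "(\<Sum>k<degree d. y (degree rp + k) * Cmat rp d $$ (degree rp + k, degree rp + l)) = (\<Sum>k<degree d. y (degree rp + k) * comp_mat d $$ (k, l))"
    using assms by (intro sum.cong) (auto simp: Cmat_def Let_def)
  then show ?thesis by (simp add: sum_lessThan_add 1)
qed

text \<open>Gram matrix of that basis: the iterates of z are orthogonal to everything, and those of
  v give a Toeplitz matrix because g is unitary.\<close>

definition Dmat :: "nat \<Rightarrow> nat \<Rightarrow> (int \<Rightarrow> 'a) \<Rightarrow> 'a mat" where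
  "Dmat a b c = mat (a + b) (a + b) (\<lambda>(i, j). if i < a \<or> j < a then 0 else c (int j - int i))"

definition Kry :: "nat \<Rightarrow> nat \<Rightarrow> nat \<Rightarrow> 'a mat \<Rightarrow> (nat \<Rightarrow> 'a) \<Rightarrow> (nat \<Rightarrow> 'a) \<Rightarrow> 'a mat" where
  "Kry n a b g z v = mat n (a + b) (\<lambda>(i, j). if j < a then (mv n g ^^ j) z i else (mv n g ^^ (j - a)) v i)"

lemma Kry_carrier [simp]: "Kry n a b g z v \<in> carrier_mat n (a + b)"
  by (simp add: Kry_def)

lemma Kry_col: assumes "z \<in> Vs n" "v \<in> Vs n"
  shows "j < a \<Longrightarrow> colf n (Kry n a b g z v) j = (mv n g ^^ j) z"
    "l < b \<Longrightarrow> colf n (Kry n a b g z v) (a + l) = (mv n g ^^ l) v"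
  using pow_Vs[OF assms(1)] pow_Vs[OF assms(2)]
  by (auto simp: colf_def Kry_def fun_eq_iff Vs_def)

text \<open>Generator of the radical of the Krylov space: d annihilates the correlation sequence, so
  d(g) v is orthogonal to every iterate of v.\<close>

definition zvec :: "nat \<Rightarrow> 'a mat \<Rightarrow> (nat \<Rightarrow> 'a) \<Rightarrow> nat \<Rightarrow> 'a" where
  "zvec n g v = pact (mv n g) (mp_seq (cs n g v)) v"

definition Nset :: "nat \<Rightarrow> (int \<Rightarrow> 'a) \<Rightarrow> 'a poly \<Rightarrow> ('a mat \<times> (nat \<Rightarrow> 'a)) set" where
  "Nset n c rp = {(g, v). g \<in> UG n \<and> v \<in> Vs n \<and> cs n g v = c \<and> mpT n g (zvec n g v) rp}"

text \<open>The left inverse demands independent columns, which a degenerate Gram matrix alone does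
  not ensure.\<close>

definition frames :: "nat \<Rightarrow> nat \<Rightarrow> nat \<Rightarrow> (int \<Rightarrow> 'a) \<Rightarrow> 'a mat set" where
  "frames n a b c = {A \<in> carrier_mat n (a + b). adj A * A = Dmat a b c \<and> (\<exists>L\<in>carrier_mat (a + b) n. L * A = 1\<^sub>m (a + b))}"

lemma cs_mp: assumes g: "g \<in> UG n" and v: "v \<in> Vs n"
  shows "SH.is_mp (cs n g v) (mp_seq (cs n g v))" "cs n g v \<in> hseqs (degree (mp_seq (cs n g v)))"
proof -
  obtain f where f: "f \<noteq> 0" "pact (mv n g) f v = (\<lambda>i. 0)" using annihilator_exists[OF v] by blast
  obtain d where d: "SH.is_mp (cs n g v) d" using SH.is_mp_exists[OF f(1) cs_pact_zero[OF g f(2)]] by blast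
  then show 1: "SH.is_mp (cs n g v) (mp_seq (cs n g v))" using mp_seq_eq by metis
  then show "cs n g v \<in> hseqs (degree (mp_seq (cs n g v)))" using cs_hseq by (auto simp: hseqs_def)
qed

definition pol_of :: "(nat \<Rightarrow> 'a) \<Rightarrow> nat \<Rightarrow> 'a poly" where "pol_of y N = (\<Sum>k<N. Polynomial.monom (y k) k)"

lemma coeff_pol_of: "poly.coeff (pol_of y N) i = (if i < N then y i else 0)"
  by (simp add: pol_of_def coeff_sum)

lemma pact_pol_of: "lin_op T \<Longrightarrow> pact T (pol_of y N) x i = (\<Sum>k<N. y k * (T ^^ k) x i)"
proof -
  assume "lin_op T"
  then interpret lin_op T .
  have "degree (pol_of y N) \<le> N" by (rule degree_le) (simp add: coeff_pol_of)
  then show ?thesis by (simp add: pact_bound[of _ N] coeff_pol_of flip: lessThan_Suc_atMost)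
qed

lemma dvd_small: assumes "monic d" "d dvd f" "\<And>k. k \<ge> degree d \<Longrightarrow> poly.coeff f k = 0" shows "f = (0 :: 'a poly)"
proof (rule ccontr)
  assume f: "f \<noteq> 0"
  then have "degree d \<le> degree f" using assms(2) by (intro dvd_imp_degree_le)
  then have "lead_coeff f = 0" using assms(3) by simp
  then show False using f by simp
qed

text \<open>Independence of the Krylov basis: a relation \<alpha>(g) z + \<beta>(g) v = 0 says that
  \<alpha> d + \<beta> annihilates v, hence also the correlations. So d divides \<beta>, which is
  too short and vanishes; then \<open>rp\<close> divides \<alpha>, likewise.\<close>

lemma Nset_frame:
  assumes gv: "(g, v) \<in> Nset n c rp" and c: "c \<in> hseqs b" and rp: "degree rp = a"
  defines "A \<equiv> Kry n a b g (zvec n g v) v"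
  shows "A \<in> frames n a b c" "g * A = A * Cmat rp (mp_seq c)"
proof -
  let ?d = "mp_seq c" and ?T = "mv n g" and ?z = "zvec n g v"
  have g: "g \<in> UG n" and v: "v \<in> Vs n" and cv: "cs n g v = c" and rz: "mpT n g ?z rp" using gv by (auto simp: Nset_def)
  have d: "SH.is_mp c ?d" "degree ?d = b" using hseqs_mp[OF c] by auto
  have z: "?z \<in> Vs n" using v by (simp add: zvec_def pact_Vs)
  have zd: "?z = pact ?T ?d v" by (simp add: zvec_def cv)
  have md: "monic ?d" "pact shft ?d c = (\<lambda>i. 0)" using d by (auto simp: SH.is_mp_def)
  have mr: "monic rp" "pact ?T rp ?z = (\<lambda>i. 0)" using rz by (auto simp: M.is_mp_def)
  note col = Kry_col[OF z v, where a = a and b = b and g = g, folded A_def]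
  have A: "A \<in> carrier_mat n (a + b)" by (simp add: A_def)
  have vz: "ip n ((?T ^^ i) v) ((?T ^^ j) ?z) = 0" for i j
    unfolding zd cs_pact[OF g] cv md(2) ..
  then have zv: "ip n ((?T ^^ j) ?z) ((?T ^^ i) v) = 0" for i j by (metis ip_cj cj_0)
  have zz: "ip n ((?T ^^ j) ?z) ((?T ^^ i) ?z) = 0" for i j
  proof -
    have "(?T ^^ i) ?z = pact ?T ?d ((?T ^^ i) v)" by (simp add: zd pact_pow)
    also have "\<dots> = (\<lambda>l. \<Sum>k\<le>degree ?d. poly.coeff ?d k * (?T ^^ (k + i)) v l)" by (simp add: pact_def funpow_add)
    finally show ?thesis by (simp add: ip_sum2 zv)
  qed
  have gram: "adj A * A = Dmat a b c"
  proof (rule eq_matI)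
    fix i j assume "i < dim_row (Dmat a b c)" "j < dim_col (Dmat a b c)"
    then have ij: "i < a + b" "j < a + b" by (auto simp: Dmat_def)
    have e: "(adj A * A) $$ (i, j) = ip n (colf n A i) (colf n A j)" using ij by (rule adj_mult_index[OF A A])
    have cb: "colf n A i = (?T ^^ (i - a)) v" if "\<not> i < a" "i < a + b" for i
      using col(2)[of "i - a"] that by simp
    have vv: "ip n ((?T ^^ i) v) ((?T ^^ j) v) = c (int j - int i)" for i j using cs_ip[OF g] cv by simp
    show "(adj A * A) $$ (i, j) = Dmat a b c $$ (i, j)"
      unfolding e using ij by (cases "i < a"; cases "j < a") (auto simp: Dmat_def col(1) cb zz vz zv vv of_nat_diff)
  qed (use A in \<open>auto simp: Dmat_def adj_def\<close>)
  have "\<exists>L\<in>carrier_mat (a + b) n. L * A = 1\<^sub>m (a + b)"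
  proof (rule left_inverse_exists(2)[OF A])
    fix y j assume y: "\<And>i. i < n \<Longrightarrow> (\<Sum>k<a + b. A $$ (i, k) * y k) = 0" and j: "j < a + b"
    let ?\<alpha> = "pol_of y a" and ?\<beta> = "pol_of (\<lambda>k. y (a + k)) b"
    have lin: "lin_op ?T" ..
    have sum0: "(\<lambda>i. pact ?T ?\<alpha> ?z i + pact ?T ?\<beta> v i) = (\<lambda>i. 0)"
    proof (rule Vs_eqI[of _ n])
      show "(\<lambda>i. pact ?T ?\<alpha> ?z i + pact ?T ?\<beta> v i) \<in> Vs n" using pact_Vs[OF z] pact_Vs[OF v] by (simp add: Vs_def)
      fix i assume i: "i < n"
      have "pact ?T ?\<alpha> ?z i + pact ?T ?\<beta> v i = (\<Sum>k<a. y k * colf n A k i) + (\<Sum>k<b. y (a + k) * colf n A (a + k) i)"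
        by (simp add: pact_pol_of[OF lin] col)
      also have "\<dots> = (\<Sum>k<a + b. A $$ (i, k) * y k)" using i by (simp add: sum_lessThan_add colf_def mult.commute)
      finally show "pact ?T ?\<alpha> ?z i + pact ?T ?\<beta> v i = 0" using y[OF i] by simp
    qed (simp add: Vs_def)
    have "pact ?T (?\<alpha> * ?d + ?\<beta>) v = (\<lambda>i. 0)"
      using sum0 by (simp add: M.pact_add M.pact_mult zd)
    then have "pact shft (?\<alpha> * ?d + ?\<beta>) c = (\<lambda>i. 0)" using cs_pact_zero[OF g] cv by blast
    then have "?d dvd ?\<alpha> * ?d + ?\<beta>" using d by (simp add: SH.is_mp_def)
    then have "?d dvd ?\<beta>" by (simp add: dvd_add_right_iff)
    then have b0: "?\<beta> = 0" using d(2) by (intro dvd_small[OF md(1)]) (auto simp: coeff_pol_of)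
    then have "pact ?T ?\<alpha> ?z = (\<lambda>i. 0)" using sum0 by simp
    then have "rp dvd ?\<alpha>" using rz by (simp add: M.is_mp_def)
    then have a0: "?\<alpha> = 0" using rp by (intro dvd_small[OF mr(1)]) (auto simp: coeff_pol_of)
    show "y j = 0"
    proof (cases "j < a")
      case True then show ?thesis using coeff_pol_of[of y a j] a0 by simp
    next
      case False
      then have "j - a < b" "a + (j - a) = j" using j by auto
      then show ?thesis using coeff_pol_of[of "\<lambda>k. y (a + k)" b "j - a"] b0 by simp
    qed
  qed
  then show "A \<in> frames n a b c" using A gram by (simp add: frames_def)
  have C: "Cmat rp ?d \<in> carrier_mat (a + b) (a + b)" using Cmat_carrier[of rp ?d] rp d(2) by simp
  show "g * A = A * Cmat rp ?d"
    unfolding mult_cols_iff[OF Un_D(1)[OF g] A C]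
  proof (intro allI impI ext)
    fix j i assume j: "j < a + b"
    show "mv n g (colf n A j) i = (\<Sum>k<a + b. colf n A k i * Cmat rp ?d $$ (k, j))"
    proof (cases "j < a")
      case True
      have "(\<Sum>k<a + b. colf n A k i * Cmat rp ?d $$ (k, j)) =
         (if Suc j < a then colf n A (Suc j) i else - (\<Sum>k<a. poly.coeff rp k * colf n A k i))"
        using Cmat_sum1[of j rp "\<lambda>k. colf n A k i" ?d] comp_sum[of j rp "\<lambda>k. colf n A k i"] True rp d(2) by simp
      also have "\<dots> = (?T ^^ Suc j) ?z i"
      proof (cases "Suc j < a")
        case False
        then have a: "Suc j = a" using True by simp
        have "(\<Sum>k<a. poly.coeff rp k * (?T ^^ k) ?z i) + (?T ^^ a) ?z i = 0"
          using pact_monic[OF mr(1), of ?T ?z i] mr(2) rp by simp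
        then show ?thesis using False a by (simp add: col add_eq_0_iff del: funpow.simps)
      qed (simp add: col)
      finally show ?thesis using True by (simp add: col)
    next
      case False
      define l where "l = j - a"
      have l: "l < b" "j = a + l" using False j by (auto simp: l_def)
      \<comment> \<open>For \<open>a = 0\<close> the matrix \<open>Cmat\<close> has no coupling
        entry; this is consistent since then \<open>rp = 1\<close> and z = 0.\<close>
      have z0: "?z i = (if a > 0 then ?z i else 0)"
      proof (cases "a = 0")
        case True then have "rp = 1" using mr(1) rp by (metis monic_degree_0)
        then show ?thesis using mr(2) True by simp
      qed simp
      have "(\<Sum>k<a + b. colf n A k i * Cmat rp ?d $$ (k, j)) =
         (if Suc l = b \<and> a > 0 then colf n A 0 i else 0) +
         (if Suc l < b then colf n A (a + Suc l) i else - (\<Sum>k<b. poly.coeff ?d k * colf n A (a + k) i))"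
        using Cmat_sum2[of l ?d "\<lambda>k. colf n A k i" rp] comp_sum[of l ?d "\<lambda>k. colf n A (a + k) i"] l rp d(2) by simp
      also have "\<dots> = (?T ^^ Suc l) v i"
      proof (cases "Suc l < b")
        case True then show ?thesis by (simp add: col(2) del: add_Suc_right)
      next
        case False
        then have b: "Suc l = b" using l by simp
        have "?z i = (\<Sum>k<b. poly.coeff ?d k * (?T ^^ k) v i) + (?T ^^ b) v i"
          using pact_monic[OF md(1), of ?T v i] d(2) zd by simp
        then have zi: "(?T ^^ b) v i = ?z i - (\<Sum>k<b. poly.coeff ?d k * (?T ^^ k) v i)" by simp
        have 1: "(if Suc l = b \<and> a > 0 then colf n A 0 i else 0) = ?z i" using b z0 col(1)[of 0] by auto
        have 2: "(\<Sum>k<b. poly.coeff ?d k * colf n A (a + k) i) = (\<Sum>k<b. poly.coeff ?d k * (?T ^^ k) v i)"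
          by (simp add: col)
        show ?thesis unfolding 1 2 using zi by (simp add: b del: funpow.simps sum.lessThan_Suc)
      qed
      finally show ?thesis using l by (simp add: col)
    qed
  qed
qed

text \<open>A radical of dimension \<open>a\<close> needs \<open>a\<close> further vectors to pair
  with. The conjugated first \<open>a\<close> rows of the left inverse are such vectors, and pairing
  a relation with the radical columns shows them independent of the frame.\<close>

lemma frames_le: assumes A: "A \<in> frames n a b c" shows "2 * a + b \<le> n"
proof -
  have Ac: "A \<in> carrier_mat n (a + b)" and gram: "adj A * A = Dmat a b c" using A by (auto simp: frames_def)
  obtain L where L: "L \<in> carrier_mat (a + b) n" "L * A = 1\<^sub>m (a + b)" using A by (auto simp: frames_def)
  define y where "y i k = L $$ (i, k) ^ q" for i k
  have yA: "ip n (colf n A j) (y i) = (if i = j then 1 else 0)" if "i < a + b" "j < a + b" for i j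
  proof -
    have "ip n (y i) (colf n A j) = (L * A) $$ (i, j)"
      using that by (subst mat_mult_index[OF L(1) Ac]) (auto simp: ip_def y_def colf_def cj_cj)
    then have "ip n (y i) (colf n A j) = (if i = j then 1 else 0)" using L(2) that by simp
    then show ?thesis using ip_cj[of n "y i" "colf n A j"] by (auto simp: cj_0 split: if_splits)
  qed
  let ?B = "mat n (a + b + a) (\<lambda>(k, j). if j < a + b then A $$ (k, j) else y (j - (a + b)) k)"
  have "has_dual n (a + b + a) (\<lambda>j k. ?B $$ (k, j))"
  proof (rule left_inverse_exists(1))
    fix w j assume w: "\<And>i. i < n \<Longrightarrow> (\<Sum>k<a + b + a. ?B $$ (i, k) * w k) = 0" and j: "j < a + b + a"
    have w': "(\<Sum>k<a + b. w k * A $$ (i, k)) + (\<Sum>k<a. w (a + b + k) * y k i) = 0" if "i < n" for i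
      using w[OF that] that by (simp add: sum_lessThan_add[of _ "a + b" a] mult.commute)
    have w2: "w (a + b + k0) = 0" if k0: "k0 < a" for k0
    proof -
      have "0 = (\<Sum>i<n. colf n A k0 i ^ q * ((\<Sum>k<a + b. w k * A $$ (i, k)) + (\<Sum>k<a. w (a + b + k) * y k i)))"
        using w' by simp
      also have "\<dots> = (\<Sum>i<n. \<Sum>k<a + b. w k * (colf n A k0 i ^ q * colf n A k i)) + (\<Sum>i<n. \<Sum>k<a. w (a + b + k) * (colf n A k0 i ^ q * y k i))"
        by (simp add: distrib_left sum.distrib sum_distrib_left mult.left_commute colf_def)
      also have "\<dots> = (\<Sum>k<a + b. w k * ip n (colf n A k0) (colf n A k)) + (\<Sum>k<a. w (a + b + k) * ip n (colf n A k0) (y k))"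
        by (subst (1 2) sum.swap) (simp add: ip_def sum_distrib_left)
      also have "(\<Sum>k<a + b. w k * ip n (colf n A k0) (colf n A k)) = 0"
      proof (rule sum.neutral, intro ballI)
        fix k assume k: "k \<in> {..<a + b}"
        then have "ip n (colf n A k0) (colf n A k) = Dmat a b c $$ (k0, k)"
          using adj_mult_index[OF Ac Ac, of k0 k] gram k0 by simp
        then show "w k * ip n (colf n A k0) (colf n A k) = 0" using k k0 by (simp add: Dmat_def)
      qed
      also have "(\<Sum>k<a. w (a + b + k) * ip n (colf n A k0) (y k)) = (\<Sum>k<a. (if k = k0 then 1 else 0) * w (a + b + k))"
        using k0 by (intro sum.cong) (auto simp: yA)
      also have "\<dots> = w (a + b + k0)" using k0 by (rule delta_sum')
      finally show ?thesis by simp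
    qed
    show "w j = 0"
    proof (cases "j < a + b")
      case True
      show ?thesis
      proof (rule left_inverse_kernel[OF Ac L _ True])
        show "(\<Sum>k<a + b. A $$ (i, k) * w k) = 0" if "i < n" for i using w'[OF that] w2 by (simp add: mult.commute)
      qed
    next
      case False then show ?thesis using w2[of "j - (a + b)"] j by simp
    qed
  qed simp
  then show ?thesis using has_dual_le by fastforce
qed

text \<open>Recovers v from its frame. If \<open>b = 0\<close> then d = 1 and v = z is the first
  column; if \<open>a\<close> is zero as well, then v = 0.\<close>

definition vrec :: "nat \<Rightarrow> nat \<Rightarrow> nat \<Rightarrow> 'a mat \<Rightarrow> nat \<Rightarrow> 'a" where
  "vrec n a b A = (if b > 0 then colf n A a else if a > 0 then colf n A 0 else (\<lambda>i. 0))"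

lemma Nset_vrec:
  assumes gv: "(g, v) \<in> Nset n c rp" and c: "c \<in> hseqs b" and rp: "degree rp = a"
  shows "vrec n a b (Kry n a b g (zvec n g v) v) = v"
proof -
  have v: "v \<in> Vs n" and cv: "cs n g v = c" and rz: "mpT n g (zvec n g v) rp" using gv by (auto simp: Nset_def)
  have z: "zvec n g v \<in> Vs n" using v by (simp add: zvec_def pact_Vs)
  have mr: "monic rp" "pact (mv n g) rp (zvec n g v) = (\<lambda>i. 0)" using rz by (auto simp: M.is_mp_def)
  have zv: "zvec n g v = v" if "b = 0"
  proof -
    have "monic (mp_seq c)" "degree (mp_seq c) = 0" using hseqs_mp[OF c] that unfolding SH.is_mp_def by blast+
    then have "mp_seq c = 1" by (metis monic_degree_0)
    then show ?thesis by (simp add: zvec_def cv)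
  qed
  have "zvec n g v = (\<lambda>i. 0)" if "a = 0"
  proof -
    have "rp = 1" using mr(1) that rp by (metis monic_degree_0)
    then show ?thesis using mr(2) by simp
  qed
  then show ?thesis using zv Kry_col[OF z v, of 0 a b g] Kry_col(2)[OF z v, of 0 b a g] by (auto simp: vrec_def)
qed

text \<open>Converse of \<open>Nset_frame\<close>. The delicate point is that the correlations are
  \<open>c\<close>: \<open>rp\<close> annihilates d(shift) of them, whose first \<open>a\<close>
  values <v, g^i z> vanish by the Gram matrix, so d annihilates them; they also agree with
  \<open>c\<close> on \<open>b\<close> consecutive places, and \<open>rec_zero\<close> applies
  again.\<close>

lemma frame_Nset:
  assumes g: "g \<in> UG n" and A: "A \<in> frames n a b c" and gA: "g * A = A * Cmat rp (mp_seq c)"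
    and c: "c \<in> hseqs b" and rp: "rp \<in> polys a"
  defines "v \<equiv> vrec n a b A"
  shows "(g, v) \<in> Nset n c rp" "Kry n a b g (zvec n g v) v = A"
proof -
  let ?d = "mp_seq c" and ?T = "mv n g"
  have d: "SH.is_mp c ?d" "degree ?d = b" "c \<in> hseq" using hseqs_mp[OF c] by auto
  have md: "monic ?d" "pact shft ?d c = (\<lambda>i. 0)" using d by (auto simp: SH.is_mp_def)
  have d0: "poly.coeff ?d 0 \<noteq> 0" using mp_coeff_0[OF d(1)] .
  have rr: "monic rp" "degree rp = a" "poly.coeff rp 0 \<noteq> 0" using rp by (auto simp: polys_def)
  have Ac: "A \<in> carrier_mat n (a + b)" and gram: "adj A * A = Dmat a b c" using A by (auto simp: frames_def)
  obtain L where L: "L \<in> carrier_mat (a + b) n" "L * A = 1\<^sub>m (a + b)" using A by (auto simp: frames_def)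
  have C: "Cmat rp ?d \<in> carrier_mat (a + b) (a + b)" using Cmat_carrier[of rp ?d] rr d(2) by simp
  have cols: "?T (colf n A j) i = (\<Sum>k<a + b. colf n A k i * Cmat rp ?d $$ (k, j))" if "j < a + b" for i j
    using gA that unfolding mult_cols_iff[OF Un_D(1)[OF g] Ac C] by simp
  define z where "z = (if a > 0 then colf n A 0 else (\<lambda>i. 0))"
  have z: "z \<in> Vs n" by (simp add: z_def Vs_def colf_def)
  have v: "v \<in> Vs n" by (simp add: v_def vrec_def Vs_def colf_def)
  have colz: "?T (colf n A j) i = (if Suc j < a then colf n A (Suc j) i else - (\<Sum>k<a. poly.coeff rp k * colf n A k i))" if "j < a" for i j
    using cols[of j i] Cmat_sum1[of j rp "\<lambda>k. colf n A k i" ?d] comp_sum[of j rp "\<lambda>k. colf n A k i"] that rr d(2) by simp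
  have colv: "?T (colf n A (a + l)) i = (if Suc l = b \<and> a > 0 then colf n A 0 i else 0) +
         (if Suc l < b then colf n A (a + Suc l) i else - (\<Sum>k<b. poly.coeff ?d k * colf n A (a + k) i))" if "l < b" for i l
    using cols[of "a + l" i] Cmat_sum2[of l ?d "\<lambda>k. colf n A k i" rp] comp_sum[of l ?d "\<lambda>k. colf n A (a + k) i"] that rr d(2) by simp
  have Tz: "(?T ^^ j) z = colf n A j" if "j < a" for j
    using that
  proof (induction j)
    case (Suc j)
    then have "(?T ^^ Suc j) z = ?T (colf n A j)" by simp
    also have "\<dots> = colf n A (Suc j)" using colz[of j] Suc.prems by (intro ext) simp
    finally show ?case .
  qed (simp add: z_def)
  have rz: "pact ?T rp z = (\<lambda>i. 0)"
  proof (cases "a = 0")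
    case True then show ?thesis using rr(1,2) monic_degree_0[of rp] by (simp add: z_def)
  next
    case False
    show ?thesis
    proof
      fix i
      have "(?T ^^ a) z i = ?T ((?T ^^ (a - 1)) z) i" using False by (cases a) auto
      also have "\<dots> = - (\<Sum>k<a. poly.coeff rp k * colf n A k i)" using False colz[of "a - 1" i] by (simp add: Tz)
      finally show "pact ?T rp z i = 0" using pact_monic[OF rr(1), of ?T z i] rr(2) by (simp add: Tz)
    qed
  qed
  have Tv: "(?T ^^ l) v = colf n A (a + l)" if "l < b" for l
    using that
  proof (induction l)
    case (Suc l)
    then have "(?T ^^ Suc l) v = ?T (colf n A (a + l))" by simp
    also have "\<dots> = colf n A (a + Suc l)" using colv[of l] Suc.prems by (intro ext) (simp del: add_Suc_right)
    finally show ?case .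
  qed (simp add: v_def vrec_def)
  have dv: "pact ?T ?d v = z"
  proof (cases "b = 0")
    case True
    then have "?d = 1" using md(1) d(2) by (metis monic_degree_0)
    then show ?thesis using True by (simp add: z_def v_def vrec_def)
  next
    case False
    show ?thesis
    proof
      fix i
      have "(?T ^^ b) v i = ?T ((?T ^^ (b - 1)) v) i" using False by (cases b) auto
      also have "\<dots> = z i - (\<Sum>k<b. poly.coeff ?d k * colf n A (a + k) i)" using False colv[of "b - 1" i] by (simp add: Tv z_def)
      finally show "pact ?T ?d v i = z i" using pact_monic[OF md(1), of ?T v i] d(2) by (simp add: Tv)
    qed
  qed
  have ipc: "ip n (colf n A i) (colf n A j) = Dmat a b c $$ (i, j)" if "i < a + b" "j < a + b" for i j
    using adj_mult_index[OF Ac Ac that] gram by simp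
  have s0: "pact shft ?d (cs n g v) = (\<lambda>i. 0)"
  proof (rule rec_zero[OF rr(1,3), where s = 0])
    have "pact ?T (rp * ?d) v = (\<lambda>i. 0)" by (simp add: M.pact_mult dv rz)
    then have "pact shft (rp * ?d) (cs n g v) = (\<lambda>i. 0)" by (rule cs_pact_zero[OF g])
    then show "pact shft rp (pact shft ?d (cs n g v)) = (\<lambda>i. 0)" by (simp only: SH.pact_mult)
    fix i assume i: "i < degree rp"
    have "pact shft ?d (cs n g v) (0 + int i) = ip n ((?T ^^ 0) v) ((?T ^^ i) z)"
      by (simp only: cs_pact[OF g] dv[symmetric]) simp
    also have "\<dots> = ip n v (colf n A i)" using i rr by (simp add: Tz)
    also have "\<dots> = 0"
    proof -
      have "v = colf n A a \<and> a < a + b \<or> v = colf n A 0" using i rr by (auto simp: v_def vrec_def)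
      then show ?thesis using ipc[of a i] ipc[of 0 i] i rr by (auto simp: Dmat_def)
    qed
    finally show "pact shft ?d (cs n g v) (0 + int i) = 0" .
  qed
  have csc: "cs n g v = c"
  proof -
    have "(\<lambda>j. cs n g v j + (-1) * c j) = (\<lambda>i. 0)"
    proof (rule rec_zero[OF md(1) d0, where s = 0])
      show "pact shft ?d (\<lambda>j. cs n g v j + (-1) * c j) = (\<lambda>i. 0)" by (simp only: SH.pact_lin s0 md(2)) simp
      fix i assume i: "i < degree ?d"
      have "cs n g v (int i) = ip n ((?T ^^ 0) v) ((?T ^^ i) v)" by (simp only: cs_ip[OF g]) simp
      also have "\<dots> = ip n (colf n A (a + 0)) (colf n A (a + i))"
      proof -
        have ib: "0 < b" "i < b" using i d(2) by auto
        show ?thesis by (simp only: Tv[OF ib(1)] Tv[OF ib(2)])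
      qed
      also have "\<dots> = Dmat a b c $$ (a + 0, a + i)" using i d(2) by (intro ipc) auto
      also have "\<dots> = c (int i)" using i d(2) by (simp add: Dmat_def)
      finally show "cs n g v (0 + int i) + (-1) * c (0 + int i) = 0" by simp
    qed
    then have "cs n g v j + (-1) * c j = 0" for j by (simp add: fun_eq_iff)
    then show ?thesis by (simp add: fun_eq_iff)
  qed
  have zv: "zvec n g v = z" by (simp add: zvec_def csc dv)
  have "mpT n g z rp"
    unfolding M.is_mp_def
  proof (intro conjI allI iffI)
    fix f assume f: "pact ?T f z = (\<lambda>i. 0)"
    have rnz: "rp \<noteq> 0" using rr(1) by auto
    have "f = f div rp * rp + f mod rp" by simp
    then have "pact ?T f z = (\<lambda>i. pact ?T (f div rp * rp) z i + pact ?T (f mod rp) z i)" by (metis M.pact_add)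
    then have m0: "pact ?T (f mod rp) z = (\<lambda>i. 0)" using f by (simp add: M.pact_mult rz)
    have md: "f mod rp = 0 \<or> degree (f mod rp) < a" using degree_mod_less[OF rnz, of f] rr(2) by auto
    have "poly.coeff (f mod rp) j = 0" for j
    proof (cases "j < a")
      case True
      let ?y = "\<lambda>k. if k < a then poly.coeff (f mod rp) k else 0"
      have "?y j = 0"
      proof (rule left_inverse_kernel[OF Ac L])
        fix i assume i: "i < n"
        have "(\<Sum>k<a + b. A $$ (i, k) * ?y k) = (\<Sum>k<a. poly.coeff (f mod rp) k * (?T ^^ k) z i)"
          using i by (simp add: sum_lessThan_add Tz colf_def mult.commute)
        also have "\<dots> = (\<Sum>k\<le>a. poly.coeff (f mod rp) k * (?T ^^ k) z i)"
          using md by (auto simp: coeff_eq_0 simp flip: lessThan_Suc_atMost)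
        also have "\<dots> = pact ?T (f mod rp) z i" using md by (subst M.pact_bound[of _ a]) auto
        finally show "(\<Sum>k<a + b. A $$ (i, k) * ?y k) = 0" using m0 by simp
      qed (use True in simp)
      then show ?thesis using True by simp
    next
      case False then show ?thesis using md by (auto simp: coeff_eq_0)
    qed
    then have "f mod rp = 0" by (simp add: poly_eq_iff)
    then show "rp dvd f" by (simp add: mod_eq_0_iff_dvd)
  next
    fix f assume "rp dvd f"
    then obtain h where "f = rp * h" ..
    then have "f = h * rp" by simp
    then show "pact ?T f z = (\<lambda>i. 0)" by (simp only: M.pact_mult rz M.pact_zero_arg)
  qed (rule rr)
  then show "(g, v) \<in> Nset n c rp" using g v csc zv by (simp add: Nset_def)
  show "Kry n a b g (zvec n g v) v = A"
  proof (rule eq_matI)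
    fix i j assume "i < dim_row A" "j < dim_col A"
    then have ij: "i < n" "j < a + b" using Ac by auto
    show "Kry n a b g (zvec n g v) v $$ (i, j) = A $$ (i, j)"
    proof (cases "j < a")
      case True then show ?thesis using ij by (simp add: Kry_def zv Tz colf_def)
    next
      case False then show ?thesis using ij Tv[of "j - a"] by (simp add: Kry_def colf_def)
    qed
  qed (use Ac in \<open>auto simp: Kry_def\<close>)
qed

end

section \<open>The functional equation\<close>

lemma carrier_mult_left_square [simp]: "A \<in> carrier_mat n n \<Longrightarrow> B \<in> carrier_mat n s \<Longrightarrow> A * B \<in> carrier_mat n s"
  by (rule mult_carrier_mat)

lemma carrier_mult_right_square [simp]: "A \<in> carrier_mat s n \<Longrightarrow> B \<in> carrier_mat n n \<Longrightarrow> A * B \<in> carrier_mat s n"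
  by (rule mult_carrier_mat)

context ff_setup
begin

section \<open>Transitivity on frames and the shift-invariant Gram matrix\<close>

lemma frames_move: assumes A: "A \<in> frames n a b c" and h: "h \<in> UG n" shows "h * A \<in> frames n a b c"
proof -
  note hc = Un_D[OF h]
  have Ac: "A \<in> carrier_mat n (a + b)" "adj A * A = Dmat a b c" using A by (auto simp: frames_def)
  obtain L where L: "L \<in> carrier_mat (a + b) n" "L * A = 1\<^sub>m (a + b)" using A by (auto simp: frames_def)
  have ah: "adj h \<in> carrier_mat n n" using hc by simp
  have e: "adj h * (h * A) = A"
    using assoc_mult_mat[OF ah hc(1) Ac(1)] hc(2) Ac(1) by simp
  have hA: "h * A \<in> carrier_mat n (a + b)" using hc Ac by simp
  have "adj (h * A) * (h * A) = adj A * (adj h * (h * A))"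
    unfolding adj_mult[OF hc(1) Ac(1)] using assoc_mult_mat[OF adj_carrier[OF Ac(1)] ah hA] .
  then have 1: "adj (h * A) * (h * A) = Dmat a b c" using e Ac(2) by simp
  have "L * adj h * (h * A) = 1\<^sub>m (a + b)" using assoc_mult_mat[OF L(1) ah hA] e L(2) by simp
  then have "\<exists>L\<in>carrier_mat (a + b) n. L * (h * A) = 1\<^sub>m (a + b)"
    by (rule bexI) (use L(1) ah in simp)
  then show ?thesis using hA 1 by (simp add: frames_def)
qed

lemma frames_trans: assumes A: "A \<in> frames n a b c" "A' \<in> frames n a b c" shows "\<exists>h\<in>UG n. h * A = A'"
proof -
  obtain L where L: "L \<in> carrier_mat (a + b) n" "L * A = 1\<^sub>m (a + b)" using A(1) by (auto simp: frames_def)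
  obtain L' where L': "L' \<in> carrier_mat (a + b) n" "L' * A' = 1\<^sub>m (a + b)" using A(2) by (auto simp: frames_def)
  show ?thesis by (rule witt_mat[OF _ _ L L']) (use A in \<open>auto simp: frames_def\<close>)
qed

text \<open>On windows of \<open>c\<close> the companion matrix of its minimal polynomial acts as
  the shift by one.\<close>

lemma hseqs_rec: assumes c: "c \<in> hseqs b" and l: "l < b"
  shows "(\<Sum>k<b. c (int k - x) * comp_mat (mp_seq c) $$ (k, l)) = c (int l + 1 - x)"
proof -
  let ?d = "mp_seq c"
  have d: "SH.is_mp c ?d" "degree ?d = b" using hseqs_mp[OF c] by auto
  have md: "monic ?d" "pact shft ?d c = (\<lambda>i. 0)" using d by (auto simp: SH.is_mp_def)
  have "pact shft ?d c (- x) = (\<Sum>k<b. poly.coeff ?d k * c (int k - x)) + c (int b - x)"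
    using pact_monic[OF md(1), of shft c "- x"] d(2) by (simp add: shft_pow)
  then have "(\<Sum>k<b. poly.coeff ?d k * c (int k - x)) + c (int b - x) = 0" using md(2) by simp
  then have e: "- (\<Sum>k<b. poly.coeff ?d k * c (int k - x)) = c (int b - x)" by (simp add: add_eq_0_iff minus_equation_iff)
  have "(\<Sum>k<b. c (int k - x) * comp_mat ?d $$ (k, l)) = (if Suc l < b then c (int (Suc l) - x) else c (int b - x))"
    using comp_sum[of l ?d "\<lambda>k. c (int k - x)"] l d(2) e by simp
  also have "\<dots> = c (int l + 1 - x)"
  proof (cases "Suc l < b")
    case False then have "b = Suc l" using l by simp
    then show ?thesis by (simp add: add_ac)
  qed (simp add: add_ac)
  finally show ?thesis .
qed

lemma hseq_cj: "c \<in> hseq \<Longrightarrow> c j ^ q = c (- j)"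
  by (simp add: hseq_def)

lemma char_poly_Cmat: assumes "monic rp" "monic d" shows "char_poly (Cmat rp d) = rp * d"
proof -
  let ?a = "degree rp" and ?b = "degree d"
  have "char_poly (Cmat rp d) = char_poly (mat ?a ?a (\<lambda>(i, j). Cmat rp d $$ (i, j))) * char_poly (mat ?b ?b (\<lambda>(i, j). Cmat rp d $$ (?a + i, ?a + j)))"
    by (rule char_poly_block) (auto simp: Cmat_def Let_def)
  also have "mat ?a ?a (\<lambda>(i, j). Cmat rp d $$ (i, j)) = comp_mat rp"
    using carrier_matD[OF comp_mat_carrier[of rp]] by (intro eq_matI) (auto simp: Cmat_def Let_def)
  also have "mat ?b ?b (\<lambda>(i, j). Cmat rp d $$ (?a + i, ?a + j)) = comp_mat d"
    using carrier_matD[OF comp_mat_carrier[of d]] by (intro eq_matI) (auto simp: Cmat_def Let_def)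
  finally show ?thesis using assms by (simp add: char_poly_comp_mat)
qed

lemma det_of_char_poly: assumes "A \<in> carrier_mat n n" "poly.coeff (char_poly A) 0 \<noteq> 0" shows "det A \<noteq> (0 :: 'a)"
  using coeff_0_char_poly[OF assms(1)] assms(2) by auto

text \<open>A Toeplitz form is shift invariant, so \<open>adj C * (D * C) = D\<close> and
  \<open>A * C\<close> has the Gram matrix of \<open>A\<close>. Witt's theorem then yields unitary g
  with \<open>g * A = A * C\<close>, so the prescribed action does occur.\<close>

lemma frames_C: assumes A: "A \<in> frames n a b c" and c: "c \<in> hseqs b" and rp: "rp \<in> polys a"
  shows "A * Cmat rp (mp_seq c) \<in> frames n a b c"
proof -
  let ?d = "mp_seq c" and ?s = "a + b"
  let ?C = "Cmat rp ?d" and ?D = "Dmat a b c"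
  have d: "SH.is_mp c ?d" "degree ?d = b" "upoly ?d" "c \<in> hseq" using hseqs_mp[OF c] by auto
  have rr: "monic rp" "degree rp = a" "poly.coeff rp 0 \<noteq> 0" using rp by (auto simp: polys_def)
  have md: "monic ?d" "poly.coeff ?d 0 \<noteq> 0" using d(3) by (auto simp: upoly_def)
  have C: "?C \<in> carrier_mat ?s ?s" using Cmat_carrier[of rp ?d] rr d(2) by simp
  have D: "?D \<in> carrier_mat ?s ?s" by (simp add: Dmat_def)
  have Ac: "A \<in> carrier_mat n ?s" "adj A * A = ?D" using A by (auto simp: frames_def)
  obtain L where L: "L \<in> carrier_mat ?s n" "L * A = 1\<^sub>m ?s" using A by (auto simp: frames_def)
  have "det ?C \<noteq> 0"
    by (rule det_of_char_poly[OF C]) (simp add: char_poly_Cmat[OF rr(1) md(1)] coeff_mult_0 rr md)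
  then obtain Ci where Ci: "Ci \<in> carrier_mat ?s ?s" "?C * Ci = 1\<^sub>m ?s" "Ci * ?C = 1\<^sub>m ?s" using obtain_mat_inverse[OF C] by metis
  have AC: "A * ?C \<in> carrier_mat n ?s" using Ac C by simp
  have LA: "L * (A * ?C) = ?C" using assoc_mult_mat[OF L(1) Ac(1) C] L(2) C by simp
  have "Ci * L * (A * ?C) = 1\<^sub>m ?s" using assoc_mult_mat[OF Ci(1) L(1) AC] LA Ci(3) by simp
  then have inv: "\<exists>L\<in>carrier_mat ?s n. L * (A * ?C) = 1\<^sub>m ?s" by (rule bexI) (use Ci L in simp)
  have DC: "(?D * ?C) $$ (u, j) = (if u < a \<or> j < a then 0 else c (int j + 1 - int u))" if uj: "u < ?s" "j < ?s" for u j
  proof -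
    have e: "(?D * ?C) $$ (u, j) = (\<Sum>k<?s. ?D $$ (u, k) * ?C $$ (k, j))" using uj by (intro mat_mult_index[OF D C])
    show ?thesis
    proof (cases "u < a \<or> j < a")
      case True
      have "(\<Sum>k<?s. ?D $$ (u, k) * ?C $$ (k, j)) = 0"
        using True uj rr d(2) by (intro sum.neutral) (auto simp: Dmat_def Cmat_def Let_def)
      then show ?thesis using e True by simp
    next
      case False
      define l where "l = j - a"
      have l: "l < b" "j = a + l" using False uj by (auto simp: l_def)
      have "(\<Sum>k<?s. ?D $$ (u, k) * ?C $$ (k, j)) = (\<Sum>k<b. c (int k - (int u - int a)) * comp_mat ?d $$ (k, l))"
        unfolding sum_lessThan_add using False uj l rr d(2) by (auto simp: Dmat_def Cmat_def Let_def algebra_simps intro!: sum.cong)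
      also have "\<dots> = c (int l + 1 - (int u - int a))" by (rule hseqs_rec[OF c l(1)])
      finally show ?thesis using e False l by (simp add: algebra_simps)
    qed
  qed
  have DCc: "?D * ?C \<in> carrier_mat ?s ?s" using D C by simp
  have CDC: "adj ?C * (?D * ?C) = ?D"
  proof (rule eq_matI)
    fix i j assume "i < dim_row ?D" "j < dim_col ?D"
    then have ij: "i < ?s" "j < ?s" by (auto simp: Dmat_def)
    have e: "(adj ?C * (?D * ?C)) $$ (i, j) = (\<Sum>u<?s. ?C $$ (u, i) ^ q * (if u < a \<or> j < a then 0 else c (int j + 1 - int u)))"
      using ij by (subst mat_mult_index[OF adj_carrier[OF C] DCc]) (auto simp: adj_index[OF C] DC simp del: index_mult_mat intro!: sum.cong)
    show "(adj ?C * (?D * ?C)) $$ (i, j) = ?D $$ (i, j)"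
    proof (cases "i < a \<or> j < a")
      case True
      have "(\<Sum>u<?s. ?C $$ (u, i) ^ q * (if u < a \<or> j < a then 0 else c (int j + 1 - int u))) = 0"
        using True ij rr d(2) q_gt1 by (intro sum.neutral) (auto simp: Cmat_def Let_def cj_0)
      then show ?thesis using e True ij by (simp add: Dmat_def)
    next
      case False
      define l where "l = i - a"
      have l: "l < b" "i = a + l" using False ij by (auto simp: l_def)
      have "(\<Sum>u<?s. ?C $$ (u, i) ^ q * (if u < a \<or> j < a then 0 else c (int j + 1 - int u))) =
         (\<Sum>u<b. comp_mat ?d $$ (u, l) ^ q * c (int j + 1 - int (a + u)))"
        unfolding sum_lessThan_add using False ij l rr d(2) by (auto simp: Cmat_def Let_def intro!: sum.cong)
      also have "\<dots> = (\<Sum>u<b. c (int u - (int j + 1 - int a)) * comp_mat ?d $$ (u, l)) ^ q"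
        unfolding cj_sum power_mult_distrib hseq_cj[OF d(4)] by (intro sum.cong) (auto simp: algebra_simps)
      also have "\<dots> = c (int l + 1 - (int j + 1 - int a)) ^ q" by (simp only: hseqs_rec[OF c l(1)])
      also have "\<dots> = c (int j - int i)" unfolding hseq_cj[OF d(4)] by (simp add: l algebra_simps)
      finally show ?thesis using e False ij by (simp add: Dmat_def)
    qed
  qed (use C D in \<open>auto simp: adj_def\<close>)
  have "adj (A * ?C) * (A * ?C) = adj ?C * (adj A * (A * ?C))"
    unfolding adj_mult[OF Ac(1) C] using assoc_mult_mat[OF adj_carrier[OF C] adj_carrier[OF Ac(1)] AC] .
  also have "adj A * (A * ?C) = ?D * ?C" using assoc_mult_mat[OF adj_carrier[OF Ac(1)] Ac(1) C] Ac(2) by simp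
  finally have "adj (A * ?C) * (A * ?C) = ?D" using CDC by simp
  then show ?thesis using AC inv by (simp add: frames_def)
qed

definition Tt :: "nat \<Rightarrow> (int \<Rightarrow> 'a) \<Rightarrow> 'a mat" where "Tt b c = mat b b (\<lambda>(i, j). c (int j - int i))"

lemma Tt_carrier [simp]: "Tt b c \<in> carrier_mat b b" by (simp add: Tt_def)

text \<open>A kernel vector is a polynomial f of degree below \<open>b\<close> for which f(shift) c
  vanishes at 0, -1, ..., 1 - b. As d annihilates that sequence, it is zero; then d divides f, so f
  = 0.\<close>

lemma det_Tt: assumes c: "c \<in> hseqs b" shows "det (Tt b c) \<noteq> 0"
proof (rule kernel_imp_det_nonzero[OF Tt_carrier])
  let ?d = "mp_seq c"
  have d: "SH.is_mp c ?d" "degree ?d = b" using hseqs_mp[OF c] by auto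
  have md: "monic ?d" "pact shft ?d c = (\<lambda>i. 0)" using d by (auto simp: SH.is_mp_def)
  fix y j assume y: "\<And>i. i < b \<Longrightarrow> (\<Sum>k<b. Tt b c $$ (i, k) * y k) = 0" and j: "j < b"
  let ?f = "pol_of y b"
  have "pact shft ?f c = (\<lambda>i. 0)"
  proof (rule rec_zero[OF md(1) mp_coeff_0[OF d(1)], where s = "1 - int b"])
    show "pact shft ?d (pact shft ?f c) = (\<lambda>i. 0)"
      by (simp only: SH.pact_mult[symmetric] mult.commute[of ?d]) (simp only: SH.pact_mult md(2) SH.pact_zero_arg)
    fix i assume i: "i < degree ?d"
    define i' where "i' = b - 1 - i"
    have i': "i' < b" "1 - int b + int i = - int i'" using i d(2) by (auto simp: i'_def)
    have "pact shft ?f c (- int i') = (\<Sum>k<b. y k * c (- int i' + int k))"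
      by (simp add: pact_pol_of[OF SH.lin_op_axioms] shft_pow)
    also have "\<dots> = (\<Sum>k<b. Tt b c $$ (i', k) * y k)" using i' by (intro sum.cong) (auto simp: Tt_def algebra_simps)
    finally show "pact shft ?f c (1 - int b + int i) = 0" using y[OF i'(1)] i'(2) by simp
  qed
  then have "?d dvd ?f" using d by (simp add: SH.is_mp_def)
  then have "?f = 0" using d(2) by (intro dvd_small[OF md(1)]) (auto simp: coeff_pol_of)
  then show "y j = 0" using coeff_pol_of[of y b j] j by simp
qed

text \<open>\<open>hermitian_basis\<close> finds Y orthonormal for the form \<open>Jm\<close>; the
  inverse of Y then has columns with Gram matrix \<open>Jm\<close> for the standard form.\<close>

lemma adapted_basis:
  assumes c: "c \<in> hseqs b"
  shows "\<exists>B\<in>carrier_mat (a + b + m + a) (a + b + m + a). adj B * B = Jm a b m (Tt b c)"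
proof -
  let ?n = "a + b + m + a" and ?J = "Jm a b m (Tt b c)"
  have hs: "c \<in> hseq" using hseqs_mp[OF c] by auto
  have J: "?J \<in> carrier_mat ?n ?n" by simp
  have "\<exists>x. \<forall>i<?n. \<forall>j<?n. hf ?n (\<lambda>i j. ?J $$ (i, j)) (x i) (x j) = (if i = j then 1 else 0)"
  proof (rule hermitian_basis)
    fix i j assume ij: "i < ?n" "j < ?n"
    show "?J $$ (i, j) ^ q = ?J $$ (j, i)"
      using ij q_gt1 by (auto simp: Jm_def Tt_def hseq_cj[OF hs] cj_0)
  next
    fix y j assume y: "\<And>i. i < ?n \<Longrightarrow> (\<Sum>j<?n. ?J $$ (i, j) * y j) = 0" and j: "j < ?n"
    have 1: "y (a + b + m + u) = 0" if "u < a" for u using y[of u] Jm_row(1)[OF that, of b m "Tt b c" y] that by simp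
    have 4: "y u = 0" if "u < a" for u using y[of "a + b + m + u"] Jm_row(4)[OF that, of b m "Tt b c" y] that by simp
    have 3: "y (a + b + u) = 0" if "u < m" for u using y[of "a + b + u"] Jm_row(3)[OF that, of a b "Tt b c" y] that by simp
    have 2: "y (a + u) = 0" if "u < b" for u
    proof (rule det_nonzero_kernel[OF Tt_carrier det_Tt[OF c] _ that, where y = "\<lambda>u. y (a + u)"])
      show "(\<Sum>k<b. Tt b c $$ (i, k) * y (a + k)) = 0" if "i < b" for i
        using y[of "a + i"] Jm_row(2)[OF that, of a m "Tt b c" y] that by simp
    qed
    consider "j < a" | "a \<le> j" "j < a + b" | "a + b \<le> j" "j < a + b + m" | "a + b + m \<le> j" by linarith
    then show "y j = 0"
      using 4[of j] 2[of "j - a"] 3[of "j - (a + b)"] 1[of "j - (a + b + m)"] j by cases auto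
  qed simp
  then obtain x where x: "\<And>i j. i < ?n \<Longrightarrow> j < ?n \<Longrightarrow> hf ?n (\<lambda>i j. ?J $$ (i, j)) (x i) (x j) = (if i = j then 1 else 0)" by blast
  define Y where "Y = mat ?n ?n (\<lambda>(k, j). x j k)"
  have Y: "Y \<in> carrier_mat ?n ?n" by (simp add: Y_def)
  have Yi: "Y $$ (k, j) = x j k" if "k < ?n" "j < ?n" for k j using that by (simp add: Y_def)
  have JY: "?J * Y \<in> carrier_mat ?n ?n" using J Y by simp
  have YJY: "adj Y * (?J * Y) = 1\<^sub>m ?n"
  proof (rule eq_matI)
    fix i j assume "i < dim_row (1\<^sub>m ?n :: 'a mat)" "j < dim_col (1\<^sub>m ?n :: 'a mat)"
    then have ij: "i < ?n" "j < ?n" by auto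
    have "(adj Y * (?J * Y)) $$ (i, j) = (\<Sum>u<?n. adj Y $$ (i, u) * (\<Sum>v<?n. ?J $$ (u, v) * Y $$ (v, j)))"
      using ij by (subst mat_mult_index[OF adj_carrier[OF Y] JY]) (auto simp: mat_mult_index[OF J Y] simp del: index_mult_mat intro!: sum.cong)
    also have "\<dots> = hf ?n (\<lambda>i j. ?J $$ (i, j)) (x i) (x j)"
      unfolding hf_def sum_distrib_left using ij by (intro sum.cong refl) (auto simp: adj_index[OF Y] Yi mult.assoc)
    finally show "(adj Y * (?J * Y)) $$ (i, j) = 1\<^sub>m ?n $$ (i, j)" using x ij by simp
  qed (use Y in \<open>auto simp: adj_def\<close>)
  have aYJ: "adj Y * ?J \<in> carrier_mat ?n ?n" using Y J by simp
  have "adj Y * ?J * Y = 1\<^sub>m ?n" using assoc_mult_mat[OF adj_carrier[OF Y] J Y] YJY by simp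
  then have "Y * (adj Y * ?J) = 1\<^sub>m ?n" by (rule mat_mult_left_right_inverse[OF aYJ Y])
  then obtain B where B: "B \<in> carrier_mat ?n ?n" "Y * B = 1\<^sub>m ?n" using aYJ by blast
  have "adj (Y * B) * (?J * (Y * B)) = adj B * ((adj Y * (?J * Y)) * B)" by (rule form_mult[OF Y B(1) J])
  then have "adj B * B = ?J" unfolding B(2) YJY adj_one using B(1) J by simp
  then show ?thesis using B(1) by blast
qed

text \<open>Orbit and stabiliser: left translation by one element carrying A to A', which Witt's
  theorem provides.\<close>

lemma card_frame_fibre: assumes A: "A \<in> frames n a b c" and A': "A' \<in> frames n a b c"
  shows "card {h \<in> UG n. h * A = A'} = card {h \<in> UG n. h * A = A}" "card {h \<in> UG n. h * A = A'} > 0"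
proof -
  obtain h0 where h0: "h0 \<in> UG n" "h0 * A = A'" using frames_trans[OF A A'] by blast
  have Ac: "A \<in> carrier_mat n (a + b)" using A by (auto simp: frames_def)
  note hc = Un_D[OF h0(1)]
  have ah: "adj h0 \<in> carrier_mat n n" using hc by simp
  have "bij_betw (\<lambda>h. h0 * h) {h \<in> UG n. h * A = A} {h \<in> UG n. h * A = A'}"
  proof (rule bij_betwI[where g = "\<lambda>h. adj h0 * h"])
    show "(\<lambda>h. h0 * h) \<in> {h \<in> UG n. h * A = A} \<rightarrow> {h \<in> UG n. h * A = A'}"
      using Un_mult h0 assoc_mult_mat[OF hc(1) Un_D(1) Ac] by auto
    have "adj h0 * A' = A" using assoc_mult_mat[OF ah hc(1) Ac] hc(2) h0(2) Ac by simp
    then show "(\<lambda>h. adj h0 * h) \<in> {h \<in> UG n. h * A = A'} \<rightarrow> {h \<in> UG n. h * A = A}"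
      using Un_mult Un_adj[OF h0(1)] assoc_mult_mat[OF ah Un_D(1) Ac] by auto
    show "adj h0 * (h0 * h) = h" if "h \<in> {h \<in> UG n. h * A = A}" for h
    proof -
      have h: "h \<in> carrier_mat n n" using that Un_D(1) by blast
      then show ?thesis using assoc_mult_mat[OF ah hc(1) h] hc(2) by simp
    qed
    show "h0 * (adj h0 * h) = h" if "h \<in> {h \<in> UG n. h * A = A'}" for h
    proof -
      have h: "h \<in> carrier_mat n n" using that Un_D(1) by blast
      then show ?thesis using assoc_mult_mat[OF hc(1) ah h] hc(3) by simp
    qed
  qed
  then show "card {h \<in> UG n. h * A = A'} = card {h \<in> UG n. h * A = A}" by (simp add: bij_betw_same_card)
  show "card {h \<in> UG n. h * A = A'} > 0" using h0 finite_Un by (auto simp: card_gt_0_iff)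
qed

lemma sum_conj: assumes h: "h \<in> UG n" and A: "A \<in> carrier_mat n s" and C: "C \<in> carrier_mat s s"
  shows "(\<Sum>g\<in>{g \<in> UG n. g * (h * A) = h * A * C}. mel (ev (char_poly g))) = (\<Sum>g\<in>{g \<in> UG n. g * A = A * C}. mel (ev (char_poly g)))"
proof (rule sum.reindex_bij_witness[where i = "\<lambda>g. h * g * adj h" and j = "\<lambda>g. adj h * g * h"])
  note hc = Un_D[OF h]
  have ah: "adj h \<in> carrier_mat n n" using hc by simp
  have hA: "h * A \<in> carrier_mat n s" using hc A by simp
  have inv1: "h * (adj h * x) = x" "adj h * (h * x) = x" if "x \<in> carrier_mat n l" for x l
    using assoc_mult_mat[OF hc(1) ah that] assoc_mult_mat[OF ah hc(1) that] hc that by simp_all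
  fix g assume g: "g \<in> {g \<in> UG n. g * (h * A) = h * A * C}"
  have gc: "g \<in> carrier_mat n n" "g \<in> UG n" using g Un_D by auto
  have as: "adj h * g * h = adj h * (g * h)" using ah gc hc by (intro assoc_mult_mat[of _ n n _ n _ n]) auto
  show "h * (adj h * g * h) * adj h = g"
  proof -
    have "h * (adj h * g * h) * adj h = h * (adj h * (g * h)) * adj h" unfolding as ..
    also have "\<dots> = g * h * adj h" using inv1(1)[of "g * h" n] gc hc by simp
    also have "\<dots> = g * (h * adj h)" using gc hc by (intro assoc_mult_mat[of _ n n _ n _ n]) auto
    finally show ?thesis using hc gc by simp
  qed
  have "adj h * g * h * A = adj h * (g * (h * A))"
    using ah gc hc A assoc_mult_mat[of "adj h * g" n n h n A s] assoc_mult_mat[of "adj h" n n g n "h * A" s] by simp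
  also have "\<dots> = adj h * (h * (A * C))" using g assoc_mult_mat[OF hc(1) A C] by simp
  also have "\<dots> = A * C" using inv1(2)[of "A * C" s] A C by simp
  finally show "adj h * g * h \<in> {g \<in> UG n. g * A = A * C}" using Un_mult Un_adj h gc by simp
  have "similar_mat (adj h * g * h) g"
    by (rule similar_matI[where P = "adj h" and Q = h and n = n]) (use hc ah gc in auto)
  then show "mel (ev (char_poly (adj h * g * h))) = mel (ev (char_poly g))" by (simp add: char_poly_similar)
next
  note hc = Un_D[OF h]
  have ah: "adj h \<in> carrier_mat n n" using hc by simp
  have hA: "h * A \<in> carrier_mat n s" using hc A by simp
  have inv1: "h * (adj h * x) = x" "adj h * (h * x) = x" if "x \<in> carrier_mat n l" for x l
    using assoc_mult_mat[OF hc(1) ah that] assoc_mult_mat[OF ah hc(1) that] hc that by simp_all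
  fix g assume g: "g \<in> {g \<in> UG n. g * A = A * C}"
  have gc: "g \<in> carrier_mat n n" "g \<in> UG n" using g Un_D by auto
  have as: "h * g * adj h = h * (g * adj h)" using ah gc hc by (intro assoc_mult_mat[of _ n n _ n _ n]) auto
  show "adj h * (h * g * adj h) * h = g"
  proof -
    have "adj h * (h * g * adj h) * h = adj h * (h * (g * adj h)) * h" unfolding as ..
    also have "\<dots> = g * adj h * h" using inv1(2)[of "g * adj h" n] gc hc by simp
    also have "\<dots> = g * (adj h * h)" using gc hc by (intro assoc_mult_mat[of _ n n _ n _ n]) auto
    finally show ?thesis using hc gc by simp
  qed
  have "h * g * adj h * (h * A) = h * (g * (adj h * (h * A)))"
    using ah gc hc hA assoc_mult_mat[of "h * g" n n "adj h" n "h * A" s] assoc_mult_mat[of h n n g n "adj h * (h * A)" s] by simp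
  also have "\<dots> = h * (A * C)" using inv1(2)[OF A] g by simp
  also have "\<dots> = h * A * C" using assoc_mult_mat[OF hc(1) A C] by simp
  finally show "h * g * adj h \<in> {g \<in> UG n. g * (h * A) = h * A * C}" using Un_mult Un_adj h gc by simp
qed

lemma finite_Nset: "finite (Nset n c rp)"
proof (rule finite_subset)
  show "Nset n c rp \<subseteq> UG n \<times> Vs n" by (auto simp: Nset_def)
qed (use finite_Un card_Vs in auto)

text \<open>Through Krylov bases, pairs (g, v) become pairs of a frame K and a unitary g with g K =
  K C. U(n) is transitive on frames and conjugation preserves eigenvalues, so all frames contribute
  equally. For one frame, completed to an adapted basis, the matrices of these g form the set
  treated in \<open>block_average\<close>. Their number equals the order of the frame stabiliser,
  which therefore cancels.\<close>

lemma Nset_sum: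
  assumes c: "c \<in> hseqs b" and rp: "rp \<in> polys a" and n: "n = a + b + m + a"
  shows "of_nat (card (UG m)) * (\<Sum>(g, v)\<in>Nset n c rp. mel (ev (char_poly g))) =
    of_nat (card (UG n)) * (mel (ev rp + image_mset phi (ev rp) + ev (mp_seq c)) * (\<Sum>P\<in>UG m. mel (ev (char_poly P))))"
proof -
  let ?d = "mp_seq c" and ?s = "a + b" and ?J = "Jm a b m (Tt b c)" and ?w = "\<lambda>g. mel (ev (char_poly g))"
  let ?C = "Cmat rp ?d"
  have d: "SH.is_mp c ?d" "degree ?d = b" "upoly ?d" "c \<in> hseq" using hseqs_mp[OF c] by auto
  have rr: "monic rp" "degree rp = a" "poly.coeff rp 0 \<noteq> 0" using rp by (auto simp: polys_def)
  have md: "monic ?d" "poly.coeff ?d 0 \<noteq> 0" using d(3) by (auto simp: upoly_def)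
  have C: "?C \<in> carrier_mat ?s ?s" using Cmat_carrier[of rp ?d] rr d(2) by simp
  have J: "?J \<in> carrier_mat n n" by (simp add: n)
  obtain B where B: "B \<in> carrier_mat n n" "adj B * B = ?J" using adapted_basis[OF c, of a m] n by auto
  have aB: "adj B \<in> carrier_mat n n" using B by simp
  have "det (adj B * B) \<noteq> 0"
  proof -
    have "det ?J \<noteq> 0"
    proof (rule kernel_imp_det_nonzero[OF J])
      fix y j assume y: "\<And>i. i < n \<Longrightarrow> (\<Sum>k<n. ?J $$ (i, k) * y k) = 0" and j: "j < n"
      have 1: "y (a + b + m + u) = 0" if "u < a" for u using y[of u] Jm_row(1)[OF that, of b m "Tt b c" y] that n by simp
      have 4: "y u = 0" if "u < a" for u using y[of "a + b + m + u"] Jm_row(4)[OF that, of b m "Tt b c" y] that n by simp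
      have 3: "y (a + b + u) = 0" if "u < m" for u using y[of "a + b + u"] Jm_row(3)[OF that, of a b "Tt b c" y] that n by simp
      have 2: "y (a + u) = 0" if "u < b" for u
      proof (rule det_nonzero_kernel[OF Tt_carrier det_Tt[OF c] _ that, where y = "\<lambda>u. y (a + u)"])
        show "(\<Sum>k<b. Tt b c $$ (i, k) * y (a + k)) = 0" if "i < b" for i
          using y[of "a + i"] Jm_row(2)[OF that, of a m "Tt b c" y] that n by simp
      qed
      consider "j < a" | "a \<le> j" "j < a + b" | "a + b \<le> j" "j < a + b + m" | "a + b + m \<le> j" by linarith
      then show "y j = 0"
        using 4[of j] 2[of "j - a"] 3[of "j - (a + b)"] 1[of "j - (a + b + m)"] j n by cases auto
    qed
    then show ?thesis using B by simp
  qed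
  then have "det B \<noteq> 0" using det_mult[OF aB B(1)] by auto
  then obtain Bi where Bi: "Bi \<in> carrier_mat n n" "B * Bi = 1\<^sub>m n" "Bi * B = 1\<^sub>m n" using obtain_mat_inverse[OF B(1)] by metis
  \<comment> \<open>The first \<open>a + b\<close> columns of the adapted basis form a frame; the
    corresponding rows of the inverse basis matrix are its left inverse.\<close>
  define A where "A = mat n ?s (\<lambda>(i, j). B $$ (i, j))"
  have Ac: "A \<in> carrier_mat n ?s" by (simp add: A_def)
  have Ai: "A $$ (k, i) = B $$ (k, i)" if "k < n" "i < ?s" for k i using that by (simp add: A_def)
  have sn: "?s \<le> n" using n by simp
  have A: "A \<in> frames n a b c"
  proof -
    have "adj A * A = Dmat a b c"
    proof (rule eq_matI)
      fix i j assume "i < dim_row (Dmat a b c)" "j < dim_col (Dmat a b c)"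
      then have ij: "i < ?s" "j < ?s" by (auto simp: Dmat_def)
      have "(adj A * A) $$ (i, j) = (\<Sum>k<n. B $$ (k, i) ^ q * B $$ (k, j))"
        using ij by (subst mat_mult_index[OF adj_carrier[OF Ac] Ac]) (auto simp: adj_index[OF Ac] Ai intro!: sum.cong)
      also have "\<dots> = (adj B * B) $$ (i, j)"
        using ij sn by (subst mat_mult_index[OF aB B(1)]) (auto simp: adj_index[OF B(1)])
      finally show "(adj A * A) $$ (i, j) = Dmat a b c $$ (i, j)"
        unfolding B(2) using ij by (auto simp: Jm_def Dmat_def Tt_def of_nat_diff)
    qed (auto simp: adj_def Dmat_def A_def)
    moreover have "mat ?s n (\<lambda>(i, j). Bi $$ (i, j)) * A = 1\<^sub>m ?s"
    proof (rule eq_matI)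
      fix i j assume "i < dim_row (1\<^sub>m ?s :: 'a mat)" "j < dim_col (1\<^sub>m ?s :: 'a mat)"
      then have ij: "i < ?s" "j < ?s" by auto
      have "(mat ?s n (\<lambda>(i, j). Bi $$ (i, j)) * A) $$ (i, j) = (\<Sum>k<n. Bi $$ (i, k) * B $$ (k, j))"
        using ij by (subst mat_mult_index[of _ ?s n _ ?s]) (auto simp: A_def)
      also have "\<dots> = (Bi * B) $$ (i, j)" using ij sn by (intro mat_mult_index[OF Bi(1) B(1), symmetric]) auto
      finally show "(mat ?s n (\<lambda>(i, j). Bi $$ (i, j)) * A) $$ (i, j) = 1\<^sub>m ?s $$ (i, j)" using ij sn Bi(3) by simp
    qed (auto simp: A_def)
    ultimately show ?thesis unfolding frames_def using Ac by (auto intro!: bexI[of _ "mat ?s n (\<lambda>(i, j). Bi $$ (i, j))"])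
  qed
  define S where "S = card {h \<in> UG n. h * A = A}"
  let ?G0 = "{g \<in> UG n. g * A = A * ?C}"
  have G0: "card ?G0 = S" "card ?G0 > 0"
    using card_frame_fibre[OF A frames_C[OF A c rp]] by (simp_all add: S_def)
  define K where "K gv = (case gv of (g, v) \<Rightarrow> Kry n a b g (zvec n g v) v)" for gv
  let ?N = "Nset n c rp"
  have KN: "K x \<in> frames n a b c" "fst x * K x = K x * ?C" "fst x \<in> UG n" "vrec n a b (K x) = snd x" if "x \<in> ?N" for x
    using that Nset_frame[of "fst x" "snd x" n c rp b a] Nset_vrec[of "fst x" "snd x" n c rp b a] c rr
    by (auto simp: K_def Nset_def case_prod_beta)
  have fibre: "(\<Sum>x\<in>{x \<in> ?N. h * A = K x}. ?w (fst x)) = (\<Sum>g\<in>?G0. ?w g)" if h: "h \<in> UG n" for h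
  proof -
    have hA: "h * A \<in> frames n a b c" using A h by (rule frames_move)
    have "(\<Sum>x\<in>{x \<in> ?N. h * A = K x}. ?w (fst x)) = (\<Sum>g\<in>{g \<in> UG n. g * (h * A) = h * A * ?C}. ?w g)"
    proof (rule sum.reindex_bij_witness[where i = "\<lambda>g. (g, vrec n a b (h * A))" and j = fst])
      fix x assume x: "x \<in> {x \<in> ?N. h * A = K x}"
      then show "(fst x, vrec n a b (h * A)) = x" using KN(4)[of x] by (simp add: prod_eq_iff)
      show "fst x \<in> {g \<in> UG n. g * (h * A) = h * A * ?C}" using x KN(2,3)[of x] by simp
    next
      fix g assume g: "g \<in> {g \<in> UG n. g * (h * A) = h * A * ?C}"
      then show "(g, vrec n a b (h * A)) \<in> {x \<in> ?N. h * A = K x}"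
        using frame_Nset[of g n "h * A" a b c rp] hA c rp by (simp add: K_def)
    qed auto
    also have "\<dots> = (\<Sum>g\<in>?G0. ?w g)" using h Ac C by (rule sum_conj)
    finally show ?thesis .
  qed
  \<comment> \<open>Each frame is hit by exactly S elements h, so a sum over frames is replaced by a
    sum over the group at the price of the factor S.\<close>
  have "of_nat S * (\<Sum>x\<in>?N. ?w (fst x)) = (\<Sum>x\<in>?N. \<Sum>h\<in>{h \<in> UG n. h * A = K x}. ?w (fst x))"
  proof -
    have "(\<Sum>h\<in>{h \<in> UG n. h * A = K x}. ?w (fst x)) = of_nat S * ?w (fst x)" if "x \<in> ?N" for x
      using card_frame_fibre(1)[OF A KN(1)[OF that]] by (simp add: S_def)
    then show ?thesis by (simp add: sum_distrib_left)
  qed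
  also have "\<dots> = (\<Sum>h\<in>UG n. \<Sum>x\<in>{x \<in> ?N. h * A = K x}. ?w (fst x))"
    by (rule sum.swap_restrict[OF finite_Nset finite_Un])
  also have "\<dots> = of_nat (card (UG n)) * (\<Sum>g\<in>?G0. ?w g)" by (simp add: fibre)
  finally have e1: "of_nat S * (\<Sum>x\<in>?N. ?w (fst x)) = of_nat (card (UG n)) * (\<Sum>g\<in>?G0. ?w g)" .
  let ?GB = "{XX \<in> carrier_mat n n. adj XX * (?J * XX) = ?J \<and>
     (\<forall>i<n. \<forall>j<a + b. XX $$ (i, j) = (if i < a + b then ?C $$ (i, j) else 0))}"
  have BBx: "B * (Bi * x) = x" "Bi * (B * x) = x" if "x \<in> carrier_mat n l" for x l
    using assoc_mult_mat[OF B(1) Bi(1) that] assoc_mult_mat[OF Bi(1) B(1) that] Bi that by simp_all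
  have aux: "adj g * g = 1\<^sub>m n \<longleftrightarrow> adj (Bi * (g * B)) * (?J * (Bi * (g * B))) = ?J" if g: "g \<in> carrier_mat n n" for g
  proof -
    let ?Z = "Bi * (g * B)"
    have Z: "?Z \<in> carrier_mat n n" "g * B \<in> carrier_mat n n" using Bi g B by simp_all
    have "?J * ?Z = adj B * (B * ?Z)" unfolding B(2)[symmetric] using aB B Z by (intro assoc_mult_mat[of _ n n _ n _ n]) auto
    also have "B * ?Z = g * B" using BBx(1)[OF Z(2)] .
    finally have 1: "?J * ?Z = adj B * (g * B)" .
    have "adj ?Z * (?J * ?Z) = adj ?Z * adj B * (g * B)" unfolding 1
      using Z aB by (intro assoc_mult_mat[symmetric, of _ n n _ n _ n]) auto
    also have "adj ?Z * adj B = adj (B * ?Z)" using adj_mult[OF B(1) Z(1)] by simp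
    also have "B * ?Z = g * B" using BBx(1)[OF Z(2)] .
    also have "adj (g * B) * (g * B) = adj B * ((adj g * g) * B)"
      using form_mult[OF g B(1), of "1\<^sub>m n"] g Z by simp
    finally have e: "adj ?Z * (?J * ?Z) = adj B * ((adj g * g) * B)" .
    show ?thesis
    proof
      assume "adj g * g = 1\<^sub>m n" then show "adj ?Z * (?J * ?Z) = ?J" using e B by simp
    next
      assume "adj ?Z * (?J * ?Z) = ?J"
      then have h: "adj B * ((adj g * g) * B) = adj B * B" using e B by simp
      have aBi: "adj Bi * adj B = 1\<^sub>m n" using adj_mult[OF B(1) Bi(1)] Bi(2) adj_one by simp
      have gg: "adj g * g \<in> carrier_mat n n" using g by simp
      have ca: "adj Bi * (adj B * x) = x" if "x \<in> carrier_mat n n" for x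
        using assoc_mult_mat[of "adj Bi" n n "adj B" n x n] Bi aB that aBi by simp
      have "(adj g * g) * B = B" using ca[of "(adj g * g) * B"] ca[OF B(1)] h gg B by simp
      then have "(adj g * g) * B * Bi = B * Bi" by simp
      moreover have "(adj g * g) * B * Bi = (adj g * g) * (B * Bi)" using gg B Bi by (intro assoc_mult_mat[of _ n n _ n _ n]) auto
      ultimately have "adj g * g * 1\<^sub>m n = 1\<^sub>m n" using Bi(2) by metis
      then show "adj g * g = 1\<^sub>m n" by (simp only: right_mult_one_mat[OF gg])
    qed
  qed
  have cols: "g * A = A * ?C \<longleftrightarrow> (\<forall>i<n. \<forall>j<a + b. (Bi * (g * B)) $$ (i, j) = (if i < a + b then ?C $$ (i, j) else 0))" if g: "g \<in> carrier_mat n n" for g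
  proof -
    let ?Z = "Bi * (g * B)" and ?E = "mat n ?s (\<lambda>(i, j). if i < ?s then ?C $$ (i, j) else 0)"
    let ?ZA = "mat n ?s (\<lambda>(i, j). ?Z $$ (i, j))"
    have gB: "g * B \<in> carrier_mat n n" "g * A \<in> carrier_mat n ?s" using g B Ac by simp_all
    have e1: "Bi * (g * A) = ?ZA"
    proof (rule eq_matI)
      fix i j assume "i < dim_row ?ZA" "j < dim_col ?ZA"
      then have ij: "i < n" "j < ?s" "j < n" using sn by auto
      have "(g * A) $$ (k, j) = (g * B) $$ (k, j)" if "k < n" for k
        using that ij by (simp only: mat_mult_index[OF g Ac that ij(2)] mat_mult_index[OF g B(1) that ij(3)]) (simp add: A_def)
      then show "(Bi * (g * A)) $$ (i, j) = ?ZA $$ (i, j)"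
        using ij by (simp add: mat_mult_index[OF Bi(1) gB(2) ij(1,2)] mat_mult_index[OF Bi(1) gB(1) ij(1,3)] del: index_mult_mat)
    qed (use Bi Ac in auto)
    have e2: "B * ?E = A * ?C"
    proof (rule eq_matI)
      fix i j assume "i < dim_row (A * ?C)" "j < dim_col (A * ?C)"
      then have ij: "i < n" "j < ?s" using Ac C by auto
      have "(B * ?E) $$ (i, j) = (\<Sum>k<?s + (n - ?s). B $$ (i, k) * ?E $$ (k, j))"
        using ij sn by (subst mat_mult_index[OF B(1), of _ ?s]) auto
      also have "\<dots> = (\<Sum>k<?s. A $$ (i, k) * ?C $$ (k, j))"
        unfolding sum_lessThan_add using ij sn by (auto simp: A_def intro!: sum.neutral)
      also have "\<dots> = (A * ?C) $$ (i, j)" using ij by (intro mat_mult_index[OF Ac C, symmetric])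
      finally show "(B * ?E) $$ (i, j) = (A * ?C) $$ (i, j)" .
    qed (use B Ac C in auto)
    have "g * A = A * ?C \<longleftrightarrow> ?ZA = ?E"
    proof
      assume "g * A = A * ?C"
      then have "?ZA = Bi * (B * ?E)" using e1 e2 by simp
      then show "?ZA = ?E" using BBx(2)[of ?E ?s] by simp
    next
      assume "?ZA = ?E"
      then have "B * (Bi * (g * A)) = A * ?C" using e1 e2 by simp
      then show "g * A = A * ?C" using BBx(1)[OF gB(2)] by simp
    qed
    also have "\<dots> \<longleftrightarrow> (\<forall>i<n. \<forall>j<a + b. ?Z $$ (i, j) = (if i < a + b then ?C $$ (i, j) else 0))"
      by (auto simp: mat_eq_iff simp del: index_mult_mat)
    finally show ?thesis .
  qed
  have bij: "bij_betw (\<lambda>g. Bi * (g * B)) ?G0 ?GB"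
  proof (rule bij_betwI[where g = "\<lambda>XX. B * (XX * Bi)"])
    have inv1: "Bi * (B * (XX * Bi) * B) = XX" "B * (XX * Bi) \<in> carrier_mat n n" if XX: "XX \<in> carrier_mat n n" for XX
    proof -
      have c: "XX * Bi \<in> carrier_mat n n" using XX Bi by simp
      have "B * (XX * Bi) * B = B * (XX * Bi * B)" using B c by (intro assoc_mult_mat[of _ n n _ n _ n]) auto
      also have "XX * Bi * B = XX * (Bi * B)" using XX Bi B by (intro assoc_mult_mat[of _ n n _ n _ n]) auto
      finally have "B * (XX * Bi) * B = B * XX" using XX Bi by simp
      then show "Bi * (B * (XX * Bi) * B) = XX" using BBx(2)[OF XX] by simp
      show "B * (XX * Bi) \<in> carrier_mat n n" using B c by simp
    qed
    show "(\<lambda>g. Bi * (g * B)) \<in> ?G0 \<rightarrow> ?GB"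
    proof
      fix g assume g: "g \<in> ?G0"
      then have gc: "g \<in> carrier_mat n n" "adj g * g = 1\<^sub>m n" using Un_D by auto
      have "Bi * (g * B) \<in> carrier_mat n n" using Bi gc B by simp
      moreover have "adj (Bi * (g * B)) * (?J * (Bi * (g * B))) = ?J" using aux[OF gc(1)] gc(2) by (rule iffD1)
      moreover have "\<forall>i<n. \<forall>j<a + b. (Bi * (g * B)) $$ (i, j) = (if i < a + b then ?C $$ (i, j) else 0)"
      proof -
        have gA: "g * A = A * ?C" using g by simp
        show ?thesis by (rule iffD1[OF cols[OF gc(1)] gA])
      qed
      ultimately show "Bi * (g * B) \<in> ?GB" by (simp del: index_mult_mat)
    qed
    show "(\<lambda>XX. B * (XX * Bi)) \<in> ?GB \<rightarrow> ?G0"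
    proof
      fix XX assume XX: "XX \<in> ?GB"
      then have c: "XX \<in> carrier_mat n n" by simp
      note i = inv1[OF c]
      have "adj (B * (XX * Bi)) * (B * (XX * Bi)) = 1\<^sub>m n"
        unfolding aux[OF i(2)] i(1) using XX by simp
      then have 1: "B * (XX * Bi) \<in> UG n" using i(2) by (simp add: UG_def)
      have "B * (XX * Bi) * A = A * ?C" unfolding cols[OF i(2)] i(1) using XX by blast
      then show "B * (XX * Bi) \<in> ?G0" using 1 by simp
    qed
    show "B * (Bi * (g * B) * Bi) = g" if "g \<in> ?G0" for g
    proof -
      have gc: "g \<in> carrier_mat n n" using that Un_D by auto
      have "Bi * (g * B) * Bi = Bi * (g * B * Bi)" using Bi gc B by (intro assoc_mult_mat[of _ n n _ n _ n]) auto
      also have "g * B * Bi = g * (B * Bi)" using Bi gc B by (intro assoc_mult_mat[of _ n n _ n _ n]) auto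
      finally have "Bi * (g * B) * Bi = Bi * g" using Bi gc by simp
      then show ?thesis using BBx(1)[OF gc] by simp
    qed
    show "Bi * (B * (XX * Bi) * B) = XX" if "XX \<in> ?GB" for XX using that inv1 by simp
  qed
  have wG: "(\<Sum>g\<in>?G0. ?w g) = (\<Sum>XX\<in>?GB. ?w XX)"
  proof -
    have "?w g = ?w (Bi * (g * B))" if "g \<in> ?G0" for g
    proof -
      have gc: "g \<in> carrier_mat n n" using that Un_D by auto
      have e: "Bi * (g * B) = Bi * g * B" using Bi gc B by (intro assoc_mult_mat[symmetric, of _ n n _ n _ n]) auto
      have "similar_mat (Bi * g * B) g"
        by (rule similar_matI[where P = Bi and Q = B and n = n]) (use Bi B gc in auto)
      then show ?thesis unfolding e by (simp add: char_poly_similar)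
    qed
    then have "(\<Sum>g\<in>?G0. ?w g) = (\<Sum>g\<in>?G0. ?w (Bi * (g * B)))" by (intro sum.cong refl)
    also have "\<dots> = (\<Sum>XX\<in>?GB. ?w XX)" by (rule sum.reindex_bij_betw[OF bij])
    finally show ?thesis .
  qed
  have C1: "comp_mat rp \<in> carrier_mat a a" "det (comp_mat rp) \<noteq> 0"
    using comp_mat_carrier[of rp] rr det_of_char_poly[of "comp_mat rp" a] by (auto simp: char_poly_comp_mat)
  have C2: "comp_mat ?d \<in> carrier_mat b b" "det (comp_mat ?d) \<noteq> 0"
    using comp_mat_carrier[of ?d] md d(2) det_of_char_poly[of "comp_mat ?d" b] by (auto simp: char_poly_comp_mat)
  have BA: "of_nat (card (UG m)) * (\<Sum>XX\<in>?GB. ?w XX) =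
     of_nat (card ?GB) * (mel (ev (char_poly (comp_mat rp)) + image_mset phi (ev (char_poly (comp_mat rp))) + ev (char_poly (comp_mat ?d))) * (\<Sum>P\<in>UG m. ?w P))"
    unfolding n
    by (rule block_average(2)[OF C1 C2 Tt_carrier det_Tt[OF c]])
       (use rr d(2) in \<open>auto simp: Cmat_def Let_def\<close>)
  have cG: "card ?GB = S" using bij_betw_same_card[OF bij] G0 by simp
  have "of_nat S * (of_nat (card (UG m)) * (\<Sum>x\<in>?N. ?w (fst x))) = of_nat (card (UG m)) * (of_nat S * (\<Sum>x\<in>?N. ?w (fst x)))"
    by (rule mult.left_commute)
  also have "\<dots> = of_nat (card (UG m)) * (of_nat (card (UG n)) * (\<Sum>XX\<in>?GB. ?w XX))" unfolding e1 wG ..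
  also have "\<dots> = of_nat (card (UG n)) * (of_nat (card (UG m)) * (\<Sum>XX\<in>?GB. ?w XX))" by (rule mult.left_commute)
  also have "\<dots> = of_nat S * (of_nat (card (UG n)) * (mel (ev rp + image_mset phi (ev rp) + ev ?d) * (\<Sum>P\<in>UG m. ?w P)))"
    unfolding BA cG char_poly_comp_mat[OF rr(1)] char_poly_comp_mat[OF md(1)] by (rule mult.left_commute)
  finally have "cst (real S) * (of_nat (card (UG m)) * (\<Sum>x\<in>?N. ?w (fst x))) = cst (real S) * (of_nat (card (UG n)) * (mel (ev rp + image_mset phi (ev rp) + ev ?d) * (\<Sum>P\<in>UG m. ?w P)))"
    by (simp only: cst_of_nat)
  moreover have "real S \<noteq> 0" using G0 by simp
  ultimately have "of_nat (card (UG m)) * (\<Sum>x\<in>?N. ?w (fst x)) = of_nat (card (UG n)) * (mel (ev rp + image_mset phi (ev rp) + ev ?d) * (\<Sum>P\<in>UG m. ?w P))"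
    by (rule cst_cancel[rotated])
  moreover have "(\<Sum>(g, v)\<in>?N. ?w g) = (\<Sum>x\<in>?N. ?w (fst x))" by (rule sum.cong[OF refl]) (auto simp: case_prod_beta)
  ultimately show ?thesis by metis
qed

section \<open>The generating function of the unitary groups\<close>

definition Ff :: "'a alg_closure malg fps" where
  "Ff = Abs_fps (\<lambda>n. cst (1 / real (card (UG n))) * (\<Sum>g\<in>UG n. mel (ev (char_poly g))))"

lemma finite_polys: "finite (polys a)"
  using bij_betw_finite[OF bij_ev[of a]] P.finite_inv_sq by simp

lemma sum_nested_Sigma:
  assumes "finite A" "\<And>a. a \<in> A \<Longrightarrow> finite (B a)" "\<And>b. finite (C b)" "\<And>a. finite (D a)"
  shows "(\<Sum>(a, b, c, d)\<in>(SIGMA a:A. SIGMA b:B a. C b \<times> D a). F a b c d) = (\<Sum>a\<in>A. \<Sum>b\<in>B a. \<Sum>c\<in>C b. \<Sum>d\<in>D a. F a b c d)"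
  using assms by (simp add: sum.Sigma)

lemma sum_prod_factor:
  fixes K :: "'c :: comm_ring_1"
  shows "(\<Sum>b\<le>m. \<Sum>c\<in>C b. \<Sum>d\<in>D. K * (F d * G c * H b)) = K * (sum F D * (\<Sum>b\<le>(m :: nat). sum G (C b) * H b))"
proof -
  have "(\<Sum>d\<in>D. K * (F d * G c * H b)) = K * (sum F D * (G c * H b))" for b c
    by (simp add: sum_distrib_left sum_distrib_right mult.assoc)
  moreover have "(\<Sum>c\<in>C b. K * (sum F D * (G c * H b))) = K * (sum F D * (sum G (C b) * H b))" for b
    by (simp only: sum_distrib_left[symmetric] sum_distrib_right[symmetric])
  ultimately show ?thesis by (simp only: sum_distrib_left[symmetric])
qed

text \<open>The factor q^(2n) on the left counts all vectors v for each g. Sorting the pairs by (a,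
  b, c, rp) and applying \<open>Nset_sum\<close> with m = n - 2a - b, the sum over \<open>rp\<close>
  gives the coefficient of R at 2a, that over \<open>c\<close> the one of Phi at b, and U(m) the one
  of F at m.\<close>

theorem star: "scale ((real q)\<^sup>2) Ff = P.Rf * (Phf * Ff)"
proof (rule fps_ext)
  fix n
  let ?w = "\<lambda>g. mel (ev (char_poly g))"
  let ?I = "SIGMA a:{a. 2 * a \<le> n}. SIGMA b:{..n - 2 * a}. hseqs b \<times> polys a"
  let ?\<tau> = "\<lambda>(g, v). let c = cs n g v; rp = (THE rp. mpT n g (zvec n g v) rp) in (degree rp, degree (mp_seq c), c, rp)"
  have U: "cst (1 / real (card (UG m))) * of_nat (card (UG m)) = (1 :: 'a alg_closure malg)" for m
    using card_Un_pos[of m] by (simp add: cst_mult flip: cst_of_nat)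
  \<comment> \<open>Minimal polynomials exist and are unique, so the definite description is
    meaningful and the fibres of this classifying map are the sets \<open>Nset\<close>.\<close>
  have tau: "(g, v) \<in> Nset n c rp \<longleftrightarrow> ?\<tau> (g, v) = (degree rp, degree (mp_seq c), c, rp)" if gv: "g \<in> UG n" "v \<in> Vs n" for g v c rp
  proof -
    have z: "zvec n g v \<in> Vs n" using gv by (simp add: zvec_def pact_Vs)
    obtain r0 where r0: "mpT n g (zvec n g v) r0" using mpT_exists[OF z] by blast
    have the: "(THE rp. mpT n g (zvec n g v) rp) = r0" using r0 by (rule the_equality) (rule M.is_mp_unique[OF _ r0])
    have u: "mpT n g (zvec n g v) rp \<longleftrightarrow> r0 = rp" using r0 M.is_mp_unique[OF r0] by metis
    have N: "(g, v) \<in> Nset n c rp \<longleftrightarrow> cs n g v = c \<and> r0 = rp"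
      unfolding Nset_def mem_Collect_eq prod.case u using gv by metis
    have T: "?\<tau> (g, v) = (degree r0, degree (mp_seq (cs n g v)), cs n g v, r0)"
      by (simp only: Let_def prod.case the)
    show ?thesis unfolding N T prod.inject by metis
  qed
  have fI: "finite ?I"
  proof (intro finite_SigmaI finite_cartesian_product finite_hseqs finite_polys)
    show "finite {a. 2 * a \<le> n}" by (rule finite_subset[of _ "{..n}"]) auto
  qed simp
  have tI: "?\<tau> ` (UG n \<times> Vs n) \<subseteq> ?I"
  proof (rule image_subsetI)
    fix x assume "x \<in> UG n \<times> Vs n"
    then obtain g v where x: "x = (g, v)" and gv: "g \<in> UG n" "v \<in> Vs n" by auto
    have z: "zvec n g v \<in> Vs n" using gv by (simp add: zvec_def pact_Vs)
    obtain r0 where r0: "mpT n g (zvec n g v) r0" using mpT_exists[OF z] by blast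
    have N: "(g, v) \<in> Nset n (cs n g v) r0" using gv r0 by (simp add: Nset_def)
    have c: "cs n g v \<in> hseqs (degree (mp_seq (cs n g v)))" using cs_mp[OF gv] by simp
    have rp: "r0 \<in> polys (degree r0)" using mpT_coeff_0[OF gv(1) z r0] r0 by (simp add: polys_def M.is_mp_def)
    have le: "2 * degree r0 + degree (mp_seq (cs n g v)) \<le> n" using frames_le[OF Nset_frame(1)[OF N c refl]] .
    have "?\<tau> x = (degree r0, degree (mp_seq (cs n g v)), cs n g v, r0)" using tau[OF gv, of "cs n g v" r0] N x by simp
    then show "?\<tau> x \<in> ?I" using c rp le by auto
  qed
  have "of_nat ((q ^ 2) ^ n) * (\<Sum>g\<in>UG n. ?w g) = (\<Sum>x\<in>UG n \<times> Vs n. ?w (fst x))"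
  proof -
    have "(\<Sum>x\<in>UG n \<times> Vs n. ?w (fst x)) = (\<Sum>g\<in>UG n. \<Sum>v\<in>Vs n. ?w g)"
      unfolding sum.cartesian_product by (rule sum.cong[OF refl]) (auto simp: case_prod_beta)
    then show ?thesis by (simp only: sum_constant card_Vs sum_distrib_left)
  qed
  also have "\<dots> = (\<Sum>y\<in>?I. \<Sum>x\<in>{x \<in> UG n \<times> Vs n. ?\<tau> x = y}. ?w (fst x))"
    by (rule sum.group[symmetric]) (use finite_Un card_Vs fI tI in auto)
  also have "\<dots> = (\<Sum>(a, b, c, rp)\<in>?I. \<Sum>(g, v)\<in>Nset n c rp. ?w g)"
  proof (rule sum.cong[OF refl])
    fix y assume "y \<in> ?I"
    then obtain a b c rp where y: "y = (a, b, c, rp)" and cr: "c \<in> hseqs b" "rp \<in> polys a" by auto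
    have dg: "degree rp = a" "degree (mp_seq c) = b" using cr hseqs_mp by (auto simp: polys_def)
    have "{x \<in> UG n \<times> Vs n. ?\<tau> x = y} = Nset n c rp"
    proof (intro equalityI subsetI)
      fix x assume "x \<in> {x \<in> UG n \<times> Vs n. ?\<tau> x = y}"
      then show "x \<in> Nset n c rp" using tau[of "fst x" "snd x" c rp] y dg by auto
    next
      fix x assume x: "x \<in> Nset n c rp"
      then have "fst x \<in> UG n" "snd x \<in> Vs n" by (auto simp: Nset_def)
      then show "x \<in> {x \<in> UG n \<times> Vs n. ?\<tau> x = y}" using tau[of "fst x" "snd x" c rp] x y dg by (auto simp: mem_Times_iff)
    qed
    then show "(\<Sum>x\<in>{x \<in> UG n \<times> Vs n. ?\<tau> x = y}. ?w (fst x)) = (case y of (a, b, c, rp) \<Rightarrow> \<Sum>(g, v)\<in>Nset n c rp. ?w g)"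
      by (simp add: y case_prod_beta)
  qed
  also have "\<dots> = (\<Sum>(a, b, c, rp)\<in>?I. of_nat (card (UG n)) * (mel (ev rp + image_mset phi (ev rp)) * mel (ev (mp_seq c)) * fps_nth Ff (n - 2 * a - b)))"
  proof (rule sum.cong[OF refl])
    fix y assume "y \<in> ?I"
    then obtain a b c rp where y: "y = (a, b, c, rp)" and cr: "c \<in> hseqs b" "rp \<in> polys a" and ab: "2 * a \<le> n" "b \<le> n - 2 * a" by auto
    define m where "m = n - 2 * a - b"
    have n: "n = a + b + m + a" using ab by (simp add: m_def)
    note NS = Nset_sum[OF cr n]
    have "(\<Sum>(g, v)\<in>Nset n c rp. ?w g) = cst (1 / real (card (UG m))) * of_nat (card (UG m)) * (\<Sum>(g, v)\<in>Nset n c rp. ?w g)"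
      unfolding U by simp
    also have "\<dots> = of_nat (card (UG n)) * (mel (ev rp + image_mset phi (ev rp)) * mel (ev (mp_seq c)) * fps_nth Ff m)"
      unfolding mult.assoc NS by (simp add: Ff_def mel_add mult_ac)
    finally show "(case y of (a, b, c, rp) \<Rightarrow> \<Sum>(g, v)\<in>Nset n c rp. ?w g) =
        (case y of (a, b, c, rp) \<Rightarrow> of_nat (card (UG n)) * (mel (ev rp + image_mset phi (ev rp)) * mel (ev (mp_seq c)) * fps_nth Ff (n - 2 * a - b)))"
      by (simp add: y m_def)
  qed
  also have "\<dots> = of_nat (card (UG n)) * fps_nth (P.Rf * (Phf * Ff)) n"
  proof -
    have R: "fps_nth P.Rf (2 * a) = (\<Sum>rp\<in>polys a. mel (ev rp + image_mset phi (ev rp)))" for a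
    proof -
      have "(\<Sum>\<rho>\<in>inv_msets (- {0}) (phi \<circ> phi) a. mel (\<rho> + image_mset phi \<rho>)) = (\<Sum>rp\<in>polys a. mel (ev rp + image_mset phi (ev rp)))"
        by (rule sum.reindex_bij_betw[OF bij_ev, symmetric])
      then show ?thesis by (simp add: P.Rf_def)
    qed
    have "(\<Sum>(a, b, c, rp)\<in>?I. of_nat (card (UG n)) * (mel (ev rp + image_mset phi (ev rp)) * mel (ev (mp_seq c)) * fps_nth Ff (n - 2 * a - b)))
      = (\<Sum>a | 2 * a \<le> n. \<Sum>b\<le>n - 2 * a. \<Sum>c\<in>hseqs b. \<Sum>rp\<in>polys a. of_nat (card (UG n)) * (mel (ev rp + image_mset phi (ev rp)) * mel (ev (mp_seq c)) * fps_nth Ff (n - 2 * a - b)))"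
      by (rule sum_nested_Sigma) (auto intro: finite_hseqs finite_polys finite_subset[of "{a. 2 * a \<le> n}" "{..n}"])
    also have "\<dots> = of_nat (card (UG n)) * (\<Sum>a | 2 * a \<le> n. fps_nth P.Rf (2 * a) * fps_nth (Phf * Ff) (n - 2 * a))"
    proof -
      have "(\<Sum>b\<le>n - 2 * a. \<Sum>c\<in>hseqs b. \<Sum>rp\<in>polys a. of_nat (card (UG n)) * (mel (ev rp + image_mset phi (ev rp)) * mel (ev (mp_seq c)) * fps_nth Ff (n - 2 * a - b)))
         = of_nat (card (UG n)) * (fps_nth P.Rf (2 * a) * fps_nth (Phf * Ff) (n - 2 * a))" for a
        unfolding R fps_mult_nth sum_prod_factor by (simp add: Phf_def atMost_atLeast0)
      then show ?thesis by (simp add: sum_distrib_left)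
    qed
    also have "(\<Sum>a | 2 * a \<le> n. fps_nth P.Rf (2 * a) * fps_nth (Phf * Ff) (n - 2 * a)) = (\<Sum>l\<in>(\<lambda>a. 2 * a) ` {a. 2 * a \<le> n}. fps_nth P.Rf l * fps_nth (Phf * Ff) (n - l))"
      by (subst sum.reindex) (auto simp: inj_on_def)
    also have "\<dots> = (\<Sum>l=0..n. fps_nth P.Rf l * fps_nth (Phf * Ff) (n - l))"
    proof (rule sum.mono_neutral_left)
      show "\<forall>l\<in>{0..n} - (\<lambda>a. 2 * a) ` {a. 2 * a \<le> n}. fps_nth P.Rf l * fps_nth (Phf * Ff) (n - l) = 0"
      proof
        fix l assume l: "l \<in> {0..n} - (\<lambda>a. 2 * a) ` {a. 2 * a \<le> n}"
        then have "odd l" by (auto elim!: evenE)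
        then show "fps_nth P.Rf l * fps_nth (Phf * Ff) (n - l) = 0" by (simp add: P.Rf_def)
      qed
    qed auto
    finally show ?thesis by (simp add: fps_mult_nth)
  qed
  finally have e: "of_nat ((q ^ 2) ^ n) * (\<Sum>g\<in>UG n. ?w g) = of_nat (card (UG n)) * fps_nth (P.Rf * (Phf * Ff)) n" .
  have "fps_nth (scale ((real q)\<^sup>2) Ff) n = cst (1 / real (card (UG n))) * (of_nat ((q ^ 2) ^ n) * (\<Sum>g\<in>UG n. ?w g))"
    unfolding cst_of_nat[symmetric] by (simp add: Ff_def mult_ac)
  also have "\<dots> = fps_nth (P.Rf * (Phf * Ff)) n" unfolding e mult.assoc[symmetric] U by simp
  finally show "fps_nth (scale ((real q)\<^sup>2) Ff) n = fps_nth (P.Rf * (Phf * Ff)) n" .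
qed

lemma Ff_0: "fps_nth Ff 0 = 1"
proof -
  have "UG 0 = {1\<^sub>m 0}"
  proof (intro equalityI subsetI)
    fix g assume "g \<in> UG 0"
    then have "g \<in> carrier_mat 0 0" by (rule Un_D)
    then show "g \<in> {1\<^sub>m 0}" by (auto intro!: eq_matI)
  qed (use Un_one in auto)
  moreover have "char_poly (1\<^sub>m 0 :: 'a mat) = 1" by (simp add: char_poly_def char_poly_matrix_def)
  moreover have "ev 1 = {#}" using size_ev[of 1] by simp
  ultimately show ?thesis by (simp add: Ff_def mel_def flip: zero_multiset_def)
qed

lemma Ff_logd: "logd Ff (Abs_fps (\<lambda>c. if c = 0 then 0 else cst (1 / (real q ^ c - (-1) ^ c)) * P.Mf c))"
  and Ff_rec: "Ff = scale (1 / real q) P.Lf * scale (- 1 / real q) Ff"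
proof -
  have "scale ((real q)\<^sup>2) Ff * P.Lf = P.Rf * (Phf * P.Lf) * Ff" unfolding star by (simp add: mult_ac)
  then have eq: "scale ((real q)\<^sup>2) Ff * P.Lf = (P.Rf * scale (real q) P.Lf) * Ff" unfolding Phf_Lf .
  have q1: "real q > 1" using q_gt1 by simp
  show "logd Ff (Abs_fps (\<lambda>c. if c = 0 then 0 else cst (1 / (real q ^ c - (-1) ^ c)) * P.Mf c))"
    by (rule P.functional_solution(1)[OF q1 eq Ff_0])
  show "Ff = scale (1 / real q) P.Lf * scale (- 1 / real q) Ff"
    by (rule P.functional_solution(2)[OF q1 eq Ff_0])
qed

end

section \<open>Newton identities and classes of unitary polynomials\<close>

text \<open>With \<open>B\<^sub>j\<close> the coefficients of the adjugate of \<open>x I - A\<close>, the identity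
  \<open>(x I - A) adj (x I - A) = \<chi> I\<close> reads \<open>B\<^sub>j = A B\<^sub>j\<^sub>+\<^sub>1 + \<chi>\<^sub>j\<^sub>+\<^sub>1 I\<close>, and the trace of the adjugate
  is the derivative of \<open>\<chi>\<close>.\<close>

lemma newton_char_poly:
  fixes A :: "'c::field mat"
  assumes A: "A \<in> carrier_mat n n"
  shows "of_nat (Suc j) * poly.coeff (char_poly A) (Suc j) =
    (\<Sum>i<n. poly.coeff (char_poly A) (Suc j + i) * (\<Sum>u<n. (A ^\<^sub>m i) $$ (u, u)))"
proof -
  let ?M = "char_poly_matrix A" and ?c = "\<lambda>j. poly.coeff (char_poly A) j"
  have M: "?M \<in> carrier_mat n n" using A by simp
  note adj = adj_mat[OF M]
  define B where "B j = mat n n (\<lambda>(u, v). poly.coeff (adj_mat ?M $$ (u, v)) j)" for j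
  have Bc: "B j \<in> carrier_mat n n" for j by (simp add: B_def)
  have Pc: "A ^\<^sub>m i \<in> carrier_mat n n" for i using A by (rule pow_carrier_mat)
  \<comment> \<open>A degree bound for all entries of the adjugate: beyond it \<open>B j\<close>
    vanishes, so iterating the recursion terminates.\<close>
  define N where "N = Max (insert 0 ((\<lambda>(u, v). degree (adj_mat ?M $$ (u, v))) ` ({..<n} \<times> {..<n})))"
  have Bz: "B j = 0\<^sub>m n n" if "j > N" for j
  proof (rule eq_matI)
    fix u v assume "u < dim_row (0\<^sub>m n n :: 'c mat)" "v < dim_col (0\<^sub>m n n :: 'c mat)"
    then have uv: "u < n" "v < n" by auto
    then have "degree (adj_mat ?M $$ (u, v)) \<le> N" unfolding N_def by (intro Max_ge) auto
    then show "B j $$ (u, v) = 0\<^sub>m n n $$ (u, v)" using that uv by (simp add: B_def coeff_eq_0)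
  qed (simp_all add: B_def)
  have rec: "B j $$ (u, v) = (A * B (Suc j)) $$ (u, v) + (if u = v then ?c (Suc j) else 0)" if uv: "u < n" "v < n" for u v j
  proof -
    have "(?M * adj_mat ?M) $$ (u, v) = (\<Sum>w<n. ?M $$ (u, w) * adj_mat ?M $$ (w, v))"
      using uv by (intro mat_mult_index[OF M adj(1)])
    also have "\<dots> = (\<Sum>w<n. (if u = w then 1 else 0) * pCons 0 (adj_mat ?M $$ (w, v))) - (\<Sum>w<n. smult (A $$ (u, w)) (adj_mat ?M $$ (w, v)))"
      unfolding sum_subtractf[symmetric] using uv A by (intro sum.cong) (auto simp: char_poly_matrix_def)
    also have "(\<Sum>w<n. (if u = w then 1 else 0) * pCons 0 (adj_mat ?M $$ (w, v))) = pCons 0 (adj_mat ?M $$ (u, v))"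
      using uv(1) by (rule delta_sum'(2))
    finally have "poly.coeff ((?M * adj_mat ?M) $$ (u, v)) (Suc j) =
       poly.coeff (adj_mat ?M $$ (u, v)) j - (\<Sum>w<n. A $$ (u, w) * poly.coeff (adj_mat ?M $$ (w, v)) (Suc j))"
      by (simp add: coeff_sum)
    moreover have "(?M * adj_mat ?M) $$ (u, v) = (if u = v then char_poly A else 0)"
      unfolding adj(2) using uv by (simp add: char_poly_def)
    moreover have "(A * B (Suc j)) $$ (u, v) = (\<Sum>w<n. A $$ (u, w) * poly.coeff (adj_mat ?M $$ (w, v)) (Suc j))"
      using uv by (simp only: mat_mult_index[OF A Bc]) (simp add: B_def)
    ultimately show ?thesis using uv by (auto simp: B_def split: if_splits)
  qed
  define T where "T i j = (\<Sum>u<n. (A ^\<^sub>m i * B j) $$ (u, u))" for i j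
  define t where "t i = (\<Sum>u<n. (A ^\<^sub>m i) $$ (u, u))" for i
  have Trec: "T i j = T (Suc i) (Suc j) + ?c (Suc j) * t i" for i j
  proof -
    have "(A ^\<^sub>m i * B j) $$ (u, u) = (A ^\<^sub>m Suc i * B (Suc j)) $$ (u, u) + ?c (Suc j) * (A ^\<^sub>m i) $$ (u, u)" if u: "u < n" for u
    proof -
      have AB: "A * B (Suc j) \<in> carrier_mat n n" using A Bc by simp
      have "(A ^\<^sub>m i * B j) $$ (u, u) = (\<Sum>w<n. (A ^\<^sub>m i) $$ (u, w) * B j $$ (w, u))" using u by (intro mat_mult_index[OF Pc Bc])
      also have "\<dots> = (\<Sum>w<n. (A ^\<^sub>m i) $$ (u, w) * (A * B (Suc j)) $$ (w, u)) + (\<Sum>w<n. (if w = u then 1 else 0) * (?c (Suc j) * (A ^\<^sub>m i) $$ (u, w)))"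
        unfolding sum.distrib[symmetric] using u by (intro sum.cong refl) (auto simp: rec distrib_left simp del: index_mult_mat)
      also have "(\<Sum>w<n. (if w = u then 1 else 0) * (?c (Suc j) * (A ^\<^sub>m i) $$ (u, w))) = ?c (Suc j) * (A ^\<^sub>m i) $$ (u, u)"
        using u by (rule delta_sum')
      also have "(\<Sum>w<n. (A ^\<^sub>m i) $$ (u, w) * (A * B (Suc j)) $$ (w, u)) = (A ^\<^sub>m i * (A * B (Suc j))) $$ (u, u)"
        using u by (intro mat_mult_index[OF Pc AB, symmetric])
      also have "A ^\<^sub>m i * (A * B (Suc j)) = A ^\<^sub>m Suc i * B (Suc j)"
        using assoc_mult_mat[OF Pc A Bc, of i "Suc j"] by simp
      finally show ?thesis .
    qed
    then show ?thesis by (simp add: T_def t_def sum.distrib sum_distrib_left)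
  qed
  have Tsum: "T 0 j = T m (j + m) + (\<Sum>i<m. ?c (Suc j + i) * t i)" for m
  proof (induction m)
    case (Suc m)
    then show ?case using Trec[of m "j + m"] by simp
  qed simp
  have Tz: "T i j = 0" if "j > N" for i j
    using Bz[OF that] by (simp add: T_def right_mult_zero_mat[OF Pc])
  have cz: "?c i = 0" if "i > n" for i
    using degree_monic_char_poly[OF A] that by (intro coeff_eq_0) simp
  have "T 0 j = (\<Sum>i<Suc (N + n). ?c (Suc j + i) * t i)"
    using Tsum[of "Suc (N + n)"] Tz[of "j + Suc (N + n)" "Suc (N + n)"] by simp
  also have "\<dots> = (\<Sum>i<n. ?c (Suc j + i) * t i)"
    by (rule sum.mono_neutral_right) (auto intro!: cz)
  finally have T0: "T 0 j = (\<Sum>i<n. ?c (Suc j + i) * t i)" .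
  have "of_nat (Suc j) * ?c (Suc j) = poly.coeff (pderiv (char_poly A)) j" by (simp add: coeff_pderiv)
  also have "\<dots> = (\<Sum>u<n. poly.coeff (char_poly (mat_delete A u u)) j)"
    by (simp add: pderiv_char_poly[OF A] coeff_sum)
  also have "\<dots> = (\<Sum>u<n. B j $$ (u, u))"
  proof (rule sum.cong[OF refl])
    fix u assume "u \<in> {..<n}"
    then have u: "u < n" by simp
    have "char_poly_matrix (mat_delete A u u) = mat_delete ?M u u"
      using A u by (intro eq_matI) (auto simp: char_poly_matrix_def mat_delete_def)
    then have "char_poly (mat_delete A u u) = cofactor ?M u u"
      by (simp add: char_poly_def cofactor_def flip: mult_2)
    also have "\<dots> = adj_mat ?M $$ (u, u)" using u carrier_matD[OF M] by (simp add: adj_mat_def)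
    finally have "char_poly (mat_delete A u u) = adj_mat ?M $$ (u, u)" .
    then show "poly.coeff (char_poly (mat_delete A u u)) j = B j $$ (u, u)" using u by (simp add: B_def)
  qed
  also have "\<dots> = T 0 j"
    using A Bc[of j] by (simp add: T_def)
  finally show ?thesis unfolding T0 t_def .
qed

section \<open>Power sums from the logarithmic derivative\<close>

text \<open>For a product of factors 1 - \<theta> X this is the generating function of the power
  sums of the \<theta>, without constant term.\<close>

definition LD :: "'c::field fps \<Rightarrow> 'c fps" where
  "LD y = - (fps_X * fps_deriv y) * inverse y"

lemma LD_mult: "fps_nth y 0 \<noteq> 0 \<Longrightarrow> LD y * y = - (fps_X * fps_deriv y)"
  by (simp add: LD_def mult.assoc inverse_mult_eq_1)

lemma LD_rec:
  assumes y: "fps_nth y 0 = 1"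
  shows "fps_nth (LD y) 0 = 0"
    "j \<ge> 1 \<Longrightarrow> fps_nth (LD y) j = - (of_nat j * fps_nth y j) - (\<Sum>i=1..<j. fps_nth (LD y) i * fps_nth y (j - i))"
proof -
  have e: "LD y * y = - (fps_X * fps_deriv y)" using y by (simp add: LD_mult)
  show 0: "fps_nth (LD y) 0 = 0" by (simp add: LD_def)
  assume j: "j \<ge> 1"
  have d: "fps_nth (fps_X * fps_deriv y) j = of_nat j * fps_nth y j" by (cases j) simp_all
  have "fps_nth (LD y * y) j = - (of_nat j * fps_nth y j)" by (simp only: e fps_neg_nth d)
  then have "(\<Sum>i=0..j. fps_nth (LD y) i * fps_nth y (j - i)) = - (of_nat j * fps_nth y j)"
    by (simp only: fps_mult_nth)
  also have "{0..j} = insert 0 (insert j {1..<j})" using j by auto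
  also have "(\<Sum>i\<in>insert 0 (insert j {1..<j}). fps_nth (LD y) i * fps_nth y (j - i)) =
     fps_nth (LD y) j + (\<Sum>i=1..<j. fps_nth (LD y) i * fps_nth y (j - i))"
    using j 0 y by (subst sum.insert; simp)+
  finally show "fps_nth (LD y) j = - (of_nat j * fps_nth y j) - (\<Sum>i=1..<j. fps_nth (LD y) i * fps_nth y (j - i))"
    by (simp add: algebra_simps)
qed

definition rchar :: "'c::field mat \<Rightarrow> 'c fps" where
  "rchar A = Abs_fps (\<lambda>j. if j \<le> dim_row A then poly.coeff (char_poly A) (dim_row A - j) else 0)"

text \<open>Newton's identity for the coefficient n - i is the recursion \<open>LD_rec\<close> in
  disguise. The bound i < n matters because \<open>newton_char_poly\<close> treats coefficients of
  index at least 1.\<close>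

lemma LD_rchar:
  fixes A :: "'c::field mat"
  assumes A: "A \<in> carrier_mat n n" and i: "1 \<le> i" "i < n"
  shows "fps_nth (LD (rchar A)) i = (\<Sum>u<n. (A ^\<^sub>m i) $$ (u, u))"
  using i
proof (induction i rule: less_induct)
  case (less m)
  let ?y = "fps_nth (rchar A)" and ?t = "\<lambda>i. \<Sum>u<n. (A ^\<^sub>m i) $$ (u, u)"
  have y: "?y j = (if j \<le> n then poly.coeff (char_poly A) (n - j) else 0)" for j using A by (auto simp: rchar_def)
  have y0: "?y 0 = 1" using degree_monic_char_poly[OF A] by (simp add: y)
  have t0: "?t 0 = of_nat n" using A by simp
  define j where "j = n - m - 1"
  have j: "Suc j = n - m" using less.prems by (simp add: j_def)
  have "of_nat (n - m) * ?y m = (\<Sum>i<n. poly.coeff (char_poly A) (n - m + i) * ?t i)"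
    using newton_char_poly[OF A, of j] less.prems unfolding j by (simp add: y)
  also have "\<dots> = (\<Sum>i<Suc m. poly.coeff (char_poly A) (n - m + i) * ?t i)"
    using less.prems degree_monic_char_poly[OF A] by (intro sum.mono_neutral_right) (auto intro!: coeff_eq_0)
  also have "\<dots> = (\<Sum>i<Suc m. ?y (m - i) * ?t i)"
    using less.prems by (intro sum.cong) (auto simp: y intro!: arg_cong2[of _ _ _ _ "(*)"] arg_cong2[of _ _ _ _ poly.coeff])
  also have "{..<Suc m} = insert 0 (insert m {1..<m})" using less.prems by auto
  also have "(\<Sum>i\<in>insert 0 (insert m {1..<m}). ?y (m - i) * ?t i) = ?y m * of_nat n + (?t m + (\<Sum>i=1..<m. ?y (m - i) * ?t i))"
    using less.prems t0 y0 by (subst sum.insert; simp)+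
  finally have "?t m = (of_nat (n - m) - of_nat n) * ?y m - (\<Sum>i=1..<m. ?y (m - i) * ?t i)" by (simp add: algebra_simps)
  also have "of_nat (n - m) - of_nat n = (- of_nat m :: 'c)" using less.prems by (simp add: of_nat_diff)
  also have "(\<Sum>i=1..<m. ?y (m - i) * ?t i) = (\<Sum>i=1..<m. fps_nth (LD (rchar A)) i * ?y (m - i))"
    using less.IH less.prems by (intro sum.cong) auto
  finally show ?case using LD_rec(2)[OF y0 less.prems(1)] by simp
qed

text \<open>The reversed polynomial as a series, the product of the 1 - \<theta> X: unions of
  multisets become products of series that are invertible, so classes can be divided.\<close>

definition cls :: "'c::field multiset \<Rightarrow> 'c fps" where
  "cls \<nu> = Abs_fps (\<lambda>j. if j \<le> size \<nu> then poly.coeff (pol \<nu>) (size \<nu> - j) else 0)"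

lemma cls_empty [simp]: "cls {#} = 1"
  by (simp add: cls_def fps_eq_iff)

lemma cls_add_mset: "cls (add_mset \<theta> \<nu>) = (1 - fps_const \<theta> * fps_X) * cls \<nu>"
proof (rule fps_ext)
  fix j
  let ?s = "size \<nu>"
  have lc: "poly.coeff (pol \<nu>) ?s = 1" using monic_pol[of \<nu>] by simp
  have e: "poly.coeff (pol (add_mset \<theta> \<nu>)) i = (case i of 0 \<Rightarrow> 0 | Suc i' \<Rightarrow> poly.coeff (pol \<nu>) i') - \<theta> * poly.coeff (pol \<nu>) i" for i
    by (simp add: coeff_pCons split: nat.splits)
  have z: "poly.coeff (pol \<nu>) i = 0" if "i > ?s" for i using that by (intro coeff_eq_0) simp
  have r: "fps_nth ((1 - fps_const \<theta> * fps_X) * cls \<nu>) j = fps_nth (cls \<nu>) j - (if j = 0 then 0 else \<theta> * fps_nth (cls \<nu>) (j - 1))"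
    by (simp add: left_diff_distrib mult.assoc)
  consider "j = 0" | "1 \<le> j" "j \<le> ?s" | "j = Suc ?s" | "j > Suc ?s" by linarith
  then show "fps_nth (cls (add_mset \<theta> \<nu>)) j = fps_nth ((1 - fps_const \<theta> * fps_X) * cls \<nu>) j"
  proof cases
    case 1 then show ?thesis unfolding r using z[of "Suc ?s"] by (simp add: cls_def e)
  next
    case 2
    then obtain i where i: "j = Suc i" by (cases j) auto
    have "Suc ?s - j = Suc (?s - j)" "?s - (j - 1) = Suc (?s - j)" using 2 by auto
    then show ?thesis unfolding r using 2 by (simp add: cls_def e)
  qed (unfold r, simp_all add: cls_def e)
qed

lemma cls_0 [simp]: "fps_nth (cls \<nu>) 0 = 1"
  using monic_pol[of \<nu>] by (simp add: cls_def)

lemma cls_union: "cls (\<mu> + \<nu>) = cls \<mu> * cls \<nu>"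
  by (induction \<mu>) (simp_all add: cls_add_mset mult.assoc)

lemma LD_cong:
  assumes "fps_nth y 0 = 1" "fps_nth z 0 = 1" "\<And>i. i \<le> k \<Longrightarrow> fps_nth y i = fps_nth z i" "j \<le> k"
  shows "fps_nth (LD y) j = fps_nth (LD z) j"
  using assms(4)
proof (induction j rule: less_induct)
  case (less j)
  show ?case
  proof (cases "j = 0")
    case False
    have "(\<Sum>i=1..<j. fps_nth (LD y) i * fps_nth y (j - i)) = (\<Sum>i=1..<j. fps_nth (LD z) i * fps_nth z (j - i))"
      using less assms(3) by (intro sum.cong) auto
    then show ?thesis using LD_rec(2)[OF assms(1), of j] LD_rec(2)[OF assms(2), of j] assms(3)[of j] less.prems False by simp
  qed (simp add: LD_rec(1)[OF assms(1)] LD_rec(1)[OF assms(2)])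
qed

lemma LD_times: "fps_nth y 0 \<noteq> 0 \<Longrightarrow> fps_nth z 0 \<noteq> 0 \<Longrightarrow> LD (y * z) = LD y + LD z"
proof -
  assume h: "fps_nth y 0 \<noteq> 0" "fps_nth z 0 \<noteq> 0"
  have "inverse (y * z) = inverse y * inverse z" by (rule fps_inverse_mult)
  then have "LD (y * z) = - (fps_X * fps_deriv y) * inverse y * (z * inverse z) + - (fps_X * fps_deriv z) * inverse z * (y * inverse y)"
    by (simp add: LD_def algebra_simps)
  then show ?thesis using h by (simp add: LD_def inverse_mult_eq_1')
qed

lemma nz_of_trunc: "fps_nth y 0 \<noteq> 0 \<Longrightarrow> (\<And>j. j \<le> k \<Longrightarrow> fps_nth (y * w) j = fps_nth (z * w) j) \<Longrightarrow> fps_nth w 0 = 1 \<Longrightarrow> j \<le> k \<Longrightarrow> fps_nth y j = fps_nth z j"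
  for y z w :: "'c::field fps"
proof -
  assume h: "\<And>j. j \<le> k \<Longrightarrow> fps_nth (y * w) j = fps_nth (z * w) j" "fps_nth w 0 = 1" "j \<le> k"
  have "fps_nth (y * w * inverse w) j = fps_nth (z * w * inverse w) j"
    unfolding fps_mult_nth[of "_ * w"] using h(1,3) by (intro sum.cong) auto
  then show ?thesis using h(2) by (simp add: mult.assoc inverse_mult_eq_1')
qed

context ff_setup
begin

lemma upoly_coeff:
  "upoly f \<longleftrightarrow> monic f \<and> poly.coeff f 0 \<noteq> 0 \<and> (\<forall>i\<le>degree f. poly.coeff f (degree f - i) ^ q = poly.coeff f 0 ^ q * poly.coeff f i)"
proof -
  have "reflect_poly (map_poly (\<lambda>x. x ^ q) f) = smult (poly.coeff f 0 ^ q) f \<longleftrightarrow>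
     (\<forall>i\<le>degree f. poly.coeff f (degree f - i) ^ q = poly.coeff f 0 ^ q * poly.coeff f i)"
    unfolding poly_eq_iff
    using q_gt1 by (auto simp: coeff_reflect_poly degree_cj coeff_map_poly coeff_eq_0 not_le)
  then show ?thesis by (simp add: upoly_iff)
qed

lemma cls_ev: "monic g \<Longrightarrow> fps_nth (cls (ev g)) j = (if j \<le> degree g then to_ac (poly.coeff g (degree g - j)) else 0)" for g :: "'a poly"
  by (simp add: cls_def size_ev pol_ev coeff_map_poly)

lemma finite_upolys: "finite (upolys m)"
  using bij_betw_finite[OF bij_ev_upolys[of m]] P.finite_inv by simp

section \<open>Unitary polynomials with prescribed leading coefficients\<close>

definition ufib :: "nat \<Rightarrow> nat \<Rightarrow> (nat \<Rightarrow> 'a) \<Rightarrow> 'a poly set" where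
  "ufib k m z = {g \<in> upolys m. \<forall>j\<le>k. (if j \<le> m then poly.coeff g (m - j) else 0) = z j}"

lemma ufib_coeff: "g \<in> ufib k m z \<Longrightarrow> j \<le> k \<Longrightarrow> (if j \<le> m then poly.coeff g (m - j) else 0) = z j"
  by (simp add: ufib_def)

lemma finite_ufib: "finite (ufib k m z)"
  using finite_upolys by (simp add: ufib_def)

lemma ufib_poly_eq: assumes "f \<in> upolys m" "g \<in> upolys m" "\<And>i. i \<le> m \<Longrightarrow> poly.coeff f i = poly.coeff g i" shows "f = g"
proof (rule poly_eqI)
  fix i show "poly.coeff f i = poly.coeff g i"
    using assms by (cases "i \<le> m") (auto simp: upolys_def coeff_eq_0)
qed

lemma upolys_coeff: assumes "g \<in> upolys m" shows "poly.coeff g m = 1" "i \<le> m \<Longrightarrow> poly.coeff g i = poly.coeff g 0 * poly.coeff g (m - i) ^ q"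
proof -
  have g: "upoly g" "degree g = m" using assms by (auto simp: upolys_def)
  note h = g(1)[unfolded upoly_coeff g(2)]
  show "poly.coeff g m = 1" using h g(2) by simp
  assume i: "i \<le> m"
  have "poly.coeff g (m - i) ^ q = poly.coeff g 0 ^ q * poly.coeff g i" using h i by blast
  moreover have "1 = poly.coeff g 0 ^ q * poly.coeff g 0" using h g(2) by (metis diff_zero le0 power_one)
  ultimately show "poly.coeff g i = poly.coeff g 0 * poly.coeff g (m - i) ^ q"
    by (metis mult.assoc mult.commute mult_1)
qed

text \<open>All coefficients are prescribed, and those prescribed beyond the degree must be zero;
  this is the first source of runs of zeros.\<close>

lemma ufib_low: assumes "m \<le> k" shows "card (ufib k m z) \<le> 1" "ufib k m z \<noteq> {} \<Longrightarrow> m < j \<Longrightarrow> j \<le> k \<Longrightarrow> z j = 0"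
proof -
  have "f = g" if "f \<in> ufib k m z" "g \<in> ufib k m z" for f g
  proof (rule ufib_poly_eq[of _ m])
    fix i assume i: "i \<le> m"
    have mi: "m - i \<le> k" using assms by simp
    have "(if m - i \<le> m then poly.coeff h (m - (m - i)) else 0) = z (m - i)" if "h \<in> ufib k m z" for h
      using that mi unfolding ufib_def by blast
    from this[OF that(1)] this[OF that(2)]
    show "poly.coeff f i = poly.coeff g i" using i by simp
  qed (use that in \<open>auto simp: ufib_def\<close>)
  then show "card (ufib k m z) \<le> 1" using finite_ufib by (auto simp: card_le_Suc0_iff_eq)
  show "ufib k m z \<noteq> {} \<Longrightarrow> m < j \<Longrightarrow> j \<le> k \<Longrightarrow> z j = 0" by (auto simp: ufib_def)
qed

text \<open>By self-reciprocity coefficient i is e times the conjugate of coefficient m - i, where e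
  is the constant coefficient; since m <= 2k, the prescribed coefficients and their mirror images
  cover everything, so e determines the polynomial. A nonzero \<open>z j\<close> in the overlap m -
  k, ..., k determines e; otherwise e can be any of the at most q + 1 roots of e^(q+1) = 1.\<close>

lemma ufib_mid: assumes m: "k < m" "m \<le> 2 * k"
  shows "card (ufib k m z) \<le> 1 + q * (if \<forall>j. m - k \<le> j \<and> j \<le> k \<longrightarrow> z j = 0 then 1 else 0)"
proof -
  have c: "poly.coeff g (m - j) = z j" if "g \<in> ufib k m z" "j \<le> k" for g j using that m by (auto simp: ufib_def)
  have up: "g \<in> upolys m" if "g \<in> ufib k m z" for g using that by (simp add: ufib_def)
  have inj: "inj_on (\<lambda>g. poly.coeff g 0) (ufib k m z)"
  proof (rule inj_onI)
    fix f g assume fg: "f \<in> ufib k m z" "g \<in> ufib k m z" "poly.coeff f 0 = poly.coeff g 0"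
    show "f = g"
    proof (rule ufib_poly_eq[OF up[OF fg(1)] up[OF fg(2)]])
      fix i assume i: "i \<le> m"
      show "poly.coeff f i = poly.coeff g i"
      proof (cases "m - i \<le> k")
        case True then show ?thesis using c[OF fg(1) True] c[OF fg(2) True] i by simp
      next
        case False
        then have ik: "i \<le> k" using m by simp
        show ?thesis using upolys_coeff(2)[OF up[OF fg(1)] i] upolys_coeff(2)[OF up[OF fg(2)] i] c[OF fg(1) ik] c[OF fg(2) ik] fg(3) by simp
      qed
    qed
  qed
  show ?thesis
  proof (cases "\<forall>j. m - k \<le> j \<and> j \<le> k \<longrightarrow> z j = 0")
    case True
    have "card (ufib k m z) = card ((\<lambda>g. poly.coeff g 0) ` ufib k m z)" using card_image[OF inj] by simp
    also have "\<dots> \<le> Suc q"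
    proof (rule card_roots_le[where P = "Polynomial.monom 1 (Suc q) - 1"])
      fix x assume "x \<in> (\<lambda>g. poly.coeff g 0) ` ufib k m z"
      then obtain g where g: "g \<in> ufib k m z" "x = poly.coeff g 0" by auto
      have "x * 1 ^ q = x" by simp
      have "poly.coeff g m = poly.coeff g 0 * poly.coeff g (m - m) ^ q" using upolys_coeff(2)[OF up[OF g(1)], of m] by simp
      then have "x * x ^ q = 1" using upolys_coeff(1)[OF up[OF g(1)]] g(2) by simp
      then show "poly (Polynomial.monom 1 (Suc q) - 1) x = 0" by (simp add: poly_monom)
    next
      have "poly.coeff (Polynomial.monom 1 (Suc q) - 1 :: 'a poly) (Suc q) = 1" by simp
      then show "Polynomial.monom 1 (Suc q) - 1 \<noteq> (0 :: 'a poly)" by (metis coeff_0 zero_neq_one)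
      show "degree (Polynomial.monom 1 (Suc q) - 1 :: 'a poly) \<le> Suc q"
        by (intro degree_diff_le degree_monom_le) simp
    qed
    finally show ?thesis using True by simp
  next
    case False
    then obtain j where j: "m - k \<le> j" "j \<le> k" "z j \<noteq> 0" by blast
    have "poly.coeff g 0 = z (m - j) / z j ^ q" if g: "g \<in> ufib k m z" for g
    proof -
      have "poly.coeff g j = poly.coeff g 0 * poly.coeff g (m - j) ^ q" using upolys_coeff(2)[OF up[OF g], of j] j m by simp
      moreover have "poly.coeff g (m - (m - j)) = z (m - j)" using c[OF g, of "m - j"] j m by simp
      ultimately show ?thesis using c[OF g j(2)] j m by (simp add: field_simps)
    qed
    then have "\<forall>f\<in>ufib k m z. \<forall>g\<in>ufib k m z. f = g" using inj by (metis inj_onD)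
    then have "card (ufib k m z) \<le> 1" using finite_ufib by (auto simp: card_le_Suc0_iff_eq)
    then show ?thesis by simp
  qed
qed

text \<open>For m > 2k the prescribed coefficients and their mirror images do not overlap. They can
  be replaced by other values while the constant coefficient and the middle of the polynomial are
  kept.\<close>

lemma ufib_top: assumes m: "2 * k < m" and z: "z 0 = 1" and z': "z' 0 = 1"
  shows "card (ufib k m z) = card (ufib k m z')"
proof -
  define h where "h z g = Abs_poly (\<lambda>i. if i > m then 0 else if m - i \<le> k then z (m - i) else if i \<le> k then poly.coeff g 0 * z i ^ q else poly.coeff g i)"
    for z :: "nat \<Rightarrow> 'a" and g
  have hc: "poly.coeff (h z g) i = (if i > m then 0 else if m - i \<le> k then z (m - i) else if i \<le> k then poly.coeff g 0 * z i ^ q else poly.coeff g i)" for z g i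
    unfolding h_def by (subst coeff_Abs_poly[of m]) auto
  have hU: "h z g \<in> ufib k m z" if g: "g \<in> upolys m" and z: "z 0 = 1" for g z
  proof -
    have c0: "poly.coeff (h z g) 0 = poly.coeff g 0" using m z by (simp add: hc)
    have cm: "poly.coeff (h z g) m = 1" using z by (simp add: hc)
    have deg: "degree (h z g) = m"
      by (rule antisym) (auto intro!: degree_le le_degree simp: hc z)
    have gup: "upoly g" "degree g = m" using g by (auto simp: upolys_def)
    have g0: "poly.coeff g 0 \<noteq> 0" using gup(1) by (simp add: upoly_def)
    have n1: "poly.coeff g 0 ^ q * poly.coeff g 0 = 1"
      using upolys_coeff[OF g] by (metis diff_self_eq_0 le_refl mult.commute)
    have "upoly (h z g)"
      unfolding upoly_coeff deg
    proof (intro conjI allI impI)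
      fix i assume i: "i \<le> m"
      have gi: "poly.coeff g (m - i) ^ q = poly.coeff g 0 ^ q * poly.coeff g i" using gup i by (simp add: upoly_coeff)
      consider "m - i \<le> k" | "i \<le> k" | "\<not> m - i \<le> k" "\<not> i \<le> k" by blast
      then show "poly.coeff (h z g) (m - i) ^ q = poly.coeff (h z g) 0 ^ q * poly.coeff (h z g) i"
      proof cases
        case 1
        then have "\<not> m - (m - i) \<le> k" using m i by simp
        then show ?thesis using 1 i unfolding c0 by (simp add: hc power_mult_distrib cj_cj)
      next
        case 2
        then have "\<not> m - i \<le> k" "\<not> m < m - i" using m by simp_all
        then show ?thesis using 2 i n1 unfolding c0 by (simp add: hc mult.assoc[symmetric])
      next
        case 3
        moreover have "\<not> m < m - i" by simp
        ultimately show ?thesis using i gi unfolding c0 by (simp add: hc)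
      qed
    qed (use cm g0 c0 deg in auto)
    then show ?thesis using m deg by (auto simp: ufib_def upolys_def hc)
  qed
  have hh: "h z (h z' g) = g" if g: "g \<in> ufib k m z" and z: "z 0 = 1" "z' 0 = 1" for z z' g
  proof (rule poly_eqI)
    have gu: "g \<in> upolys m" using g by (simp add: ufib_def)
    have c0: "poly.coeff (h z' g) 0 = poly.coeff g 0" using m z by (simp add: hc)
    fix i
    have gz: "poly.coeff g (m - j) = z j" if "j \<le> k" for j using g that m by (auto simp: ufib_def)
    consider "i > m" | "i \<le> m" "m - i \<le> k" | "i \<le> k" | "i \<le> m" "\<not> m - i \<le> k" "\<not> i \<le> k" by linarith
    then show "poly.coeff (h z (h z' g)) i = poly.coeff g i"
    proof cases
      case 1 then show ?thesis using gu by (simp add: hc upolys_def coeff_eq_0)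
    next
      case 2 then show ?thesis using gz[of "m - i"] by (simp add: hc)
    next
      case 3
      then have "\<not> m - i \<le> k" "i \<le> m" using m by auto
      then show ?thesis using 3 upolys_coeff(2)[OF gu, of i] gz[of i] by (simp add: hc[of z] c0)
    next
      case 4 then show ?thesis by (simp add: hc)
    qed
  qed
  have "bij_betw (h z') (ufib k m z) (ufib k m z')"
    by (rule bij_betwI[where g = "h z"]) (use hU hh z z' in \<open>auto simp: ufib_def\<close>)
  then show ?thesis by (rule bij_betw_same_card)
qed

text \<open>The value at 0 is forced to be 1 and the other k are free, so the degree-m unitary
  polynomials split into (q^2)^k fibres of equal size.\<close>

lemma card_ufib_top: assumes m: "2 * k < m" and z: "z 0 = 1"
  shows "card (upolys m) = (q ^ 2) ^ k * card (ufib k m z)"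
proof -
  let ?Z = "PiE {1..k} (\<lambda>_. UNIV :: 'a set)"
  let ?e = "\<lambda>w j. if j = 0 then 1 else w j"
  have "card (upolys m) = card (\<Union>w\<in>?Z. ufib k m (?e w))"
  proof (rule arg_cong[of _ _ card], intro equalityI subsetI)
    fix g assume g: "g \<in> upolys m"
    have "g \<in> ufib k m (?e (restrict (\<lambda>j. poly.coeff g (m - j)) {1..k}))"
      using g m upolys_coeff(1)[OF g] by (auto simp: ufib_def)
    then show "g \<in> (\<Union>w\<in>?Z. ufib k m (?e w))" by (intro UN_I) auto
  qed (auto simp: ufib_def)
  also have "\<dots> = (\<Sum>w\<in>?Z. card (ufib k m (?e w)))"
  proof (rule card_UN_disjoint)
    show "\<forall>w\<in>?Z. \<forall>w'\<in>?Z. w \<noteq> w' \<longrightarrow> ufib k m (?e w) \<inter> ufib k m (?e w') = {}"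
    proof (intro ballI impI)
      fix w w' assume w: "w \<in> ?Z" "w' \<in> ?Z" "w \<noteq> w'"
      then obtain j where j: "j \<in> {1..k}" "w j \<noteq> w' j" by (metis PiE_ext)
      show "ufib k m (?e w) \<inter> ufib k m (?e w') = {}"
      proof (rule equals0I)
        fix g assume g: "g \<in> ufib k m (?e w) \<inter> ufib k m (?e w')"
        note g1 = IntD1[OF g] and g2 = IntD2[OF g]
        have jk: "j \<le> k" using j(1) by simp
        have "?e w j = ?e w' j" by (rule trans[OF ufib_coeff[OF g1 jk, symmetric] ufib_coeff[OF g2 jk]])
        then show False using j by auto
      qed
    qed
  qed (auto intro!: finite_PiE finite_ufib)
  also have "\<dots> = (\<Sum>w\<in>?Z. card (ufib k m z))"
    by (intro sum.cong refl ufib_top[OF m]) (use z in auto)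
  also have "\<dots> = (q ^ 2) ^ k * card (ufib k m z)"
    using card_PiE[of "{1..k}" "\<lambda>_. UNIV :: 'a set"] card_K by simp
  finally show ?thesis .
qed

section \<open>Classes of series with prescribed power sums\<close>

text \<open>The classes modulo X^(k+1) that make up the event, each represented by its polynomial
  truncation so that the set is finite.\<close>

definition CC :: "nat \<Rightarrow> (nat \<Rightarrow> 'a) \<Rightarrow> 'a fps set" where
  "CC k a = {y. fps_nth y 0 = 1 \<and> (\<forall>j>k. fps_nth y j = 0) \<and> (\<forall>i. 1 \<le> i \<and> i \<le> k \<and> \<not> p dvd i \<longrightarrow> fps_nth (LD y) i = a i)}"

lemma of_nat_p_zero: "(of_nat i :: 'a) = 0 \<longleftrightarrow> p dvd i"
  using char_K by (simp add: of_nat_eq_0_iff_char_dvd)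

text \<open>Adding v to the coefficient of X^(k+1) changes the logarithmic derivative at k + 1 by
  -(k+1) v and leaves earlier coefficients alone. So the new coefficient is determined when p does
  not divide k + 1, and free when it does.\<close>

lemma CC_Suc: "CC (Suc k) a = (\<lambda>(y, v). y + fps_const v * fps_X ^ Suc k) `
   (SIGMA y:CC k a. {v. p dvd Suc k \<or> v = (fps_nth (LD y) (Suc k) - a (Suc k)) / of_nat (Suc k)})"
proof -
  have nth: "fps_nth (y + fps_const v * fps_X ^ Suc k) j = (if j = Suc k then fps_nth y j + v else fps_nth y j)" for y v j
    by (simp add: fps_X_power_nth del: power_Suc)
  have LDv: "fps_nth (LD (y + fps_const v * fps_X ^ Suc k)) i = fps_nth (LD y) i - (if i = Suc k then of_nat (Suc k) * v else 0)"
    if y: "fps_nth y 0 = 1" and i: "i \<le> Suc k" for y :: "'a fps" and v i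
  proof -
    let ?z = "y + fps_const v * fps_X ^ Suc k"
    have z0: "fps_nth ?z 0 = 1" using y by (simp only: nth) simp
    have le: "fps_nth (LD ?z) j = fps_nth (LD y) j" if "j \<le> k" for j
      by (rule LD_cong[OF z0 y _ that]) (simp only: nth, simp)
    show ?thesis
    proof (cases "i = Suc k")
      case True
      have "(\<Sum>j=1..<Suc k. fps_nth (LD ?z) j * fps_nth ?z (Suc k - j)) = (\<Sum>j=1..<Suc k. fps_nth (LD y) j * fps_nth y (Suc k - j))"
      proof (rule sum.cong[OF refl])
        fix j assume "j \<in> {1..<Suc k}"
        then have "j \<le> k" "(Suc k - j = Suc k) = False" by auto
        then show "fps_nth (LD ?z) j * fps_nth ?z (Suc k - j) = fps_nth (LD y) j * fps_nth y (Suc k - j)"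
          by (simp only: le nth if_False)
      qed
      then show ?thesis using LD_rec(2)[OF z0, of "Suc k"] LD_rec(2)[OF y, of "Suc k"] True
        by (simp only: nth) (simp add: algebra_simps)
    next
      case False then show ?thesis using le i by simp
    qed
  qed
  show ?thesis
  proof (intro equalityI subsetI)
    fix z assume z: "z \<in> CC (Suc k) a"
    define v where "v = fps_nth z (Suc k)"
    define y where "y = z - fps_const v * fps_X ^ Suc k"
    have zy: "z = y + fps_const v * fps_X ^ Suc k" by (simp add: y_def)
    have yn: "fps_nth y j = (if j = Suc k then 0 else fps_nth z j)" for j by (simp add: y_def fps_X_power_nth v_def del: power_Suc)
    have y0: "fps_nth y 0 = 1" using z by (simp add: yn CC_def)
    have L: "fps_nth (LD z) i = fps_nth (LD y) i - (if i = Suc k then of_nat (Suc k) * v else 0)" if "i \<le> Suc k" for i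
      unfolding zy by (rule LDv[OF y0 that])
    have "y \<in> CC k a"
      unfolding CC_def mem_Collect_eq
    proof (intro conjI allI impI)
      fix j assume "k < j" then show "fps_nth y j = 0" using z by (auto simp: yn CC_def)
    next
      fix i assume i: "1 \<le> i \<and> i \<le> k \<and> \<not> p dvd i"
      then have "fps_nth (LD z) i = a i" using z by (simp add: CC_def)
      then show "fps_nth (LD y) i = a i" using L[of i] i by simp
    qed (rule y0)
    moreover have "p dvd Suc k \<or> v = (fps_nth (LD y) (Suc k) - a (Suc k)) / of_nat (Suc k)"
    proof (cases "p dvd Suc k")
      case False
      then have "fps_nth (LD z) (Suc k) = a (Suc k)" using z by (simp add: CC_def)
      then have "of_nat (Suc k) * v = fps_nth (LD y) (Suc k) - a (Suc k)" using L[of "Suc k"] by (simp add: algebra_simps)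
      moreover have "(of_nat (Suc k) :: 'a) \<noteq> 0" using False of_nat_p_zero[of "Suc k"] by blast
      ultimately show ?thesis by (metis nonzero_mult_div_cancel_left)
    qed simp
    ultimately show "z \<in> (\<lambda>(y, v). y + fps_const v * fps_X ^ Suc k) `
       (SIGMA y:CC k a. {v. p dvd Suc k \<or> v = (fps_nth (LD y) (Suc k) - a (Suc k)) / of_nat (Suc k)})"
      using zy by (intro image_eqI[of _ _ "(y, v)"]) auto
  next
    fix z assume "z \<in> (\<lambda>(y, v). y + fps_const v * fps_X ^ Suc k) `
       (SIGMA y:CC k a. {v. p dvd Suc k \<or> v = (fps_nth (LD y) (Suc k) - a (Suc k)) / of_nat (Suc k)})"
    then obtain y v where zy: "z = y + fps_const v * fps_X ^ Suc k" and y: "y \<in> CC k a"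
      and v: "p dvd Suc k \<or> v = (fps_nth (LD y) (Suc k) - a (Suc k)) / of_nat (Suc k)" by auto
    have y0: "fps_nth y 0 = 1" using y by (simp add: CC_def)
    show "z \<in> CC (Suc k) a"
      unfolding CC_def mem_Collect_eq
    proof (intro conjI allI impI)
      show "fps_nth z 0 = 1" unfolding zy by (simp only: nth) (simp add: y0)
      fix j assume "Suc k < j" then show "fps_nth z j = 0" unfolding zy using y by (simp only: nth) (simp add: CC_def)
    next
      fix i assume i: "1 \<le> i \<and> i \<le> Suc k \<and> \<not> p dvd i"
      have L: "fps_nth (LD z) i = fps_nth (LD y) i - (if i = Suc k then of_nat (Suc k) * v else 0)"
        unfolding zy using i by (intro LDv[OF y0]) simp
      show "fps_nth (LD z) i = a i"
      proof (cases "i = Suc k")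
        case True
        have "(of_nat (Suc k) :: 'a) \<noteq> 0" using i True of_nat_p_zero[of "Suc k"] by blast
        then have "of_nat (Suc k) * v = fps_nth (LD y) (Suc k) - a (Suc k)" using v i True by (metis nonzero_mult_div_cancel_left times_divide_eq_right)
        then show ?thesis using L True by simp
      next
        case False then show ?thesis using L y i by (simp add: CC_def)
      qed
    qed
  qed
qed

lemma card_CC: "finite (CC k a)" "card (CC k a) = (q ^ 2) ^ (k div p)"
proof (induction k)
  case 0
  have "CC 0 a = {1}"
    by (auto simp: CC_def fps_eq_iff)
  { case 1 then show ?case using \<open>CC 0 a = {1}\<close> by simp }
  { case 2 then show ?case using \<open>CC 0 a = {1}\<close> by simp }
next
  case (Suc k)
  let ?V = "\<lambda>y. {v. p dvd Suc k \<or> v = (fps_nth (LD y) (Suc k) - a (Suc k)) / of_nat (Suc k)}"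
  have fin: "finite (SIGMA y:CC k a. ?V y)" using Suc.IH(1) by (intro finite_SigmaI) auto
  { case 1 then show ?case unfolding CC_Suc using fin by (rule finite_imageI) }
  { case 2
    have inj: "inj_on (\<lambda>(y, v). y + fps_const v * fps_X ^ Suc k) (SIGMA y:CC k a. ?V y)"
    proof (rule inj_onI, clarify)
      fix y v y' v' assume h: "y \<in> CC k a" "y' \<in> CC k a" and e: "y + fps_const v * fps_X ^ Suc k = y' + fps_const v' * fps_X ^ Suc k"
      have en: "fps_nth y j + v * (if j = Suc k then 1 else 0) = fps_nth y' j + v' * (if j = Suc k then 1 else 0)" for j
        using arg_cong[OF e, of "\<lambda>f. fps_nth f j"] by (simp add: fps_X_power_nth del: power_Suc)
      have "v = v'" using en[of "Suc k"] h by (simp add: CC_def)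
      moreover have "y = y'"
      proof (rule fps_ext)
        fix j show "fps_nth y j = fps_nth y' j" using en[of j] \<open>v = v'\<close> by simp
      qed
      ultimately show "y = y' \<and> v = v'" by simp
    qed
    have cV: "card (?V y) = (if p dvd Suc k then q ^ 2 else 1)" for y using card_K by simp
    have "card (CC (Suc k) a) = (\<Sum>y\<in>CC k a. card (?V y))"
      unfolding CC_Suc card_image[OF inj] using Suc.IH(1) by (intro card_SigmaI) auto
    also have "\<dots> = card (CC k a) * (if p dvd Suc k then q ^ 2 else 1)" by (simp only: cV sum_constant of_nat_id)
    also have "\<dots> = (q ^ 2) ^ (Suc k div p)"
      using Suc.IH(2) by (simp add: div_Suc dvd_eq_mod_eq_0)
    finally show ?case . }
qed

text \<open>No positive index below p is divisible by p, so every coefficient there is forced by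
  Newton's recursion.\<close>

lemma CC_unique: assumes "y \<in> CC k a" "y' \<in> CC k a" "j \<le> k" "j < p" shows "fps_nth y j = fps_nth y' j"
  using assms(3,4)
proof (induction j rule: less_induct)
  case (less j)
  show ?case
  proof (cases "j = 0")
    case False
    have y0: "fps_nth y 0 = 1" "fps_nth y' 0 = 1" using assms by (auto simp: CC_def)
    have nd: "\<not> p dvd i" if "1 \<le> i" "i \<le> j" for i using that less.prems by (auto dest: dvd_imp_le)
    have L: "fps_nth (LD y) i = fps_nth (LD y') i" if "1 \<le> i" "i \<le> j" for i
      using assms(1,2) nd[OF that] that less.prems by (auto simp: CC_def)
    have "(\<Sum>i=1..<j. fps_nth (LD y) i * fps_nth y (j - i)) = (\<Sum>i=1..<j. fps_nth (LD y') i * fps_nth y' (j - i))"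
      using less L by (intro sum.cong) auto
    then have "of_nat j * fps_nth y j = of_nat j * fps_nth y' j"
      using LD_rec(2)[OF y0(1), of j] LD_rec(2)[OF y0(2), of j] L[of j] False by (auto simp: algebra_simps)
    moreover have "(of_nat j :: 'a) \<noteq> 0" using nd[of j] False of_nat_p_zero by auto
    ultimately show ?thesis by simp
  qed (use assms in \<open>auto simp: CC_def\<close>)
qed

definition trn :: "nat \<Rightarrow> 'a fps \<Rightarrow> 'a fps" where "trn k y = Abs_fps (\<lambda>j. if j \<le> k then fps_nth y j else 0)"

lemma trn_CC: assumes y: "fps_nth y 0 = 1" shows "trn k y \<in> CC k a \<longleftrightarrow> (\<forall>i. 1 \<le> i \<and> i \<le> k \<and> \<not> p dvd i \<longrightarrow> fps_nth (LD y) i = a i)"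
proof -
  have "fps_nth (LD (trn k y)) i = fps_nth (LD y) i" if "i \<le> k" for i
    by (rule LD_cong[OF _ y _ that]) (use y in \<open>auto simp: trn_def\<close>)
  then show ?thesis using y by (auto simp: CC_def trn_def)
qed

text \<open>In characteristic p the factor 1 + \<alpha> X^(p u) has derivative zero, hence does not
  affect the logarithmic derivative.\<close>

lemma CC_shift: assumes y: "y \<in> CC k a" and u: "u \<ge> 1" shows "trn k (y * (1 + fps_const \<alpha> * fps_X ^ (p * u))) \<in> CC k a"
proof -
  have y0: "fps_nth y 0 = 1" using y by (simp add: CC_def)
  have pu: "p * u \<ge> 1" using u p prime_gt_0_nat by (simp add: Suc_le_eq)
  let ?w = "1 + fps_const \<alpha> * fps_X ^ (p * u)"
  have w0: "fps_nth ?w 0 = 1" using pu by (simp add: fps_X_power_nth del: power_Suc)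
  have "fps_deriv ?w = 0"
  proof -
    have "(of_nat (p * u) :: 'a) = 0" using of_nat_p_zero[of "p * u"] by simp
    then have "fps_deriv (fps_X ^ (p * u) :: 'a fps) = 0"
      unfolding fps_deriv_power by (simp add: fps_of_nat[symmetric] del: of_nat_mult)
    then show ?thesis by simp
  qed
  then have "LD ?w = 0" by (simp add: LD_def)
  moreover have "LD (y * ?w) = LD y + LD ?w"
    by (rule LD_times) (simp_all only: y0 w0 one_neq_zero not_False_eq_True)
  ultimately have L: "LD (y * ?w) = LD y" by simp
  have yw0: "fps_nth (y * ?w) 0 = 1" by (simp only: fps_mult_nth_0 y0 w0 mult_1)
  show ?thesis unfolding trn_CC[OF yw0] L using y by (simp add: CC_def)
qed

definition em :: "'a fps \<Rightarrow> 'a alg_closure fps" where "em y = Abs_fps (\<lambda>j. to_ac (fps_nth y j))"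

lemma em_nth [simp]: "fps_nth (em y) j = to_ac (fps_nth y j)" by (simp add: em_def)

lemma em_mult: "em (y * z) = em y * em z"
proof -
  interpret t: comm_ring_hom "to_ac :: 'a \<Rightarrow> 'a alg_closure" by (rule to_ac_hom)
  show ?thesis by (rule fps_ext) (simp add: fps_mult_nth t.hom_sum t.hom_mult)
qed

text \<open>Let d = p (k div p), and call y bad if \<open>em y * W\<close> has the run of zeros. For
  bad y, coefficient d + i of the product of W with y (1 + \<alpha> X^d) is \<alpha> times
  coefficient i of \<open>em y0 * W\<close>, since i < p makes low coefficients common to all
  classes. So \<alpha>, and then y, can be recovered: bad classes times F_{q^2} embed into all
  classes.\<close>

lemma CC_average:
  fixes W :: "'a alg_closure fps"
  assumes W: "fps_nth W 0 = 1" and y0: "y0 \<in> CC k a" and t: "k div p \<ge> 1" and \<rho>: "1 \<le> \<rho>" "\<rho> \<le> k"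
    and nz: "i \<le> k mod p" "k mod p < i + \<rho>" "fps_nth (em y0 * W) i \<noteq> 0"
  shows "card {y \<in> CC k a. \<forall>j. k - \<rho> < j \<and> j \<le> k \<longrightarrow> fps_nth (em y * W) j = 0} * q ^ 2 \<le> card (CC k a)"
proof -
  let ?B = "{y \<in> CC k a. \<forall>j. k - \<rho> < j \<and> j \<le> k \<longrightarrow> fps_nth (em y * W) j = 0}"
  let ?d = "p * (k div p)"
  have kd: "k = ?d + k mod p" by simp
  define f where "f y \<alpha> = y * (1 + fps_const \<alpha> * fps_X ^ ?d)" for y and \<alpha> :: 'a
  have emf: "fps_nth (em (f y \<alpha>) * W) (?d + i) = to_ac \<alpha> * fps_nth (em y0 * W) i" if y: "y \<in> ?B" for y \<alpha>
  proof -
    have e: "em (1 + fps_const \<alpha> * fps_X ^ ?d) = 1 + fps_const (to_ac \<alpha>) * fps_X ^ ?d"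
      by (rule fps_ext) (simp add: fps_X_power_nth del: power_Suc)
    have "em (f y \<alpha>) * W = em y * W + fps_const (to_ac \<alpha>) * (fps_X ^ ?d * (em y * W))"
      unfolding f_def em_mult e by (simp add: algebra_simps)
    then have "fps_nth (em (f y \<alpha>) * W) (?d + i) = fps_nth (em y * W) (?d + i) + to_ac \<alpha> * fps_nth (em y * W) i"
      by (simp only: fps_add_nth fps_mult_left_const_nth fps_X_power_mult_nth) simp
    also have "fps_nth (em y * W) (?d + i) = 0"
    proof -
      have "k - \<rho> < ?d + i" "?d + i \<le> k" using nz kd \<rho> by linarith+
      then show ?thesis using y by blast
    qed
    also have "fps_nth (em y * W) i = fps_nth (em y0 * W) i"
    proof -
      have "fps_nth y j = fps_nth y0 j" if "j \<le> i" for j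
      proof (rule CC_unique[of _ k a])
        have "k mod p < p" using p prime_gt_0_nat by simp
        then show "j < p" "j \<le> k" using that nz kd by linarith+
      qed (use y y0 in auto)
      then show ?thesis unfolding fps_mult_nth by (intro sum.cong) auto
    qed
    finally show ?thesis by simp
  qed
  have "inj_on (\<lambda>(y, \<alpha>). trn k (f y \<alpha>)) (?B \<times> UNIV)"
  proof (rule inj_onI, clarify)
    fix y \<alpha> y' \<alpha>' assume h: "y \<in> CC k a" "\<forall>j. k - \<rho> < j \<and> j \<le> k \<longrightarrow> fps_nth (em y * W) j = 0"
      "y' \<in> CC k a" "\<forall>j. k - \<rho> < j \<and> j \<le> k \<longrightarrow> fps_nth (em y' * W) j = 0" and e: "trn k (f y \<alpha>) = trn k (f y' \<alpha>')"
    have en: "fps_nth (f y \<alpha>) j = fps_nth (f y' \<alpha>') j" if "j \<le> k" for j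
      using arg_cong[OF e, of "\<lambda>g. fps_nth g j"] that by (simp add: trn_def)
    have "fps_nth (em (f y \<alpha>) * W) (?d + i) = fps_nth (em (f y' \<alpha>') * W) (?d + i)"
    proof -
      have di: "?d + i \<le> k" using nz kd by linarith
      show ?thesis unfolding fps_mult_nth
      proof (rule sum.cong[OF refl])
        fix x assume "x \<in> {0..?d + i}"
        then have "x \<le> k" using di by simp
        then show "fps_nth (em (f y \<alpha>)) x * fps_nth W (?d + i - x) = fps_nth (em (f y' \<alpha>')) x * fps_nth W (?d + i - x)"
          using en by simp
      qed
    qed
    then have "to_ac \<alpha> * fps_nth (em y0 * W) i = to_ac \<alpha>' * fps_nth (em y0 * W) i" using emf h by simp
    then have al: "\<alpha> = \<alpha>'" using nz(3) by (simp add: inj_eq[OF inj_to_ac])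
    have "fps_nth y j = fps_nth y' j" if "j \<le> k" for j
    proof (rule nz_of_trunc[OF _ _ _ that])
      show "fps_nth (y * (1 + fps_const \<alpha> * fps_X ^ ?d)) j = fps_nth (y' * (1 + fps_const \<alpha> * fps_X ^ ?d)) j" if "j \<le> k" for j
        using en[OF that] al by (simp add: f_def)
      show "fps_nth (1 + fps_const \<alpha> * fps_X ^ ?d) 0 = 1" using t p prime_gt_0_nat by (auto simp: fps_X_power_nth)
    qed (use h in \<open>simp add: CC_def\<close>)
    moreover have "fps_nth y j = fps_nth y' j" if "j > k" for j using h that by (simp add: CC_def)
    ultimately show "y = y' \<and> \<alpha> = \<alpha>'" using al by (metis fps_ext not_le)
  qed
  then have "card (?B \<times> (UNIV :: 'a set)) = card ((\<lambda>(y, \<alpha>). trn k (f y \<alpha>)) ` (?B \<times> UNIV))" by (simp add: card_image)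
  also have "\<dots> \<le> card (CC k a)"
    using CC_shift[OF _ t] by (intro card_mono card_CC) (auto simp: f_def)
  finally show ?thesis by (simp add: card_cartesian_product card_K)
qed

end

section \<open>Runs of vanishing coefficients\<close>

lemma sum_of_bool_card: "(\<Sum>x\<in>A. of_bool (P x)) = real (card {x \<in> A. P x})" if "finite A"
proof -
  have e: "{x \<in> A. P x} = A \<inter> {x. P x}" by auto
  show ?thesis unfolding e using that by simp
qed

section \<open>Functionals on the monoid algebra and elementary estimates\<close>

text \<open>The linear extension of a function on multisets to the monoid algebra; it turns series
  identities into identities between averages.\<close>

definition EE :: "'b malg \<Rightarrow> ('b multiset \<Rightarrow> real) \<Rightarrow> real" where
  "EE G \<Phi> = (\<Sum>\<nu>\<in>Poly_Mapping.keys G. Poly_Mapping.lookup G \<nu> * \<Phi> \<nu>)"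

lemma EE_superset: "finite A \<Longrightarrow> Poly_Mapping.keys G \<subseteq> A \<Longrightarrow> EE G \<Phi> = (\<Sum>\<nu>\<in>A. Poly_Mapping.lookup G \<nu> * \<Phi> \<nu>)"
  unfolding EE_def by (rule sum.mono_neutral_left) (auto simp: in_keys_iff)

lemma EE_add: "EE (G + H) \<Phi> = EE G \<Phi> + EE H \<Phi>"
proof -
  let ?A = "Poly_Mapping.keys G \<union> Poly_Mapping.keys H"
  have f: "finite ?A" by simp
  have "EE (G + H) \<Phi> = (\<Sum>\<nu>\<in>?A. Poly_Mapping.lookup (G + H) \<nu> * \<Phi> \<nu>)"
    by (rule EE_superset[OF f]) (rule Poly_Mapping.keys_add)
  also have "\<dots> = EE G \<Phi> + EE H \<Phi>"
    by (simp add: EE_superset[OF f] lookup_add distrib_right sum.distrib)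
  finally show ?thesis .
qed

lemma EE_0 [simp]: "EE 0 \<Phi> = 0"
  by (simp add: EE_def)

lemma EE_sum: "EE (\<Sum>i\<in>I. G i) \<Phi> = (\<Sum>i\<in>I. EE (G i) \<Phi>)"
  by (induction I rule: infinite_finite_induct) (simp_all add: EE_add)

lemma EE_single: "EE (Poly_Mapping.single \<nu> v) \<Phi> = v * \<Phi> \<nu>"
  by (subst EE_superset[of "{\<nu>}"]) auto

lemma EE_mult: "EE (Poly_Mapping.single \<mu> v * G) \<Phi> = v * EE G (\<lambda>\<nu>. \<Phi> (\<mu> + \<nu>))"
proof -
  have "G = (\<Sum>\<nu>\<in>Poly_Mapping.keys G. Poly_Mapping.single \<nu> (Poly_Mapping.lookup G \<nu>))"
    by (rule poly_mapping_eqI) (auto simp: lookup_sum lookup_single when_def in_keys_iff)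
  then have "Poly_Mapping.single \<mu> v * G = Poly_Mapping.single \<mu> v * (\<Sum>\<nu>\<in>Poly_Mapping.keys G. Poly_Mapping.single \<nu> (Poly_Mapping.lookup G \<nu>))"
    by (rule arg_cong)
  also have "\<dots> = (\<Sum>\<nu>\<in>Poly_Mapping.keys G. Poly_Mapping.single (\<mu> + \<nu>) (v * Poly_Mapping.lookup G \<nu>))"
    by (simp add: sum_distrib_left mult_single)
  finally show ?thesis by (simp add: EE_sum EE_single) (simp add: EE_def sum_distrib_left mult.assoc)
qed

lemma EE_cst: "EE (cst rp * G) \<Phi> = rp * EE G \<Phi>"
  by (simp add: cst_def EE_mult)

lemma EE_mel: "EE (mel \<mu> * G) \<Phi> = EE G (\<lambda>\<nu>. \<Phi> (\<mu> + \<nu>))"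
  by (simp add: mel_def EE_mult)

definition zr :: "nat \<Rightarrow> nat \<Rightarrow> 'c::zero fps \<Rightarrow> bool" where
  "zr k \<rho> w \<longleftrightarrow> (\<forall>j. k - \<rho> < j \<and> j \<le> k \<longrightarrow> fps_nth w j = 0)"

lemma cls_beyond: "j > size \<nu> \<Longrightarrow> fps_nth (cls \<nu>) j = 0"
  by (simp add: cls_def)

lemma geom_coeff:
  fixes w V :: "'c::field fps"
  assumes "V = (1 - fps_const \<theta> * fps_X) * w"
  shows "fps_nth w n = (\<Sum>j\<le>n. fps_nth V j * \<theta> ^ (n - j))"
proof (induction n)
  case 0 show ?case using assms by simp
next
  case (Suc n)
  have "V = w - fps_const \<theta> * (fps_X * w)" using assms by (simp add: left_diff_distrib mult.assoc)
  then have "fps_nth V (Suc n) = fps_nth w (Suc n) - \<theta> * fps_nth w n" by simp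
  moreover have "(\<Sum>j\<le>n. fps_nth V j * \<theta> ^ (Suc n - j)) = \<theta> * (\<Sum>j\<le>n. fps_nth V j * \<theta> ^ (n - j))"
    unfolding sum_distrib_left by (intro sum.cong refl) (auto simp: Suc_diff_le)
  ultimately show ?case using Suc by simp
qed

text \<open>A factor of degree at most c mixes only coefficients N - c, ..., N, so a run loses c
  places at its lower end and keeps its upper end.\<close>

lemma run_coeff_zero:
  fixes w u :: "'c::field fps"
  assumes "zr k \<rho> w" "\<And>i. i > c \<Longrightarrow> fps_nth u i = 0" "N \<le> k" "k < N + \<rho> - c" "c < \<rho>" "\<rho> \<le> k"
  shows "fps_nth (w * u) N = 0"
proof -
  have z: "fps_nth w i * fps_nth u (N - i) = 0" if "i \<le> N" for i
  proof (cases "k - \<rho> < i")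
    case True then show ?thesis using assms(1,3) that by (simp add: zr_def)
  next
    case False
    then have "N - i > c" using assms by linarith
    then show ?thesis using assms(2) by simp
  qed
  show ?thesis unfolding fps_mult_nth
  proof (rule sum.neutral, rule ballI)
    fix i assume "i \<in> {0..N}"
    then have "i \<le> N" by simp
    then show "fps_nth w i * fps_nth u (N - i) = 0" by (rule z)
  qed
qed

lemma pow_add_one:
  fixes x :: real
  assumes x: "x \<ge> 0" and c: "c \<ge> 1"
  shows "x ^ c + 1 \<le> (x + 1) ^ c"
  using c
proof (induction c rule: nat_induct_at_least)
  case (Suc c)
  have "x ^ Suc c + 1 \<le> (x + 1) * (x ^ c + 1)" using x by (simp add: algebra_simps)
  also have "\<dots> \<le> (x + 1) * (x + 1) ^ c" using Suc x by (intro mult_left_mono) auto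
  finally show ?case by simp
qed simp

text \<open>It telescopes: the i-th summand is x^(i+1)/i! - x^i/(i-1)!.\<close>

lemma run_sum: "(\<Sum>i=1..<\<rho>. (x - real i) * 1 * x ^ i / fact i) = x ^ \<rho> / fact (\<rho> - 1) - x" if "\<rho> \<ge> 1" for x :: real
  using that
proof (induction \<rho> rule: nat_induct_at_least)
  case (Suc n)
  have f: "(fact n :: real) = real n * fact (n - 1)" using Suc.hyps by (subst fact_reduce) auto
  have "real n * x ^ n / fact n = x ^ n / fact (n - 1)" using Suc.hyps by (simp add: f)
  then have "(x - real n) * 1 * x ^ n / fact n = x ^ Suc n / fact n - x ^ n / fact (n - 1)"
    by (simp add: algebra_simps diff_divide_distrib)
  then show ?case using Suc by simp
qed simp

lemma pow_fact: "1 \<le> \<rho> \<Longrightarrow> \<rho> \<le> k \<Longrightarrow> real k * fact \<rho> \<le> real k ^ \<rho>"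
proof (induction \<rho> rule: nat_induct_at_least)
  case (Suc n)
  have "real k * fact (Suc n) = real (Suc n) * (real k * fact n)" by (simp add: algebra_simps)
  also have "\<dots> \<le> real k * real k ^ n" using Suc by (intro mult_mono) auto
  finally show ?case by simp
qed simp

context ff_setup
begin

section \<open>Averages over the unitary group and their recursions\<close>

definition EU :: "nat \<Rightarrow> ('a alg_closure multiset \<Rightarrow> real) \<Rightarrow> real" where
  "EU n \<Phi> = (\<Sum>g\<in>UG n. \<Phi> (ev (char_poly g))) / real (card (UG n))"

lemma EE_Ff: "EE (fps_nth Ff n) \<Phi> = EU n \<Phi>"
  by (simp add: Ff_def EE_cst EE_sum EU_def) (simp add: mel_def EE_single)

lemma EU_mono: "(\<And>\<nu>. \<nu> \<in> inv_msets (-{0}) phi n \<Longrightarrow> \<Phi> \<nu> \<le> \<Psi> \<nu>) \<Longrightarrow> EU n \<Phi> \<le> EU n \<Psi>"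
  unfolding EU_def using ev_Un by (intro divide_right_mono sum_mono) auto

lemma EU_cong: "(\<And>\<nu>. \<nu> \<in> inv_msets (-{0}) phi n \<Longrightarrow> \<Phi> \<nu> = \<Psi> \<nu>) \<Longrightarrow> EU n \<Phi> = EU n \<Psi>"
  unfolding EU_def using ev_Un by (intro arg_cong2[of _ _ _ _ "(/)"] sum.cong) auto

lemma EU_sum: "EU n (\<lambda>\<nu>. \<Sum>i\<in>I. \<Phi> i \<nu>) = (\<Sum>i\<in>I. EU n (\<Phi> i))"
  unfolding EU_def by (simp add: sum.swap[of _ I] sum_divide_distrib)

lemma EU_mult: "EU n (\<lambda>\<nu>. rp * \<Phi> \<nu>) = rp * EU n \<Phi>"
  unfolding EU_def by (simp add: sum_distrib_left)

lemma EU_add: "EU n (\<lambda>\<nu>. \<Phi> \<nu> + \<Psi> \<nu>) = EU n \<Phi> + EU n \<Psi>"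
  unfolding EU_def by (simp add: sum.distrib add_divide_distrib)

lemma EU_const: "EU n (\<lambda>\<nu>. rp) = rp"
  unfolding EU_def using card_Un_pos[of n] by simp

lemma EU_nonneg: "(\<And>\<nu>. 0 \<le> \<Phi> \<nu>) \<Longrightarrow> 0 \<le> EU n \<Phi>"
  unfolding EU_def by (intro divide_nonneg_nonneg sum_nonneg) auto

text \<open>Coefficient l of u F' = G F, with G from \<open>Ff_logd\<close>: averages over U(l) are
  reduced to smaller groups by splitting off an orbit of length c.\<close>

lemma EU_rec: "real l * EU l \<Phi> = (\<Sum>c=1..l. 1 / (real q ^ c - (-1) ^ c) *
    EU (l - c) (\<lambda>\<nu>. \<Sum>\<theta>\<in>period_pts (-{0}) phi c. \<Phi> (orb phi c \<theta> + \<nu>)))"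
proof -
  let ?G = "Abs_fps (\<lambda>c. if c = 0 then 0 else cst (1 / (real q ^ c - (-1) ^ c)) * P.Mf c)"
  have "of_nat l * fps_nth Ff l = (\<Sum>c=1..l. fps_nth ?G c * fps_nth Ff (l - c))"
    using Ff_logd unfolding logd_iff' by blast
  then have "EE (of_nat l * fps_nth Ff l) \<Phi> = (\<Sum>c=1..l. EE (fps_nth ?G c * fps_nth Ff (l - c)) \<Phi>)"
    by (simp only: EE_sum)
  moreover have "EE (of_nat l * fps_nth Ff l) \<Phi> = real l * EU l \<Phi>"
    unfolding cst_of_nat[symmetric] by (simp add: EE_cst EE_Ff)
  moreover have "EE (fps_nth ?G c * fps_nth Ff (l - c)) \<Phi> = 1 / (real q ^ c - (-1) ^ c) *
     EU (l - c) (\<lambda>\<nu>. \<Sum>\<theta>\<in>period_pts (-{0}) phi c. \<Phi> (orb phi c \<theta> + \<nu>))" if "c \<in> {1..l}" for c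
  proof -
    have "EE (fps_nth ?G c * fps_nth Ff (l - c)) \<Phi> = EE (cst (1 / (real q ^ c - (-1) ^ c)) * (P.Mf c * fps_nth Ff (l - c))) \<Phi>"
      using that by (simp add: mult.assoc)
    also have "\<dots> = 1 / (real q ^ c - (-1) ^ c) * EE (P.Mf c * fps_nth Ff (l - c)) \<Phi>" by (rule EE_cst)
    also have "EE (P.Mf c * fps_nth Ff (l - c)) \<Phi> = (\<Sum>\<theta>\<in>period_pts (-{0}) phi c. EU (l - c) (\<lambda>\<nu>. \<Phi> (orb phi c \<theta> + \<nu>)))"
      unfolding P.Mf_def sum_distrib_right by (simp add: EE_sum EE_mel EE_Ff)
    finally show ?thesis by (simp add: EU_sum)
  qed
  ultimately show ?thesis by simp
qed

text \<open>Coefficient n of F(u) = L(u/q) F(-u/q); the sign and the absence of powers of q on the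
  right come from the two scalings.\<close>

lemma EU_frec: "real q ^ n * EU n \<Phi> = (\<Sum>m\<le>n. (-1) ^ (n - m) * EU (n - m) (\<lambda>\<nu>. \<Sum>f\<in>inv_msets (-{0}) phi m. \<Phi> (f + \<nu>)))"
proof -
  have "EU n \<Phi> = EE (fps_nth (scale (1 / real q) P.Lf * scale (- 1 / real q) Ff) n) \<Phi>"
    using Ff_rec EE_Ff by metis
  also have "\<dots> = (\<Sum>m\<le>n. EE (cst ((1 / real q) ^ m) * (cst ((- 1 / real q) ^ (n - m)) * (fps_nth P.Lf m * fps_nth Ff (n - m)))) \<Phi>)"
  proof -
    have e: "(cst x * A) * (cst y * B) = cst x * (cst y * (A * B))" for x y and A B :: "'a alg_closure malg" by (simp only: mult_ac)
    show ?thesis by (simp only: fps_mult_nth scale_nth EE_sum atMost_atLeast0 e)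
  qed
  also have "\<dots> = (\<Sum>m\<le>n. (1 / real q) ^ m * (- 1 / real q) ^ (n - m) * EU (n - m) (\<lambda>\<nu>. \<Sum>f\<in>inv_msets (-{0}) phi m. \<Phi> (f + \<nu>)))"
    unfolding EE_cst P.Lf_def by (simp add: sum_distrib_right EE_sum EE_mel EE_Ff EU_sum mult.assoc)
  finally have "real q ^ n * EU n \<Phi> = (\<Sum>m\<le>n. real q ^ n * ((1 / real q) ^ m * (- 1 / real q) ^ (n - m)) * EU (n - m) (\<lambda>\<nu>. \<Sum>f\<in>inv_msets (-{0}) phi m. \<Phi> (f + \<nu>)))"
    by (simp add: sum_distrib_left mult.assoc)
  also have "\<dots> = (\<Sum>m\<le>n. (-1) ^ (n - m) * EU (n - m) (\<lambda>\<nu>. \<Sum>f\<in>inv_msets (-{0}) phi m. \<Phi> (f + \<nu>)))"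
  proof (rule sum.cong[OF refl])
    fix m assume m: "m \<in> {..n}"
    have "real q ^ n = real q ^ m * real q ^ (n - m)" using m by (simp flip: power_add)
    then have "real q ^ n * ((1 / real q) ^ m * (- 1 / real q) ^ (n - m)) = (real q * (1 / real q)) ^ m * (real q * (- 1 / real q)) ^ (n - m)"
      by (simp only: power_mult_distrib mult_ac)
    also have "\<dots> = (-1) ^ (n - m)" using q_gt1 by simp
    finally show "real q ^ n * ((1 / real q) ^ m * (- 1 / real q) ^ (n - m)) * EU (n - m) (\<lambda>\<nu>. \<Sum>f\<in>inv_msets (-{0}) phi m. \<Phi> (f + \<nu>)) =
      (-1) ^ (n - m) * EU (n - m) (\<lambda>\<nu>. \<Sum>f\<in>inv_msets (-{0}) phi m. \<Phi> (f + \<nu>))" by simp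
  qed
  finally show ?thesis .
qed

section \<open>The probability of a run of zeros\<close>

text \<open>Multiplying back by all c orbit factors leaves V a run of length rho - c. Multiplying
  back all but the first shows that coefficient N = k - (rho - c) of V/(1 - \<theta> X) is zero, a
  monic equation of degree N for \<theta>.\<close>

lemma run_small:
  assumes V: "fps_nth V 0 = 1" and c: "1 \<le> c" "c < \<rho>" "\<rho> \<le> k"
  shows "card {\<theta> \<in> period_pts (-{0}) phi c. zr k \<rho> (V * inverse (cls (orb phi c \<theta>)))} \<le> (if zr k (\<rho> - c) V then k - (\<rho> - c) else 0)"
proof -
  let ?S = "{\<theta> \<in> period_pts (-{0}) phi c. zr k \<rho> (V * inverse (cls (orb phi c \<theta>)))}" and ?N = "k - (\<rho> - c)"
  let ?w = "\<lambda>\<theta>. V * inverse (cls (orb phi c \<theta>))"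
  have Vw: "V = ?w \<theta> * cls (orb phi c \<theta>)" for \<theta> by (simp add: mult.assoc inverse_mult_eq_1)
  have zV: "zr k (\<rho> - c) V" if "\<theta> \<in> ?S" for \<theta>
    unfolding zr_def
  proof (intro allI impI)
    fix j assume j: "k - (\<rho> - c) < j \<and> j \<le> k"
    have "fps_nth (?w \<theta> * cls (orb phi c \<theta>)) j = 0"
      by (rule run_coeff_zero[of k \<rho> _ c]) (use that j c in \<open>auto intro!: cls_beyond\<close>)
    then show "fps_nth V j = 0" using Vw[of \<theta>] by simp
  qed
  define PP where "PP = (\<Sum>j\<le>?N. Polynomial.monom (fps_nth V j) (?N - j))"
  have cN: "poly.coeff PP ?N = 1"
  proof -
    have "poly.coeff PP ?N = (\<Sum>j\<le>?N. if j = 0 then fps_nth V j else 0)"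
      unfolding PP_def coeff_sum by (intro sum.cong) auto
    then show ?thesis using V by simp
  qed
  then have nz: "PP \<noteq> 0" by auto
  have dg: "degree PP \<le> ?N" unfolding PP_def by (rule degree_sum_le) (auto intro: order.trans[OF degree_monom_le])
  have root: "poly PP \<theta> = 0" if "\<theta> \<in> ?S" for \<theta>
  proof -
    have o1: "orb phi c \<theta> = add_mset \<theta> (orb phi (c - 1) (phi \<theta>))"
      using orb_add[of phi 1 "c - 1" \<theta>] c(1) by (simp add: orb_def)
    let ?w' = "?w \<theta> * cls (orb phi (c - 1) (phi \<theta>))"
    have "V = (1 - fps_const \<theta> * fps_X) * ?w'"
      using Vw[of \<theta>] unfolding o1 cls_add_mset by (metis mult.left_commute)
    then have "fps_nth ?w' ?N = (\<Sum>j\<le>?N. fps_nth V j * \<theta> ^ (?N - j))" by (rule geom_coeff)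
    moreover have "fps_nth ?w' ?N = 0"
      by (rule run_coeff_zero[of k \<rho> _ "c - 1"]) (use that c in \<open>auto intro!: cls_beyond\<close>)
    ultimately show ?thesis by (simp add: PP_def poly_sum poly_monom)
  qed
  have "card ?S \<le> card {\<theta>. poly PP \<theta> = 0}"
    by (rule card_mono) (use poly_roots_finite[OF nz] root in auto)
  also have "\<dots> \<le> ?N" using poly_roots_degree[OF nz] dg by simp
  finally have "card ?S \<le> ?N" .
  show ?thesis
  proof (cases "zr k (\<rho> - c) V")
    case True then show ?thesis using \<open>card ?S \<le> ?N\<close> by simp
  next
    case False
    then have "?S = {}" using zV by blast
    then show ?thesis by (simp only: card.empty le0)
  qed
qed

text \<open>Exponent of \<theta>^s times the e-th iterate of \<theta>, which is \<theta> to the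
  power q^e or -q^e according to parity; s is chosen large enough to clear the negative
  exponents.\<close>

definition dd :: "nat \<Rightarrow> nat \<Rightarrow> nat" where "dd s e = (if even e then s + q ^ e else s - q ^ e)"

text \<open>\<theta>^(s j) times the complete homogeneous symmetric function of degree j in the
  first e iterates of \<theta>, as a polynomial in \<theta>.\<close>

fun Gp :: "nat \<Rightarrow> nat \<Rightarrow> nat \<Rightarrow> 'a alg_closure poly" where
  "Gp s 0 j = (if j = 0 then 1 else 0)"
| "Gp s (Suc e) j = (\<Sum>i\<le>j. Polynomial.monom 1 (dd s e * (j - i)) * Gp s e i)"

lemma Gp_poly: "\<theta> \<noteq> 0 \<Longrightarrow> (\<And>i. i < e \<Longrightarrow> odd i \<Longrightarrow> q ^ i \<le> s) \<Longrightarrow>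
   poly (Gp s e j) \<theta> = \<theta> ^ (s * j) * fps_nth (inverse (cls (orb phi e \<theta>))) j"
proof (induction e arbitrary: j)
  case 0
  then show ?case by simp
next
  case (Suc e)
  let ?\<alpha> = "(phi ^^ e) \<theta>"
  have "inverse (cls (orb phi e \<theta>)) = (1 - fps_const ?\<alpha> * fps_X) * inverse (cls (orb phi (Suc e) \<theta>))"
  proof -
    have "inverse (cls (orb phi (Suc e) \<theta>)) = inverse (1 - fps_const ?\<alpha> * fps_X) * inverse (cls (orb phi e \<theta>))"
      unfolding orb_Suc cls_add_mset by (rule fps_inverse_mult)
    moreover have "(1 - fps_const ?\<alpha> * fps_X) * inverse (1 - fps_const ?\<alpha> * fps_X) = 1"
      by (rule inverse_mult_eq_1') simp
    ultimately show ?thesis by (simp add: mult.assoc[symmetric])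
  qed
  then have g: "fps_nth (inverse (cls (orb phi (Suc e) \<theta>))) j = (\<Sum>i\<le>j. fps_nth (inverse (cls (orb phi e \<theta>))) i * ?\<alpha> ^ (j - i))"
    by (rule geom_coeff)
  have al: "\<theta> ^ s * ?\<alpha> = \<theta> ^ dd s e"
  proof (cases "even e")
    case True then show ?thesis by (simp add: phi_pow dd_def power_add)
  next
    case False
    then have "q ^ e \<le> s" using Suc.prems(2)[of e] by simp
    then show ?thesis using False Suc.prems(1) by (simp add: phi_pow dd_def power_diff divide_inverse)
  qed
  have "poly (Gp s (Suc e) j) \<theta> = (\<Sum>i\<le>j. \<theta> ^ (dd s e * (j - i)) * (\<theta> ^ (s * i) * fps_nth (inverse (cls (orb phi e \<theta>))) i))"
    using Suc by (simp add: poly_sum poly_monom)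
  also have "\<dots> = (\<Sum>i\<le>j. \<theta> ^ (s * j) * (fps_nth (inverse (cls (orb phi e \<theta>))) i * ?\<alpha> ^ (j - i)))"
  proof (rule sum.cong[OF refl])
    fix i assume i: "i \<in> {..j}"
    have e1: "\<theta> ^ (dd s e * (j - i)) = (\<theta> ^ s) ^ (j - i) * ?\<alpha> ^ (j - i)" by (simp only: power_mult al[symmetric] power_mult_distrib)
    have e2: "(\<theta> ^ s) ^ (j - i) * \<theta> ^ (s * i) = \<theta> ^ (s * j)"
      using i by (simp add: power_mult[symmetric] power_add[symmetric] distrib_left[symmetric])
    show "\<theta> ^ (dd s e * (j - i)) * (\<theta> ^ (s * i) * fps_nth (inverse (cls (orb phi e \<theta>))) i) = \<theta> ^ (s * j) * (fps_nth (inverse (cls (orb phi e \<theta>))) i * ?\<alpha> ^ (j - i))"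
      unfolding e1 e2[symmetric] by (simp only: mult_ac)
  qed
  finally show ?case by (simp add: g sum_distrib_left)
qed

lemma Gp_degree: "(\<And>i. i < e \<Longrightarrow> dd s i \<le> D) \<Longrightarrow> degree (Gp s e j) \<le> j * D"
proof (induction e arbitrary: j)
  case (Suc e)
  show ?case unfolding Gp.simps
  proof (rule degree_sum_le)
    fix i assume i: "i \<in> {..j}"
    have "degree (Polynomial.monom 1 (dd s e * (j - i)) * Gp s e i) \<le> dd s e * (j - i) + i * D"
      using Suc.IH[of i] Suc.prems
      by (intro order.trans[OF degree_mult_le] add_mono degree_monom_le) auto
    also have "dd s e * (j - i) \<le> D * (j - i)" using Suc.prems[of e] by simp
    also have "D * (j - i) + i * D = j * D" using i by (simp add: mult.commute[of i] flip: distrib_left)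
    finally show "degree (Polynomial.monom 1 (dd s e * (j - i)) * Gp s e i) \<le> j * D" by simp
  qed simp
qed simp

lemma Gp_top_step:
  assumes "\<And>i. i < e \<Longrightarrow> dd s i \<le> D" "dd s e < D"
  shows "poly.coeff (Gp s (Suc e) j) (j * D) = poly.coeff (Gp s e j) (j * D)"
proof -
  have "poly.coeff (Polynomial.monom 1 (dd s e * (j - i)) * Gp s e i) (j * D) = (if i = j then poly.coeff (Gp s e j) (j * D) else 0)" if i: "i \<le> j" for i
  proof (cases "i = j")
    case False
    have "dd s e * (j - i) < D * (j - i)" using assms(2) i False by simp
    moreover have "D * (j - i) + i * D = j * D" using i by (simp add: mult.commute[of i] flip: distrib_left)
    ultimately have "i * D < j * D - dd s e * (j - i)" by linarith
    then have "poly.coeff (Gp s e i) (j * D - dd s e * (j - i)) = 0"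
      using Gp_degree[of e s D i] assms(1) by (intro coeff_eq_0) fastforce
    then show ?thesis using False by (simp add: coeff_monom_mult)
  qed (simp add: coeff_monom_mult)
  then show ?thesis by (simp add: coeff_sum)
qed

lemma Gp_top_0: "(\<And>i. i < e \<Longrightarrow> dd s i < D) \<Longrightarrow> poly.coeff (Gp s e j) (j * D) = (if j = 0 then 1 else 0)"
proof (induction e)
  case (Suc e)
  have "poly.coeff (Gp s (Suc e) j) (j * D) = poly.coeff (Gp s e j) (j * D)"
    by (rule Gp_top_step) (use Suc.prems in \<open>auto intro: less_imp_le\<close>)
  then show ?case using Suc by simp
qed simp

lemma Gp_top_1: assumes "\<And>i. i < e \<Longrightarrow> dd s i < D" "dd s e = D"
  shows "poly.coeff (Gp s (Suc e) j) (j * D) = 1"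
proof -
  have "poly.coeff (Polynomial.monom 1 (dd s e * (j - i)) * Gp s e i) (j * D) = (if i = 0 then 1 else 0)" if i: "i \<le> j" for i
  proof -
    have "D * (j - i) + i * D = j * D" using i by (simp add: mult.commute[of i] flip: distrib_left)
    then have "D * (j - i) \<le> j * D" "j * D - D * (j - i) = i * D" by linarith+
    then show ?thesis using Gp_top_0[of e s D i] assms by (simp add: coeff_monom_mult)
  qed
  then show ?thesis by (simp add: coeff_sum)
qed

text \<open>Multiplying back rho - 1 orbit factors uses up all but one place of the run: coefficient
  k of V divided by the first e factors vanishes. Times \<theta>^(s k), it is a polynomial in
  \<theta> of degree k D with leading coefficient 1, where D is the largest exponent
  \<open>dd s i\<close>, attained by only one iterate.\<close>

lemma run_large:
  assumes V: "fps_nth V 0 = 1" and e: "1 \<le> e" and \<rho>: "1 \<le> \<rho>" "\<rho> \<le> k"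
  shows "card {\<theta> \<in> period_pts (-{0}) phi (e + (\<rho> - 1)). zr k \<rho> (V * inverse (cls (orb phi (e + (\<rho> - 1)) \<theta>)))} \<le> k * (if e = 1 then 1 else q ^ (e - 2) * (q + 1))"
proof -
  let ?c = "e + (\<rho> - 1)"
  let ?S = "{\<theta> \<in> period_pts (-{0}) phi ?c. zr k \<rho> (V * inverse (cls (orb phi ?c \<theta>)))}"
  have "\<exists>s D. (\<forall>i<e. odd i \<longrightarrow> q ^ i \<le> s) \<and> (\<forall>i<e. dd s i \<le> D) \<and> s < D \<and> (\<forall>j. poly.coeff (Gp s e j) (j * D) = 1) \<and> D = (if e = 1 then 1 else q ^ (e - 2) * (q + 1))"
  proof -
    \<comment> \<open>E is the largest even index below e. The shift s is q to the largest odd index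
      below e, or 0 if there is none. The top exponent s + q^E is then 1 for e = 1 and q^(e-2) (q +
      1) otherwise.\<close>
    define E where "E = (if odd e then e - 1 else e - 2)"
    have E: "even E" "e = Suc E \<or> e = Suc (Suc E)" using e by (auto simp: E_def elim!: evenE)
    define s where "s = (if e = Suc E then (if E = 0 then 0 else q ^ (E - 1)) else q ^ Suc E)"
    have mono: "q ^ i \<le> q ^ j" if "i \<le> j" for i j using that q_gt1 by (simp add: power_increasing)
    have sm: "q ^ i < q ^ j" if "i < j" for i j using that q_gt1 by (simp add: power_strict_increasing)
    have pos: "q ^ E > 0" using q_gt1 by simp
    have odd_s: "q ^ i \<le> s" if "i < e" "odd i" for i
    proof (cases "e = Suc E")
      case True
      then have "i \<le> E - 1" "E \<noteq> 0" using that E(1) by (cases "i = E"; auto)+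
      then show ?thesis using True mono by (simp add: s_def)
    next
      case False
      then have "i \<le> Suc E" using that E by auto
      then show ?thesis using False mono by (simp add: s_def del: power_Suc)
    qed
    have lt: "dd s i < s + q ^ E" if "i < E" for i using that sm[of i E] pos by (auto simp: dd_def)
    have eq: "dd s E = s + q ^ E" using E(1) by (simp add: dd_def)
    have top: "poly.coeff (Gp s e j) (j * (s + q ^ E)) = 1" and le: "\<forall>i<e. dd s i \<le> s + q ^ E" for j
    proof -
      have t1: "poly.coeff (Gp s (Suc E) j) (j * (s + q ^ E)) = 1" by (rule Gp_top_1[OF lt eq])
      have l1: "dd s i \<le> s + q ^ E" if "i \<le> E" for i using lt[of i] eq that by (cases "i = E") auto
      have "dd s (Suc E) \<le> s" using E(1) by (simp add: dd_def)
      then have l2: "dd s (Suc E) < s + q ^ E" using pos by linarith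
      have t2: "poly.coeff (Gp s (Suc (Suc E)) j) (j * (s + q ^ E)) = 1"
        using Gp_top_step[of "Suc E" s "s + q ^ E" j] l1 l2 t1 by simp
      show "poly.coeff (Gp s e j) (j * (s + q ^ E)) = 1" using E(2) t1 t2 by metis
      show "\<forall>i<e. dd s i \<le> s + q ^ E"
      proof (intro allI impI)
        fix i assume "i < e"
        then have "i \<le> E \<or> i = Suc E" using E(2) by auto
        then show "dd s i \<le> s + q ^ E" using l1 l2 by auto
      qed
    qed
    have Deq: "s + q ^ E = (if e = 1 then 1 else q ^ (e - 2) * (q + 1))"
    proof (cases "e = Suc E")
      case True
      show ?thesis
      proof (cases "E = 0")
        case False
        then obtain E' where "E = Suc E'" by (cases E) auto
        then show ?thesis using True by (simp add: s_def)
      qed (use True in \<open>simp add: s_def\<close>)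
    next
      case False
      then have "e = Suc (Suc E)" using E(2) by simp
      then show ?thesis using False by (simp add: s_def)
    qed
    have 1: "\<forall>i<e. odd i \<longrightarrow> q ^ i \<le> s" using odd_s by simp
    have 2: "s < s + q ^ E" using pos by linarith
    have 3: "\<forall>j. poly.coeff (Gp s e j) (j * (s + q ^ E)) = 1" using top by (rule allI)
    show ?thesis by (rule exI[of _ s], rule exI[of _ "s + q ^ E"], intro conjI 1 le 2 3 Deq)
  qed
  then obtain s D where sD: "\<And>i. i < e \<Longrightarrow> odd i \<Longrightarrow> q ^ i \<le> s" "\<And>i. i < e \<Longrightarrow> dd s i \<le> D" "s < D"
    "\<And>j. poly.coeff (Gp s e j) (j * D) = 1" "D = (if e = 1 then 1 else q ^ (e - 2) * (q + 1))" by blast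
  \<comment> \<open>Written out as a convolution: j belongs to the inverse orbit factors, k - j to
    V. Only j = k reaches the exponent k D, with coefficient V_0 = 1.\<close>
  define PP where "PP = (\<Sum>j\<le>k. smult (fps_nth V (k - j)) (Polynomial.monom 1 (s * (k - j)) * Gp s e j))"
  have jk: "D * (k - j) + j * D = k * D" if "j \<le> k" for j
    using that by (simp add: mult.commute[of j] flip: distrib_left)
  have cf: "poly.coeff (smult (fps_nth V (k - j)) (Polynomial.monom 1 (s * (k - j)) * Gp s e j)) (k * D) = (if j = k then 1 else 0)" if j: "j \<le> k" for j
  proof (cases "j = k")
    case True then show ?thesis using V sD(4) by (simp add: coeff_monom_mult)
  next
    case False
    have "s * (k - j) < D * (k - j)" using sD(3) j False by simp
    then have "j * D < k * D - s * (k - j)" using jk[OF j] by linarith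
    then have "poly.coeff (Gp s e j) (k * D - s * (k - j)) = 0"
      using Gp_degree[of e s D j] sD(2) by (intro coeff_eq_0) fastforce
    then show ?thesis using False by (simp add: coeff_monom_mult)
  qed
  have "poly.coeff PP (k * D) = (\<Sum>j\<le>k. if j = k then 1 else 0)" unfolding PP_def coeff_sum by (intro sum.cong refl) (rule cf, simp)
  then have cN: "poly.coeff PP (k * D) = 1" by simp
  then have nz: "PP \<noteq> 0" by auto
  have dg: "degree PP \<le> k * D"
    unfolding PP_def
  proof (rule degree_sum_le)
    fix j assume j: "j \<in> {..k}"
    have "degree (Polynomial.monom 1 (s * (k - j)) * Gp s e j) \<le> s * (k - j) + j * D"
      using Gp_degree[of e s D j] sD(2) by (intro order.trans[OF degree_mult_le] add_mono degree_monom_le) auto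
    also have "\<dots> \<le> k * D" using jk[of j] j sD(3) by (metis add_le_mono1 atMost_iff less_imp_le mult_le_mono1)
    finally show "degree (smult (fps_nth V (k - j)) (Polynomial.monom 1 (s * (k - j)) * Gp s e j)) \<le> k * D"
      using degree_smult_le order.trans by blast
  qed simp
  have root: "poly PP \<theta> = 0" if \<theta>: "\<theta> \<in> ?S" for \<theta>
  proof -
    have nz: "\<theta> \<noteq> 0" using \<theta> by (auto simp: period_pts_def)
    let ?u = "V * inverse (cls (orb phi e \<theta>))" and ?w = "V * inverse (cls (orb phi ?c \<theta>))"
    let ?o2 = "orb phi (\<rho> - 1) ((phi ^^ e) \<theta>)"
    have "inverse (cls (orb phi ?c \<theta>)) = inverse (cls (orb phi e \<theta>)) * inverse (cls ?o2)"
      unfolding orb_add cls_union by (rule fps_inverse_mult)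
    then have uw: "?u = ?w * cls ?o2" by (simp add: mult.assoc inverse_mult_eq_1)
    have u: "fps_nth ?u k = 0"
      by (subst uw, rule run_coeff_zero[of k \<rho> _ "\<rho> - 1"]) (use \<theta> \<rho> in \<open>auto intro!: cls_beyond\<close>)
    have "poly PP \<theta> = (\<Sum>j\<le>k. fps_nth V (k - j) * (\<theta> ^ (s * (k - j)) * (\<theta> ^ (s * j) * fps_nth (inverse (cls (orb phi e \<theta>))) j)))"
      using Gp_poly[OF nz, of e s] sD(1) by (simp add: PP_def poly_sum poly_monom)
    also have "\<dots> = (\<Sum>j\<le>k. \<theta> ^ (s * k) * (fps_nth V (k - j) * fps_nth (inverse (cls (orb phi e \<theta>))) j))"
    proof (rule sum.cong[OF refl])
      fix j assume j: "j \<in> {..k}"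
      have e1: "\<theta> ^ (s * (k - j)) * \<theta> ^ (s * j) = \<theta> ^ (s * k)"
        using j by (simp add: power_add[symmetric] distrib_left[symmetric])
      show "fps_nth V (k - j) * (\<theta> ^ (s * (k - j)) * (\<theta> ^ (s * j) * fps_nth (inverse (cls (orb phi e \<theta>))) j)) = \<theta> ^ (s * k) * (fps_nth V (k - j) * fps_nth (inverse (cls (orb phi e \<theta>))) j)"
        unfolding e1[symmetric] by (simp only: mult_ac)
    qed
    also have "\<dots> = \<theta> ^ (s * k) * fps_nth (inverse (cls (orb phi e \<theta>)) * V) k"
      unfolding fps_mult_nth sum_distrib_left atMost_atLeast0 by (intro sum.cong refl) (simp add: mult.commute)
    finally show ?thesis using u by (simp add: mult.commute[of V])
  qed
  have "card ?S \<le> card {\<theta>. poly PP \<theta> = 0}"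
    by (rule card_mono) (use poly_roots_finite[OF nz] root in auto)
  also have "\<dots> \<le> k * D" using poly_roots_degree[OF nz] dg by simp
  finally show ?thesis using sD(5) by simp
qed

lemma weight_bound: assumes "c \<ge> 1" shows "0 < (real q - 1) ^ c" "(real q - 1) ^ c \<le> real q ^ c - (-1) ^ c"
proof -
  have q: "real q > 1" using q_gt1 by simp
  then show "0 < (real q - 1) ^ c" by simp
  have "(real q - 1) ^ c + 1 \<le> (real q - 1 + 1) ^ c" by (rule pow_add_one) (use q assms in auto)
  moreover have "(-1) ^ c \<le> (1 :: real)" by (cases "even c") auto
  ultimately show "(real q - 1) ^ c \<le> real q ^ c - (-1) ^ c" by simp
qed

lemma frac_bound: "A * C \<le> B \<Longrightarrow> 0 < B \<Longrightarrow> 0 < C \<Longrightarrow> A / B \<le> 1 / C" for A B C :: real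
  by (simp add: pos_le_divide_eq pos_divide_le_eq)

text \<open>The identity (q + 1)(q - 1) = q^2 - 1 absorbs the number of points from
  \<open>run_large\<close> into the weight of the orbit, so every length c >= rho receives the same
  bound k / (q - 1)^rho.\<close>

lemma weight_large: assumes "1 \<le> e" "1 \<le> \<rho>"
  shows "real (if e = 1 then 1 else q ^ (e - 2) * (q + 1)) / (real q ^ (e + (\<rho> - 1)) - (-1) ^ (e + (\<rho> - 1))) \<le> 1 / (real q - 1) ^ \<rho>"
proof (cases "e = 1")
  case True
  then show ?thesis using weight_bound[OF assms(2)] assms by (simp add: frac_le)
next
  case False
  then obtain f where f: "e = f + 2" using assms by (metis Suc_1 Suc_leI add.commute le_add_diff_inverse le_neq_implies_less)
  obtain \<sigma> where \<sigma>: "\<rho> = Suc \<sigma>" using assms by (cases \<rho>) auto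
  have q: "real q > 1" using q_gt1 by simp
  let ?c = "f + 2 + \<sigma>"
  have "real q ^ f * (real q + 1) * (real q - 1) ^ \<rho> = real q ^ f * ((real q + 1) * (real q - 1)) * (real q - 1) ^ \<sigma>"
    by (simp add: \<sigma>)
  also have "\<dots> \<le> real q ^ f * ((real q + 1) * (real q - 1)) * real q ^ \<sigma>"
    using q by (intro mult_left_mono power_mono) auto
  also have "\<dots> = real q ^ ?c - real q ^ (f + \<sigma>)" by (simp add: power_add power2_eq_square algebra_simps)
  also have "\<dots> \<le> real q ^ ?c - 1" using q by (simp add: one_le_power)
  also have "\<dots> \<le> real q ^ ?c - (-1) ^ ?c" by (cases "even ?c") auto
  finally have "real q ^ f * (real q + 1) * (real q - 1) ^ \<rho> \<le> real q ^ ?c - (-1) ^ ?c" .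
  moreover have "0 < real q ^ ?c - (-1) ^ ?c" using weight_bound[of ?c] by linarith
  moreover have "0 < (real q - 1) ^ \<rho>" using q by simp
  ultimately have "real q ^ f * (real q + 1) / (real q ^ ?c - (-1) ^ ?c) \<le> 1 / (real q - 1) ^ \<rho>"
    by (rule frac_bound)
  moreover have "e + (\<rho> - 1) = ?c" by (simp add: f \<sigma>)
  moreover have "real (if e = 1 then 1 else q ^ (e - 2) * (q + 1)) = real q ^ f * (real q + 1)" using f by (simp add: algebra_simps)
  ultimately show ?thesis by metis
qed

text \<open>Induction on l through \<open>EU_rec\<close>: orbits of length c < rho lead to runs of
  length rho - c, longer ones are bounded outright. By \<open>run_sum\<close> the total is
  (k^rho/(rho-1)! + (l - rho) k)/(q - 1)^rho, and k <= k^rho/rho! makes it at most l times the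
  claimed bound.\<close>

theorem Z_bound:
  assumes y: "fps_nth y 0 = 1" and "1 \<le> \<rho>" "\<rho> \<le> k" "\<rho> \<le> l"
  shows "EU l (\<lambda>\<nu>. of_bool (zr k \<rho> (y * inverse (cls \<nu>)))) \<le> (real k / (real q - 1)) ^ \<rho> / fact \<rho>"
  using assms(2-4)
proof (induction l arbitrary: \<rho> rule: less_induct)
  case (less l)
  let ?Q = "real q - 1"
  have q: "?Q > 0" using q_gt1 by simp
  let ?\<Phi> = "\<lambda>\<rho> \<nu>. of_bool (zr k \<rho> (y * inverse (cls \<nu>))) :: real"
  have V0: "fps_nth (y * inverse (cls \<nu>)) 0 = 1" for \<nu> using y by simp
  have sp: "(\<Sum>\<theta>\<in>period_pts (-{0}) phi c. ?\<Phi> \<rho> (orb phi c \<theta> + \<nu>)) =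
     real (card {\<theta> \<in> period_pts (-{0}) phi c. zr k \<rho> ((y * inverse (cls \<nu>)) * inverse (cls (orb phi c \<theta>)))})" if "c \<ge> 1" for c \<nu>
  proof -
    have e: "y * inverse (cls (orb phi c \<theta> + \<nu>)) = (y * inverse (cls \<nu>)) * inverse (cls (orb phi c \<theta>))" for \<theta>
      unfolding cls_union by (simp add: fps_inverse_mult mult_ac)
    show ?thesis unfolding e by (rule sum_of_bool_card[OF finite_period_phi[OF that]])
  qed
  let ?W = "\<lambda>c. 1 / (real q ^ c - (-1) ^ c)"
  have W: "0 \<le> ?W c" "?W c \<le> 1 / ?Q ^ c" if "c \<ge> 1" for c
    using weight_bound[OF that] by (auto intro!: divide_left_mono mult_pos_pos)
  let ?T = "\<lambda>c. ?W c * EU (l - c) (\<lambda>\<nu>. \<Sum>\<theta>\<in>period_pts (-{0}) phi c. ?\<Phi> \<rho> (orb phi c \<theta> + \<nu>))"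
  have small: "?T c \<le> (real k - real (\<rho> - c)) * real k ^ (\<rho> - c) / fact (\<rho> - c) / ?Q ^ \<rho>" if c: "1 \<le> c" "c < \<rho>" for c
  proof -
    have "EU (l - c) (\<lambda>\<nu>. \<Sum>\<theta>\<in>period_pts (-{0}) phi c. ?\<Phi> \<rho> (orb phi c \<theta> + \<nu>)) \<le> EU (l - c) (\<lambda>\<nu>. real (k - (\<rho> - c)) * ?\<Phi> (\<rho> - c) \<nu>)"
    proof (rule EU_mono)
      fix \<nu>
      show "(\<Sum>\<theta>\<in>period_pts (-{0}) phi c. ?\<Phi> \<rho> (orb phi c \<theta> + \<nu>)) \<le> real (k - (\<rho> - c)) * ?\<Phi> (\<rho> - c) \<nu>"
        unfolding sp[OF c(1)] using run_small[OF V0[of \<nu>] c less.prems(2)] by (auto split: if_splits)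
    qed
    also have "\<dots> \<le> real (k - (\<rho> - c)) * ((real k / ?Q) ^ (\<rho> - c) / fact (\<rho> - c))"
      unfolding EU_mult using less.prems c by (intro mult_left_mono less.IH) auto
    finally have "?T c \<le> 1 / ?Q ^ c * (real (k - (\<rho> - c)) * ((real k / ?Q) ^ (\<rho> - c) / fact (\<rho> - c)))"
      using W[OF c(1)] q by (intro mult_mono EU_nonneg sum_nonneg) auto
    also have "\<dots> = (real k - real (\<rho> - c)) * real k ^ (\<rho> - c) / fact (\<rho> - c) / (?Q ^ c * ?Q ^ (\<rho> - c))"
    proof -
      have e: "1 / A * (R * (B / C / D)) = R * B / D / (A * C)" for A B C D R :: real
        by (simp add: mult_ac)
      have "\<rho> - c \<le> k" using less.prems by linarith
      then have "real (k - (\<rho> - c)) = real k - real (\<rho> - c)" by (rule of_nat_diff)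
      then show ?thesis by (simp only: power_divide e)
    qed
    also have "?Q ^ c * ?Q ^ (\<rho> - c) = ?Q ^ \<rho>" using c by (simp flip: power_add)
    finally show ?thesis .
  qed
  have large: "?T c \<le> real k / ?Q ^ \<rho>" if c: "\<rho> \<le> c" for c
  proof -
    define e where "e = c - \<rho> + 1"
    have e: "1 \<le> e" "c = e + (\<rho> - 1)" "c \<ge> 1" using c less.prems by (auto simp: e_def)
    let ?D = "real (if e = 1 then 1 else q ^ (e - 2) * (q + 1))"
    have "EU (l - c) (\<lambda>\<nu>. \<Sum>\<theta>\<in>period_pts (-{0}) phi c. ?\<Phi> \<rho> (orb phi c \<theta> + \<nu>)) \<le> EU (l - c) (\<lambda>\<nu>. real k * ?D)"
    proof (rule EU_mono)
      fix \<nu>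
      show "(\<Sum>\<theta>\<in>period_pts (-{0}) phi c. ?\<Phi> \<rho> (orb phi c \<theta> + \<nu>)) \<le> real k * ?D"
        unfolding sp[OF e(3)] unfolding e(2) of_nat_mult[symmetric] of_nat_le_iff
        using run_large[OF V0[of \<nu>] e(1) less.prems(1,2)] .
    qed
    then have "?T c \<le> ?W c * (real k * ?D)" unfolding EU_const using W[OF e(3)] by (intro mult_left_mono) auto
    also have "\<dots> = real k * (?D / (real q ^ (e + (\<rho> - 1)) - (-1) ^ (e + (\<rho> - 1))))" by (simp add: e(2))
    also have "\<dots> \<le> real k * (1 / ?Q ^ \<rho>)" using weight_large[OF e(1) less.prems(1)] by (intro mult_left_mono) auto
    finally show ?thesis by simp
  qed
  have "real l * EU l (?\<Phi> \<rho>) = (\<Sum>c=1..l. ?T c)" by (rule EU_rec)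
  also have "{1..l} = {1..<\<rho>} \<union> {\<rho>..l}" using less.prems by auto
  also have "(\<Sum>c\<in>{1..<\<rho>} \<union> {\<rho>..l}. ?T c) = (\<Sum>c=1..<\<rho>. ?T c) + (\<Sum>c=\<rho>..l. ?T c)" by (intro sum.union_disjoint) auto
  also have "\<dots> \<le> (\<Sum>c=1..<\<rho>. (real k - real (\<rho> - c)) * real k ^ (\<rho> - c) / fact (\<rho> - c) / ?Q ^ \<rho>) + (\<Sum>c=\<rho>..l. real k / ?Q ^ \<rho>)"
    using small large by (intro add_mono sum_mono) auto
  also have "(\<Sum>c=1..<\<rho>. (real k - real (\<rho> - c)) * real k ^ (\<rho> - c) / fact (\<rho> - c) / ?Q ^ \<rho>) = (\<Sum>i=1..<\<rho>. (real k - real i) * 1 * real k ^ i / fact i) / ?Q ^ \<rho>"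
    unfolding sum_divide_distrib
    by (rule sum.reindex_bij_witness[where i = "\<lambda>i. \<rho> - i" and j = "\<lambda>i. \<rho> - i"]) auto
  also have "\<dots> = (real k ^ \<rho> / fact (\<rho> - 1) - real k) / ?Q ^ \<rho>" by (simp only: run_sum[OF less.prems(1)])
  also have "(\<Sum>c=\<rho>..l. real k / ?Q ^ \<rho>) = (real l - real \<rho> + 1) * real k / ?Q ^ \<rho>"
    using less.prems by (simp add: of_nat_diff)
  finally have "real l * EU l (?\<Phi> \<rho>) \<le> (real k ^ \<rho> / fact (\<rho> - 1) - real k) / ?Q ^ \<rho> + (real l - real \<rho> + 1) * real k / ?Q ^ \<rho>" .
  also have "\<dots> = (real k ^ \<rho> / fact (\<rho> - 1) + (real l - real \<rho>) * real k) / ?Q ^ \<rho>"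
    unfolding add_divide_distrib[symmetric] by (rule arg_cong[of _ _ "\<lambda>t. t / _"]) (simp add: algebra_simps)
  also have "\<dots> \<le> (real l * (real k ^ \<rho> / fact \<rho>)) / ?Q ^ \<rho>"
  proof (rule divide_right_mono)
    have f: "(fact \<rho> :: real) = real \<rho> * fact (\<rho> - 1)" using less.prems by (subst fact_reduce) auto
    have e1: "real k ^ \<rho> / fact (\<rho> - 1) = real \<rho> * (real k ^ \<rho> / fact \<rho>)" using less.prems by (simp add: f)
    have e2: "L * P = R * P + (L - R) * P" for L P R :: real by (simp add: algebra_simps)
    have "real k \<le> real k ^ \<rho> / fact \<rho>" using pow_fact[OF less.prems(1,2)] by (simp add: pos_le_divide_eq)
    then have "(real l - real \<rho>) * real k \<le> (real l - real \<rho>) * (real k ^ \<rho> / fact \<rho>)" using less.prems by (intro mult_left_mono) auto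
    then show "real k ^ \<rho> / fact (\<rho> - 1) + (real l - real \<rho>) * real k \<le> real l * (real k ^ \<rho> / fact \<rho>)"
      unfolding e1 e2[of "real l" _ "real \<rho>"] by (rule add_left_mono)
  qed (use q in simp)
  finally have "real l * EU l (?\<Phi> \<rho>) \<le> real l * ((real k / ?Q) ^ \<rho> / fact \<rho>)" by (simp add: power_divide mult.commute)
  then show ?case by (rule mult_left_le_imp_le) (use less.prems in simp)
qed

end

section \<open>The error bound\<close>

text \<open>A tail bounded by a fifth of its last term stays so bounded when terms shrink by a
  factor of at least 6; this is the induction step of the next two sums.\<close>

lemma fifth_bound: "6 / G \<le> 1 / F \<Longrightarrow> 1 / G \<le> 1 / (5 * F) - 1 / (5 * G)" for F G :: real
proof -
  assume "6 / G \<le> 1 / F"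
  moreover have "1 / (5 * F) = (1 / F) / 5" "1 / (5 * G) = (1 / G) / 5" "6 / G = 6 * (1 / G)" by simp_all
  ultimately show ?thesis by linarith
qed

text \<open>The limit is sinh 1 = 1.1752...; the constant is 1 + 1/6 plus the tail allowance
  1/30.\<close>

lemma fact_odd_sum: "(\<Sum>u<N. 1 / fact (2 * u + 1)) \<le> (6 / 5 :: real)"
proof -
  have "(\<Sum>u<Suc (Suc N). 1 / fact (2 * u + 1)) \<le> (6 / 5 :: real) - 1 / (5 * fact (2 * N + 3))" for N
  proof (induction N)
    case 0 show ?case by (simp add: fact_numeral numeral_eq_Suc)
  next
    case (Suc N)
    have "(fact (2 * Suc N + 3) :: real) = real (2 * N + 5) * (real (2 * N + 4) * fact (2 * N + 3))"
      by (simp add: numeral_eq_Suc algebra_simps)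
    moreover have "6 * fact (2 * N + 3) \<le> real (2 * N + 5) * (real (2 * N + 4) * fact (2 * N + 3))"
    proof -
      have "6 \<le> real (2 * N + 5) * real (2 * N + 4)"
        using mult_mono[of 5 "real (2 * N + 5)" 4 "real (2 * N + 4)"] by simp
      then have "6 * fact (2 * N + 3) \<le> real (2 * N + 5) * real (2 * N + 4) * (fact (2 * N + 3) :: real)" by (intro mult_right_mono) auto
      then show ?thesis by (simp only: mult.assoc)
    qed
    ultimately have le: "6 * fact (2 * N + 3) \<le> (fact (2 * Suc N + 3) :: real)" by simp
    let ?F = "fact (2 * N + 3) :: real" and ?G = "fact (2 * Suc N + 3) :: real"
    have pos: "?F > 0" "?G > 0" by simp_all
    have "6 / ?G \<le> 1 / ?F" using le pos by (simp add: pos_divide_le_eq pos_le_divide_eq)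
    then have "1 / ?G \<le> 1 / (5 * ?F) - 1 / (5 * ?G)" by (rule fifth_bound)
    moreover have "(\<Sum>u<Suc (Suc (Suc N)). 1 / fact (2 * u + 1)) = (\<Sum>u<Suc (Suc N). 1 / fact (2 * u + 1)) + 1 / ?G"
    proof -
      have "2 * Suc (Suc N) + 1 = 2 * Suc N + 3" by simp
      then show ?thesis by (subst sum.lessThan_Suc) (simp only:)
    qed
    ultimately show ?case using Suc by linarith
  qed
  from this[of N] have "(\<Sum>u<Suc (Suc N). 1 / fact (2 * u + 1)) \<le> (6 / 5 :: real)"
    by (smt (verit) divide_nonneg_nonneg fact_ge_zero)
  moreover have "(\<Sum>u<N. 1 / fact (2 * u + 1)) \<le> (\<Sum>u<Suc (Suc N). 1 / fact (2 * u + 1) :: real)"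
    by (rule sum_mono2) auto
  ultimately show ?thesis by linarith
qed

text \<open>The limit is cosh 1 - 1 = 0.5430...; the constant is 1/2 plus the tail allowance
  1/10.\<close>

lemma fact_even_sum: "(\<Sum>u<N. 1 / fact (2 * u + 2)) \<le> (3 / 5 :: real)"
proof -
  have "(\<Sum>u<Suc N. 1 / fact (2 * u + 2)) \<le> (3 / 5 :: real) - 1 / (5 * fact (2 * N + 2))" for N
  proof (induction N)
    case 0 show ?case by (simp add: fact_numeral numeral_eq_Suc)
  next
    case (Suc N)
    have "(fact (2 * Suc N + 2) :: real) = real (2 * N + 4) * (real (2 * N + 3) * fact (2 * N + 2))"
      by (simp add: numeral_eq_Suc algebra_simps)
    moreover have "6 * fact (2 * N + 2) \<le> real (2 * N + 4) * (real (2 * N + 3) * fact (2 * N + 2))"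
    proof -
      have "6 \<le> real (2 * N + 4) * real (2 * N + 3)"
        using mult_mono[of 4 "real (2 * N + 4)" 3 "real (2 * N + 3)"] by simp
      then have "6 * fact (2 * N + 2) \<le> real (2 * N + 4) * real (2 * N + 3) * (fact (2 * N + 2) :: real)" by (intro mult_right_mono) auto
      then show ?thesis by (simp only: mult.assoc)
    qed
    ultimately have le: "6 * fact (2 * N + 2) \<le> (fact (2 * Suc N + 2) :: real)" by simp
    let ?F = "fact (2 * N + 2) :: real" and ?G = "fact (2 * Suc N + 2) :: real"
    have pos: "?F > 0" "?G > 0" by simp_all
    have "6 / ?G \<le> 1 / ?F" using le pos by (simp add: pos_divide_le_eq pos_le_divide_eq)
    then have "1 / ?G \<le> 1 / (5 * ?F) - 1 / (5 * ?G)" by (rule fifth_bound)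
    moreover have "(\<Sum>u<Suc (Suc N). 1 / fact (2 * u + 2)) = (\<Sum>u<Suc N. 1 / fact (2 * u + 2)) + 1 / ?G"
      by (subst sum.lessThan_Suc) (simp only:)
    ultimately show ?case using Suc by linarith
  qed
  from this[of N] have "(\<Sum>u<Suc N. 1 / fact (2 * u + 2)) \<le> (3 / 5 :: real)"
    by (smt (verit) divide_nonneg_nonneg fact_ge_zero)
  moreover have "(\<Sum>u<N. 1 / fact (2 * u + 2)) \<le> (\<Sum>u<Suc N. 1 / fact (2 * u + 2) :: real)"
    by (rule sum_mono2) auto
  ultimately show ?thesis by linarith
qed

lemma fact_all_sum: "(\<Sum>i<N. 1 / fact (i + 1)) \<le> (2 :: real)"
proof -
  have "(\<Sum>i<Suc N. 1 / fact (i + 1)) \<le> (2 :: real) - 1 / fact (N + 1)" for N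
  proof (induction N)
    case (Suc N)
    have "2 * fact (N + 1) \<le> real (N + 2) * (fact (N + 1) :: real)" by (intro mult_right_mono) auto
    also have "\<dots> = fact (Suc N + 1)" by (simp add: algebra_simps)
    finally have "2 / fact (Suc N + 1) \<le> (1 / fact (N + 1) :: real)"
      by (simp add: pos_divide_le_eq pos_le_divide_eq del: fact_Suc)
    moreover have "(\<Sum>i<Suc (Suc N). 1 / fact (i + 1)) = (\<Sum>i<Suc N. 1 / fact (i + 1)) + (1 / fact (Suc N + 1) :: real)"
      by (subst sum.lessThan_Suc) (simp only:)
    ultimately show ?case using Suc by (simp del: fact_Suc sum.lessThan_Suc)
  qed simp
  from this[of N] have "(\<Sum>i<Suc N. 1 / fact (i + 1)) \<le> (2 :: real)"
    by (smt (verit) divide_nonneg_nonneg fact_ge_zero)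
  moreover have "(\<Sum>i<N. 1 / fact (i + 1)) \<le> (\<Sum>i<Suc N. 1 / fact (i + 1) :: real)"
    by (rule sum_mono2) auto
  ultimately show ?thesis by linarith
qed

lemma pow_le_base: "0 \<le> x \<Longrightarrow> x \<le> 1 \<Longrightarrow> i \<ge> 1 \<Longrightarrow> x ^ i \<le> x" for x :: real
  using power_decreasing[of 1 i x] by simp

context ff_setup
begin

section \<open>The event in terms of unitary polynomials\<close>

text \<open>The descent of \<open>cls \<nu>\<close> to F_{q^2}, which exists for stable multisets by
  \<open>bij_ev_upolys\<close>; it allows division of classes over the base field.\<close>

definition Yn :: "'a alg_closure multiset \<Rightarrow> 'a fps" where "Yn \<nu> = (SOME Y. em Y = cls \<nu>)"

lemma em_1: "em 1 = 1"
  by (rule fps_ext) (simp add: fps_one_nth)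

lemma Yn: assumes "\<nu> \<in> inv_msets (-{0}) phi l" shows "em (Yn \<nu>) = cls \<nu>" "fps_nth (Yn \<nu>) 0 = 1"
proof -
  obtain g where g: "g \<in> upolys l" "\<nu> = ev g" using bij_betw_imp_surj_on[OF bij_ev_upolys[of l]] assms by blast
  have m: "monic g" using g(1) by (auto simp: upolys_def upoly_def)
  have "em (Abs_fps (\<lambda>j. if j \<le> degree g then poly.coeff g (degree g - j) else 0)) = cls \<nu>"
    by (rule fps_ext) (simp add: g(2) cls_ev[OF m])
  then show 1: "em (Yn \<nu>) = cls \<nu>" unfolding Yn_def by (rule someI)
  have "to_ac (fps_nth (Yn \<nu>) 0) = to_ac 1" using arg_cong[OF 1, of "\<lambda>f. fps_nth f 0"] by simp
  then show "fps_nth (Yn \<nu>) 0 = 1" by (simp only: inj_eq[OF inj_to_ac])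
qed

lemma em_inverse_Yn: assumes "\<nu> \<in> inv_msets (-{0}) phi l" shows "em (y * inverse (Yn \<nu>)) = em y * inverse (cls \<nu>)"
proof -
  have "em (Yn \<nu>) * em (inverse (Yn \<nu>)) = 1"
    using Yn(2)[OF assms] by (simp only: em_mult[symmetric]) (simp add: inverse_mult_eq_1' em_1)
  then have "cls \<nu> * em (inverse (Yn \<nu>)) = 1" by (simp only: Yn(1)[OF assms])
  moreover have "inverse (cls \<nu>) * cls \<nu> = 1" by (rule inverse_mult_eq_1) simp
  ultimately have "inverse (cls \<nu>) * (cls \<nu> * em (inverse (Yn \<nu>))) = inverse (cls \<nu>)" "inverse (cls \<nu>) * cls \<nu> * em (inverse (Yn \<nu>)) = em (inverse (Yn \<nu>))"
    by (simp_all only: mult_1 mult_1_right)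
  then have "em (inverse (Yn \<nu>)) = inverse (cls \<nu>)" by (simp only: mult.assoc)
  then show ?thesis by (simp only: em_mult)
qed

definition Hit :: "nat \<Rightarrow> (nat \<Rightarrow> 'a) \<Rightarrow> 'a alg_closure multiset \<Rightarrow> real" where
  "Hit k a \<nu> = of_bool (\<exists>y\<in>CC k a. \<forall>j\<le>k. fps_nth (cls \<nu>) j = to_ac (fps_nth y j))"

lemma Hit_sum: "Hit k a \<nu> = (\<Sum>y\<in>CC k a. of_bool (\<forall>j\<le>k. fps_nth (cls \<nu>) j = to_ac (fps_nth y j)))"
proof (cases "\<exists>y\<in>CC k a. \<forall>j\<le>k. fps_nth (cls \<nu>) j = to_ac (fps_nth y j)")
  case True
  then obtain y where y: "y \<in> CC k a" "\<forall>j\<le>k. fps_nth (cls \<nu>) j = to_ac (fps_nth y j)" by blast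
  have u: "y' = y" if "y' \<in> CC k a" "\<forall>j\<le>k. fps_nth (cls \<nu>) j = to_ac (fps_nth y' j)" for y'
  proof (rule fps_ext)
    fix j show "fps_nth y' j = fps_nth y j"
    proof (cases "j \<le> k")
      case True
      then have "to_ac (fps_nth y' j) = to_ac (fps_nth y j)" using that(2) y(2) by metis
      then show ?thesis by (simp only: inj_eq[OF inj_to_ac])
    next
      case False then show ?thesis using that(1) y(1) by (simp add: CC_def)
    qed
  qed
  have "(\<Sum>y'\<in>CC k a. of_bool (\<forall>j\<le>k. fps_nth (cls \<nu>) j = to_ac (fps_nth y' j))) = (\<Sum>y'\<in>CC k a. if y' = y then 1 else (0 :: real))"
    by (intro sum.cong refl) (use u y in \<open>auto simp: of_bool_def\<close>)
  then show ?thesis using True y(1) card_CC(1) by (simp add: Hit_def)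
next
  case False
  have "(\<Sum>y\<in>CC k a. of_bool (\<forall>j\<le>k. fps_nth (cls \<nu>) j = to_ac (fps_nth y j))) = (0 :: real)"
  proof (rule sum.neutral, rule ballI)
    fix y assume "y \<in> CC k a"
    then have "\<not> (\<forall>j\<le>k. fps_nth (cls \<nu>) j = to_ac (fps_nth y j))" using False by blast
    then show "of_bool (\<forall>j\<le>k. fps_nth (cls \<nu>) j = to_ac (fps_nth y j)) = (0 :: real)" by (simp only: of_bool_eq(1))
  qed
  then show ?thesis using False by (simp only: Hit_def of_bool_eq(1))
qed

definition Bk :: "nat \<Rightarrow> (nat \<Rightarrow> 'a) \<Rightarrow> nat \<Rightarrow> 'a alg_closure multiset \<Rightarrow> real" where
  "Bk k a m \<nu> = (\<Sum>y\<in>CC k a. real (card (ufib k m (fps_nth (y * inverse (Yn \<nu>))))))"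

text \<open>Since \<open>cls\<close> is multiplicative, f joined to the given multiset lies in the
  class y exactly when f lies in the quotient class, which is a condition on leading coefficients
  and hence a set \<open>ufib\<close>.\<close>

lemma Hit_fibre: assumes \<nu>: "\<nu> \<in> inv_msets (-{0}) phi l"
  shows "(\<Sum>f\<in>inv_msets (-{0}) phi m. Hit k a (f + \<nu>)) = Bk k a m \<nu>"
proof -
  have eq: "(\<forall>j\<le>k. fps_nth (cls (f + \<nu>)) j = to_ac (fps_nth y j)) \<longleftrightarrow> (\<forall>j\<le>k. fps_nth (cls f) j = to_ac (fps_nth (y * inverse (Yn \<nu>)) j))" for f y
  proof -
    let ?c = "cls \<nu>"
    have cc: "?c * inverse ?c = 1" by (rule inverse_mult_eq_1') simp
    have e: "em (y * inverse (Yn \<nu>)) = em y * inverse ?c" by (rule em_inverse_Yn[OF \<nu>])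
    have yc: "em y = em (y * inverse (Yn \<nu>)) * ?c" unfolding e using cc by (simp add: mult.assoc mult.commute[of _ ?c])
    show ?thesis
    proof
      assume h: "\<forall>j\<le>k. fps_nth (cls (f + \<nu>)) j = to_ac (fps_nth y j)"
      show "\<forall>j\<le>k. fps_nth (cls f) j = to_ac (fps_nth (y * inverse (Yn \<nu>)) j)"
      proof (intro allI impI)
        fix j assume j: "j \<le> k"
        have "fps_nth (cls f) j = fps_nth (em (y * inverse (Yn \<nu>))) j"
        proof (rule nz_of_trunc[OF _ _ _ j])
          show "fps_nth (cls f * ?c) i = fps_nth (em (y * inverse (Yn \<nu>)) * ?c) i" if "i \<le> k" for i
            unfolding yc[symmetric] using h that by (simp add: cls_union)
        qed simp_all
        then show "fps_nth (cls f) j = to_ac (fps_nth (y * inverse (Yn \<nu>)) j)" by simp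
      qed
    next
      assume h: "\<forall>j\<le>k. fps_nth (cls f) j = to_ac (fps_nth (y * inverse (Yn \<nu>)) j)"
      show "\<forall>j\<le>k. fps_nth (cls (f + \<nu>)) j = to_ac (fps_nth y j)"
      proof (intro allI impI)
        fix j assume j: "j \<le> k"
        have "fps_nth (cls f * ?c) j = fps_nth (em (y * inverse (Yn \<nu>)) * ?c) j"
          unfolding fps_mult_nth using h j by (intro sum.cong refl) auto
        then show "fps_nth (cls (f + \<nu>)) j = to_ac (fps_nth y j)" unfolding yc[symmetric] cls_union by simp
      qed
    qed
  qed
  have fib: "(\<Sum>f\<in>inv_msets (-{0}) phi m. of_bool (\<forall>j\<le>k. fps_nth (cls f) j = to_ac (z j))) = real (card (ufib k m z))" for z
  proof -
    have "(\<Sum>f\<in>inv_msets (-{0}) phi m. of_bool (\<forall>j\<le>k. fps_nth (cls f) j = to_ac (z j))) = (\<Sum>g\<in>upolys m. of_bool (\<forall>j\<le>k. fps_nth (cls (ev g)) j = to_ac (z j)) :: real)"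
      by (rule sum.reindex_bij_betw[OF bij_ev_upolys, symmetric])
    also have "\<dots> = (\<Sum>g\<in>upolys m. of_bool (g \<in> ufib k m z))"
    proof (rule sum.cong[OF refl])
      fix g assume g: "g \<in> upolys m"
      then have m: "monic g" "degree g = m" by (auto simp: upolys_def upoly_def)
      have "(fps_nth (cls (ev g)) j = to_ac (z j)) = ((if j \<le> m then poly.coeff g (m - j) else 0) = z j)" for j
        using inj_eq[OF inj_to_ac, of "if j \<le> m then poly.coeff g (m - j) else 0" "z j"] by (simp add: cls_ev[OF m(1)] m(2) split: if_splits)
      then show "of_bool (\<forall>j\<le>k. fps_nth (cls (ev g)) j = to_ac (z j)) = (of_bool (g \<in> ufib k m z) :: real)"
        using g by (simp add: ufib_def)
    qed
    also have "\<dots> = real (card (upolys m \<inter> ufib k m z))"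
      using finite_upolys by (simp add: sum_of_bool_eq)
    also have "upolys m \<inter> ufib k m z = ufib k m z" by (auto simp: ufib_def)
    finally show ?thesis .
  qed
  show ?thesis unfolding Hit_sum Bk_def by (subst sum.swap) (simp only: eq fib)
qed

lemma Bk_nonneg: "Bk k a m \<nu> \<ge> 0"
  by (simp add: Bk_def sum_nonneg)

lemma zcoef_0: assumes "\<nu> \<in> inv_msets (-{0}) phi l" "y \<in> CC k a" shows "fps_nth (y * inverse (Yn \<nu>)) 0 = 1"
  using Yn(2)[OF assms(1)] assms(2) by (simp add: CC_def)

lemma zcoef_zero: assumes "\<nu> \<in> inv_msets (-{0}) phi l"
  shows "fps_nth (y * inverse (Yn \<nu>)) j = 0 \<longleftrightarrow> fps_nth (em y * inverse (cls \<nu>)) j = 0"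
proof -
  have "fps_nth (em y * inverse (cls \<nu>)) j = to_ac (fps_nth (y * inverse (Yn \<nu>)) j)"
    by (simp only: em_inverse_Yn[OF assms, symmetric] em_nth)
  then show ?thesis by simp
qed

lemma Bk_top: assumes "2 * k < m" "\<nu> \<in> inv_msets (-{0}) phi l"
  shows "Bk k a m \<nu> = real (card (CC k a)) * real (card (upolys m)) / (real q ^ 2) ^ k"
proof -
  have "real (card (ufib k m (fps_nth (y * inverse (Yn \<nu>))))) = real (card (upolys m)) / (real q ^ 2) ^ k" if "y \<in> CC k a" for y
  proof -
    have "card (upolys m) = (q ^ 2) ^ k * card (ufib k m (fps_nth (y * inverse (Yn \<nu>))))"
      by (rule card_ufib_top[where z = "fps_nth (y * inverse (Yn \<nu>))", OF assms(1) zcoef_0[OF assms(2) that]])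
    then have "real (card (upolys m)) = (real q ^ 2) ^ k * real (card (ufib k m (fps_nth (y * inverse (Yn \<nu>)))))"
      by (simp only: of_nat_mult of_nat_power)
    then show ?thesis using q_gt1 by simp
  qed
  then show ?thesis by (simp add: Bk_def)
qed

lemma Bk_low: assumes "m \<le> k" "\<nu> \<in> inv_msets (-{0}) phi l"
  shows "Bk k a m \<nu> \<le> (\<Sum>y\<in>CC k a. of_bool (zr k (k - m) (em y * inverse (cls \<nu>))))"
  unfolding Bk_def
proof (rule sum_mono)
  fix y assume y: "y \<in> CC k a"
  let ?z = "fps_nth (y * inverse (Yn \<nu>))"
  show "real (card (ufib k m ?z)) \<le> of_bool (zr k (k - m) (em y * inverse (cls \<nu>)))"
  proof (cases "ufib k m ?z = {}")
    case False
    have "zr k (k - m) (em y * inverse (cls \<nu>))"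
      unfolding zr_def
    proof (intro allI impI)
      fix j assume j: "k - (k - m) < j \<and> j \<le> k"
      then have "m < j" "j \<le> k" using assms(1) by auto
      then have "?z j = 0" by (rule ufib_low(2)[OF assms(1) False])
      then show "fps_nth (em y * inverse (cls \<nu>)) j = 0" by (simp only: zcoef_zero[OF assms(2)])
    qed
    then show ?thesis using ufib_low(1)[OF assms(1), of ?z] by simp
  qed simp
qed

lemma Bk_mid: assumes "k < m" "m \<le> 2 * k" "\<nu> \<in> inv_msets (-{0}) phi l"
  shows "Bk k a m \<nu> \<le> real (card (CC k a)) + real q * (\<Sum>y\<in>CC k a. of_bool (zr k (2 * k + 1 - m) (em y * inverse (cls \<nu>))))"
proof -
  have "real (card (ufib k m (fps_nth (y * inverse (Yn \<nu>))))) \<le> 1 + real q * of_bool (zr k (2 * k + 1 - m) (em y * inverse (cls \<nu>)))" for y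
  proof -
    have "(\<forall>j. m - k \<le> j \<and> j \<le> k \<longrightarrow> fps_nth (y * inverse (Yn \<nu>)) j = 0) \<longleftrightarrow> zr k (2 * k + 1 - m) (em y * inverse (cls \<nu>))"
    proof -
      have "m - k \<le> j \<longleftrightarrow> k - (2 * k + 1 - m) < j" for j using assms by linarith
      then show ?thesis unfolding zr_def zcoef_zero[OF assms(3)] by simp
    qed
    then have "card (ufib k m (fps_nth (y * inverse (Yn \<nu>)))) \<le> 1 + q * (if zr k (2 * k + 1 - m) (em y * inverse (cls \<nu>)) then 1 else 0)"
      using ufib_mid[OF assms(1,2), of "fps_nth (y * inverse (Yn \<nu>))"] by presburger
    then have "real (card (ufib k m (fps_nth (y * inverse (Yn \<nu>))))) \<le> real (1 + q * (if zr k (2 * k + 1 - m) (em y * inverse (cls \<nu>)) then 1 else 0))"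
      by (simp only: of_nat_le_iff)
    then show ?thesis by (simp split: if_splits)
  qed
  then have "Bk k a m \<nu> \<le> (\<Sum>y\<in>CC k a. 1 + real q * of_bool (zr k (2 * k + 1 - m) (em y * inverse (cls \<nu>))))"
    unfolding Bk_def by (intro sum_mono)
  then show ?thesis by (simp add: sum.distrib sum_distrib_left)
qed

lemma CC_ex: "\<exists>y. y \<in> CC k a"
proof -
  have "card (CC k a) > 0" unfolding card_CC(2) using q_gt1 by simp
  then show ?thesis by (auto simp: card_gt_0_iff)
qed

text \<open>Coefficients up to \<open>k mod p\<close> are common to all classes. If one of the last
  \<open>\<rho>\<close> of them is nonzero after division, \<open>CC_average\<close> leaves at most
  a fraction 1/q^2 of the classes, and none when k < p, where the class is unique. Otherwise the
  quotient for \<open>y0\<close> itself has a run ending at \<open>k mod p\<close>, to which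
  \<open>Z_bound\<close> applies.\<close>

lemma run_average:
  assumes y0: "y0 \<in> CC k a" and \<rho>: "1 \<le> \<rho>" "\<rho> \<le> k" and \<nu>: "\<nu> \<in> inv_msets (-{0}) phi l"
  shows "(\<Sum>y\<in>CC k a. of_bool (zr k \<rho> (em y * inverse (cls \<nu>)))) \<le>
    real (card (CC k a)) * ((if k div p \<ge> 1 then 1 / real q ^ 2 else 0) +
      (if \<rho> \<le> k mod p then of_bool (zr (k mod p) \<rho> (em y0 * inverse (cls \<nu>))) else 0))"
proof -
  let ?W = "inverse (cls \<nu>)" and ?j = "k mod p"
  let ?B = "{y \<in> CC k a. zr k \<rho> (em y * ?W)}"
  have lhs: "(\<Sum>y\<in>CC k a. of_bool (zr k \<rho> (em y * ?W))) = real (card ?B)"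
    using card_CC(1) by (rule sum_of_bool_card)
  have le: "card ?B \<le> card (CC k a)" using card_CC(1) by (intro card_mono) auto
  have W0: "fps_nth ?W 0 = 1" by simp
  have y00: "fps_nth (em y0 * ?W) 0 = 1" using y0 by (simp add: CC_def)
  show ?thesis
  proof (cases "\<exists>i. i \<le> ?j \<and> ?j < i + \<rho> \<and> fps_nth (em y0 * ?W) i \<noteq> 0")
    case False
    then have r: "\<rho> \<le> ?j" using y00 by (metis add_0 le0 not_le zero_neq_one)
    have "zr ?j \<rho> (em y0 * ?W)"
      unfolding zr_def
    proof (intro allI impI)
      fix i assume "?j - \<rho> < i \<and> i \<le> ?j"
      then have "i \<le> ?j" "?j < i + \<rho>" by linarith+
      then show "fps_nth (em y0 * ?W) i = 0" using False by blast
    qed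
    then have "real (card (CC k a)) * 1 \<le> real (card (CC k a)) * ((if k div p \<ge> 1 then 1 / real q ^ 2 else 0) +
      (if \<rho> \<le> k mod p then of_bool (zr (k mod p) \<rho> (em y0 * inverse (cls \<nu>))) else 0))"
      using r by (intro mult_left_mono) auto
    then show ?thesis unfolding lhs using le by linarith
  next
    case True
    then obtain i where i: "i \<le> ?j" "?j < i + \<rho>" "fps_nth (em y0 * ?W) i \<noteq> 0" by blast
    have "real (card ?B) \<le> real (card (CC k a)) * (if k div p \<ge> 1 then 1 / real q ^ 2 else 0)"
    proof (cases "k div p \<ge> 1")
      case True
      have "card ?B * q ^ 2 \<le> card (CC k a)"
        using CC_average[OF W0 y0 True \<rho> i] by (simp only: zr_def)
      then have "real (card ?B * q ^ 2) \<le> real (card (CC k a))" by (simp only: of_nat_le_iff)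
      then show ?thesis using True q_gt1 by (simp add: pos_le_divide_eq)
    next
      case False
      then have kj: "?j = k" by (metis One_nat_def Suc_leI add_0 div_mult_mod_eq mult_0 not_gr_zero)
      have "?B = {}"
      proof (rule equals0I)
        fix y assume y: "y \<in> ?B"
        have kp: "k < p" using kj p prime_gt_0_nat[OF p] by (metis mod_less_divisor)
        have "fps_nth (em y * ?W) i = fps_nth (em y0 * ?W) i"
        proof -
          have "fps_nth y j = fps_nth y0 j" if "j \<le> i" for j
            by (rule CC_unique[of _ k a]) (use y y0 that i(1) kj kp in auto)
          then show ?thesis unfolding fps_mult_nth by (intro sum.cong refl) auto
        qed
        moreover have "fps_nth (em y * ?W) i = 0"
        proof -
          have "k - \<rho> < i \<and> i \<le> k" using i(1,2) kj \<rho> by linarith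
          then show ?thesis using y by (simp add: zr_def)
        qed
        ultimately show False using i(3) by simp
      qed
      then show ?thesis by (simp only: card.empty) simp
    qed
    also have "\<dots> \<le> real (card (CC k a)) * ((if k div p \<ge> 1 then 1 / real q ^ 2 else 0) +
      (if \<rho> \<le> k mod p then of_bool (zr (k mod p) \<rho> (em y0 * inverse (cls \<nu>))) else 0))"
      by (intro mult_left_mono) auto
    finally show ?thesis unfolding lhs .
  qed
qed

section \<open>The error estimate\<close>

theorem Hit_bound:
  assumes k: "1 \<le> k" "2 * k < n"
  shows "\<bar>EU n (Hit k a) - 1 / (real q ^ 2) ^ (k - k div p)\<bar> \<le> 2 * (real k + 1) * real q ^ (2 * (k div p)) / real q ^ n"
proof -
  let ?c = "real (card (CC k a))" and ?Q = "(real q ^ 2) ^ k"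
  let ?U = "\<lambda>m. real (card (upolys m))"
  define A where "A m = EU (n - m) (Bk k a m)" for m
  have q: "real q > 1" using q_gt1 by simp
  have c: "?c = (real q ^ 2) ^ (k div p)" by (simp add: card_CC(2))
  have cpos: "?c > 0" unfolding c using q by simp
  have Apos: "A m \<ge> 0" for m
    using EU_mono[of "n - m" "\<lambda>_. 0" "Bk k a m"] by (simp add: A_def EU_const Bk_nonneg)
  \<comment> \<open>\<open>EU_frec\<close> for the constant function 1. With N = n and N = 2k it
    evaluates the alternating sum of the numbers of unitary polynomials over the high
    degrees.\<close>
  have total: "real q ^ N = (\<Sum>m\<le>N. (-1) ^ (N - m) * ?U m)" for N
  proof -
    have cU: "card (inv_msets (-{0}) phi m) = card (upolys m)" for m using bij_betw_same_card[OF bij_ev_upolys] by metis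
    have "real q ^ N * EU N (\<lambda>_. 1) = (\<Sum>m\<le>N. (-1) ^ (N - m) * EU (N - m) (\<lambda>\<nu>. \<Sum>f\<in>inv_msets (-{0}) phi m. 1))"
      by (rule EU_frec)
    then show ?thesis by (simp add: EU_const cU)
  qed
  have sgn: "(-1) ^ (N - m) = (-1) ^ N * ((-1) ^ m :: real)" if "m \<le> N" for N m :: nat
  proof -
    have "(-1) ^ N = (-1) ^ (N - m) * ((-1) ^ m :: real)" using that by (simp flip: power_add)
    moreover have "(-1) ^ m * ((-1) ^ m :: real) = 1" by (simp flip: power_add mult_2)
    ultimately show ?thesis by (simp add: mult.assoc)
  qed
  have hit: "real q ^ n * EU n (Hit k a) = (\<Sum>m\<le>n. (-1) ^ (n - m) * A m)"
  proof -
    have "EU (n - m) (\<lambda>\<nu>. \<Sum>f\<in>inv_msets (-{0}) phi m. Hit k a (f + \<nu>)) = A m" for m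
      unfolding A_def by (rule EU_cong) (rule Hit_fibre)
    then show ?thesis using EU_frec[of n "Hit k a"] by simp
  qed
  have split: "(\<Sum>m\<le>n. f m) = (\<Sum>m\<le>2 * k. f m) + (\<Sum>m=Suc (2 * k)..n. f m)" for f :: "nat \<Rightarrow> real"
  proof -
    have "{..n} = {..2 * k} \<union> {Suc (2 * k)..n}" using k by auto
    then show ?thesis by (simp only:) (rule sum.union_disjoint, auto)
  qed
  have top: "A m = ?c / ?Q * ?U m" if "2 * k < m" for m
  proof -
    have "A m = EU (n - m) (\<lambda>_. ?c * ?U m / ?Q)" unfolding A_def by (rule EU_cong) (rule Bk_top[OF that])
    then show ?thesis by (simp add: EU_const)
  qed
  have q2k: "real q ^ (2 * k) = ?Q" by (simp add: power_mult)
  \<comment> \<open>High degrees are exactly equidistributed: they give the main term, and the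
    missing low degrees cost precisely one multiple of the number of classes, up to sign.\<close>
  have "(\<Sum>m=Suc (2 * k)..n. (-1) ^ (n - m) * A m) = ?c / ?Q * (\<Sum>m=Suc (2 * k)..n. (-1) ^ (n - m) * ?U m)"
    unfolding sum_distrib_left by (intro sum.cong refl) (simp add: top)
  also have "(\<Sum>m=Suc (2 * k)..n. (-1) ^ (n - m) * ?U m) = real q ^ n - (\<Sum>m\<le>2 * k. (-1) ^ (n - m) * ?U m)"
    using total[of n] split[of "\<lambda>m. (-1) ^ (n - m) * ?U m"] by simp
  also have "(\<Sum>m\<le>2 * k. (-1) ^ (n - m) * ?U m) = (-1) ^ n * real q ^ (2 * k)"
    unfolding total[of "2 * k"] sum_distrib_left using k by (intro sum.cong refl) (simp add: sgn)
  finally have "(\<Sum>m=Suc (2 * k)..n. (-1) ^ (n - m) * A m) = ?c / ?Q * (real q ^ n - (-1) ^ n * ?Q)" unfolding q2k .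
  also have "\<dots> = ?c / ?Q * real q ^ n - (-1) ^ n * ?c" using q by (simp add: right_diff_distrib)
  finally have tops: "(\<Sum>m=Suc (2 * k)..n. (-1) ^ (n - m) * A m) = ?c / ?Q * real q ^ n - (-1) ^ n * ?c" .
  have bot: "(\<Sum>m\<le>2 * k. (-1) ^ (n - m) * A m) = (-1) ^ n * (\<Sum>m\<le>2 * k. (-1) ^ m * A m)"
    unfolding sum_distrib_left using k by (intro sum.cong refl) (simp add: sgn)
  have err: "real q ^ n * EU n (Hit k a) - ?c / ?Q * real q ^ n = (-1) ^ n * ((\<Sum>m\<le>2 * k. (-1) ^ m * A m) - ?c)"
    unfolding hit split[of "\<lambda>m. (-1) ^ (n - m) * A m"] tops bot by (simp add: right_diff_distrib)
  \<comment> \<open>Even and odd degrees, counted down from 2k. In degree m the critical run has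
    length 2k + 1 - m, which is 2u + 1 in the first sum and 2u + 2 in the second.\<close>
  define Se where "Se = (\<Sum>u\<le>k. A (2 * (k - u)))"
  define So where "So = (\<Sum>u<k. A (2 * (k - u) - 1))"
  have alt: "(\<Sum>m\<le>2 * k. (-1) ^ m * A m) = Se - So"
  proof -
    have "(\<Sum>m\<le>2 * N. (-1) ^ m * A m) = (\<Sum>u\<le>N. A (2 * u)) - (\<Sum>u<N. A (2 * u + 1))" for N
      by (induction N) simp_all
    moreover have "(\<Sum>u\<le>k. A (2 * u)) = Se" unfolding Se_def
      by (rule sum.reindex_bij_witness[where i = "\<lambda>u. k - u" and j = "\<lambda>u. k - u"]) auto
    moreover have "(\<Sum>u<k. A (2 * u + 1)) = So" unfolding So_def
      by (rule sum.reindex_bij_witness[where i = "\<lambda>u. k - Suc u" and j = "\<lambda>u. k - Suc u"]) (auto simp: Suc_diff_le intro!: arg_cong[of _ _ A])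
    ultimately show ?thesis by metis
  qed
  obtain y0 where y0: "y0 \<in> CC k a" using CC_ex by blast
  define j0 where "j0 = k mod p"
  \<comment> \<open>The base of the bound in \<open>Z_bound\<close>, at most 1 because j0 < p <= q.
    In \<open>qx\<close> it compensates the factor q from the possible q + 1 polynomials in a
    fibre.\<close>
  define x where "x = real j0 / (real q - 1)"
  define dl where "dl = (if k div p \<ge> 1 then 1 / real q ^ 2 else 0)"
  have pq: "p \<le> q" using q_def r p prime_gt_0_nat[OF p] by (simp add: self_le_power)
  have j0p: "j0 < p" using prime_gt_0_nat[OF p] by (simp add: j0_def)
  have x01: "0 \<le> x" "x \<le> 1" using j0p pq q by (auto simp: x_def pos_divide_le_eq)
  have qx: "real q * x \<le> real j0 + 1"
  proof -
    have "real q * x = (real q - 1) * x + x" by (simp add: algebra_simps)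
    also have "(real q - 1) * x = real j0" using q by (simp add: x_def)
    finally show ?thesis using x01 by simp
  qed
  have y00: "fps_nth (em y0) 0 = 1" using y0 by (simp add: CC_def)
  have low: "A m \<le> ?c" if "m \<le> k" for m
  proof -
    have "A m \<le> EU (n - m) (\<lambda>_. ?c)" unfolding A_def
    proof (rule EU_mono)
      fix \<nu> assume \<nu>: "\<nu> \<in> inv_msets (-{0}) phi (n - m)"
      have "(\<Sum>y\<in>CC k a. of_bool (zr k (k - m) (em y * inverse (cls \<nu>)))) \<le> (\<Sum>y\<in>CC k a. 1 :: real)" by (intro sum_mono) auto
      then show "Bk k a m \<nu> \<le> ?c" using Bk_low[OF that \<nu>, of a] by simp
    qed
    then show ?thesis by (simp add: EU_const)
  qed
  have mid: "A m \<le> ?c * (1 + real q * (dl + (if 2 * k + 1 - m \<le> j0 then x ^ (2 * k + 1 - m) / fact (2 * k + 1 - m) else 0)))"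
    if m: "k < m" "m \<le> 2 * k" for m
  proof -
    let ?r = "2 * k + 1 - m"
    have r: "1 \<le> ?r" "?r \<le> k" "?r \<le> n - m" using m k by auto
    let ?z = "\<lambda>\<nu>. if ?r \<le> j0 then of_bool (zr j0 ?r (em y0 * inverse (cls \<nu>))) else (0 :: real)"
    have "A m \<le> EU (n - m) (\<lambda>\<nu>. ?c + real q * ?c * (dl + ?z \<nu>))" unfolding A_def
    proof (rule EU_mono)
      fix \<nu> assume \<nu>: "\<nu> \<in> inv_msets (-{0}) phi (n - m)"
      have "Bk k a m \<nu> \<le> ?c + real q * (\<Sum>y\<in>CC k a. of_bool (zr k ?r (em y * inverse (cls \<nu>))))" by (rule Bk_mid[OF m \<nu>])
      also have "\<dots> \<le> ?c + real q * (?c * (dl + ?z \<nu>))"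
        using run_average[OF y0 r(1,2) \<nu>] q unfolding dl_def j0_def by (intro add_left_mono mult_left_mono) auto
      finally show "Bk k a m \<nu> \<le> ?c + real q * ?c * (dl + ?z \<nu>)" by (simp only: mult.assoc)
    qed
    also have "\<dots> = ?c + real q * ?c * (dl + EU (n - m) ?z)" by (simp only: EU_add EU_mult EU_const)
    also have "EU (n - m) ?z \<le> (if ?r \<le> j0 then x ^ ?r / fact ?r else 0)"
      using Z_bound[OF y00 r(1) _ r(3), of j0] by (simp add: x_def EU_const)
    finally show ?thesis using q cpos by (simp add: algebra_simps)
  qed
  have even_term: "A (2 * (k - u)) \<le> ?c * (1 + (if 2 * u + 1 \<le> k then real q * dl else 0) + real q * (if 2 * u + 1 \<le> j0 then x ^ (2 * u + 1) / fact (2 * u + 1) else 0))" if "u \<le> k" for u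
  proof (cases "2 * u + 1 \<le> k")
    case True
    have e: "2 * k + 1 - 2 * (k - u) = 2 * u + 1" using that by simp
    have "A (2 * (k - u)) \<le> ?c * (1 + real q * (dl + (if 2 * u + 1 \<le> j0 then x ^ (2 * u + 1) / fact (2 * u + 1) else 0)))"
      by (rule mid[of "2 * (k - u)", unfolded e]) (use True that in auto)
    also have "\<dots> = ?c * (1 + real q * dl + real q * (if 2 * u + 1 \<le> j0 then x ^ (2 * u + 1) / fact (2 * u + 1) else 0))"
      by (simp only: distrib_left add.assoc)
    finally show ?thesis by (simp only: if_P[OF True])
  next
    case False
    have "A (2 * (k - u)) \<le> ?c * 1" using low[of "2 * (k - u)"] False by simp
    also have "\<dots> \<le> ?c * (1 + (if 2 * u + 1 \<le> k then real q * dl else 0) + real q * (if 2 * u + 1 \<le> j0 then x ^ (2 * u + 1) / fact (2 * u + 1) else 0))"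
      using cpos x01 False q by (intro mult_left_mono) auto
    finally show ?thesis .
  qed
  have odd_term: "A (2 * (k - u) - 1) \<le> ?c * (1 + (if 2 * u + 2 \<le> k then real q * dl else 0) + real q * (if 2 * u + 2 \<le> j0 then x ^ (2 * u + 2) / fact (2 * u + 2) else 0))" if "u < k" for u
  proof (cases "2 * u + 2 \<le> k")
    case True
    have e: "2 * k + 1 - (2 * (k - u) - 1) = 2 * u + 2" using that by simp
    have "A (2 * (k - u) - 1) \<le> ?c * (1 + real q * (dl + (if 2 * u + 2 \<le> j0 then x ^ (2 * u + 2) / fact (2 * u + 2) else 0)))"
      by (rule mid[of "2 * (k - u) - 1", unfolded e]) (use True that in auto)
    also have "\<dots> = ?c * (1 + real q * dl + real q * (if 2 * u + 2 \<le> j0 then x ^ (2 * u + 2) / fact (2 * u + 2) else 0))"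
      by (simp only: distrib_left add.assoc)
    finally show ?thesis by (simp only: if_P[OF True])
  next
    case False
    have "A (2 * (k - u) - 1) \<le> ?c * 1" using low[of "2 * (k - u) - 1"] False by simp
    also have "\<dots> \<le> ?c * (1 + (if 2 * u + 2 \<le> k then real q * dl else 0) + real q * (if 2 * u + 2 \<le> j0 then x ^ (2 * u + 2) / fact (2 * u + 2) else 0))"
      using cpos x01 False q by (intro mult_left_mono) auto
    finally show ?thesis .
  qed
  have oddsum: "real q * (\<Sum>u\<in>I. if 2 * u + 1 \<le> j0 then x ^ (2 * u + 1) / fact (2 * u + 1) else 0) \<le> 6 / 5 * (real j0 + 1)" if "I \<subseteq> {..k}" for I
  proof -
    have "(\<Sum>u\<in>I. if 2 * u + 1 \<le> j0 then x ^ (2 * u + 1) / fact (2 * u + 1) else 0) \<le> (\<Sum>u\<in>I. x * (1 / fact (2 * u + 1)))"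
    proof (rule sum_mono)
      fix u show "(if 2 * u + 1 \<le> j0 then x ^ (2 * u + 1) / fact (2 * u + 1) else 0) \<le> x * (1 / fact (2 * u + 1))"
        using pow_le_base[OF x01, of "2 * u + 1"] x01 by (simp add: divide_right_mono del: fact_Suc power_Suc)
    qed
    also have "\<dots> \<le> (\<Sum>u<Suc k. x * (1 / fact (2 * u + 1)))" using that x01 by (intro sum_mono2) auto
    also have "\<dots> = x * (\<Sum>u<Suc k. 1 / fact (2 * u + 1))" by (simp only: sum_distrib_left)
    also have "\<dots> \<le> x * (6 / 5)" using fact_odd_sum x01 by (intro mult_left_mono)
    finally have "real q * (\<Sum>u\<in>I. if 2 * u + 1 \<le> j0 then x ^ (2 * u + 1) / fact (2 * u + 1) else 0) \<le> real q * (x * (6 / 5))"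
      using q by (intro mult_left_mono) auto
    then show ?thesis using qx by simp
  qed
  have evensum: "real q * (\<Sum>u<k. if 2 * u + 2 \<le> j0 then x ^ (2 * u + 2) / fact (2 * u + 2) else 0) \<le> 3 / 5 * (real j0 + 1)"
  proof -
    have "(\<Sum>u<k. if 2 * u + 2 \<le> j0 then x ^ (2 * u + 2) / fact (2 * u + 2) else 0) \<le> (\<Sum>u<k. x * (1 / fact (2 * u + 2)))"
    proof (rule sum_mono)
      fix u show "(if 2 * u + 2 \<le> j0 then x ^ (2 * u + 2) / fact (2 * u + 2) else 0) \<le> x * (1 / fact (2 * u + 2))"
        using pow_le_base[OF x01, of "2 * u + 2"] x01 by (simp add: divide_right_mono del: fact_Suc power_Suc)
    qed
    also have "\<dots> = x * (\<Sum>u<k. 1 / fact (2 * u + 2))" by (simp only: sum_distrib_left)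
    also have "\<dots> \<le> x * (3 / 5)" using fact_even_sum x01 by (intro mult_left_mono)
    finally have "real q * (\<Sum>u<k. if 2 * u + 2 \<le> j0 then x ^ (2 * u + 2) / fact (2 * u + 2) else 0) \<le> real q * (x * (3 / 5))"
      using q by (intro mult_left_mono) auto
    then show ?thesis using qx by simp
  qed
  have qdl: "0 \<le> real q * dl" "real q * dl \<le> 1 / 2" "k div p = 0 \<Longrightarrow> dl = 0"
    using q q_gt1 by (auto simp: dl_def power2_eq_square field_simps)
  have j0k: "j0 \<le> k" by (simp add: j0_def)
  \<comment> \<open>If k >= p then k >= p + j0 > 2 j0, so the residue takes up less than half of the
    allowance.\<close>
  have j0t: "2 * j0 + 1 \<le> k" if "k div p \<ge> 1"
  proof -
    have "p * 1 \<le> p * (k div p)" using that by (intro mult_le_mono2)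
    moreover have "p * (k div p) + j0 = k" by (simp add: j0_def)
    ultimately have "p + j0 \<le> k" by linarith
    then show ?thesis using j0p by simp
  qed
  have half: "real (N div 2) \<le> real N / 2" for N
  proof -
    have "2 * (N div 2) \<le> N" by simp
    then have "real (2 * (N div 2)) \<le> real N" by (simp only: of_nat_le_iff)
    then show ?thesis by simp
  qed
  have cnt1: "(\<Sum>u\<le>k. if 2 * u + 1 \<le> k then real q * dl else 0) \<le> (real k + 1) / 2 * (real q * dl)"
  proof -
    have "(\<Sum>u\<le>k. if 2 * u + 1 \<le> k then real q * dl else 0) = (\<Sum>u\<in>{..k} \<inter> {u. 2 * u + 1 \<le> k}. real q * dl)"
      using sum.inter_restrict[of "{..k}" "\<lambda>_. real q * dl" "{u. 2 * u + 1 \<le> k}"] by (simp only: mem_Collect_eq finite_atMost finite_lessThan)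
    also have "{..k} \<inter> {u. 2 * u + 1 \<le> k} = {..<(k + 1) div 2}" by auto
    also have "(\<Sum>u<(k + 1) div 2. real q * dl) = real ((k + 1) div 2) * (real q * dl)" by simp
    also have "\<dots> \<le> (real k + 1) / 2 * (real q * dl)" using qdl(1) half[of "k + 1"] by (intro mult_right_mono) simp_all
    finally show ?thesis .
  qed
  have cnt2: "(\<Sum>u<k. if 2 * u + 2 \<le> k then real q * dl else 0) \<le> real k / 2 * (real q * dl)"
  proof -
    have "(\<Sum>u<k. if 2 * u + 2 \<le> k then real q * dl else 0) = (\<Sum>u\<in>{..<k} \<inter> {u. 2 * u + 2 \<le> k}. real q * dl)"
      using sum.inter_restrict[of "{..<k}" "\<lambda>_. real q * dl" "{u. 2 * u + 2 \<le> k}"] by (simp only: mem_Collect_eq finite_atMost finite_lessThan)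
    also have "{..<k} \<inter> {u. 2 * u + 2 \<le> k} = {..<k div 2}" by auto
    also have "(\<Sum>u<k div 2. real q * dl) = real (k div 2) * (real q * dl)" by simp
    also have "\<dots> \<le> real k / 2 * (real q * dl)" using qdl(1) half[of k] by (intro mult_right_mono) simp_all
    finally show ?thesis .
  qed
  have So_le: "So \<le> ?c * (real k + real k / 2 * (real q * dl) + 3 / 5 * (real j0 + 1))"
  proof -
    have "So \<le> (\<Sum>u<k. ?c * (1 + (if 2 * u + 2 \<le> k then real q * dl else 0) + real q * (if 2 * u + 2 \<le> j0 then x ^ (2 * u + 2) / fact (2 * u + 2) else 0)))"
      unfolding So_def using odd_term by (intro sum_mono) auto
    also have "\<dots> = ?c * (real k + (\<Sum>u<k. if 2 * u + 2 \<le> k then real q * dl else 0) + real q * (\<Sum>u<k. if 2 * u + 2 \<le> j0 then x ^ (2 * u + 2) / fact (2 * u + 2) else 0))"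
      unfolding sum_distrib_left[symmetric] sum.distrib by simp
    also have "\<dots> \<le> ?c * (real k + real k / 2 * (real q * dl) + 3 / 5 * (real j0 + 1))"
      using cnt2 evensum cpos by (intro mult_left_mono add_mono) auto
    finally show ?thesis .
  qed
  have So2: "So \<le> ?c * (2 * real k + 1)"
  proof -
    have "real k + real k / 2 * (real q * dl) + 3 / 5 * (real j0 + 1) \<le> 2 * real k + 1"
    proof (cases "k div p \<ge> 1")
      case True
      have "real k / 2 * (real q * dl) \<le> real k / 2 * (1 / 2)" using qdl(2) by (intro mult_left_mono) auto
      moreover have "2 * real j0 + 1 \<le> real k" using j0t[OF True] by linarith
      moreover have "K + T + 3 / 5 * (J + 1) \<le> 2 * K + 1" if "T \<le> K / 2 * (1 / 2)" "2 * J + 1 \<le> K" "0 \<le> K" for K J T :: real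
        using that by (simp add: field_simps)
      ultimately show ?thesis using of_nat_0_le_iff by blast
    next
      case False
      then have "dl = 0" using qdl(3) by simp
      then have e: "real k / 2 * (real q * dl) = 0" by simp
      have "real j0 \<le> real k" "1 \<le> real k" using j0k k(1) by simp_all
      then show ?thesis unfolding e by (simp add: field_simps)
    qed
    then show ?thesis using So_le cpos by (meson mult_left_mono less_imp_le order_trans)
  qed
  have Se_le: "Se \<le> ?c * (real k + 1 + (real k + 1) / 2 * (real q * dl) + 6 / 5 * (real j0 + 1))"
  proof -
    have "Se \<le> (\<Sum>u\<le>k. ?c * (1 + (if 2 * u + 1 \<le> k then real q * dl else 0) + real q * (if 2 * u + 1 \<le> j0 then x ^ (2 * u + 1) / fact (2 * u + 1) else 0)))"
      unfolding Se_def using even_term by (intro sum_mono) auto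
    also have "\<dots> = ?c * (real k + 1 + (\<Sum>u\<le>k. if 2 * u + 1 \<le> k then real q * dl else 0) + real q * (\<Sum>u\<le>k. if 2 * u + 1 \<le> j0 then x ^ (2 * u + 1) / fact (2 * u + 1) else 0))"
      unfolding sum_distrib_left[symmetric] sum.distrib by simp
    also have "\<dots> \<le> ?c * (real k + 1 + (real k + 1) / 2 * (real q * dl) + 6 / 5 * (real j0 + 1))"
      using cnt1 oddsum[of "{..k}"] cpos by (intro mult_left_mono add_mono) auto
    finally show ?thesis .
  qed
  have Se2: "Se \<le> ?c * (2 * real k + 3)"
  \<comment> \<open>For k < p the straightforward bound is 11/5 (k + 1), which is within 2k + 3 only
    up to k = 4; larger k need a saving in the low degrees.\<close>
  proof (cases "k div p \<ge> 1 \<or> k \<le> 4")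
    case True
    have "real k + 1 + (real k + 1) / 2 * (real q * dl) + 6 / 5 * (real j0 + 1) \<le> 2 * real k + 3"
    proof (cases "k div p \<ge> 1")
      case True
      have "(real k + 1) / 2 * (real q * dl) \<le> (real k + 1) / 2 * (1 / 2)" using qdl(2) by (intro mult_left_mono) auto
      moreover have "2 * real j0 + 1 \<le> real k" using j0t[OF True] by linarith
      moreover have "K + 1 + T + 6 / 5 * (J + 1) \<le> 2 * K + 3" if "T \<le> (K + 1) / 2 * (1 / 2)" "2 * J + 1 \<le> K" "0 \<le> K" for K J T :: real
        using that by (simp add: field_simps)
      ultimately show ?thesis using of_nat_0_le_iff by blast
    next
      case False
      then have "dl = 0" "k \<le> 4" using qdl(3) True by auto
      then have e: "(real k + 1) / 2 * (real q * dl) = 0" "real k \<le> 4" by simp_all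
      have "real j0 \<le> real k" using j0k by simp
      then show ?thesis unfolding e(1) using e(2) by (simp add: field_simps)
    qed
    then show ?thesis using Se_le cpos by (meson mult_left_mono less_imp_le order_trans)
  next
    case False
    then have t0: "k div p = 0" "k \<ge> 4" by auto
    then have c1: "?c = 1" unfolding c by simp
    have j0e: "j0 = k" using t0(1) mult_div_mod_eq[of p k] by (simp add: j0_def)
    have dl0: "dl = 0" using qdl(3) t0 by simp
    have CC1: "CC k a = {y0}"
    proof -
      have "card (CC k a) = 1" using c1 by simp
      then show ?thesis using y0 by (metis card_1_singletonE singletonD)
    qed
    \<comment> \<open>There is a single class here, and a polynomial of degree m < k in it forces a
      run of length k - m. So these terms decay factorially and sum to at most 2, instead of
      contributing 1 each.\<close>
    have lowz: "A m \<le> 1 / fact (k - m)" if "m < k" for m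
    proof -
      have "A m \<le> EU (n - m) (\<lambda>\<nu>. of_bool (zr k (k - m) (em y0 * inverse (cls \<nu>))))"
        unfolding A_def
      proof (rule EU_mono)
        fix \<nu> assume \<nu>: "\<nu> \<in> inv_msets (-{0}) phi (n - m)"
        have s1: "(\<Sum>y\<in>{y0}. f y) = f y0" for f :: "'a fps \<Rightarrow> real" by simp
        show "Bk k a m \<nu> \<le> of_bool (zr k (k - m) (em y0 * inverse (cls \<nu>)))"
          using Bk_low[OF less_imp_le[OF that] \<nu>, of a] unfolding CC1 s1 .
      qed
      also have "\<dots> \<le> (real k / (real q - 1)) ^ (k - m) / fact (k - m)"
        by (rule Z_bound[OF y00]) (use that k in auto)
      also have "\<dots> \<le> 1 / fact (k - m)"
        using x01 power_le_one[OF x01, of "k - m"] by (intro divide_right_mono) (auto simp: x_def j0e)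
      finally show ?thesis .
    qed
    have Se_split: "Se = (\<Sum>u\<in>{..k} \<inter> {u. 2 * u \<le> k}. A (2 * (k - u))) + (\<Sum>u\<in>{..k} - {u. 2 * u \<le> k}. A (2 * (k - u)))"
      unfolding Se_def by (rule sum.Int_Diff) simp
    have lower: "(\<Sum>u\<in>{..k} \<inter> {u. 2 * u \<le> k}. A (2 * (k - u))) \<le> (real k / 2 + 1) + 6 / 5 * (real j0 + 1)"
    proof -
      have "(\<Sum>u\<in>{..k} \<inter> {u. 2 * u \<le> k}. A (2 * (k - u))) \<le> (\<Sum>u\<in>{..k} \<inter> {u. 2 * u \<le> k}. 1 + real q * (if 2 * u + 1 \<le> j0 then x ^ (2 * u + 1) / fact (2 * u + 1) else 0))"
      proof (rule sum_mono)
        fix u assume "u \<in> {..k} \<inter> {u. 2 * u \<le> k}"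
        then have "u \<le> k" by simp
        have z: "(if 2 * u + 1 \<le> k then real q * dl else 0) = 0" by (simp add: dl0)
        show "A (2 * (k - u)) \<le> 1 + real q * (if 2 * u + 1 \<le> j0 then x ^ (2 * u + 1) / fact (2 * u + 1) else 0)"
          using even_term[OF \<open>u \<le> k\<close>] unfolding c1 z mult_1 add_0_right .
      qed
      also have "\<dots> = real (card ({..k} \<inter> {u. 2 * u \<le> k})) + real q * (\<Sum>u\<in>{..k} \<inter> {u. 2 * u \<le> k}. if 2 * u + 1 \<le> j0 then x ^ (2 * u + 1) / fact (2 * u + 1) else 0)"
        unfolding sum.distrib sum_distrib_left[symmetric] by (simp only: sum_constant mult_1_right)
      also have "\<dots> \<le> (real k / 2 + 1) + 6 / 5 * (real j0 + 1)"
      proof (rule add_mono[OF _ oddsum])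
        have "{..k} \<inter> {u. 2 * u \<le> k} = {..k div 2}" by auto
        then have "real (card ({..k} \<inter> {u. 2 * u \<le> k})) = real (k div 2) + 1" by simp
        then show "real (card ({..k} \<inter> {u. 2 * u \<le> k})) \<le> real k / 2 + 1" using half[of k] by simp
      qed auto
      finally show ?thesis .
    qed
    have upper: "(\<Sum>u\<in>{..k} - {u. 2 * u \<le> k}. A (2 * (k - u))) \<le> 2"
    proof -
      have "(\<Sum>u\<in>{..k} - {u. 2 * u \<le> k}. A (2 * (k - u))) \<le> (\<Sum>u\<in>{..k} - {u. 2 * u \<le> k}. 1 / fact (2 * u - k - 1 + 1))"
      proof (rule sum_mono)
        fix u assume u: "u \<in> {..k} - {u. 2 * u \<le> k}"
        then have "k - 2 * (k - u) = 2 * u - k - 1 + 1" "2 * (k - u) < k" by auto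
        then show "A (2 * (k - u)) \<le> 1 / fact (2 * u - k - 1 + 1)" using lowz[of "2 * (k - u)"] by simp
      qed
      also have "\<dots> = (\<Sum>i\<in>(\<lambda>u. 2 * u - k - 1) ` ({..k} - {u. 2 * u \<le> k}). 1 / fact (i + 1))"
        by (subst sum.reindex) (auto simp: inj_on_def)
      also have "\<dots> \<le> (\<Sum>i<k. 1 / fact (i + 1))" using t0 by (intro sum_mono2) auto
      also have "\<dots> \<le> 2" by (rule fact_all_sum)
      finally show ?thesis .
    qed
    have "Se \<le> (real k / 2 + 1) + 6 / 5 * (real j0 + 1) + 2" unfolding Se_split by (rule add_mono[OF lower upper])
    moreover have "real k \<ge> 4" using t0(2) by simp
    ultimately have "Se \<le> 2 * real k + 3" unfolding j0e by (simp add: field_simps)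
    then show ?thesis by (simp add: c1)
  qed
  have Sp: "0 \<le> Se" "0 \<le> So" unfolding Se_def So_def using Apos by (auto intro!: sum_nonneg)
  \<comment> \<open>Both sums are nonnegative: the difference is at most Se - c on one side and So +
    c on the other, each giving 2k + 2 multiples of c.\<close>
  have "\<bar>Se - So - ?c\<bar> \<le> ?c * (2 * real k + 2)"
    using Se2 So2 Sp by (simp add: abs_le_iff algebra_simps)
  then have "\<bar>real q ^ n * EU n (Hit k a) - ?c / ?Q * real q ^ n\<bar> \<le> ?c * (2 * real k + 2)"
    unfolding err alt by (simp add: abs_mult power_abs)
  moreover have "real q ^ n * EU n (Hit k a) - ?c / ?Q * real q ^ n = real q ^ n * (EU n (Hit k a) - ?c / ?Q)" by (simp add: algebra_simps)
  ultimately have "real q ^ n * \<bar>EU n (Hit k a) - ?c / ?Q\<bar> \<le> ?c * (2 * real k + 2)" using q by (simp add: abs_mult)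
  then have "\<bar>EU n (Hit k a) - ?c / ?Q\<bar> \<le> ?c * (2 * real k + 2) / real q ^ n" using q by (simp add: pos_le_divide_eq mult.commute)
  moreover have "?c / ?Q = 1 / (real q ^ 2) ^ (k - k div p)"
  proof -
    have "k div p \<le> k" by simp
    then have "?Q = ?c * (real q ^ 2) ^ (k - k div p)" unfolding c by (simp flip: power_add)
    then show ?thesis using cpos by simp
  qed
  moreover have "?c * (2 * real k + 2) = 2 * (real k + 1) * real q ^ (2 * (k div p))" unfolding c by (simp add: power_mult)
  ultimately show ?thesis by simp
qed

end

section \<open>Transport to the matrices of the statement\<close>

lemma bij_jm_sum:
  fixes f :: "'n::finite \<Rightarrow> 'c::comm_monoid_add"
  assumes "bij_betw h {..<n} (UNIV :: 'n set)"
  shows "(\<Sum>k\<in>UNIV. f k) = (\<Sum>i<n. f (h i))"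
  using sum.reindex_bij_betw[OF assms, of f] by simp

text \<open>Lying in a class of \<open>CC\<close> is a condition on the logarithmic derivative up to
  index k; as k < n, its coefficients there are the traces of powers by
  \<open>LD_rchar\<close>.\<close>

lemma (in ff_setup) Hit_char_poly:
  assumes g: "g \<in> UG n" and kn: "2 * k < n"
  shows "Hit k a (ev (char_poly g)) = of_bool (\<forall>i. 1 \<le> i \<and> i \<le> k \<and> \<not> p dvd i \<longrightarrow> (\<Sum>u<n. (g ^\<^sub>m i) $$ (u, u)) = a i)"
proof -
  have gc: "g \<in> carrier_mat n n" using g by (rule Un_D)
  have deg: "degree (char_poly g) = n" "monic (char_poly g)" using degree_monic_char_poly[OF gc] by auto
  have y: "fps_nth (cls (ev (char_poly g))) j = to_ac (fps_nth (rchar g) j)" for j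
    using gc by (simp add: cls_ev[OF deg(2)] deg(1) rchar_def)
  have y0: "fps_nth (rchar g) 0 = 1" using gc deg by (simp add: rchar_def)
  have "(\<exists>y\<in>CC k a. \<forall>j\<le>k. fps_nth (cls (ev (char_poly g))) j = to_ac (fps_nth y j)) \<longleftrightarrow> trn k (rchar g) \<in> CC k a"
  proof
    assume "\<exists>y\<in>CC k a. \<forall>j\<le>k. fps_nth (cls (ev (char_poly g))) j = to_ac (fps_nth y j)"
    then obtain z where z: "z \<in> CC k a" "\<forall>j\<le>k. fps_nth (rchar g) j = fps_nth z j" by (auto simp: y inj_eq[OF inj_to_ac])
    have "trn k (rchar g) = z" using z by (intro fps_ext) (auto simp: trn_def CC_def)
    then show "trn k (rchar g) \<in> CC k a" using z by simp
  qed (auto simp: y trn_def intro!: bexI[of _ "trn k (rchar g)"])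
  also have "\<dots> \<longleftrightarrow> (\<forall>i. 1 \<le> i \<and> i \<le> k \<and> \<not> p dvd i \<longrightarrow> fps_nth (LD (rchar g)) i = a i)" by (rule trn_CC[OF y0])
  also have "\<dots> \<longleftrightarrow> (\<forall>i. 1 \<le> i \<and> i \<le> k \<and> \<not> p dvd i \<longrightarrow> (\<Sum>u<n. (g ^\<^sub>m i) $$ (u, u)) = a i)"
    using LD_rchar[OF gc] kn by (metis (no_types, lifting) le_less_trans mult_2 trans_le_add1 order_refl)
  finally show ?thesis by (simp only: Hit_def)
qed

theorem theorem5p24:
  fixes p r q n k :: nat
    and a :: "nat \<Rightarrow> 'a::{field,finite}"
  assumes "prime p" and "r \<ge> 1" and "q = p ^ r"
    and "CARD('a) = q ^ 2"
    and "CARD('n::finite) = n"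
    and "1 \<le> k" and "2 * k \<le> n - 1"
  shows "\<bar>measure_pmf.prob (pmf_of_set (unitary_group q :: ('a^'n^'n) set))
            {M. \<forall>i. 1 \<le> i \<and> i \<le> k \<and> \<not> p dvd i \<longrightarrow> trace (matpow M i) = a i}
          - 1 / (real q ^ 2) ^ (k - k div p)\<bar>
         \<le> 2 * (real k + 1) * real q ^ (2 * (k div p)) / real q ^ n"
proof -
  interpret ff_setup q p r "TYPE('a)" using assms(1-4) by unfold_locales
  have kn: "2 * k < n" using assms(6,7) by linarith
  have "\<exists>h. bij_betw h {0..<card (UNIV :: 'n set)} (UNIV :: 'n set)" by (rule ex_bij_betw_nat_finite) simp
  then obtain h :: "nat \<Rightarrow> 'n" where h: "bij_betw h {..<n} UNIV" using assms(5) by (auto simp: atLeast0LessThan)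
  have hinj: "h i = h j \<longleftrightarrow> i = j" if "i < n" "j < n" for i j
    using bij_betw_imp_inj_on[OF h] that by (auto simp: inj_on_def)
  \<comment> \<open>Matrices indexed by the type are carried, along a fixed enumeration of it, to
    matrices with explicit dimension.\<close>
  define jm where "jm M = mat n n (\<lambda>(i, j). vec_nth (vec_nth M (h i)) (h j))" for M :: "'a^'n^'n"
  have jc: "jm M \<in> carrier_mat n n" for M by (simp add: jm_def)
  have ji: "jm M $$ (i, j) = vec_nth (vec_nth M (h i)) (h j)" if "i < n" "j < n" for M i j using that by (simp add: jm_def)
  have jm_mult: "jm (M ** N) = jm M * jm N" for M N
  proof (rule eq_matI)
    fix i j assume "i < dim_row (jm M * jm N)" "j < dim_col (jm M * jm N)"
    then have ij: "i < n" "j < n" using carrier_matD[OF jc] by auto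
    have "jm (M ** N) $$ (i, j) = (\<Sum>l<n. vec_nth (vec_nth M (h i)) (h l) * vec_nth (vec_nth N (h l)) (h j))"
      using ij by (simp add: ji matrix_matrix_mult_def bij_jm_sum[OF h])
    also have "\<dots> = (jm M * jm N) $$ (i, j)"
      using ij by (simp add: mat_mult_index[OF jc jc] ji del: index_mult_mat)
    finally show "jm (M ** N) $$ (i, j) = (jm M * jm N) $$ (i, j)" .
  qed (use jc in \<open>auto simp: jm_def\<close>)
  have jm_one: "jm (Finite_Cartesian_Product.mat 1) = 1\<^sub>m n"
    by (rule eq_matI) (auto simp: jm_def Finite_Cartesian_Product.mat_def hinj)
  have jm_adj: "jm (transpose (conjq q M)) = adj (jm M)" for M
    by (rule eq_matI) (auto simp: jm_def adj_def transpose_def conjq_def)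
  have jm_inj: "M = N" if "jm M = jm N" for M N
  proof -
    have "vec_nth (vec_nth M u) v = vec_nth (vec_nth N u) v" for u v
    proof -
      obtain i j where ij: "i < n" "j < n" "u = h i" "v = h j" using bij_betw_imp_surj_on[OF h] by (metis UNIV_I imageE lessThan_iff)
      then show ?thesis using that ji[of i j M] ji[of i j N] by simp
    qed
    then show ?thesis by (simp add: Finite_Cartesian_Product.vec_eq_iff)
  qed
  have jm_surj: "\<exists>M. jm M = g" if g: "g \<in> carrier_mat n n" for g
  proof -
    let ?h = "the_inv_into {..<n} h"
    have hh: "?h (h i) = i" if "i < n" for i using the_inv_into_f_f[OF bij_betw_imp_inj_on[OF h]] that by simp
    have "jm (\<chi> u v. g $$ (?h u, ?h v)) = g" using g by (intro eq_matI) (auto simp: jm_def hh)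
    then show ?thesis by blast
  qed
  have jm_pow: "jm (matpow M i) = jm M ^\<^sub>m i" for M i
  proof (induction i)
    case 0 show ?case using carrier_matD[OF jc] by (simp add: matpow_def jm_one)
  next
    case (Suc i)
    have "matpow M (Suc i) = M ** matpow M i" by (simp add: matpow_def)
    then have "jm (matpow M (Suc i)) = jm M * jm M ^\<^sub>m i" by (simp add: jm_mult Suc)
    \<comment> \<open>\<open>matpow\<close> multiplies on the left and the matrix power on the
      right, so an inner induction commutes the factor past the power.\<close>
    also have "\<dots> = jm M ^\<^sub>m Suc i"
    proof (induction i)
      case 0 show ?case using jc[of M] by simp
    next
      case (Suc i)
      have "jm M * jm M ^\<^sub>m Suc i = (jm M * jm M ^\<^sub>m i) * jm M"
        using jc[of M] pow_carrier_mat[OF jc] by (simp add: assoc_mult_mat[of _ n n _ n _ n])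
      then show ?case using Suc by simp
    qed
    finally show ?case .
  qed
  have jm_trace: "trace (matpow M i) = (\<Sum>u<n. (jm M ^\<^sub>m i) $$ (u, u))" for M i
    unfolding jm_pow[symmetric] by (simp add: trace_def bij_jm_sum[OF h] ji)
  have uni: "M \<in> unitary_group q \<longleftrightarrow> jm M \<in> UG n" for M :: "'a^'n^'n"
  proof
    assume "M \<in> unitary_group q"
    then have "M ** transpose (conjq q M) = Finite_Cartesian_Product.mat 1" by (simp add: unitary_group_def)
    then have "jm M * adj (jm M) = 1\<^sub>m n" by (metis jm_mult jm_one jm_adj)
    then have "adj (jm M) * jm M = 1\<^sub>m n" using mat_mult_left_right_inverse[of "jm M" n "adj (jm M)"] jc by simp
    then show "jm M \<in> UG n" using jc by (simp add: UG_def)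
  next
    assume "jm M \<in> UG n"
    then have "jm M * adj (jm M) = 1\<^sub>m n" by (rule Un_D(3))
    then have e: "M ** transpose (conjq q M) = Finite_Cartesian_Product.mat 1" by (intro jm_inj) (simp add: jm_mult jm_one jm_adj)
    then have "invertible M" using invertible_right_inverse by blast
    then show "M \<in> unitary_group q" using e by (simp add: unitary_group_def)
  qed
  have bij: "bij_betw jm (unitary_group q) (UG n)"
  proof (rule bij_betw_imageI)
    show "inj_on jm (unitary_group q)" using jm_inj by (auto simp: inj_on_def)
    show "jm ` unitary_group q = UG n"
    proof (intro equalityI subsetI)
      fix g assume g: "g \<in> UG n"
      then obtain M where "jm M = g" using jm_surj Un_D(1) by blast
      then show "g \<in> jm ` unitary_group q" using g uni by blast
    qed (use uni in auto)
  qed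
  let ?S = "unitary_group q :: ('a^'n^'n) set" and ?P = "\<lambda>M :: 'a^'n^'n. \<forall>i. 1 \<le> i \<and> i \<le> k \<and> \<not> p dvd i \<longrightarrow> trace (matpow M i) = a i"
  have fin: "finite ?S" "card ?S = card (UG n)" using bij_betw_finite[OF bij] finite_Un bij_betw_same_card[OF bij] by auto
  have ne: "?S \<noteq> {}" using fin card_Un_pos[of n] by auto
  have "measure_pmf.prob (pmf_of_set ?S) {M. ?P M} = real (card (?S \<inter> {M. ?P M})) / real (card ?S)"
    by (rule measure_pmf_of_set[OF ne fin(1)])
  also have "real (card (?S \<inter> {M. ?P M})) = (\<Sum>M\<in>?S. of_bool (?P M))" using fin by (simp add: sum_of_bool_eq)
  also have "\<dots> = (\<Sum>M\<in>?S. Hit k a (ev (char_poly (jm M))))"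
    by (intro sum.cong refl) (simp only: uni Hit_char_poly[OF _ kn] jm_trace)
  also have "\<dots> = (\<Sum>g\<in>UG n. Hit k a (ev (char_poly g)))" by (rule sum.reindex_bij_betw[OF bij])
  finally have "measure_pmf.prob (pmf_of_set ?S) {M. ?P M} = EU n (Hit k a)" by (simp add: EU_def fin)
  then show ?thesis using Hit_bound[OF assms(6) kn, of a] by simp
qed

end
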